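(* Let $d\ge 1$, $\Omega=[0,1]^d$. For any $p\in[1,\infty)$ and $L>0$ there exists an estimator $\hat f^\circ$ (that is, for each sample size $n$, a probability density on $\Omega$ computed from $n$ i.i.d. observations with density $f$; it may depend on $p$, $L$, $n$ and the wavelet system of regularity $r$, but not on $p',q,m,s$ below) such that for any $p'$ with $p\le p'<\infty$, any $1\le q\le\infty$, any $m\in(0,1)$ and any $s\ge0$ with $s<r$ there is a constant $C$, not depending on $n$, with, for all $n\ge 2$, $$\sup_{f\in\mathcal B^{s}_{p',q}(L;m)}\mathbb E\,W_p(f,\hat f^\circ)\le C\cdot\begin{cases} n^{-\frac{1+s}{d+2s}}\log n & d\ge 3,\\ n^{-1/2}(\log n)^2 & d=2,\\ n^{-1/2} & d=1.\end{cases}$$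
   Context: $W_p(f,g)$ denotes the $p$-Wasserstein distance between the probability measures $\mu,\nu$ on $\Omega$ with densities $f,g$: $W_p^p(\mu,\nu)=\inf_\pi\int\|x-y\|^p\,d\pi(x,y)$ over couplings $\pi$ of $\mu$ and $\nu$, with $\|\cdot\|$ the Euclidean norm. $\mathbb E$ is expectation over $X_1,\dots,X_n$ i.i.d. with density $f$. Wavelet system. Fix sets $\Phi$ and $\Psi_j$ ($j\ge0$) of functions in $L_2(\Omega)$, of regularity $r>1$, such that, with constants depending only on the system: (i) $\Phi\cup\bigcup_{j\ge0}\Psi_j$ is an orthonormal basis of $L_2(\Omega)$; (ii) all these functions lie in $C^r(\Omega)$, and polynomials of degree at most $r$ on $\Omega$ lie in $\mathrm{span}(\Phi)$; (iii) each $\psi\in\Psi_j$ has the form $\psi(x)=\prod_{i=1}^d\psi_i(x_i)$ with univariate $\psi_i$; (iv) for each $\psi\in\Psi_j$ there is a rectangle $I_\psi\subseteq\Omega$ with $\mathrm{supp}(\psi)\subseteq I_\psi$, $\mathrm{diam}(I_\psi)\lesssim 2^{-j}$, and $\|\sum_{\psi\in\Psi_j}\mathbf 1\{x\in I_\psi\}\|_{L_\infty}\lesssim1$; (v) $\|\psi\|_{L_t(\Omega)}\asymp2^{dj(\frac12-\frac1t)}$ for all $\psi\in\Psi_j$ and $t\in[1,\infty]$; (vi) $\|\nabla u\|_{L_t(\Omega)}\lesssim 2^j\|u\|_{L_t(\Omega)}$ for $u\in\mathrm{span}(\Phi\cup\bigcup_{0\le k<j}\Psi_k)$. Consequently $|\Phi|\lesssim1$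 and $|\Psi_j|\lesssim2^{dj}$. Besov norm. For a function $f$ put $\alpha=(\int f\phi)_{\phi\in\Phi}$ and $\beta_j=(\int f\psi)_{\psi\in\Psi_j}$, and $$\|f\|_{\mathcal B^s_{p,q}}=\|\alpha\|_{\ell_p}+\Big\|\big(2^{js}2^{dj(\frac12-\frac1p)}\|\beta_j\|_{\ell_p}\big)_{j\ge0}\Big\|_{\ell_q}.$$ Classes. $\mathcal B^s_{p,q}(L)=\{f\in L_p(\Omega):\|f\|_{\mathcal B^s_{p,q}}\le L,\ \int_\Omega f=1,\ f\ge0\}$ and $\mathcal B^s_{p,q}(L;m)=\mathcal B^s_{p,q}(L)\cap\{f\ge m\}$. *)

theory Defs
  imports "HOL-Probability.Probability"
begin

section \<open>Lebesgue norms with exponent in $[1,\infty]$\<close>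

definition epowr :: "ennreal \<Rightarrow> real \<Rightarrow> ennreal" where
  "epowr x a = (if x = \<infinity> then \<infinity> else ennreal (enn2real x powr a))"

text \<open>Exponents are extended reals \<^term>\<open>t \<ge> 1\<close>. The same definition with a counting
  measure gives the sequence norms, possibly infinite.\<close>

definition eLnorm :: "'a measure \<Rightarrow> ennreal \<Rightarrow> ('a \<Rightarrow> ennreal) \<Rightarrow> ennreal" where
  "eLnorm M t g = (if t = \<infinity> then esssup M g
     else epowr (\<integral>\<^sup>+x. epowr (g x) (enn2real t) \<partial>M) (1 / enn2real t))"

definition Lnorm :: "'a measure \<Rightarrow> ennreal \<Rightarrow> ('a \<Rightarrow> 'b::real_normed_vector) \<Rightarrow> ennreal" where
  "Lnorm M t f = eLnorm M t (\<lambda>x. ennreal (norm (f x)))"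

definition Lspace :: "'a measure \<Rightarrow> ennreal \<Rightarrow> ('a \<Rightarrow> real) set" where
  "Lspace M t = {f. f \<in> borel_measurable M \<and> Lnorm M t f < \<infinity>}"


section \<open>The cube\<close>

definition Cube :: "(real ^ 'd) set" where
  "Cube = cbox 0 1"

text \<open>Lebesgue measure on the Borel sets of the cube. A function on the cube is represented by a
  function on the whole space, of which only the values on the cube are used.\<close>

definition cubeM :: "(real ^ 'd) measure" where
  "cubeM = restrict_space lborel Cube"

definition is_density :: "(real ^ 'd \<Rightarrow> real) \<Rightarrow> bool" where
  "is_density f \<longleftrightarrow>
     f \<in> borel_measurable cubeM \<and> (AE x in cubeM. 0 \<le> f x) \<and>
     integrable cubeM f \<and> (\<integral>x. f x \<partial>cubeM) = 1"

definition law :: "(real ^ 'd \<Rightarrow> real) \<Rightarrow> (real ^ 'd) measure" where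
  "law f = density cubeM (\<lambda>x. ennreal (f x))"


section \<open>Wasserstein distance\<close>

definition couplings :: "'a measure \<Rightarrow> 'b measure \<Rightarrow> ('a \<times> 'b) measure set" where
  "couplings M N =
     {P. sets P = sets (M \<Otimes>\<^sub>M N) \<and> distr P M fst = M \<and> distr P N snd = N}"

definition wasserstein ::
  "real \<Rightarrow> 'a::real_normed_vector measure \<Rightarrow> 'a measure \<Rightarrow> ennreal" where
  "wasserstein p M N =
     epowr (INF P \<in> couplings M N. \<integral>\<^sup>+z. ennreal (norm (fst z - snd z) powr p) \<partial>P) (1 / p)"


section \<open>Wavelet systems\<close>

definition lin_span :: "('a \<Rightarrow> real) set \<Rightarrow> ('a \<Rightarrow> real) set" where
  "lin_span B = {u. \<exists>F c. finite F \<and> F \<subseteq> B \<and> u = (\<lambda>x. \<Sum>b\<in>F. c b * b x)}"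

definition polynomials :: "real \<Rightarrow> (real ^ 'd \<Rightarrow> real) set" where
  "polynomials r =
     lin_span {\<lambda>x. \<Prod>i\<in>UNIV. (x $ i) ^ k i | k :: 'd \<Rightarrow> nat. real (\<Sum>i\<in>UNIV. k i) \<le> r}"

text \<open>\<open>holder_smooth a S k f\<close>: \<open>f\<close> is \<open>k\<close> times continuously differentiable on \<open>S\<close>, and if
  \<open>a > 0\<close> its derivatives of order \<open>k\<close> are moreover \<open>a\<close>-Hoelder. For the closed cube, derivatives
  at boundary points are one-sided and are uniquely determined.\<close>

primrec holder_smooth ::
  "real \<Rightarrow> (real ^ 'd) set \<Rightarrow> nat \<Rightarrow> (real ^ 'd \<Rightarrow> real) \<Rightarrow> bool" where
  "holder_smooth a S 0 f \<longleftrightarrow> continuous_on S f \<and>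
     (a > 0 \<longrightarrow> (\<exists>C. \<forall>x\<in>S. \<forall>y\<in>S. \<bar>f x - f y\<bar> \<le> C * norm (x - y) powr a))"
| "holder_smooth a S (Suc k) f \<longleftrightarrow>
     (\<exists>g. (\<forall>x\<in>S. (f has_derivative (\<lambda>h. g x \<bullet> h)) (at x within S)) \<and>
          (\<forall>i. holder_smooth a S k (\<lambda>x. g x $ i)))"

definition C_class :: "real \<Rightarrow> (real ^ 'd) set \<Rightarrow> (real ^ 'd \<Rightarrow> real) set" where
  "C_class r S = {f. holder_smooth (frac r) S (nat \<lfloor>r\<rfloor>) f}"

definition grad :: "(real ^ 'd \<Rightarrow> real) \<Rightarrow> real ^ 'd \<Rightarrow> real ^ 'd" where
  "grad u x = (\<chi> i. frechet_derivative u (at x within Cube) (axis i 1))"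

definition inner_L2 :: "(real ^ 'd \<Rightarrow> real) \<Rightarrow> (real ^ 'd \<Rightarrow> real) \<Rightarrow> real" where
  "inner_L2 f g = (\<integral>x. f x * g x \<partial>cubeM)"

definition orthonormal_basis_L2 :: "(real ^ 'd \<Rightarrow> real) set \<Rightarrow> bool" where
  "orthonormal_basis_L2 B \<longleftrightarrow>
     B \<subseteq> Lspace cubeM 2 \<and>
     (\<forall>b\<in>B. \<forall>b'\<in>B. inner_L2 b b' = (if b = b' then 1 else 0)) \<and>
     (\<forall>f\<in>Lspace cubeM 2. \<forall>\<epsilon>>0. \<exists>u\<in>lin_span B. Lnorm cubeM 2 (\<lambda>x. f x - u x) < ennreal \<epsilon>)"

text \<open>Axis-parallel rectangles, that is, products of intervals of any kind, are the sets
  satisfying \<^const>\<open>is_interval\<close>. The bound on their overlap is a bound on the essential supremum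
  over \<open>x\<close> of the number of rectangles containing \<open>x\<close>.
  All constants may depend on the system only, hence not on the level \<open>j\<close> or the exponent \<open>t\<close>.\<close>

definition wavelet_system ::
  "real \<Rightarrow> (real ^ 'd \<Rightarrow> real) set \<Rightarrow> (nat \<Rightarrow> (real ^ 'd \<Rightarrow> real) set) \<Rightarrow> bool" where
  "wavelet_system r \<Phi> \<Psi> \<longleftrightarrow>
     orthonormal_basis_L2 (\<Phi> \<union> (\<Union>j. \<Psi> j)) \<and>
     \<Phi> \<union> (\<Union>j. \<Psi> j) \<subseteq> C_class r Cube \<and>
     (\<forall>P\<in>polynomials r. \<exists>u\<in>lin_span \<Phi>. \<forall>x\<in>Cube. P x = u x) \<and>
     (\<forall>j. \<forall>\<psi>\<in>\<Psi> j. \<exists>h :: 'd \<Rightarrow> real \<Rightarrow> real. \<forall>x\<in>Cube. \<psi> x = (\<Prod>i\<in>UNIV. h i (x $ i))) \<and>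
     (\<exists>I :: nat \<Rightarrow> (real ^ 'd \<Rightarrow> real) \<Rightarrow> (real ^ 'd) set. \<exists>C > 0.
        (\<forall>j. \<forall>\<psi>\<in>\<Psi> j. is_interval (I j \<psi>) \<and> I j \<psi> \<subseteq> Cube \<and>
           closure {x\<in>Cube. \<psi> x \<noteq> 0} \<subseteq> I j \<psi> \<and>
           diameter (I j \<psi>) \<le> C * 2 powr (- real j)) \<and>
        (\<forall>j. AE x in cubeM.
           finite {\<psi>\<in>\<Psi> j. x \<in> I j \<psi>} \<and> real (card {\<psi>\<in>\<Psi> j. x \<in> I j \<psi>}) \<le> C)) \<and>
     (\<exists>c > 0. \<exists>C > 0. \<forall>j. \<forall>\<psi>\<in>\<Psi> j. \<forall>t\<ge>1.
        ennreal (c * 2 powr (real CARD('d) * real j * (1/2 - enn2real (1 / t))))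
          \<le> Lnorm cubeM t \<psi> \<and>
        Lnorm cubeM t \<psi>
          \<le> ennreal (C * 2 powr (real CARD('d) * real j * (1/2 - enn2real (1 / t))))) \<and>
     (\<exists>C > 0. \<forall>j. \<forall>u\<in>lin_span (\<Phi> \<union> (\<Union>k<j. \<Psi> k)). \<forall>t\<ge>1.
        Lnorm cubeM t (grad u) \<le> ennreal (C * 2 ^ j) * Lnorm cubeM t u)"


section \<open>Besov classes\<close>

definition besov_norm ::
  "(real ^ 'd \<Rightarrow> real) set \<Rightarrow> (nat \<Rightarrow> (real ^ 'd \<Rightarrow> real) set) \<Rightarrow>
   real \<Rightarrow> real \<Rightarrow> ennreal \<Rightarrow> (real ^ 'd \<Rightarrow> real) \<Rightarrow> ennreal" where
  "besov_norm \<Phi> \<Psi> s p q f =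
     Lnorm (count_space \<Phi>) (ennreal p) (\<lambda>\<phi>. inner_L2 f \<phi>) +
     eLnorm (count_space UNIV) q
       (\<lambda>j. ennreal (2 powr (real j * s) * 2 powr (real CARD('d) * real j * (1/2 - 1/p))) *
            Lnorm (count_space (\<Psi> j)) (ennreal p) (\<lambda>\<psi>. inner_L2 f \<psi>))"

definition besov_class ::
  "(real ^ 'd \<Rightarrow> real) set \<Rightarrow> (nat \<Rightarrow> (real ^ 'd \<Rightarrow> real) set) \<Rightarrow>
   real \<Rightarrow> real \<Rightarrow> ennreal \<Rightarrow> real \<Rightarrow> (real ^ 'd \<Rightarrow> real) set" where
  "besov_class \<Phi> \<Psi> s p q L =
     {f \<in> Lspace cubeM (ennreal p). besov_norm \<Phi> \<Psi> s p q f \<le> ennreal L \<and> is_density f}"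

definition besov_class_lower ::
  "(real ^ 'd \<Rightarrow> real) set \<Rightarrow> (nat \<Rightarrow> (real ^ 'd \<Rightarrow> real) set) \<Rightarrow>
   real \<Rightarrow> real \<Rightarrow> ennreal \<Rightarrow> real \<Rightarrow> real \<Rightarrow> (real ^ 'd \<Rightarrow> real) set" where
  "besov_class_lower \<Phi> \<Psi> s p q L m =
     {f \<in> besov_class \<Phi> \<Psi> s p q L. AE x in cubeM. m \<le> f x}"


section \<open>Estimators and their risk\<close>

text \<open>An estimator from \<open>n\<close> observations maps a sample, indexed by \<open>{..<n}\<close>, to a density, and
  is jointly measurable in the sample and the point of evaluation.\<close>

definition density_estimator ::
  "nat \<Rightarrow> ((nat \<Rightarrow> real ^ 'd) \<Rightarrow> real ^ 'd \<Rightarrow> real) \<Rightarrow> bool" where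
  "density_estimator n F \<longleftrightarrow>
     (\<lambda>(X, x). F X x) \<in> borel_measurable (PiM {..<n} (\<lambda>_. cubeM) \<Otimes>\<^sub>M cubeM) \<and>
     (\<forall>X \<in> space (PiM {..<n} (\<lambda>_. cubeM)). is_density (F X))"

definition wasserstein_risk ::
  "real \<Rightarrow> nat \<Rightarrow> (real ^ 'd \<Rightarrow> real) \<Rightarrow>
   ((nat \<Rightarrow> real ^ 'd) \<Rightarrow> real ^ 'd \<Rightarrow> real) \<Rightarrow> ennreal" where
  "wasserstein_risk p n f F =
     (\<integral>\<^sup>+X. wasserstein p (law f) (law (F X)) \<partial>PiM {..<n} (\<lambda>_. law f))"

definition rate :: "nat \<Rightarrow> real \<Rightarrow> nat \<Rightarrow> real" where
  "rate d s n =
     (if d \<ge> 3 then real n powr (- ((1 + s) / (real d + 2 * s))) * ln (real n)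
      else if d = 2 then real n powr (- 1/2) * (ln (real n))\<^sup>2
      else real n powr (- 1/2))"

end

theory Submission
  imports Defs
begin

text \<open>
  The difference of two densities that are bounded below is transported coordinate by
  coordinate: at level \<open>j\<close> the wavelets have mean zero and live on rectangles of diameter of order
  \<open>2\<^sup>-\<^sup>j\<close>, so moving the mass of one level costs at most that much, and the p-Wasserstein distance is
  bounded by the sum over \<open>j\<close> of \<open>2\<^sup>-\<^sup>j\<close> times a Besov-type norm of the coefficients at level \<open>j\<close>.
  The estimator selects, from a countable dense family of Lipschitz densities, one whose
  coefficients are nearly closest in this dual norm to the empirical coefficients, so that its error is
  controlled by the error of the empirical coefficients alone. The latter is bounded by exponential
  moments of empirical means, where the sum of variances over one level is of the order of the number of
  wavelets up to a factor \<open>j + 1\<close>. In dimension at least three, whole levels of empirical coefficients are set to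
  zero if their norm does not exceed the noise, which balances noise against bias at the unknown
  smoothness.\<close>

section \<open>Weighted power means and sequence norms\<close>

text \<open>Only \<open>f\<close> is bounded below; the fitted density, chosen without knowledge of
  \<open>m\<close>, may vanish, so no path of densities bounded below joins the two. The path runs
  from their midpoint to \<open>f\<close>, and replacing \<open>f\<close> by the midpoint halves the
  p-th power of the cost of a coupling with the fit. The distance is thus at most
  \<open>2 powr (- 1 / p)\<close> times itself plus the cost of the flow, and the factor below one
  is absorbed. A flow along a coordinate requires an increment with vanishing mean on every line in
  that direction; for a wavelet this comes from its product form. As \<open>p'\<close> is finite,
  \<open>f\<close> may be unbounded above: its variances are therefore summed over a level, by
  expanding squares of wavelets in the basis itself, and increments are cut into small time steps.
  Empirical coefficients need not belong to any density, which is why the estimator is a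
  near-projection in the dual norm; by the triangle inequality this doubles the error and adds a
  slack. The estimator uses \<open>L\<close>, \<open>p\<close> and the constants of the system;
  \<open>m\<close> enters the comparison of the distances only, and \<open>s\<close> only the level
  at which the analysis splits the error.\<close>

lemma powr_convex_on_nonneg:
  fixes p :: real
  assumes "1 \<le> p" "0 \<le> x" "0 \<le> y" "0 < A" "0 < B"
  shows "(x + y) powr p \<le> (A + B) powr p * (A / (A + B) * (x / A) powr p + B / (A + B) * (y / B) powr p)"
proof -
  define s where "s = A / (A + B)"
  define t where "t = B / (A + B)"
  have st: "0 < s" "0 < t" "s + t = 1"
    using assms by (simp_all add: s_def t_def flip: add_divide_distrib)
  then have st': "s < 1" "t < 1" "1 - t = s" by linarith+
  have le: "z powr p \<le> z" if "0 < z" "z < 1" for z :: real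
    using powr_mono'[of 1 p z] that assms(1) by simp
  have conv: "(s * u + t * v) powr p \<le> s * u powr p + t * v powr p" if "0 \<le> u" "0 \<le> v" for u v
  \<comment> \<open>A zero argument reduces the claim to \<open>z powr p \<le> z\<close> for a
    weight \<open>z\<close> below one; otherwise both points are positive and convexity of the power
    applies.\<close>
  proof (cases "u = 0 \<or> v = 0")
    case True
    then show ?thesis
      using le[of s] le[of t] st st' that by (auto simp: powr_mult intro!: mult_right_mono)
  next
    case False
    then show ?thesis
      using convex_onD[OF powr_convex[OF assms(1)], of t u v] st st' that by simp
  qed
  \<comment> \<open>The sum is \<open>A + B\<close> times a convex combination of
    \<open>x / A\<close> and \<open>y / B\<close>. With \<open>A\<close> and \<open>B\<close> the
    norms of two functions this becomes Minkowski's inequality after integration.\<close>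
  have "s * (x / A) = x / (A + B)" "t * (y / B) = y / (A + B)"
    using assms by (simp_all add: s_def t_def)
  then have "x + y = (A + B) * (s * (x / A) + t * (y / B))"
    using assms by (simp flip: add_divide_distrib)
  then have "(x + y) powr p = (A + B) powr p * (s * (x / A) + t * (y / B)) powr p"
    using assms st by (simp add: powr_mult)
  also have "\<dots> \<le> (A + B) powr p * (s * (x / A) powr p + t * (y / B) powr p)"
    using assms by (intro mult_left_mono conv) auto
  finally show ?thesis by (simp add: s_def t_def)
qed

lemma powr_add_bound:
  fixes p :: real
  assumes "1 \<le> p" "0 \<le> x" "0 \<le> y" "0 < A" "0 < B"
  shows "(x + y) powr p \<le> (A + B) powr p * (A / (A + B) * A powr - p) * x powr p +
    (A + B) powr p * (B / (A + B) * B powr - p) * y powr p"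
  using powr_convex_on_nonneg[OF assms] assms
  by (simp add: powr_divide powr_minus_divide algebra_simps)

lemma powr_weight:
  fixes p :: real
  assumes "0 < A" "0 < B"
  shows "(A + B) powr p * (A / (A + B) * A powr - p) * A powr p = (A + B) powr p * (A / (A + B))"
proof -
  have "A powr - p * A powr p = 1" using assms by (simp flip: powr_add)
  then show ?thesis by (metis (no_types) mult.assoc mult.right_neutral)
qed

text \<open>After integrating the weighted convexity bound, the two summands contribute the shares
  \<open>A / (A + B)\<close> and \<open>B / (A + B)\<close> of \<open>(A + B) powr p\<close>. The
  form with given bounds \<open>A\<close>, \<open>B\<close> instead of norms avoids roots of
  possibly infinite integrals.\<close>

lemma nn_integral_minkowski:
  fixes f g :: "'a \<Rightarrow> real"
  assumes [measurable]: "f \<in> borel_measurable M" "g \<in> borel_measurable M"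
    and nn: "\<And>x. x \<in> space M \<Longrightarrow> 0 \<le> f x" "\<And>x. x \<in> space M \<Longrightarrow> 0 \<le> g x"
    and p: "1 \<le> p" and AB: "0 < A" "0 < B"
    and f: "(\<integral>\<^sup>+x. ennreal (f x powr p) \<partial>M) \<le> ennreal (A powr p)"
    and g: "(\<integral>\<^sup>+x. ennreal (g x powr p) \<partial>M) \<le> ennreal (B powr p)"
  shows "(\<integral>\<^sup>+x. ennreal ((f x + g x) powr p) \<partial>M) \<le> ennreal ((A + B) powr p)"
proof -
  define a where "a = (A + B) powr p * (A / (A + B) * A powr - p)"
  define b where "b = (A + B) powr p * (B / (A + B) * B powr - p)"
  have ab: "0 \<le> a" "0 \<le> b" using AB by (auto simp: a_def b_def)
  have "(\<integral>\<^sup>+x. ennreal ((f x + g x) powr p) \<partial>M) \<le>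
      (\<integral>\<^sup>+x. ennreal a * ennreal (f x powr p) + ennreal b * ennreal (g x powr p) \<partial>M)"
  proof (intro nn_integral_mono)
    fix x assume "x \<in> space M"
    from powr_add_bound[OF p nn(1)[OF this] nn(2)[OF this] AB]
    show "ennreal ((f x + g x) powr p) \<le> ennreal a * ennreal (f x powr p) + ennreal b * ennreal (g x powr p)"
      using ab unfolding a_def[symmetric] b_def[symmetric]
      by (simp add: ennreal_leI flip: ennreal_mult' ennreal_plus)
  qed
  also have "\<dots> = ennreal a * (\<integral>\<^sup>+x. ennreal (f x powr p) \<partial>M) + ennreal b * (\<integral>\<^sup>+x. ennreal (g x powr p) \<partial>M)"
    by (simp add: nn_integral_add nn_integral_cmult)
  also have "\<dots> \<le> ennreal a * ennreal (A powr p) + ennreal b * ennreal (B powr p)"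
    by (intro add_mono mult_left_mono f g) auto
  also have "\<dots> = ennreal (a * A powr p + b * B powr p)"
    using ab by (simp flip: ennreal_mult ennreal_plus)
  also have "a * A powr p + b * B powr p = (A + B) powr p * (A / (A + B) + B / (A + B))"
    unfolding a_def b_def using powr_weight[OF AB, of p] powr_weight[OF AB(2,1), of p]
    by (simp only: distrib_left add.commute[of B A])
  also have "A / (A + B) + B / (A + B) = 1"
    using AB by (simp flip: add_divide_distrib)
  finally show ?thesis by simp
qed

definition lpn :: "real \<Rightarrow> 'a set \<Rightarrow> ('a \<Rightarrow> real) \<Rightarrow> real" where
  "lpn p S f = (\<Sum>a\<in>S. \<bar>f a\<bar> powr p) powr (1 / p)"

lemma lpn_nonneg [simp]: "0 \<le> lpn p S f"
  by (simp add: lpn_def)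

lemma lpn_powr: "0 < p \<Longrightarrow> lpn p S f powr p = (\<Sum>a\<in>S. \<bar>f a\<bar> powr p)"
  by (simp add: lpn_def powr_powr sum_nonneg)

lemma lpn_le_iff:
  assumes "0 < p" "0 \<le> A"
  shows "lpn p S f \<le> A \<longleftrightarrow> (\<Sum>a\<in>S. \<bar>f a\<bar> powr p) \<le> A powr p"
  by (metis assms lpn_nonneg lpn_powr powr_less_mono2 powr_mono2 less_eq_real_def not_le)

lemma lpn_uminus: "lpn p S (\<lambda>a. - f a) = lpn p S f"
  by (simp add: lpn_def)

lemma lpn_minus_commute: "lpn p S (\<lambda>a. f a - g a) = lpn p S (\<lambda>a. g a - f a)"
  by (simp add: lpn_def abs_minus_commute)

lemma lpn_cong: "(\<And>a. a \<in> S \<Longrightarrow> f a = g a) \<Longrightarrow> lpn p S f = lpn p S g"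
  by (simp add: lpn_def)

lemma lpn_mono:
  assumes "0 < p" "\<And>a. a \<in> S \<Longrightarrow> \<bar>f a\<bar> \<le> \<bar>g a\<bar>"
  shows "lpn p S f \<le> lpn p S g"
  unfolding lpn_def using assms by (intro powr_mono2 sum_mono sum_nonneg) auto

lemma lpn_eq_0:
  assumes "finite S" "0 < p" "lpn p S f = 0" "a \<in> S"
  shows "f a = 0"
proof -
  have "(\<Sum>a\<in>S. \<bar>f a\<bar> powr p) = 0"
    using assms lpn_powr[of p S f] by simp
  then show ?thesis using assms by (auto simp: sum_nonneg_eq_0_iff)
qed

lemma abs_le_lpn:
  assumes "finite S" "0 < p" "a \<in> S"
  shows "\<bar>f a\<bar> \<le> lpn p S f"
proof -
  have "\<bar>f a\<bar> powr p \<le> (\<Sum>a\<in>S. \<bar>f a\<bar> powr p)"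
    using assms by (intro member_le_sum) auto
  then have "(\<bar>f a\<bar> powr p) powr (1/p) \<le> lpn p S f"
    unfolding lpn_def using assms by (intro powr_mono2) auto
  then show ?thesis using assms by (simp add: powr_powr)
qed

lemma lpn_cmult: "0 < p \<Longrightarrow> lpn p S (\<lambda>a. c * f a) = \<bar>c\<bar> * lpn p S f"
  by (simp add: lpn_def abs_mult powr_mult powr_powr sum_nonneg flip: sum_distrib_left)

text \<open>The weights of the convexity bound are the two norms themselves; they have to be
  positive, so a zero norm is treated first.\<close>

lemma lpn_triangle:
  assumes fin: "finite S" and p: "1 \<le> p"
  shows "lpn p S (\<lambda>a. f a + g a) \<le> lpn p S f + lpn p S g"
proof (cases "lpn p S f = 0 \<or> lpn p S g = 0")
  case True
  then show ?thesis
  proof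
    assume "lpn p S f = 0"
    then have "lpn p S (\<lambda>a. f a + g a) = lpn p S g"
      using lpn_eq_0[OF fin, of p f] p by (intro lpn_cong) auto
    then show ?thesis by simp
  next
    assume "lpn p S g = 0"
    then have "lpn p S (\<lambda>a. f a + g a) = lpn p S f"
      using lpn_eq_0[OF fin, of p g] p by (intro lpn_cong) auto
    then show ?thesis by simp
  qed
next
  case False
  define A where "A = lpn p S f"
  define B where "B = lpn p S g"
  have AB: "0 < A" "0 < B" using False by (auto simp: A_def B_def less_le)
  define a where "a = (A + B) powr p * (A / (A + B) * A powr - p)"
  define b where "b = (A + B) powr p * (B / (A + B) * B powr - p)"
  have "(\<Sum>x\<in>S. \<bar>f x + g x\<bar> powr p) \<le> (\<Sum>x\<in>S. a * \<bar>f x\<bar> powr p + b * \<bar>g x\<bar> powr p)"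
  proof (intro sum_mono)
    fix x
    have "\<bar>f x + g x\<bar> powr p \<le> (\<bar>f x\<bar> + \<bar>g x\<bar>) powr p"
      using p by (intro powr_mono2) auto
    also have "\<dots> \<le> a * \<bar>f x\<bar> powr p + b * \<bar>g x\<bar> powr p"
      unfolding a_def b_def using powr_add_bound[OF p _ _ AB] by simp
    finally show "\<bar>f x + g x\<bar> powr p \<le> a * \<bar>f x\<bar> powr p + b * \<bar>g x\<bar> powr p" .
  qed
  also have "\<dots> = a * A powr p + b * B powr p"
    using p by (simp add: A_def B_def lpn_powr sum.distrib sum_distrib_left)
  also have "\<dots> = (A + B) powr p * (A / (A + B) + B / (A + B))"
    unfolding a_def b_def using powr_weight[OF AB, of p] powr_weight[OF AB(2,1), of p]
    by (simp only: distrib_left add.commute[of B A])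
  also have "A / (A + B) + B / (A + B) = 1"
    using AB by (simp flip: add_divide_distrib)
  finally have "(\<Sum>x\<in>S. \<bar>f x + g x\<bar> powr p) \<le> (A + B) powr p" by simp
  then show ?thesis
    unfolding A_def[symmetric] B_def[symmetric] using p AB by (subst lpn_le_iff) auto
qed

lemma lpn_sum_le:
  assumes "finite S" "1 \<le> p" "finite K"
  shows "lpn p S (\<lambda>a. \<Sum>k\<in>K. f k a) \<le> (\<Sum>k\<in>K. lpn p S (f k))"
  using assms(3)
proof induction
  case empty
  then show ?case using assms by (simp add: lpn_def)
next
  case (insert k K)
  then show ?case
    using lpn_triangle[OF assms(1,2), of "f k" "\<lambda>a. \<Sum>k\<in>K. f k a"] by simp
qed

text \<open>Jensen's inequality for the uniform distribution on \<open>S\<close>. The cardinality is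
  replaced by a bound \<open>c \<ge> 1\<close>, so that overlap constants can be inserted and the
  empty set causes no exception.\<close>

lemma sum_powr_le_card:
  assumes fin: "finite S" and p: "1 \<le> p" and nn: "\<And>a. a \<in> S \<Longrightarrow> 0 \<le> f a"
    and card: "real (card S) \<le> c" and c: "1 \<le> c"
  shows "(\<Sum>a\<in>S. f a) powr p \<le> c powr (p - 1) * (\<Sum>a\<in>S. f a powr p)"
proof -
  have "(\<Sum>a\<in>S. 1 * f a) powr p \<le> (\<Sum>a\<in>S. 1::real) powr (p - 1) * (\<Sum>a\<in>S. 1 * f a powr p)"
    if "S \<noteq> {}"
  proof -
    define n where "n = real (card S)"
    have n: "0 < n" using that fin by (auto simp: n_def card_gt_0_iff)
    \<comment> \<open>The closed half-line is used here because the summands may vanish.\<close>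
    have conv: "convex_on {0..} (\<lambda>x::real. x powr p)"
    proof (intro convex_onI)
      fix t x y :: real assume t: "0 < t" "t < 1" and xy: "x \<in> {0..}" "y \<in> {0..}"
      show "((1 - t) *\<^sub>R x + t *\<^sub>R y) powr p \<le> (1 - t) * x powr p + t * y powr p"
        using powr_convex_on_nonneg[OF p, of "(1-t)*x" "t*y" "1-t" t] t xy by simp
    qed auto
    have "(\<Sum>a\<in>S. (1/n) *\<^sub>R f a) powr p \<le> (\<Sum>a\<in>S. (1/n) * f a powr p)"
      using n that fin nn by (intro convex_on_sum[OF _ _ conv]) (auto simp: n_def)
    then have "n powr p * ((1/n) * (\<Sum>a\<in>S. f a)) powr p \<le> n powr p * ((1/n) * (\<Sum>a\<in>S. f a powr p))"
      by (intro mult_left_mono) (auto simp: sum_distrib_left)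
    moreover have "n powr p * ((1/n) * (\<Sum>a\<in>S. f a)) powr p = (\<Sum>a\<in>S. f a) powr p"
      using n nn by (subst powr_mult[symmetric]) (auto simp: sum_nonneg)
    moreover have "n powr p * (1 / n) = n powr (p - 1)"
      using n by (simp add: powr_diff)
    ultimately have "(\<Sum>a\<in>S. f a) powr p \<le> n powr (p - 1) * (\<Sum>a\<in>S. f a powr p)"
      by (simp only: mult.assoc[symmetric])
    then show ?thesis by (simp add: n_def)
  qed
  moreover have "real (card S) powr (p - 1) * (\<Sum>a\<in>S. f a powr p) \<le> c powr (p - 1) * (\<Sum>a\<in>S. f a powr p)"
    using card c p by (intro mult_right_mono powr_mono2) (auto simp: sum_nonneg)
  ultimately show ?thesis by (cases "S = {}") auto
qed

section \<open>The cube and its coordinates\<close>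

definition upd :: "real ^ 'd \<Rightarrow> 'd \<Rightarrow> real \<Rightarrow> real ^ 'd" where
  "upd x i t = (\<chi> l. if l = i then t else x $ l)"

lemma upd_nth [simp]: "upd x i t $ l = (if l = i then t else x $ l)"
  by (simp add: upd_def)

lemma upd_same [simp]: "upd x i (x $ i) = x"
  by (simp add: vec_eq_iff)

lemma upd_upd [simp]: "upd (upd x i s) i t = upd x i t"
  by (simp add: vec_eq_iff)

lemma norm_axis_real: "norm (axis i a :: real ^ 'd) = \<bar>a\<bar>"
proof -
  have "axis i a = a *\<^sub>R (axis i 1 :: real ^ 'd)" by (simp add: vec_eq_iff axis_def)
  then show ?thesis using norm_Basis[of "axis i 1 :: real ^ 'd"] by (auto simp: Basis_vec_def)
qed

lemma norm_upd_diff: "norm (upd x i s - upd x i t) = \<bar>s - t\<bar>"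
proof -
  have "upd x i s - upd x i t = axis i (s - t)"
    by (simp add: vec_eq_iff axis_def)
  then show ?thesis by (simp add: norm_axis_real)
qed

lemma norm_upd_diff_le: "norm (upd x i t - upd y i t) \<le> norm (x - y)"
  by (rule norm_le_componentwise_cart) auto

lemma norm_upd_diff_self: "norm (upd x i t - x) = \<bar>t - x $ i\<bar>"
  using norm_upd_diff[of x i t "x $ i"] by simp

lemma mem_Cube: "x \<in> Cube \<longleftrightarrow> (\<forall>i. 0 \<le> x $ i \<and> x $ i \<le> 1)"
  by (simp add: Cube_def mem_box_cart)

lemma upd_Cube: "x \<in> Cube \<Longrightarrow> 0 \<le> t \<Longrightarrow> t \<le> 1 \<Longrightarrow> upd x i t \<in> Cube"
  by (simp add: mem_Cube)

lemma Cube_borel [measurable]: "Cube \<in> sets borel"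
  by (simp add: Cube_def)

lemma compact_Cube [simp]: "compact Cube"
  by (simp add: Cube_def compact_cbox)

lemma convex_Cube [simp]: "convex Cube"
  by (simp add: Cube_def)

lemma space_cubeM [simp]: "space cubeM = Cube"
  by (simp add: cubeM_def space_restrict_space)

lemma sets_cubeM: "sets cubeM = sets (restrict_space borel Cube)"
  unfolding cubeM_def by (rule sets_restrict_space_cong) simp

lemma prod_Basis_cart: "(\<Prod>b\<in>(Basis :: (real ^ 'd) set). f b) = (\<Prod>i\<in>UNIV. f (axis i (1::real)))"
proof -
  have B: "(Basis :: (real^'d) set) = (\<lambda>i. axis i 1) ` UNIV"
    by (auto simp: Basis_vec_def)
  have "inj (\<lambda>i::'d::finite. axis i (1::real))"
    by (auto simp: inj_on_def axis_eq_axis)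
  then show ?thesis unfolding B by (simp add: prod.reindex)
qed

lemma Basis_cartE:
  assumes "b \<in> (Basis :: (real^'d) set)" obtains i where "b = axis i 1"
  using assms by (auto simp: Basis_vec_def)

lemma axis_1_Basis [simp]: "axis i 1 \<in> (Basis :: (real^'d) set)"
  by (auto simp: Basis_vec_def)

lemma emeasure_lborel_box_cart:
  fixes l u :: "real ^ 'd"
  assumes "\<And>i. l $ i \<le> u $ i"
  shows "emeasure lborel (box l u) = ennreal (\<Prod>i\<in>UNIV. u $ i - l $ i)"
proof -
  have "emeasure lborel (box l u) = ennreal (\<Prod>b\<in>Basis. (u - l) \<bullet> b)"
    using assms by (intro emeasure_lborel_box) (auto elim!: Basis_cartE simp: inner_axis)
  then show ?thesis by (simp only: prod_Basis_cart) (simp add: inner_axis)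
qed

lemma emeasure_lborel_cbox_cart:
  fixes l u :: "real ^ 'd"
  assumes "\<And>i. l $ i \<le> u $ i"
  shows "emeasure lborel (cbox l u) = ennreal (\<Prod>i\<in>UNIV. u $ i - l $ i)"
proof -
  have "emeasure lborel (cbox l u) = ennreal (\<Prod>b\<in>Basis. (u - l) \<bullet> b)"
    using assms by (intro emeasure_lborel_cbox) (auto elim!: Basis_cartE simp: inner_axis)
  then show ?thesis by (simp only: prod_Basis_cart) (simp add: inner_axis)
qed

interpretation cubeM: prob_space "cubeM :: (real ^ 'd) measure"
proof
  show "emeasure cubeM (space (cubeM :: (real ^ 'd) measure)) = 1"
    using emeasure_lborel_cbox_cart[of "0 :: real ^ 'd" 1]
    by (simp add: cubeM_def emeasure_restrict_space Cube_def space_restrict_space)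
qed

abbreviation unitM :: "real measure" where
  "unitM \<equiv> restrict_space lborel {0..1}"

interpretation unitM: prob_space unitM
  by standard (simp add: emeasure_restrict_space space_restrict_space)

lemma space_unitM [simp]: "space unitM = {0..1}"
  by (simp add: space_restrict_space)

lemma measurable_upd [measurable]:
  assumes [measurable]: "f \<in> borel_measurable M" "g \<in> borel_measurable M"
  shows "(\<lambda>w. upd (f w) i (g w) :: real ^ 'd) \<in> borel_measurable M"
proof -
  have "continuous_on UNIV (\<lambda>(x :: real ^ 'd, t). upd x i t)"
    unfolding upd_def case_prod_beta
  proof (rule continuous_on_vec_lambda)
    fix l
    show "continuous_on UNIV (\<lambda>w :: (real ^ 'd) \<times> real. if l = i then snd w else fst w $ l)"
      by (cases "l = i") (auto intro!: continuous_intros)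
  qed
  then have "(\<lambda>(x :: real ^ 'd, t). upd x i t) \<in> borel_measurable (borel \<Otimes>\<^sub>M borel)"
    by (simp add: borel_prod borel_measurable_continuous_onI)
  then have "(\<lambda>w. (\<lambda>(x, t). upd x i t) (f w, g w)) \<in> borel_measurable M"
    by (rule measurable_compose[rotated]) simp
  then show ?thesis by simp
qed

lemma measurable_into_cubeM:
  assumes "f \<in> borel_measurable M" "\<And>w. w \<in> space M \<Longrightarrow> f w \<in> Cube"
  shows "f \<in> measurable M cubeM"
  unfolding cubeM_def using assms by (intro measurable_restrict_space2) auto

lemma measurable_id_cubeM [measurable]: "(\<lambda>x. x) \<in> borel_measurable cubeM"
  unfolding cubeM_def by (intro measurable_restrict_space1) auto

lemma measurable_id_unitM [measurable]: "(\<lambda>x. x) \<in> borel_measurable unitM"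
  by (intro measurable_restrict_space1) auto

lemma measurable_from_cubeM:
  "f \<in> measurable M cubeM \<Longrightarrow> f \<in> borel_measurable M"
  by (rule measurable_compose[OF _ measurable_id_cubeM])

lemma measurable_from_unitM:
  "f \<in> measurable M unitM \<Longrightarrow> f \<in> borel_measurable M"
  by (rule measurable_compose[OF _ measurable_id_unitM])

lemma measurable_upd_cubeM [measurable]:
  "(\<lambda>(x :: real ^ 'd, t). upd x i t) \<in> measurable (cubeM \<Otimes>\<^sub>M unitM) cubeM"
proof (rule measurable_into_cubeM)
  have [measurable]: "fst \<in> borel_measurable (cubeM \<Otimes>\<^sub>M unitM :: ((real^'d) \<times> real) measure)"
      "snd \<in> borel_measurable (cubeM \<Otimes>\<^sub>M unitM :: ((real^'d) \<times> real) measure)"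
    by (auto intro!: measurable_from_cubeM measurable_from_unitM)
  show "(\<lambda>(x, t). upd x i t) \<in> borel_measurable (cubeM \<Otimes>\<^sub>M unitM :: ((real^'d) \<times> real) measure)"
    unfolding case_prod_beta by measurable
qed (auto simp: space_pair_measure intro!: upd_Cube)

lemma measurable_upd_section [measurable]:
  assumes "x \<in> Cube" shows "(\<lambda>t. upd x i t) \<in> measurable unitM cubeM"
proof (rule measurable_into_cubeM)
  show "upd x i \<in> borel_measurable unitM" by measurable
qed (use assms in \<open>auto intro: upd_Cube\<close>)

lemma borel_measurable_cubeM_cont:
  "continuous_on Cube f \<Longrightarrow> f \<in> borel_measurable cubeM"
  by (subst measurable_cong_sets[OF sets_cubeM refl]) (rule borel_measurable_continuous_on_restrict)

section \<open>Integration over the cube along the lines in one coordinate direction\<close>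

lemma lborel_upd:
  fixes i :: "'d :: finite"
  shows "(lborel :: (real ^ 'd) measure) =
    distr (density lborel (indicator {x. 0 < x $ i \<and> x $ i < 1}) \<Otimes>\<^sub>M lborel) borel (\<lambda>(x, t). upd x i t)"
proof (rule lborel_eqI)
  \<comment> \<open>The old i-th coordinate of \<open>x\<close> is forgotten by \<open>upd\<close>,
    so it may carry any distribution of mass one; the indicator of the unit interval supplies such a
    weight.\<close>
  let ?D = "density lborel (indicator {x :: real ^ 'd. 0 < x $ i \<and> x $ i < 1})"
  have S: "{x :: real ^ 'd. 0 < x $ i \<and> x $ i < 1} \<in> sets borel" by measurable
  fix l u :: "real ^ 'd"
  assume le: "\<And>b. b \<in> Basis \<Longrightarrow> l \<bullet> b \<le> u \<bullet> b"
  have le': "l $ k \<le> u $ k" for k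
    using le[of "axis k 1"] by (auto simp: Basis_vec_def inner_axis)
  let ?S = "{x :: real ^ 'd. \<forall>k. k \<noteq> i \<longrightarrow> l $ k < x $ k \<and> x $ k < u $ k}"
  have S': "?S \<in> sets borel" by measurable
  have [measurable]: "(\<lambda>(x, t). upd x i t) \<in> borel_measurable (?D \<Otimes>\<^sub>M lborel)"
    unfolding case_prod_beta by measurable
  have "emeasure (distr (?D \<Otimes>\<^sub>M lborel) borel (\<lambda>(x, t). upd x i t)) (box l u) =
      emeasure (?D \<Otimes>\<^sub>M lborel) (?S \<times> {l $ i <..< u $ i})"
    by (subst emeasure_distr)
      (auto simp: space_pair_measure mem_box_cart intro!: arg_cong[where f="emeasure _"] split: if_splits)
  also have "\<dots> = emeasure ?D ?S * emeasure lborel {l $ i <..< u $ i}"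
    using S' by (intro lborel.emeasure_pair_measure_Times) auto
  also have "emeasure ?D ?S = (\<integral>\<^sup>+x. indicator {x. 0 < x $ i \<and> x $ i < 1} x * indicator ?S x \<partial>lborel)"
    using S S' by (intro emeasure_density) auto
  also have "\<dots> = (\<integral>\<^sup>+x. indicator (box (upd l i 0) (upd u i 1)) x \<partial>lborel)"
    by (intro nn_integral_cong) (auto simp: indicator_def mem_box_cart split: if_splits)
  also have "\<dots> = emeasure lborel (box (upd l i 0) (upd u i 1))" by simp
  also have "\<dots> = ennreal (\<Prod>k\<in>UNIV. (upd u i 1) $ k - (upd l i 0) $ k)"
    using le' by (intro emeasure_lborel_box_cart) auto
  also have "emeasure lborel {l $ i <..< u $ i} = ennreal (u $ i - l $ i)"
    using le' by simp
  also have "(\<Prod>k\<in>UNIV. (upd u i 1) $ k - (upd l i 0) $ k) = (\<Prod>k\<in>UNIV - {i}. u $ k - l $ k)"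
    by (subst prod.remove[of _ i]) (auto intro!: prod.cong)
  also have "ennreal \<dots> * ennreal (u $ i - l $ i) = ennreal (\<Prod>k\<in>UNIV. u $ k - l $ k)"
    using le' by (subst (2) prod.remove[of _ i])
      (auto simp: prod_nonneg mult.commute simp flip: ennreal_mult)
  also have "(\<Prod>k\<in>UNIV. u $ k - l $ k) = (\<Prod>b\<in>Basis. (u - l) \<bullet> b)"
    by (simp add: prod_Basis_cart inner_axis)
  finally show "emeasure (distr (?D \<Otimes>\<^sub>M lborel) borel (\<lambda>(x, t). upd x i t)) (box l u) =
      ennreal (\<Prod>b\<in>Basis. (u - l) \<bullet> b)" .
qed simp

lemma AE_lborel_nth_neq: "AE x in lborel. (x :: real ^ 'd) $ i \<noteq> c"
  using AE_lborel_inner_neq[of "axis i 1 :: real ^ 'd" c] by (simp add: inner_axis)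

text \<open>Tonelli's theorem with one coordinate resampled. The open unit interval in
  \<open>lborel_upd\<close> and the closed cube differ only by two faces, which are null
  sets.\<close>

theorem nn_integral_cube_fiber:
  fixes h :: "real ^ 'd \<Rightarrow> ennreal"
  assumes h: "h \<in> borel_measurable cubeM"
  shows "(\<integral>\<^sup>+x. h x \<partial>cubeM) = (\<integral>\<^sup>+x. (\<integral>\<^sup>+t. h (upd x i t) \<partial>unitM) \<partial>cubeM)"
proof -
  define h' where "h' = (\<lambda>x. h x * indicator Cube x)"
  have h'[measurable]: "h' \<in> borel_measurable borel"
    using h unfolding h'_def cubeM_def by (simp add: borel_measurable_restrict_space_iff_ennreal)
  let ?I = "{x :: real ^ 'd. 0 < x $ i \<and> x $ i < 1}"
  have I[measurable]: "?I \<in> sets borel" by measurable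
  have m[measurable]: "(\<lambda>(x, t). upd x i t) \<in> borel_measurable (density lborel (indicator ?I) \<Otimes>\<^sub>M lborel)"
    unfolding case_prod_beta by measurable
  have m2[measurable]: "(\<lambda>x. \<integral>\<^sup>+t. h' (upd x i t) \<partial>lborel) \<in> borel_measurable borel"
    by measurable
  have "(\<integral>\<^sup>+x. h x \<partial>cubeM) = (\<integral>\<^sup>+x. h' x \<partial>lborel)"
    unfolding cubeM_def h'_def by (subst nn_integral_restrict_space) auto
  also have "\<dots> = (\<integral>\<^sup>+z. h' (case z of (x, t) \<Rightarrow> upd x i t) \<partial>(density lborel (indicator ?I) \<Otimes>\<^sub>M lborel))"
    by (subst lborel_upd[of i], subst nn_integral_distr) auto
  also have "\<dots> = (\<integral>\<^sup>+x. (\<integral>\<^sup>+t. h' (upd x i t) \<partial>lborel) \<partial>density lborel (indicator ?I))"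
    by (subst lborel.nn_integral_fst[symmetric]) auto
  also have "\<dots> = (\<integral>\<^sup>+x. indicator ?I x * (\<integral>\<^sup>+t. h' (upd x i t) \<partial>lborel) \<partial>lborel)"
    by (subst nn_integral_density) auto
  also have "\<dots> = (\<integral>\<^sup>+x. (\<integral>\<^sup>+t. h (upd x i t) \<partial>unitM) * indicator Cube x \<partial>lborel)"
  proof (rule nn_integral_cong_AE)
    show "AE x in lborel. indicator ?I x * (\<integral>\<^sup>+t. h' (upd x i t) \<partial>lborel) =
        (\<integral>\<^sup>+t. h (upd x i t) \<partial>unitM) * indicator Cube x"
      using AE_lborel_nth_neq[of i 0] AE_lborel_nth_neq[of i 1]
    proof eventually_elim
      case (elim x)
      have eq: "(\<integral>\<^sup>+t. h (upd x i t) \<partial>unitM) = (\<integral>\<^sup>+t. h (upd x i t) * indicator {0..1} t \<partial>lborel)"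
        by (subst nn_integral_restrict_space) auto
      show ?case
      proof (cases "x \<in> Cube")
        case True
        then have "x \<in> ?I" using elim by (auto simp: mem_Cube less_le)
        moreover have "h' (upd x i t) = h (upd x i t) * indicator {0..1} t" for t
          using True by (auto simp: h'_def indicator_def mem_Cube)
        ultimately show ?thesis using True by (simp add: eq)
      next
        case False
        show ?thesis
        proof (cases "x \<in> ?I")
          case True
          then obtain k where "k \<noteq> i" "\<not> (0 \<le> x $ k \<and> x $ k \<le> 1)"
            using False by (auto simp: mem_Cube) (metis less_imp_le)+
          then have "upd x i t \<notin> Cube" for t by (auto simp: mem_Cube intro!: exI[of _ k])
          then show ?thesis using False by (simp add: h'_def)
        qed (use False in simp)
      qed
    qed
  qed
  also have "\<dots> = (\<integral>\<^sup>+x. (\<integral>\<^sup>+t. h (upd x i t) \<partial>unitM) \<partial>cubeM)"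
    unfolding cubeM_def by (subst nn_integral_restrict_space) auto
  finally show ?thesis .
qed

lemma measurable_fiber:
  assumes h: "h \<in> measurable cubeM N"
  shows "(\<lambda>(x, t). h (upd x i t)) \<in> measurable (cubeM \<Otimes>\<^sub>M unitM) N"
  using measurable_compose[OF measurable_upd_cubeM h] by (simp add: case_prod_beta)

lemma distr_upd_cubeM: "distr (cubeM \<Otimes>\<^sub>M unitM) cubeM (\<lambda>(x, t). upd x i t) = cubeM"
proof (rule measure_eqI)
  fix A assume "A \<in> sets (distr (cubeM \<Otimes>\<^sub>M unitM) cubeM (\<lambda>(x, t). upd x i t))"
  then have A[measurable]: "A \<in> sets cubeM" by simp
  note mf[measurable] = measurable_fiber[OF borel_measurable_indicator[OF A], of i]
  have "emeasure (distr (cubeM \<Otimes>\<^sub>M unitM) cubeM (\<lambda>(x, t). upd x i t)) A =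
      (\<integral>\<^sup>+z. indicator A z \<partial>distr (cubeM \<Otimes>\<^sub>M unitM) cubeM (\<lambda>(x, t). upd x i t))"
    using A by simp
  also have "\<dots> = (\<integral>\<^sup>+z. indicator A ((\<lambda>(x, t). upd x i t) z) \<partial>(cubeM \<Otimes>\<^sub>M unitM))"
    by (rule nn_integral_distr) measurable
  also have "\<dots> = (\<integral>\<^sup>+x. (\<integral>\<^sup>+t. indicator A (upd x i t) \<partial>unitM) \<partial>cubeM)"
    by (subst unitM.nn_integral_fst[symmetric]) (auto simp: case_prod_beta)
  also have "\<dots> = emeasure cubeM A"
    by (subst nn_integral_cube_fiber[symmetric]) auto
  finally show "emeasure (distr (cubeM \<Otimes>\<^sub>M unitM) cubeM (\<lambda>(x, t). upd x i t)) A = emeasure cubeM A" .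
qed simp

text \<open>The image-measure form of the fibre formula carries integrability of \<open>h\<close>
  over to the product space, where Fubini's theorem for real functions applies.\<close>

lemma integral_cube_fiber:
  fixes h :: "real ^ 'd \<Rightarrow> real"
  assumes h: "integrable cubeM h"
  shows "(\<integral>x. h x \<partial>cubeM) = (\<integral>x. (\<integral>t. h (upd x i t) \<partial>unitM) \<partial>cubeM)"
proof -
  interpret P: pair_sigma_finite "cubeM :: (real ^ 'd) measure" unitM ..
  note mf[measurable] = measurable_fiber[OF borel_measurable_integrable[OF h], of i]
  have "integrable (distr (cubeM \<Otimes>\<^sub>M unitM) cubeM (\<lambda>(x, t). upd x i t)) h"
    using h by (simp only: distr_upd_cubeM)
  from integrable_distr[OF measurable_upd_cubeM this]
  have int: "integrable (cubeM \<Otimes>\<^sub>M unitM) (\<lambda>(x, t). h (upd x i t))"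
    by (simp add: case_prod_beta')
  have "(\<integral>x. h x \<partial>cubeM) = (\<integral>x. h x \<partial>distr (cubeM \<Otimes>\<^sub>M unitM) cubeM (\<lambda>(x, t). upd x i t))"
    by (simp only: distr_upd_cubeM)
  also have "\<dots> = (\<integral>z. (\<lambda>(x, t). h (upd x i t)) z \<partial>(cubeM \<Otimes>\<^sub>M unitM))"
    using h by (subst integral_distr) (auto simp: case_prod_beta')
  also have "\<dots> = (\<integral>x. (\<integral>t. h (upd x i t) \<partial>unitM) \<partial>cubeM)"
    using P.integral_fst'[OF int] by simp
  finally show ?thesis .
qed

section \<open>Continuous and Lipschitz functions on the cube\<close>

lemma closure_open_Cube: "closure (box 0 1 :: (real ^ 'd) set) = Cube"
proof -
  have "box 0 (1 :: real ^ 'd) \<noteq> {}"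
    by (auto simp: box_ne_empty Basis_vec_def inner_axis)
  then show ?thesis by (simp add: Cube_def closure_box)
qed

text \<open>Inside the open cube the set where the inequality fails is open, hence empty once it is
  null; the boundary follows by taking closures. This upgrades the essential bounds in the
  definition of a wavelet system to bounds at every point.\<close>

lemma AE_cubeM_le_imp_le:
  fixes f g :: "real ^ 'd \<Rightarrow> real"
  assumes f: "continuous_on Cube f" and g: "continuous_on Cube g"
    and le: "AE x in cubeM. f x \<le> g x" and x: "x \<in> Cube"
  shows "f x \<le> g x"
proof -
  let ?B = "box 0 1 :: (real ^ 'd) set"
  have sub: "?B \<subseteq> Cube" by (simp add: Cube_def box_subset_cbox)
  have AE: "AE x in lborel. x \<in> Cube \<longrightarrow> f x \<le> g x"
    using le unfolding cubeM_def by (subst (asm) AE_restrict_space_iff) auto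
  have cont: "continuous_on ?B (\<lambda>x. f x - g x)"
    using f g sub by (intro continuous_intros) (auto intro: continuous_on_subset)
  have op: "open {x\<in>?B. f x - g x > 0}"
    using continuous_open_preimage[OF cont, of "{0<..}"] by (simp add: vimage_def Int_def conj_commute open_box)
  have "AE x in lborel. x \<notin> {x\<in>?B. f x - g x > 0}"
    using AE by eventually_elim (use sub in auto)
  then have "{x\<in>?B. f x - g x > 0} \<in> null_sets lborel"
    using op by (subst AE_iff_null_sets) auto
  then have "negligible {x\<in>?B. f x - g x > 0}"
    by (simp add: negligible_iff_null_sets null_sets_completionI)
  then have "{x\<in>?B. f x - g x > 0} = {}"
    using op open_not_negligible by blast
  then have "f y - g y \<le> 0" if "y \<in> ?B" for y using that by force
  moreover have "continuous_on (closure ?B) (\<lambda>x. f x - g x)"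
    using f g by (simp add: closure_open_Cube continuous_intros)
  ultimately have "f x - g x \<le> 0"
    using x continuous_le_on_closure[of ?B "\<lambda>x. f x - g x" x 0] by (simp add: closure_open_Cube)
  then show ?thesis by simp
qed

lemma cont_bounded_Cube:
  fixes f :: "real ^ 'd \<Rightarrow> real"
  assumes "continuous_on Cube f"
  obtains K where "0 < K" "\<And>x. x \<in> Cube \<Longrightarrow> \<bar>f x\<bar> \<le> K"
proof -
  have "bounded (f ` Cube)"
    using assms compact_continuous_image compact_imp_bounded compact_Cube by blast
  then show ?thesis using that by (auto simp: bounded_pos)
qed

lemma integrable_cubeM_bounded:
  fixes f :: "real ^ 'd \<Rightarrow> real"
  assumes "f \<in> borel_measurable cubeM" "\<And>x. x \<in> Cube \<Longrightarrow> \<bar>f x\<bar> \<le> K"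
  shows "integrable cubeM f"
  using assms by (intro cubeM.integrable_const_bound[of _ K]) auto

lemma integrable_cubeM_cont:
  fixes f :: "real ^ 'd \<Rightarrow> real"
  assumes "continuous_on Cube f" shows "integrable cubeM f"
  using cont_bounded_Cube[OF assms] borel_measurable_cubeM_cont[OF assms] integrable_cubeM_bounded
  by metis

text \<open>The working class of functions: it contains the wavelets, is stable under linear
  combinations, truncation and averaging along coordinates, and its wavelet expansions converge
  uniformly.\<close>

definition lipc :: "(real ^ 'd \<Rightarrow> real) \<Rightarrow> bool" where
  "lipc f \<longleftrightarrow> (\<exists>K. \<forall>x\<in>Cube. \<forall>y\<in>Cube. \<bar>f x - f y\<bar> \<le> K * norm (x - y))"

lemma lipcE:
  assumes "lipc f" obtains K where "0 \<le> K" "\<And>x y. x \<in> Cube \<Longrightarrow> y \<in> Cube \<Longrightarrow> \<bar>f x - f y\<bar> \<le> K * norm (x - y)"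
proof -
  obtain K where K: "\<forall>x\<in>Cube. \<forall>y\<in>Cube. \<bar>f x - f y\<bar> \<le> K * norm (x - y)"
    using assms by (auto simp: lipc_def)
  have "\<bar>f x - f y\<bar> \<le> \<bar>K\<bar> * norm (x - y)" if "x \<in> Cube" "y \<in> Cube" for x y
    using K that by (meson abs_ge_self mult_right_mono norm_ge_zero order_trans)
  then show ?thesis using that[of "\<bar>K\<bar>"] by auto
qed

lemma lipc_cont: "lipc f \<Longrightarrow> continuous_on Cube f"
proof (erule lipcE)
  fix K assume "0 \<le> K" "\<And>x y. x \<in> Cube \<Longrightarrow> y \<in> Cube \<Longrightarrow> \<bar>f x - f y\<bar> \<le> K * norm (x - y)"
  then have "K-lipschitz_on Cube f" by (auto simp: lipschitz_on_def dist_norm)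
  then show ?thesis by (rule lipschitz_on_continuous_on)
qed

lemma lipc_const [simp]: "lipc (\<lambda>x. c)"
  by (auto simp: lipc_def intro: exI[of _ 0])

lemma lipc_add:
  assumes "lipc f" "lipc g" shows "lipc (\<lambda>x. f x + g x)"
proof -
  obtain K where K: "\<And>x y. x \<in> Cube \<Longrightarrow> y \<in> Cube \<Longrightarrow> \<bar>f x - f y\<bar> \<le> K * norm (x - y)" using assms lipcE by metis
  obtain L where L: "\<And>x y. x \<in> Cube \<Longrightarrow> y \<in> Cube \<Longrightarrow> \<bar>g x - g y\<bar> \<le> L * norm (x - y)" using assms lipcE by metis
  have "\<bar>f x + g x - (f y + g y)\<bar> \<le> (K + L) * norm (x - y)" if "x \<in> Cube" "y \<in> Cube" for x y
    using K[OF that] L[OF that] by (simp add: algebra_simps abs_if split: if_splits)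
  then show ?thesis unfolding lipc_def by blast
qed

lemma lipc_cmult:
  assumes "lipc f" shows "lipc (\<lambda>x. c * f x)"
proof -
  obtain K where K: "\<And>x y. x \<in> Cube \<Longrightarrow> y \<in> Cube \<Longrightarrow> \<bar>f x - f y\<bar> \<le> K * norm (x - y)" using assms lipcE by metis
  have "\<bar>c * f x - c * f y\<bar> \<le> (\<bar>c\<bar> * K) * norm (x - y)" if "x \<in> Cube" "y \<in> Cube" for x y
    using mult_left_mono[OF K[OF that], of "\<bar>c\<bar>"] by (simp add: algebra_simps flip: abs_mult)
  then show ?thesis unfolding lipc_def by blast
qed

lemma lipc_sum: "(\<And>k. k \<in> A \<Longrightarrow> lipc (f k)) \<Longrightarrow> lipc (\<lambda>x. \<Sum>k\<in>A. f k x)"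
  by (induction A rule: infinite_finite_induct) (auto intro: lipc_add)

lemma lipc_diff: "lipc f \<Longrightarrow> lipc g \<Longrightarrow> lipc (\<lambda>x. f x - g x)"
  using lipc_add[of f "\<lambda>x. -1 * g x"] lipc_cmult[of g "-1"] by simp

lemma lipc_max_const:
  assumes "lipc f" shows "lipc (\<lambda>x. max c (f x))"
proof -
  obtain K where K: "\<And>x y. x \<in> Cube \<Longrightarrow> y \<in> Cube \<Longrightarrow> \<bar>f x - f y\<bar> \<le> K * norm (x - y)" using assms lipcE by metis
  have "\<bar>max c (f x) - max c (f y)\<bar> \<le> K * norm (x - y)" if "x \<in> Cube" "y \<in> Cube" for x y
    using K[OF that] by (auto simp: max_def abs_if split: if_splits)
  then show ?thesis unfolding lipc_def by blast
qed

lemma lipc_min_const: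
  assumes "lipc f" shows "lipc (\<lambda>x. min (f x) c)"
proof -
  have "(\<lambda>x. min (f x) c) = (\<lambda>x. - 1 * max (- c) (- 1 * f x))"
    by (auto simp: max_def min_def)
  then show ?thesis using assms by (simp only: lipc_cmult lipc_max_const)
qed

section \<open>Couplings\<close>

lemma space_law [simp]: "space (law f) = Cube"
  by (simp add: law_def)

lemma sets_law [simp, measurable_cong]: "sets (law f) = sets cubeM"
  by (simp add: law_def)

lemma prob_space_law:
  fixes f :: "real ^ 'a \<Rightarrow> real"
  assumes "is_density f" shows "prob_space (law f)"
proof
  have [measurable]: "f \<in> borel_measurable cubeM" using assms by (simp add: is_density_def)
  have "emeasure (law f) (space (law f)) = (\<integral>\<^sup>+x. ennreal (f x) \<partial>cubeM)"
    unfolding law_def using sets.top[of "cubeM :: (real ^ 'a) measure"]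
    by (subst emeasure_density) (auto intro!: nn_integral_cong)
  also have "\<dots> = 1"
    using assms by (subst nn_integral_eq_integral) (auto simp: is_density_def)
  finally show "emeasure (law f) (space (law f)) = 1" .
qed

lemma nn_integral_law:
  assumes "f \<in> borel_measurable cubeM" "g \<in> borel_measurable cubeM"
  shows "(\<integral>\<^sup>+x. g x \<partial>law f) = (\<integral>\<^sup>+x. ennreal (f x) * g x \<partial>cubeM)"
  using assms unfolding law_def by (intro nn_integral_density) auto

text \<open>A bound on the distance together with a coupling that attains it. Having the witness
  allows one marginal to be altered while the other is kept, which replaces the gluing of couplings
  in the triangle inequality.\<close>

definition coupled :: "real \<Rightarrow> 'a::real_normed_vector measure \<Rightarrow> 'a measure \<Rightarrow> real \<Rightarrow> bool" where
  "coupled p M N A \<longleftrightarrow>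
     (\<exists>P\<in>couplings M N. (\<integral>\<^sup>+z. ennreal (norm (fst z - snd z) powr p) \<partial>P) \<le> ennreal (A powr p))"

lemma wasserstein_le_coupled:
  assumes "coupled p M N A" "0 \<le> A" "1 \<le> p"
  shows "wasserstein p M N \<le> ennreal A"
proof -
  let ?I = "INF P \<in> couplings M N. \<integral>\<^sup>+z. ennreal (norm (fst z - snd z) powr p) \<partial>P"
  have le: "?I \<le> ennreal (A powr p)"
    using assms(1) unfolding coupled_def by (meson INF_lower2)
  then have fin: "?I \<noteq> \<infinity>"
    by (metis ennreal_neq_top infinity_ennreal_def top_unique)
  have "enn2real ?I powr (1 / p) \<le> (A powr p) powr (1 / p)"
    using assms le by (intro powr_mono2) (auto intro: enn2real_leI)
  moreover have "wasserstein p M N = ennreal (enn2real ?I powr (1 / p))"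
    by (simp only: wasserstein_def epowr_def fin if_False)
  ultimately show ?thesis using assms by (simp add: powr_powr)
qed

lemma coupled_mono: "coupled p M N A \<Longrightarrow> 0 \<le> A \<Longrightarrow> A \<le> B \<Longrightarrow> 0 \<le> p \<Longrightarrow> coupled p M N B"
  unfolding coupled_def by (meson ennreal_leI order_trans powr_mono2)

text \<open>Independent coupling, with the diameter of the cube bounded in the l1 norm. It starts
  the iteration of the transport step and bounds the loss on exceptional samples.\<close>

lemma coupled_trivial:
  fixes M N :: "(real ^ 'd) measure"
  assumes "prob_space M" "prob_space N" and [measurable_cong]: "sets M = sets cubeM" "sets N = sets cubeM"
    and p: "1 \<le> p"
  shows "coupled p M N (real CARD('d))"
proof -
  interpret M: prob_space M by fact
  interpret N: prob_space N by fact
  interpret P: pair_prob_space M N ..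
  have sp: "space M = Cube" "space N = Cube"
    using sets_eq_imp_space_eq[OF assms(3)] sets_eq_imp_space_eq[OF assms(4)] by auto
  have "distr (M \<Otimes>\<^sub>M N) N snd = N"
  proof -
    have "distr (M \<Otimes>\<^sub>M N) N snd = distr (N \<Otimes>\<^sub>M M) N fst"
      by (subst P.distr_pair_swap) (auto simp: distr_distr comp_def case_prod_beta)
    then show ?thesis by (simp add: M.distr_pair_fst)
  qed
  then have "M \<Otimes>\<^sub>M N \<in> couplings M N"
    by (simp add: couplings_def N.distr_pair_fst)
  moreover have "(\<integral>\<^sup>+z. ennreal (norm (fst z - snd z) powr p) \<partial>(M \<Otimes>\<^sub>M N))
      \<le> (\<integral>\<^sup>+z. ennreal (real CARD('d) powr p) \<partial>(M \<Otimes>\<^sub>M N))"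
  proof (intro nn_integral_mono ennreal_leI powr_mono2)
    fix z assume "z \<in> space (M \<Otimes>\<^sub>M N)"
    then have z: "fst z \<in> Cube" "snd z \<in> Cube" by (auto simp: space_pair_measure sp)
    have "norm (fst z - snd z) \<le> (\<Sum>i\<in>UNIV. \<bar>(fst z - snd z) $ i\<bar>)" by (rule norm_le_l1_cart)
    also have "\<dots> \<le> (\<Sum>i\<in>(UNIV::'d set). 1)"
    proof (intro sum_mono)
      fix i
      have "0 \<le> fst z $ i" "fst z $ i \<le> 1" "0 \<le> snd z $ i" "snd z $ i \<le> 1" using z by (auto simp: mem_Cube)
      then show "\<bar>(fst z - snd z) $ i\<bar> \<le> 1" by (simp add: abs_le_iff)
    qed
    finally show "norm (fst z - snd z) \<le> real CARD('d)" by simp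
  qed (use p in auto)
  ultimately show ?thesis
    unfolding coupled_def by (auto simp: P.emeasure_space_1 intro!: bexI[of _ "M \<Otimes>\<^sub>M N"])
qed

section \<open>Moving a part of the mass of one marginal\<close>

lemma nn_integral_unit_split:
  assumes r: "0 \<le> r" "r \<le> 1"
  shows "(\<integral>\<^sup>+w. (if w \<le> r then u else v) \<partial>unitM) = ennreal r * u + ennreal (1 - r) * v"
proof -
  have sub: "{0..r} \<subseteq> {0..1}" "{r<..1} \<subseteq> {0..1}" using r by auto
  then have m: "{0..r} \<in> sets unitM" "{r<..1} \<in> sets unitM"
    by (auto simp: sets_restrict_space_iff)
  have e: "emeasure unitM {0..r} = ennreal r" "emeasure unitM {r<..1} = ennreal (1 - r)"
    using r sub by (simp_all add: emeasure_restrict_space)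
  have "(\<integral>\<^sup>+w. (if w \<le> r then u else v) \<partial>unitM) =
      (\<integral>\<^sup>+w. u * indicator {0..r} w + v * indicator {r<..1} w \<partial>unitM)"
    using r by (intro nn_integral_cong) (simp add: indicator_def)
  also have "\<dots> = u * ennreal r + v * ennreal (1 - r)"
    using m by (simp add: nn_integral_add nn_integral_cmult e)
  finally show ?thesis by (simp add: mult.commute)
qed

text \<open>A uniform variable decides, with probability \<open>a / s\<close>, whether mass at a
  point of density \<open>s\<close> is moved. The comparison is written as a product, so that it
  also makes sense where the density vanishes.\<close>

lemma nn_integral_split_density:
  assumes a: "0 \<le> a" "a \<le> s" and K: "prob_space K" and F[measurable]: "F \<in> borel_measurable K"
  shows "ennreal s * (\<integral>\<^sup>+wk. (if fst wk * s \<le> a then F (snd wk) else c) \<partial>(unitM \<Otimes>\<^sub>M K)) =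
    ennreal a * (\<integral>\<^sup>+k. F k \<partial>K) + ennreal (s - a) * c"
proof (cases "s = 0")
  case False
  then have s: "0 < s" using a by simp
  interpret K: prob_space K by fact
  have [measurable]: "fst \<in> borel_measurable (unitM \<Otimes>\<^sub>M K)"
    by (rule measurable_from_unitM) simp
  have "(\<integral>\<^sup>+wk. (if fst wk * s \<le> a then F (snd wk) else c) \<partial>(unitM \<Otimes>\<^sub>M K)) =
      (\<integral>\<^sup>+w. (\<integral>\<^sup>+k. (if w * s \<le> a then F k else c) \<partial>K) \<partial>unitM)"
    by (subst K.nn_integral_fst[symmetric]) (auto cong: if_cong)
  also have "\<dots> = (\<integral>\<^sup>+w. (if w \<le> a / s then (\<integral>\<^sup>+k. F k \<partial>K) else c) \<partial>unitM)"
    using s by (intro nn_integral_cong) (auto simp: field_simps K.emeasure_space_1)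
  also have "\<dots> = ennreal (a / s) * (\<integral>\<^sup>+k. F k \<partial>K) + ennreal (1 - a / s) * c"
    using a s by (intro nn_integral_unit_split) auto
  also have "ennreal s * \<dots> = (ennreal s * ennreal (a / s)) * (\<integral>\<^sup>+k. F k \<partial>K) + (ennreal s * ennreal (1 - a / s)) * c"
    by (simp add: distrib_left mult.assoc)
  also have "ennreal s * ennreal (a / s) = ennreal a"
    using a s by (simp flip: ennreal_mult)
  also have "ennreal s * ennreal (1 - a / s) = ennreal (s - a)"
    using a s by (simp add: field_simps flip: ennreal_mult)
  finally show ?thesis .
qed (use a in simp)

lemma couplingsD:
  assumes P: "P \<in> couplings M N" and "sets M = sets cubeM" "sets N = sets cubeM" "prob_space M"
  shows "sets P = sets (cubeM \<Otimes>\<^sub>M cubeM)" "space P = Cube \<times> Cube" "prob_space P"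
    "distr P M fst = M" "distr P N snd = N"
proof -
  show S: "sets P = sets (cubeM \<Otimes>\<^sub>M cubeM)"
    using P assms(2,3) by (auto simp: couplings_def cong: sets_pair_measure_cong)
  then show sp: "space P = Cube \<times> Cube"
    using sets_eq_imp_space_eq[OF S] by (simp add: space_pair_measure)
  show d: "distr P M fst = M" "distr P N snd = N" using P by (auto simp: couplings_def)
  have m: "fst \<in> measurable P M"
    using measurable_cong_sets[OF S assms(2)] by simp
  interpret prob_space M by fact
  show "prob_space P"
  proof
    have "emeasure P (space P) = emeasure (distr P M fst) (space M)"
      using m by (subst emeasure_distr) (auto intro!: arg_cong[where f="emeasure P"] dest: measurable_space)
    then show "emeasure P (space P) = 1" by (simp add: d emeasure_space_1)
  qed
qed

text \<open>Of the mass \<open>\<sigma> x\<close> at \<open>x\<close>, the part \<open>a x\<close>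
  is sent through the randomised map \<open>T\<close> and the rest stays; \<open>push\<close> says
  that the moved part arrives with density \<open>b\<close>. The given coupling is enlarged by
  independent randomness and its first component is moved, so the second marginal is unchanged and,
  by Minkowski's inequality on the enlarged space, the costs add up.\<close>

lemma coupled_transport_part:
  fixes \<sigma> a b :: "real ^ 'd \<Rightarrow> real" and K :: "'k measure"
  assumes \<sigma>: "is_density \<sigma>" and [measurable]: "a \<in> borel_measurable cubeM" "b \<in> borel_measurable cubeM"
    and a: "\<And>x. x \<in> Cube \<Longrightarrow> 0 \<le> a x" "\<And>x. x \<in> Cube \<Longrightarrow> a x \<le> \<sigma> x"
    and b: "\<And>x. x \<in> Cube \<Longrightarrow> 0 \<le> b x"
    and K: "prob_space K" and T[measurable]: "T \<in> measurable (cubeM \<Otimes>\<^sub>M K) cubeM"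
    and push: "\<And>A. A \<in> sets cubeM \<Longrightarrow>
      (\<integral>\<^sup>+x. ennreal (a x) * (\<integral>\<^sup>+k. indicator A (T (x, k)) \<partial>K) \<partial>cubeM) = (\<integral>\<^sup>+x. ennreal (b x) * indicator A x \<partial>cubeM)"
    and cost: "(\<integral>\<^sup>+x. ennreal (a x) * (\<integral>\<^sup>+k. ennreal (norm (T (x, k) - x) powr p) \<partial>K) \<partial>cubeM) \<le> ennreal (B powr p)"
    and [measurable_cong]: "sets N = sets cubeM"
    and cpl: "coupled p (law \<sigma>) N A" and AB: "0 < A" "0 < B" and p: "1 \<le> p"
  shows "coupled p (law (\<lambda>x. \<sigma> x - a x + b x)) N (A + B)"
proof -
  have [measurable]: "\<sigma> \<in> borel_measurable cubeM" using \<sigma> by (simp add: is_density_def)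
  obtain P where P: "P \<in> couplings (law \<sigma>) N"
    and PA: "(\<integral>\<^sup>+z. ennreal (norm (fst z - snd z) powr p) \<partial>P) \<le> ennreal (A powr p)"
    using cpl by (auto simp: coupled_def)
  note [measurable_cong] = couplingsD(1)[OF P sets_law assms(11) prob_space_law[OF \<sigma>]]
  note sp = couplingsD(2)[OF P sets_law assms(11) prob_space_law[OF \<sigma>]]
  note d1 = couplingsD(4)[OF P sets_law assms(11) prob_space_law[OF \<sigma>]]
  note d2 = couplingsD(5)[OF P sets_law assms(11) prob_space_law[OF \<sigma>]]
  interpret PP: prob_space P by (rule couplingsD(3)[OF P sets_law assms(11) prob_space_law[OF \<sigma>]])
  interpret K: prob_space K by fact
  let ?R = "unitM \<Otimes>\<^sub>M K"
  have "prob_space ?R"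
  proof -
    interpret pair_prob_space unitM K ..
    show ?thesis by unfold_locales
  qed
  then interpret R': prob_space ?R .
  interpret Q: pair_prob_space P ?R ..
  let ?Q = "P \<Otimes>\<^sub>M ?R"
  \<comment> \<open>The new position of the first component: \<open>fst wk\<close> decides whether
    to move, \<open>snd wk\<close> drives the map \<open>T\<close>.\<close>
  define S where "S = (\<lambda>x wk. if fst wk * \<sigma> x \<le> a x then T (x, snd wk) else x)"
  have cm: "id \<in> borel_measurable (cubeM :: (real ^ 'd) measure)" "fst \<in> borel_measurable ?R"
    by (auto intro!: measurable_from_unitM simp: id_def)
  have S[measurable]: "(\<lambda>(x, wk). S x wk) \<in> measurable (cubeM \<Otimes>\<^sub>M ?R) cubeM"
  proof -
    have [measurable]: "(\<lambda>z. fst (snd z)) \<in> borel_measurable (cubeM \<Otimes>\<^sub>M ?R :: ((real ^ 'd) \<times> real \<times> _) measure)"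
      by (rule measurable_from_unitM) simp
    show ?thesis unfolding S_def case_prod_beta by measurable
  qed
  have S'[measurable]: "(\<lambda>z. S (fst (fst z)) (snd z)) \<in> measurable ?Q cubeM"
  proof -
    have "(\<lambda>z. (\<lambda>(x, wk). S x wk) (fst (fst z), snd z)) \<in> measurable ?Q cubeM"
      by (rule measurable_compose[OF _ S]) measurable
    then show ?thesis by simp
  qed
  define G where "G = (\<lambda>z :: ((real ^ 'd) \<times> (real ^ 'd)) \<times> real \<times> 'k. (S (fst (fst z)) (snd z), snd (fst z)))"
  let ?\<sigma>' = "\<lambda>x. \<sigma> x - a x + b x"
  have G[measurable]: "G \<in> measurable ?Q (cubeM \<Otimes>\<^sub>M cubeM)"
    unfolding G_def by measurable
  have marg: "(\<integral>\<^sup>+z. h (fst z) \<partial>?Q) = (\<integral>\<^sup>+z. h z \<partial>P)" if [measurable]: "h \<in> borel_measurable P" for h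
    by (subst R'.nn_integral_fst[symmetric]) (auto simp: R'.emeasure_space_1)
  \<comment> \<open>Any function of the old and the new position is integrated by first averaging
    over the added randomness and then using that the old position has density
    \<open>\<sigma>\<close>. Both the new marginal and the cost of the move are instances.\<close>
  have key: "(\<integral>\<^sup>+z. h (fst (fst z)) (S (fst (fst z)) (snd z)) \<partial>?Q) =
      (\<integral>\<^sup>+x. ennreal (a x) * (\<integral>\<^sup>+k. h x (T (x, k)) \<partial>K) + ennreal (\<sigma> x - a x) * h x x \<partial>cubeM)"
    if h[measurable]: "(\<lambda>(x, y). h x y) \<in> borel_measurable (cubeM \<Otimes>\<^sub>M cubeM)" for h :: "real ^ 'd \<Rightarrow> real ^ 'd \<Rightarrow> ennreal"
  proof -
    define H where "H = (\<lambda>x. \<integral>\<^sup>+wk. h x (S x wk) \<partial>?R)"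
    have hm: "(\<lambda>(x, wk). h x (S x wk)) \<in> borel_measurable (cubeM \<Otimes>\<^sub>M ?R)"
      using measurable_compose[OF _ h, of "\<lambda>(x, wk). (x, S x wk)" "cubeM \<Otimes>\<^sub>M ?R"] by (simp add: case_prod_beta)
    then have [measurable]: "H \<in> borel_measurable cubeM"
      unfolding H_def by (rule R'.borel_measurable_nn_integral)
    have hq: "(\<lambda>z. h (fst (fst z)) (S (fst (fst z)) (snd z))) \<in> borel_measurable ?Q"
      using measurable_compose[OF _ h, of "\<lambda>z. (fst (fst z), S (fst (fst z)) (snd z))" ?Q] by simp
    have "(\<integral>\<^sup>+z. h (fst (fst z)) (S (fst (fst z)) (snd z)) \<partial>?Q) = (\<integral>\<^sup>+z. H (fst z) \<partial>P)"
      unfolding H_def using hq by (subst R'.nn_integral_fst[symmetric]) auto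
    also have "\<dots> = (\<integral>\<^sup>+x. H x \<partial>distr P (law \<sigma>) fst)"
      by (subst nn_integral_distr) auto
    also have "\<dots> = (\<integral>\<^sup>+x. ennreal (\<sigma> x) * H x \<partial>cubeM)"
      unfolding d1 by (rule nn_integral_law) auto
    also have "\<dots> = (\<integral>\<^sup>+x. ennreal (a x) * (\<integral>\<^sup>+k. h x (T (x, k)) \<partial>K) + ennreal (\<sigma> x - a x) * h x x \<partial>cubeM)"
    proof (rule nn_integral_cong)
      fix x :: "real ^ 'd" assume x: "x \<in> space cubeM"
      have F: "(\<lambda>k. h x (T (x, k))) \<in> borel_measurable K"
        using measurable_compose[OF _ h, of "\<lambda>k. (x, T (x, k))" K] x by simp
      have "H x = (\<integral>\<^sup>+wk. (if fst wk * \<sigma> x \<le> a x then h x (T (x, snd wk)) else h x x) \<partial>?R)"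
        unfolding H_def S_def by (intro nn_integral_cong) auto
      then show "ennreal (\<sigma> x) * H x = ennreal (a x) * (\<integral>\<^sup>+k. h x (T (x, k)) \<partial>K) + ennreal (\<sigma> x - a x) * h x x"
        using nn_integral_split_density[OF _ _ K F, of "a x" "\<sigma> x" "h x x"] a x by simp
    qed
    finally show ?thesis .
  qed
  let ?P' = "distr ?Q (law ?\<sigma>' \<Otimes>\<^sub>M N) G"
  have [measurable_cong]: "sets (law ?\<sigma>' \<Otimes>\<^sub>M N) = sets (cubeM \<Otimes>\<^sub>M cubeM)"
    by (rule sets_pair_measure_cong) (auto simp: assms)
  have "?P' \<in> couplings (law ?\<sigma>') N"
    unfolding couplings_def
  proof (intro CollectI conjI)
    show "distr ?P' (law ?\<sigma>') fst = law ?\<sigma>'"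
    proof (rule measure_eqI)
      fix A assume "A \<in> sets (distr ?P' (law ?\<sigma>') fst)"
      then have A[measurable]: "A \<in> sets cubeM" by simp
      have "emeasure (distr ?P' (law ?\<sigma>') fst) A = (\<integral>\<^sup>+x. indicator A x \<partial>distr ?P' (law ?\<sigma>') fst)"
        by simp
      also have "\<dots> = (\<integral>\<^sup>+z. indicator A (fst z) \<partial>?P')"
        by (rule nn_integral_distr) measurable
      also have "\<dots> = (\<integral>\<^sup>+z. indicator A (fst (G z)) \<partial>?Q)"
        by (rule nn_integral_distr) measurable
      also have "\<dots> = (\<integral>\<^sup>+z. indicator A (S (fst (fst z)) (snd z)) \<partial>?Q)"
        by (simp add: G_def)
      also have "\<dots> = (\<integral>\<^sup>+x. ennreal (a x) * (\<integral>\<^sup>+k. indicator A (T (x, k)) \<partial>K) + ennreal (\<sigma> x - a x) * indicator A x \<partial>cubeM)"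
        by (rule key[of "\<lambda>x y. indicator A y"]) measurable
      also have "\<dots> = (\<integral>\<^sup>+x. ennreal (a x) * (\<integral>\<^sup>+k. indicator A (T (x, k)) \<partial>K) \<partial>cubeM) +
          (\<integral>\<^sup>+x. ennreal (\<sigma> x - a x) * indicator A x \<partial>cubeM)"
        by (rule nn_integral_add) measurable
      also have "\<dots> = (\<integral>\<^sup>+x. ennreal (b x) * indicator A x + ennreal (\<sigma> x - a x) * indicator A x \<partial>cubeM)"
        unfolding push[OF A] by (rule nn_integral_add[symmetric]) measurable
      also have "\<dots> = (\<integral>\<^sup>+x. ennreal (?\<sigma>' x) * indicator A x \<partial>cubeM)"
        using a b by (intro nn_integral_cong) (auto simp: indicator_def simp flip: ennreal_plus)
      also have "\<dots> = emeasure (law ?\<sigma>') A"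
        unfolding law_def by (rule emeasure_density[symmetric]) auto
      finally show "emeasure (distr ?P' (law ?\<sigma>') fst) A = emeasure (law ?\<sigma>') A" .
    qed simp
    show "distr ?P' N snd = N"
    proof (rule measure_eqI)
      fix A assume "A \<in> sets (distr ?P' N snd)"
      then have A[measurable]: "A \<in> sets N" by simp
      have "emeasure (distr ?P' N snd) A = (\<integral>\<^sup>+x. indicator A x \<partial>distr ?P' N snd)"
        by simp
      also have "\<dots> = (\<integral>\<^sup>+z. indicator A (snd z) \<partial>?P')"
        by (rule nn_integral_distr) measurable
      also have "\<dots> = (\<integral>\<^sup>+z. indicator A (snd (G z)) \<partial>?Q)"
        by (rule nn_integral_distr) measurable
      also have "\<dots> = (\<integral>\<^sup>+z. indicator A (snd (fst z)) \<partial>?Q)"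
        by (simp add: G_def)
      also have "\<dots> = (\<integral>\<^sup>+z. indicator A (snd z) \<partial>P)"
        by (rule marg) measurable
      also have "\<dots> = (\<integral>\<^sup>+x. indicator A x \<partial>distr P N snd)"
        by (rule nn_integral_distr[symmetric]) measurable
      also have "\<dots> = emeasure N A" by (simp add: d2)
      finally show "emeasure (distr ?P' N snd) A = emeasure N A" .
    qed simp
  qed simp
  moreover have "(\<integral>\<^sup>+z. ennreal (norm (fst z - snd z) powr p) \<partial>?P') \<le> ennreal ((A + B) powr p)"
  proof -
    have [measurable]: "(\<lambda>z. fst (fst z)) \<in> borel_measurable ?Q" "(\<lambda>z. snd (fst z)) \<in> borel_measurable ?Q"
        "(\<lambda>z. S (fst (fst z)) (snd z)) \<in> borel_measurable ?Q"
      by (rule measurable_from_cubeM, measurable)+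
    have nm: "(\<lambda>z. ennreal (norm (fst z - snd z) powr p)) \<in> borel_measurable (cubeM \<Otimes>\<^sub>M cubeM :: ((real ^ 'd) \<times> (real ^ 'd)) measure)"
    proof -
      have [measurable]: "fst \<in> borel_measurable (cubeM \<Otimes>\<^sub>M cubeM :: ((real ^ 'd) \<times> (real ^ 'd)) measure)"
         "snd \<in> borel_measurable (cubeM \<Otimes>\<^sub>M cubeM :: ((real ^ 'd) \<times> (real ^ 'd)) measure)"
        by (rule measurable_from_cubeM, measurable)+
      show ?thesis by measurable
    qed
    have c1: "(\<integral>\<^sup>+z. ennreal (norm (fst (fst z) - snd (fst z)) powr p) \<partial>?Q) \<le> ennreal (A powr p)"
      using marg[of "\<lambda>z. ennreal (norm (fst z - snd z) powr p)"] nm PA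
      by (simp add: measurable_cong_sets[OF couplingsD(1)[OF P sets_law assms(11) prob_space_law[OF \<sigma>]] refl])
    have nm2: "(\<lambda>(x, y). ennreal (norm (y - x) powr p)) \<in> borel_measurable (cubeM \<Otimes>\<^sub>M cubeM :: ((real ^ 'd) \<times> (real ^ 'd)) measure)"
      using nm by (simp add: case_prod_beta norm_minus_commute)
    have c2: "(\<integral>\<^sup>+z. ennreal (norm (S (fst (fst z)) (snd z) - fst (fst z)) powr p) \<partial>?Q) \<le> ennreal (B powr p)"
      using key[OF nm2] cost by simp
    have "(\<integral>\<^sup>+z. ennreal (norm (fst z - snd z) powr p) \<partial>?P') =
        (\<integral>\<^sup>+z. ennreal (norm (S (fst (fst z)) (snd z) - snd (fst z)) powr p) \<partial>?Q)"
      using nm by (subst nn_integral_distr) (auto simp: G_def cong: measurable_cong_sets)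
    also have "\<dots> \<le> (\<integral>\<^sup>+z. ennreal ((norm (fst (fst z) - snd (fst z)) +
        norm (S (fst (fst z)) (snd z) - fst (fst z))) powr p) \<partial>?Q)"
    proof (intro nn_integral_mono ennreal_leI powr_mono2)
      fix z
      show "norm (S (fst (fst z)) (snd z) - snd (fst z)) \<le>
          norm (fst (fst z) - snd (fst z)) + norm (S (fst (fst z)) (snd z) - fst (fst z))"
        using norm_triangle_ineq[of "fst (fst z) - snd (fst z)" "S (fst (fst z)) (snd z) - fst (fst z)"]
        by (simp add: algebra_simps)
    qed (use p in auto)
    also have "\<dots> \<le> ennreal ((A + B) powr p)"
      by (rule nn_integral_minkowski) (use c1 c2 p AB in auto)
    finally show ?thesis .
  qed
  ultimately show ?thesis unfolding coupled_def by blast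
qed

text \<open>A fair coin decides whether the first component is kept or placed on its partner. Half
  of the p-th power of the cost disappears; this contraction is what later absorbs the unknown
  distance.\<close>

lemma coupled_mixture:
  fixes f g :: "real ^ 'd \<Rightarrow> real"
  assumes f: "is_density f" and g: "is_density g"
    and nn: "\<And>x. x \<in> Cube \<Longrightarrow> 0 \<le> f x" "\<And>x. x \<in> Cube \<Longrightarrow> 0 \<le> g x"
    and cpl: "coupled p (law f) (law g) A" and p: "1 \<le> p" and A: "0 \<le> A"
  shows "coupled p (law (\<lambda>x. (f x + g x) / 2)) (law g) (A * 2 powr (- 1 / p))"
proof -
  have [measurable]: "f \<in> borel_measurable cubeM" "g \<in> borel_measurable cubeM"
    using f g by (auto simp: is_density_def)
  obtain P where P: "P \<in> couplings (law f) (law g)"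
    and PA: "(\<integral>\<^sup>+z. ennreal (norm (fst z - snd z) powr p) \<partial>P) \<le> ennreal (A powr p)"
    using cpl by (auto simp: coupled_def)
  note D = couplingsD[OF P sets_law sets_law prob_space_law[OF f]]
  note [measurable_cong] = D(1)
  interpret PP: prob_space P by (rule D(3))
  interpret Q: pair_prob_space P unitM ..
  let ?Q = "P \<Otimes>\<^sub>M unitM"
  have w[measurable]: "snd \<in> borel_measurable ?Q" by (rule measurable_from_unitM) simp
  define G where "G = (\<lambda>z :: ((real ^ 'd) \<times> (real ^ 'd)) \<times> real. (if snd z \<le> 1/2 then fst (fst z) else snd (fst z), snd (fst z)))"
  have G[measurable]: "G \<in> measurable ?Q (cubeM \<Otimes>\<^sub>M cubeM)"
    unfolding G_def by measurable
  let ?h = "\<lambda>x. (f x + g x) / 2"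
  have key: "(\<integral>\<^sup>+z. h (G z) \<partial>?Q) = (\<integral>\<^sup>+z. ennreal (1/2) * h z + ennreal (1/2) * h (snd z, snd z) \<partial>P)"
    if [measurable]: "h \<in> borel_measurable (cubeM \<Otimes>\<^sub>M cubeM)" for h
  proof -
    have "(\<integral>\<^sup>+z. h (G z) \<partial>?Q) = (\<integral>\<^sup>+z. (\<integral>\<^sup>+w. h (G (z, w)) \<partial>unitM) \<partial>P)"
      by (rule unitM.nn_integral_fst[symmetric]) measurable
    also have "\<dots> = (\<integral>\<^sup>+z. (\<integral>\<^sup>+w. (if w \<le> 1/2 then h z else h (snd z, snd z)) \<partial>unitM) \<partial>P)"
      by (intro nn_integral_cong) (auto simp: G_def)
    also have "\<dots> = (\<integral>\<^sup>+z. ennreal (1/2) * h z + ennreal (1/2) * h (snd z, snd z) \<partial>P)"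
      by (intro nn_integral_cong) (subst nn_integral_unit_split, auto)
    finally show ?thesis .
  qed
  have half: "ennreal (1/2) * ennreal u + ennreal (1/2) * ennreal v = ennreal ((u + v) / 2)"
    if "0 \<le> u" "0 \<le> v" for u v :: real
    using that by (subst (1 2) ennreal_mult[symmetric]) (auto simp: add_divide_distrib simp flip: ennreal_plus)
  let ?P' = "distr ?Q (law ?h \<Otimes>\<^sub>M law g) G"
  have mu: "(\<integral>\<^sup>+z. k (fst z) \<partial>P) = (\<integral>\<^sup>+x. ennreal (f x) * k x \<partial>cubeM)"
      "(\<integral>\<^sup>+z. k (snd z) \<partial>P) = (\<integral>\<^sup>+x. ennreal (g x) * k x \<partial>cubeM)"
    if [measurable]: "k \<in> borel_measurable cubeM" for k
  proof -
    have "(\<integral>\<^sup>+z. k (fst z) \<partial>P) = (\<integral>\<^sup>+x. k x \<partial>distr P (law f) fst)"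
      by (rule nn_integral_distr[symmetric]) measurable
    then show "(\<integral>\<^sup>+z. k (fst z) \<partial>P) = (\<integral>\<^sup>+x. ennreal (f x) * k x \<partial>cubeM)"
      by (simp add: D nn_integral_law)
    have "(\<integral>\<^sup>+z. k (snd z) \<partial>P) = (\<integral>\<^sup>+x. k x \<partial>distr P (law g) snd)"
      by (rule nn_integral_distr[symmetric]) measurable
    then show "(\<integral>\<^sup>+z. k (snd z) \<partial>P) = (\<integral>\<^sup>+x. ennreal (g x) * k x \<partial>cubeM)"
      by (simp add: D nn_integral_law)
  qed
  have [measurable_cong]: "sets (law ?h \<Otimes>\<^sub>M law g) = sets (cubeM \<Otimes>\<^sub>M cubeM)"
    by (rule sets_pair_measure_cong) (auto simp: assms)
  have "?P' \<in> couplings (law ?h) (law g)"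
    unfolding couplings_def
  proof (intro CollectI conjI)
    show "distr ?P' (law ?h) fst = law ?h"
    proof (rule measure_eqI)
      fix A assume "A \<in> sets (distr ?P' (law ?h) fst)"
      then have A[measurable]: "A \<in> sets cubeM" by simp
      have "emeasure (distr ?P' (law ?h) fst) A = (\<integral>\<^sup>+x. indicator A x \<partial>distr ?P' (law ?h) fst)"
        by simp
      also have "\<dots> = (\<integral>\<^sup>+z. indicator A (fst z) \<partial>?P')"
        by (rule nn_integral_distr) measurable
      also have "\<dots> = (\<integral>\<^sup>+z. indicator A (fst (G z)) \<partial>?Q)"
        by (rule nn_integral_distr) measurable
      also have "\<dots> = (\<integral>\<^sup>+z. ennreal (1/2) * indicator A (fst z) + ennreal (1/2) * indicator A (fst (snd z, snd z)) \<partial>P)"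
        by (rule key[of "\<lambda>z. indicator A (fst z)"]) measurable
      also have "\<dots> = ennreal (1/2) * (\<integral>\<^sup>+z. indicator A (fst z) \<partial>P) + ennreal (1/2) * (\<integral>\<^sup>+z. indicator A (snd z) \<partial>P)"
        by (simp add: nn_integral_add nn_integral_cmult)
      also have "\<dots> = (\<integral>\<^sup>+x. ennreal (1/2) * (ennreal (f x) * indicator A x) + ennreal (1/2) * (ennreal (g x) * indicator A x) \<partial>cubeM)"
        by (simp add: nn_integral_add nn_integral_cmult mu)
      also have "\<dots> = (\<integral>\<^sup>+x. ennreal (?h x) * indicator A x \<partial>cubeM)"
        using nn by (intro nn_integral_cong) (auto simp: indicator_def half[unfolded ennreal_half])
      also have "\<dots> = emeasure (law ?h) A"
        unfolding law_def by (rule emeasure_density[symmetric]) auto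
      finally show "emeasure (distr ?P' (law ?h) fst) A = emeasure (law ?h) A" .
    qed simp
    show "distr ?P' (law g) snd = law g"
    proof (rule measure_eqI)
      fix A assume "A \<in> sets (distr ?P' (law g) snd)"
      then have A[measurable]: "A \<in> sets cubeM" by simp
      have "emeasure (distr ?P' (law g) snd) A = (\<integral>\<^sup>+x. indicator A x \<partial>distr ?P' (law g) snd)"
        by simp
      also have "\<dots> = (\<integral>\<^sup>+z. indicator A (snd z) \<partial>?P')"
        by (rule nn_integral_distr) measurable
      also have "\<dots> = (\<integral>\<^sup>+z. indicator A (snd (G z)) \<partial>?Q)"
        by (rule nn_integral_distr) measurable
      also have "\<dots> = (\<integral>\<^sup>+z. ennreal (1/2) * indicator A (snd z) + ennreal (1/2) * indicator A (snd (snd z, snd z)) \<partial>P)"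
        by (rule key[of "\<lambda>z. indicator A (snd z)"]) measurable
      also have "\<dots> = (\<integral>\<^sup>+z. indicator A (snd z) \<partial>P)"
        using half[of 1 1] by (intro nn_integral_cong) (auto simp: indicator_def)
      also have "\<dots> = emeasure (law g) A"
        by (subst mu) (auto simp: law_def emeasure_density)
      finally show "emeasure (distr ?P' (law g) snd) A = emeasure (law g) A" .
    qed simp
  qed simp
  moreover have "(\<integral>\<^sup>+z. ennreal (norm (fst z - snd z) powr p) \<partial>?P') \<le> ennreal ((A * 2 powr (- 1 / p)) powr p)"
  proof -
    have [measurable]: "fst \<in> borel_measurable (cubeM \<Otimes>\<^sub>M cubeM :: ((real ^ 'd) \<times> (real ^ 'd)) measure)"
         "snd \<in> borel_measurable (cubeM \<Otimes>\<^sub>M cubeM :: ((real ^ 'd) \<times> (real ^ 'd)) measure)"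
      by (rule measurable_from_cubeM, measurable)+
    have nm[measurable]: "(\<lambda>z. ennreal (norm (fst z - snd z) powr p)) \<in> borel_measurable (cubeM \<Otimes>\<^sub>M cubeM :: ((real ^ 'd) \<times> (real ^ 'd)) measure)"
      by measurable
    have nmP: "(\<lambda>z. ennreal (norm (fst z - snd z) powr p)) \<in> borel_measurable P"
      using nm by (simp add: measurable_cong_sets[OF D(1) refl])
    have "(\<integral>\<^sup>+z. ennreal (norm (fst z - snd z) powr p) \<partial>?P') = (\<integral>\<^sup>+z. ennreal (norm (fst (G z) - snd (G z)) powr p) \<partial>?Q)"
      using nm by (subst nn_integral_distr) (auto cong: measurable_cong_sets)
    also have "\<dots> = (\<integral>\<^sup>+z. ennreal (1/2) * ennreal (norm (fst z - snd z) powr p) + ennreal (1/2) * ennreal (norm (fst (snd z, snd z) - snd (snd z, snd z)) powr p) \<partial>P)"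
      by (rule key[OF nm])
    also have "\<dots> = ennreal (1/2) * (\<integral>\<^sup>+z. ennreal (norm (fst z - snd z) powr p) \<partial>P)"
      using nmP by (simp add: nn_integral_cmult)
    also have "\<dots> \<le> ennreal (1/2) * ennreal (A powr p)"
      by (intro mult_left_mono PA) auto
    also have "\<dots> = ennreal ((A * 2 powr (- 1 / p)) powr p)"
    proof -
      have "(A * 2 powr (- 1 / p)) powr p = (1/2) * A powr p"
      proof -
        have "(2 powr (1 / p)) powr p = (2::real)" using p by (simp add: powr_powr)
        then show ?thesis using A p by (simp add: powr_divide powr_minus_divide)
      qed
      moreover have "ennreal (1/2) * ennreal (A powr p) = ennreal (1/2 * A powr p)"
        by (rule ennreal_mult[symmetric]) auto
      ultimately show ?thesis by (simp only:)
    qed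
    finally show ?thesis .
  qed
  ultimately show ?thesis unfolding coupled_def by blast
qed

section \<open>Transport along one coordinate\<close>

declare measurable_id_unitM [measurable del] measurable_id_cubeM [measurable del]

lemma measurable_nth_cubeM [measurable]: "(\<lambda>x. x $ i) \<in> borel_measurable cubeM"
  by (intro borel_measurable_cubeM_cont continuous_intros)

lemma law_cong:
  assumes "f \<in> borel_measurable cubeM" "g \<in> borel_measurable cubeM" "AE x in cubeM. f x = g x"
  shows "law f = law g"
  unfolding law_def using assms by (intro density_cong) auto

definition avg :: "'d \<Rightarrow> (real ^ 'd \<Rightarrow> real) \<Rightarrow> real ^ 'd \<Rightarrow> real" where
  "avg i v x = (\<integral>t. v (upd x i t) \<partial>unitM)"

text \<open>The primitive of \<open>v\<close> along the line through \<open>x\<close>, started at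
  the face where the coordinate is 0: a flux in direction \<open>i\<close> whose derivative in that
  direction is \<open>v\<close>. It returns to 0 at the opposite face when
  \<open>avg i v x = 0\<close>.\<close>

definition fib :: "'d \<Rightarrow> (real ^ 'd \<Rightarrow> real) \<Rightarrow> real ^ 'd \<Rightarrow> real" where
  "fib i v x = (\<integral>t. indicator {..x $ i} t * v (upd x i t) \<partial>unitM)"

lemma measurable_fib_integrand:
  assumes "v \<in> borel_measurable cubeM"
  shows "(\<lambda>(x, t). indicator {..x $ i} t * v (upd x i t) :: real) \<in> borel_measurable (cubeM \<Otimes>\<^sub>M unitM)"
proof -
  have [measurable]: "(\<lambda>z. v (upd (fst z) i (snd z))) \<in> borel_measurable (cubeM \<Otimes>\<^sub>M unitM)"
    using measurable_fiber[OF assms, of i] by (simp add: case_prod_beta')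
  have [measurable]: "fst \<in> borel_measurable (cubeM \<Otimes>\<^sub>M unitM :: ((real ^ 'a) \<times> real) measure)"
      "snd \<in> borel_measurable (cubeM \<Otimes>\<^sub>M unitM :: ((real ^ 'a) \<times> real) measure)"
    by (auto intro!: measurable_from_cubeM measurable_from_unitM)
  have "(\<lambda>z. (if snd z \<le> fst z $ i then 1 else 0) * v (upd (fst z) i (snd z)) :: real) \<in> borel_measurable (cubeM \<Otimes>\<^sub>M unitM)"
    by measurable
  then show ?thesis by (simp add: case_prod_beta' indicator_def of_bool_def)
qed

lemma measurable_fib [measurable]:
  assumes "v \<in> borel_measurable cubeM" shows "fib i v \<in> borel_measurable cubeM"
  using unitM.borel_measurable_lebesgue_integral[OF measurable_fib_integrand[OF assms, of i]]
  by (simp add: fib_def[abs_def])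

lemma section_integrable:
  assumes v: "v \<in> borel_measurable cubeM" "\<And>x. x \<in> Cube \<Longrightarrow> \<bar>v x\<bar> \<le> M" and x: "x \<in> Cube"
  shows "integrable unitM (\<lambda>t. v (upd x i t))" "integrable unitM (\<lambda>t. indicator {..c} t * v (upd x i t) :: real)"
proof -
  have m[measurable]: "(\<lambda>t. v (upd x i t)) \<in> borel_measurable unitM"
    using measurable_compose[OF measurable_upd_section[OF x] v(1)] .
  show 1: "integrable unitM (\<lambda>t. v (upd x i t))"
    by (rule unitM.integrable_const_bound[of _ M]) (use v x in \<open>auto intro!: AE_I2 simp: upd_Cube\<close>)
  have mc: "indicator {..c} \<in> borel_measurable unitM"
    by (rule measurable_compose[OF measurable_id_unitM]) simp
  show "integrable unitM (\<lambda>t. indicator {..c} t * v (upd x i t) :: real)"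
    by (rule Bochner_Integration.integrable_bound[OF 1 borel_measurable_times[OF mc m]]) (auto simp: indicator_def)
qed

lemma measure_unitM_atMost: "0 \<le> c \<Longrightarrow> c \<le> 1 \<Longrightarrow> (\<integral>t. indicator {..c} t \<partial>unitM) = c"
proof -
  assume c: "0 \<le> c" "c \<le> 1"
  have "(\<integral>t. indicator {..c} t \<partial>unitM) = measure unitM ({..c} \<inter> space unitM)"
    by simp
  also have "{..c} \<inter> space unitM = {0..c}" using c by auto
  also have "measure unitM {0..c} = measure lborel {0..c}"
    using c by (intro measure_restrict_space) auto
  finally show ?thesis using c by simp
qed

lemma fib_bound:
  assumes v: "v \<in> borel_measurable cubeM" "\<And>x. x \<in> Cube \<Longrightarrow> \<bar>v x\<bar> \<le> M" and x: "x \<in> Cube" and M: "0 \<le> M"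
  shows "\<bar>fib i v x\<bar> \<le> M * x $ i"
proof -
  have xi: "0 \<le> x $ i" "x $ i \<le> 1" using x by (auto simp: mem_Cube)
  have "\<bar>fib i v x\<bar> \<le> (\<integral>t. \<bar>indicator {..x $ i} t * v (upd x i t)\<bar> \<partial>unitM)"
    unfolding fib_def by (rule integral_abs_bound)
  also have "\<dots> \<le> (\<integral>t. M * indicator {..x $ i} t \<partial>unitM)"
  proof (rule integral_mono_AE)
    show "integrable unitM (\<lambda>t. \<bar>indicator {..x $ i} t * v (upd x i t)\<bar>)"
      using section_integrable(2)[OF v x] by (rule integrable_abs)
    have mc: "indicator {..x $ i} \<in> borel_measurable unitM"
      by (rule measurable_compose[OF measurable_id_unitM]) simp
    show "integrable unitM (\<lambda>t. M * indicator {..x $ i} t)"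
      by (intro integrable_mult_right unitM.integrable_const_bound[of _ 1]) (use mc in auto)
  qed (use v x M in \<open>auto intro!: AE_I2 simp: indicator_def upd_Cube\<close>)
  also have "\<dots> = M * x $ i" using measure_unitM_atMost[OF xi] by simp
  finally show ?thesis .
qed

text \<open>With zero average the primitive is also minus the integral over the rest of the line.
  Together with \<open>fib_bound\<close> this shows that points displaced by a multiple of the flux
  do not leave the cube.\<close>

lemma fib_bound_right:
  assumes v: "v \<in> borel_measurable cubeM" "\<And>x. x \<in> Cube \<Longrightarrow> \<bar>v x\<bar> \<le> M" and x: "x \<in> Cube" and M: "0 \<le> M"
    and z: "avg i v x = 0"
  shows "\<bar>fib i v x\<bar> \<le> M * (1 - x $ i)"
proof -
  have xi: "0 \<le> x $ i" "x $ i \<le> 1" using x by (auto simp: mem_Cube)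
  note I = section_integrable[OF v x, where i = i]
  have mc: "indicator {..x $ i} \<in> borel_measurable unitM"
    by (rule measurable_compose[OF measurable_id_unitM]) simp
  have i1: "integrable unitM (\<lambda>t. indicator {..x $ i} t :: real)"
    by (rule unitM.integrable_const_bound[of _ 1]) (use mc in auto)
  have "- fib i v x = (\<integral>t. v (upd x i t) - indicator {..x $ i} t * v (upd x i t) \<partial>unitM)"
    using z I by (simp add: fib_def avg_def)
  then have "\<bar>fib i v x\<bar> \<le> (\<integral>t. \<bar>v (upd x i t) - indicator {..x $ i} t * v (upd x i t)\<bar> \<partial>unitM)"
    using integral_abs_bound[of unitM "\<lambda>t. v (upd x i t) - indicator {..x $ i} t * v (upd x i t)"]
    by (metis abs_minus_cancel)
  also have "\<dots> \<le> (\<integral>t. M - M * indicator {..x $ i} t \<partial>unitM)"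
    by (rule integral_mono_AE) (use I i1 v x M in \<open>auto intro!: AE_I2 simp: indicator_def upd_Cube\<close>)
  also have "\<dots> = M * (1 - x $ i)"
    using measure_unitM_atMost[OF xi] i1 by (simp add: algebra_simps unitM.prob_space[simplified])
  finally show ?thesis .
qed

lemma unitM_integral_eq:
  assumes "continuous_on {0..1} V" "0 \<le> t" "t \<le> 1"
  shows "(\<integral>s. indicator {..t} s * V s \<partial>unitM) = integral {0..t} (V :: real \<Rightarrow> real)"
proof -
  have "(\<integral>s. indicator {..t} s * V s \<partial>unitM) = (\<integral>s. indicator {0..1} s *\<^sub>R (indicator {..t} s * V s) \<partial>lborel)"
    by (subst integral_restrict_space) auto
  also have "\<dots> = (LINT s:{0..t}|lborel. V s)"
    unfolding set_lebesgue_integral_def using assms by (intro Bochner_Integration.integral_cong) (auto simp: indicator_def)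
  also have "\<dots> = integral {0..t} V"
  proof (rule set_borel_integral_eq_integral)
    show "set_integrable lborel {0..t} V"
      using assms by (intro borel_integrable_atLeastAtMost') (auto intro: continuous_on_subset)
  qed
  finally show ?thesis .
qed

text \<open>The map \<open>t \<mapsto> t - V1 t / c\<close>, with \<open>V1\<close> the primitive of
  \<open>V\<close>, has derivative \<open>1 - V t / c\<close>, so by substitution it carries the
  density \<open>c - V\<close> to the constant \<open>c\<close>. Zero total integral makes it fix
  both ends of the interval.\<close>

lemma flow_1d:
  fixes V :: "real \<Rightarrow> real" and h :: "real \<Rightarrow> ennreal"
  assumes V: "continuous_on {0..1} V" and c: "0 < c" and Vc: "\<And>t. 0 \<le> t \<Longrightarrow> t \<le> 1 \<Longrightarrow> \<bar>V t\<bar> \<le> c / 2"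
    and zero: "(\<integral>t. V t \<partial>unitM) = 0" and h[measurable]: "h \<in> borel_measurable borel"
  shows "(\<integral>\<^sup>+t. ennreal (c - V t) * h (t - (\<integral>s. indicator {..t} s * V s \<partial>unitM) / c) \<partial>unitM) =
    (\<integral>\<^sup>+t. ennreal c * h t \<partial>unitM)"
proof -
  \<comment> \<open>A continuous extension of \<open>V\<close> to the line, so that the primitive
    has two-sided derivatives at 0 and 1.\<close>
  define W where "W = (\<lambda>t. V (min 1 (max 0 t)))"
  have W: "continuous_on UNIV W"
    unfolding W_def by (rule continuous_on_compose2[OF V]) (auto intro!: continuous_intros)
  have WV: "W t = V t" if "0 \<le> t" "t \<le> 1" for t using that by (simp add: W_def)
  \<comment> \<open>The base point -1 makes all of the unit interval interior to the domain of
    differentiation; the surplus \<open>F 0\<close> is subtracted in \<open>g\<close>.\<close>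
  define F where "F = (\<lambda>t. integral {-1..t} W)"
  have Wint: "W integrable_on {a..b}" for a b
    using W by (intro integrable_continuous_real) (auto intro: continuous_on_subset)
  have F: "(F has_real_derivative W t) (at t)" if "t \<in> {0..1}" for t
  proof -
    have "(F has_real_derivative W t) (at t within {-1..2})"
      unfolding F_def using W that by (intro integral_has_real_derivative) (auto intro: continuous_on_subset)
    then show ?thesis using that by (subst (asm) at_within_interior) auto
  qed
  have FV: "(\<integral>s. indicator {..t} s * V s \<partial>unitM) = F t - F 0" if "0 \<le> t" "t \<le> 1" for t
  proof -
    have "F 0 + integral {0..t} W = F t"
      unfolding F_def using that Wint by (intro Henstock_Kurzweil_Integration.integral_combine) auto
    moreover have "integral {0..t} W = integral {0..t} V"
      using that by (intro integral_cong) (auto simp: WV)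
    ultimately show ?thesis using unitM_integral_eq[OF V that] by simp
  qed
  define g where "g = (\<lambda>t. t - (F t - F 0) / c)"
  have "(\<integral>s. indicator {..1} s * V s \<partial>unitM) = (\<integral>t. V t \<partial>unitM)"
    by (intro Bochner_Integration.integral_cong) auto
  then have g01: "g 0 = 0" "g 1 = 1" using FV[of 1] zero by (auto simp: g_def)
  have "(\<integral>\<^sup>+t. ennreal (c - V t) * h (t - (\<integral>s. indicator {..t} s * V s \<partial>unitM) / c) \<partial>unitM) =
      (\<integral>\<^sup>+t. ennreal (c - W t) * h (g t) \<partial>unitM)"
    by (intro nn_integral_cong) (auto simp: FV WV g_def)
  also have "\<dots> = (\<integral>\<^sup>+t. ennreal (c - W t) * h (g t) * indicator {0..1} t \<partial>lborel)"
    by (subst nn_integral_restrict_space) auto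
  also have "\<dots> = (\<integral>\<^sup>+t. ennreal c * (h (g t) * ennreal (1 - W t / c) * indicator {0..1} t) \<partial>lborel)"
  proof (intro nn_integral_cong)
    fix t
    have "ennreal (c - W t) = ennreal c * ennreal (1 - W t / c)" if "0 \<le> t" "t \<le> 1"
      using c Vc[OF that] that by (subst ennreal_mult[symmetric]) (auto simp: WV field_simps abs_le_iff)
    then show "ennreal (c - W t) * h (g t) * indicator {0..1} t =
        ennreal c * (h (g t) * ennreal (1 - W t / c) * indicator {0..1} t)"
      by (auto simp: indicator_def mult_ac)
  qed
  also have "\<dots> = ennreal c * (\<integral>\<^sup>+t. h (g t) * ennreal (1 - W t / c) * indicator {0..1} t \<partial>lborel)"
  proof (rule nn_integral_cmult)
    have "continuous_on {0..1} g"
      unfolding g_def using F by (intro continuous_intros DERIV_continuous_on) (auto intro: has_field_derivative_at_within, use c in auto)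
    then have [measurable]: "(\<lambda>t. if t \<in> {0..1} then g t else 0) \<in> borel_measurable borel"
      by (intro borel_measurable_continuous_on_if) auto
    have [measurable]: "W \<in> borel_measurable borel" using W by (rule borel_measurable_continuous_onI)
    have "(\<lambda>t. h (if t \<in> {0..1} then g t else 0) * ennreal (1 - W t / c) * indicator {0..1} t) \<in> borel_measurable lborel"
      by measurable
    also have "(\<lambda>t. h (if t \<in> {0..1} then g t else 0) * ennreal (1 - W t / c) * indicator {0..1} t) =
        (\<lambda>t. h (g t) * ennreal (1 - W t / c) * indicator {0..1} t)"
      by (auto simp: fun_eq_iff indicator_def)
    finally show "(\<lambda>t. h (g t) * ennreal (1 - W t / c) * indicator {0..1} t) \<in> borel_measurable lborel" .
  qed
  also have "(\<integral>\<^sup>+t. h (g t) * ennreal (1 - W t / c) * indicator {0..1} t \<partial>lborel) =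
      (\<integral>\<^sup>+t. h t * indicator {g 0..g 1} t \<partial>lborel)"
  proof (rule nn_integral_substitution_aux[symmetric])
    show "(g has_real_derivative 1 - W t / c) (at t)" if "t \<in> {0..1}" for t
      unfolding g_def using F[OF that] c by (auto intro!: derivative_eq_intros)
    show "continuous_on {0..1} (\<lambda>t. 1 - W t / c)"
      using W c by (auto intro!: continuous_intros intro: continuous_on_subset)
    show "0 \<le> 1 - W t / c" if "t \<in> {0..1}" for t
      using Vc[of t] that c by (auto simp: WV field_simps abs_le_iff)
  qed auto
  also have "ennreal c * (\<integral>\<^sup>+t. h t * indicator {g 0..g 1} t \<partial>lborel) = ennreal c * (\<integral>\<^sup>+t. h t \<partial>unitM)"
    by (subst nn_integral_restrict_space) (auto simp: g01)
  also have "\<dots> = (\<integral>\<^sup>+t. ennreal c * h t \<partial>unitM)"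
    by (rule nn_integral_cmult[symmetric]) (rule measurable_compose[OF measurable_id_unitM h])
  finally show ?thesis .
qed

lemma section_cont:
  assumes "continuous_on Cube v" "x \<in> Cube"
  shows "continuous_on {0..1} (\<lambda>t. v (upd x i t))"
proof (rule continuous_on_compose2[OF assms(1)])
  have "1-lipschitz_on {0..1} (\<lambda>t. upd x i t)"
    by (auto simp: lipschitz_on_def dist_norm norm_upd_diff)
  then show "continuous_on {0..1} (\<lambda>t. upd x i t)" by (rule lipschitz_on_continuous_on)
qed (use assms(2) in \<open>auto intro: upd_Cube\<close>)

text \<open>Only a layer of the density is moved: the part \<open>c - v\<close>, which lies between
  0 and \<open>3 * c / 2\<close>, is turned into the constant \<open>c\<close>, so that
  \<open>v\<close> is added in total. Each point travels \<open>\<bar>fib i v x\<bar> / c\<close>;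
  the factor \<open>3 / 2 * c powr (1 - p)\<close> is the layer height times the scaling of the
  displacement.\<close>

lemma coupled_flow:
  fixes v \<sigma> :: "real ^ 'd \<Rightarrow> real"
  assumes v: "continuous_on Cube v" and zero: "\<And>x. x \<in> Cube \<Longrightarrow> avg i v x = 0"
    and c: "0 < c" and vc: "\<And>x. x \<in> Cube \<Longrightarrow> \<bar>v x\<bar> \<le> c / 2"
    and \<sigma>: "is_density \<sigma>" and \<sigma>c: "\<And>x. x \<in> Cube \<Longrightarrow> 3 * c / 2 \<le> \<sigma> x"
    and B: "(\<integral>\<^sup>+x. ennreal (\<bar>fib i v x\<bar> powr p) \<partial>cubeM) \<le> ennreal (B powr p)" "0 < B"
    and N: "sets N = sets cubeM" and cpl: "coupled p (law \<sigma>) N A" and A: "0 < A" and p: "1 \<le> p"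
  shows "coupled p (law (\<lambda>x. \<sigma> x + v x)) N (A + (3 / 2 * c powr (1 - p)) powr (1 / p) * B)"
proof -
  have vm[measurable]: "v \<in> borel_measurable cubeM" by (rule borel_measurable_cubeM_cont[OF v])
  define G where "G = (\<lambda>x. upd x i (x $ i - fib i v x / c))"
  have G: "G \<in> measurable cubeM cubeM"
  proof (rule measurable_into_cubeM)
    note [measurable] = measurable_id_cubeM
    show "G \<in> borel_measurable cubeM" unfolding G_def by measurable
    fix x :: "real ^ 'd" assume "x \<in> space cubeM"
    then have x: "x \<in> Cube" by simp
    \<comment> \<open>The bounds from the two ends of the line keep the image in the cube.\<close>
    have "\<bar>fib i v x\<bar> \<le> c / 2 * x $ i" "\<bar>fib i v x\<bar> \<le> c / 2 * (1 - x $ i)"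
      using fib_bound[OF vm vc x] fib_bound_right[OF vm vc x _ zero[OF x]] c by auto
    moreover have "0 \<le> c * x $ i" "0 \<le> c * (1 - x $ i)" using c x by (auto simp: mem_Cube)
    ultimately have "fib i v x \<le> c * x $ i" "- fib i v x \<le> c * (1 - x $ i)" by auto
    then show "G x \<in> Cube" unfolding G_def using c x by (intro upd_Cube) (auto simp: field_simps)
  qed
  have "coupled p (law (\<lambda>x. \<sigma> x - (c - v x) + c)) N (A + (3 / 2 * c powr (1 - p)) powr (1 / p) * B)"
  proof (rule coupled_transport_part[OF \<sigma>])
    \<comment> \<open>The transport is deterministic; \<open>unitM\<close> serves as a dummy source
      of randomness.\<close>
    show "prob_space unitM" by (rule unitM.prob_space_axioms)
    show "(\<lambda>z. G (fst z)) \<in> measurable (cubeM \<Otimes>\<^sub>M unitM) cubeM"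
      by (rule measurable_compose[OF measurable_fst G])
    fix S :: "(real ^ 'd) set" assume S[measurable]: "S \<in> sets cubeM"
    have Sb[measurable]: "S \<in> sets borel"
      using S sets_restrict_space_iff[of Cube lborel] by (auto simp: cubeM_def)
    have GS[measurable]: "(\<lambda>x. indicator S (G x) :: ennreal) \<in> borel_measurable cubeM"
      by (rule measurable_compose[OF G]) measurable
    have "(\<integral>\<^sup>+x. ennreal (c - v x) * (\<integral>\<^sup>+k. indicator S (G (fst (x, k))) \<partial>unitM) \<partial>cubeM) =
        (\<integral>\<^sup>+x. ennreal (c - v x) * indicator S (G x) \<partial>cubeM)"
      by (simp add: unitM.emeasure_space_1[simplified])
    also have "\<dots> = (\<integral>\<^sup>+x. (\<integral>\<^sup>+t. ennreal (c - v (upd x i t)) * indicator S (G (upd x i t)) \<partial>unitM) \<partial>cubeM)"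
      by (rule nn_integral_cube_fiber) measurable
    also have "\<dots> = (\<integral>\<^sup>+x. (\<integral>\<^sup>+t. ennreal c * indicator S (upd x i t) \<partial>unitM) \<partial>cubeM)"
    proof (rule nn_integral_cong)
      fix x :: "real ^ 'd" assume "x \<in> space cubeM"
      then have x: "x \<in> Cube" by simp
      have hm: "(\<lambda>t. indicator S (upd x i t) :: ennreal) \<in> borel_measurable borel" by measurable
      show "(\<integral>\<^sup>+t. ennreal (c - v (upd x i t)) * indicator S (G (upd x i t)) \<partial>unitM) =
          (\<integral>\<^sup>+t. ennreal c * indicator S (upd x i t) \<partial>unitM)"
        using flow_1d[OF section_cont[OF v x] c _ _ hm, of i] vc zero[OF x] x
        by (simp add: G_def fib_def avg_def upd_Cube)
    qed
    also have "\<dots> = (\<integral>\<^sup>+x. ennreal c * indicator S x \<partial>cubeM)"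
      by (rule nn_integral_cube_fiber[symmetric]) measurable
    finally show "(\<integral>\<^sup>+x. ennreal (c - v x) * (\<integral>\<^sup>+k. indicator S (G (fst (x, k))) \<partial>unitM) \<partial>cubeM) =
      (\<integral>\<^sup>+x. ennreal c * indicator S x \<partial>cubeM)" .
  next
    have d: "norm (G x - x) = \<bar>fib i v x\<bar> / c" for x
      using c by (simp add: G_def norm_upd_diff_self)
    have "(\<integral>\<^sup>+x. ennreal (c - v x) * (\<integral>\<^sup>+k. ennreal (norm (G (fst (x, k)) - x) powr p) \<partial>unitM) \<partial>cubeM) =
        (\<integral>\<^sup>+x. ennreal (c - v x) * ennreal (norm (G x - x) powr p) \<partial>cubeM)"
      by (simp add: unitM.emeasure_space_1[simplified])
    also have "\<dots> \<le> (\<integral>\<^sup>+x. ennreal (3 / 2 * c powr (1 - p)) * ennreal (\<bar>fib i v x\<bar> powr p) \<partial>cubeM)"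
    proof (rule nn_integral_mono)
      fix x :: "real ^ 'd" assume "x \<in> space cubeM"
      then have x: "\<bar>v x\<bar> \<le> c / 2" using vc by simp
      have "(c - v x) * (norm (G x - x) powr p) \<le> (3 / 2 * c) * (norm (G x - x) powr p)"
        using x by (intro mult_right_mono) (auto simp: abs_le_iff)
      also have "\<dots> = 3 / 2 * c powr (1 - p) * \<bar>fib i v x\<bar> powr p"
        using c unfolding d by (simp add: powr_divide powr_diff)
      finally show "ennreal (c - v x) * ennreal (norm (G x - x) powr p) \<le> ennreal (3 / 2 * c powr (1 - p)) * ennreal (\<bar>fib i v x\<bar> powr p)"
        using x by (simp add: ennreal_leI abs_le_iff flip: ennreal_mult)
    qed
    also have "\<dots> = ennreal (3 / 2 * c powr (1 - p)) * (\<integral>\<^sup>+x. ennreal (\<bar>fib i v x\<bar> powr p) \<partial>cubeM)"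
      by (rule nn_integral_cmult) measurable
    also have "\<dots> \<le> ennreal (3 / 2 * c powr (1 - p)) * ennreal (B powr p)"
      by (intro mult_left_mono B) auto
    also have "\<dots> = ennreal (((3 / 2 * c powr (1 - p)) powr (1 / p) * B) powr p)"
      using B p c by (simp add: powr_mult powr_powr ennreal_mult flip: ennreal_mult)
    finally show "(\<integral>\<^sup>+x. ennreal (c - v x) * (\<integral>\<^sup>+k. ennreal (norm (G (fst (x, k)) - x) powr p) \<partial>unitM) \<partial>cubeM)
      \<le> ennreal (((3 / 2 * c powr (1 - p)) powr (1 / p) * B) powr p)" .
    show "0 \<le> c - v x" "c - v x \<le> \<sigma> x" if "x \<in> Cube" for x
      using vc[OF that] \<sigma>c[OF that] c by (auto simp: abs_le_iff)
  qed (use c B A p N cpl in auto)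
  then show ?thesis by simp
qed

section \<open>Composing flows along different coordinates\<close>

lemma integral_avg: "integrable cubeM h \<Longrightarrow> (\<integral>x. avg i h x \<partial>cubeM) = (\<integral>x. h x \<partial>cubeM)"
  unfolding avg_def by (rule integral_cube_fiber[symmetric])

lemma integral_cubeM_cong: "(\<And>x. x \<in> Cube \<Longrightarrow> f x = g x) \<Longrightarrow> (\<integral>x. f x \<partial>cubeM) = (\<integral>x. g x \<partial>cubeM)"
  by (rule Bochner_Integration.integral_cong) auto

lemma integral_zero_avg:
  assumes "continuous_on Cube v" "\<And>x. x \<in> Cube \<Longrightarrow> avg i v x = 0"
  shows "(\<integral>x. v x \<partial>cubeM) = 0"
  using integral_avg[OF integrable_cubeM_cont[OF assms(1)], of i] assms(2)
  by (simp add: integral_cubeM_cong[of "avg i v" "\<lambda>_. 0"])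

lemma is_densityI:
  assumes "continuous_on Cube f" "\<And>x. x \<in> Cube \<Longrightarrow> 0 \<le> f x" "(\<integral>x. f x \<partial>cubeM) = 1"
  shows "is_density f"
  using assms by (auto simp: is_density_def integrable_cubeM_cont borel_measurable_cubeM_cont)

text \<open>An increment that can be realised by moving mass in direction \<open>i\<close> with flux
  of p-norm at most \<open>B\<close>. Positivity of \<open>B\<close> is included since the Minkowski
  bound divides by it.\<close>

definition flow_piece :: "real \<Rightarrow> 'd \<Rightarrow> (real ^ 'd \<Rightarrow> real) \<Rightarrow> real \<Rightarrow> bool" where
  "flow_piece p i v B \<longleftrightarrow> continuous_on Cube v \<and> (\<forall>x\<in>Cube. avg i v x = 0) \<and> 0 < B \<and>
     (\<integral>\<^sup>+x. ennreal (\<bar>fib i v x\<bar> powr p) \<partial>cubeM) \<le> ennreal (B powr p)"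

lemma flow_piece_cmult:
  assumes "flow_piece p i v B" "c \<noteq> 0"
  shows "flow_piece p i (\<lambda>x. c * v x) (\<bar>c\<bar> * B)"
proof -
  have v: "continuous_on Cube v" "v \<in> borel_measurable cubeM"
    using assms borel_measurable_cubeM_cont by (auto simp: flow_piece_def)
  have a: "avg i (\<lambda>x. c * v x) x = c * avg i v x" for x by (simp add: avg_def)
  have f: "fib i (\<lambda>x. c * v x) x = c * fib i v x" for x
    by (simp add: fib_def mult.left_commute)
  have "(\<integral>\<^sup>+x. ennreal (\<bar>fib i (\<lambda>x. c * v x) x\<bar> powr p) \<partial>cubeM) =
      (\<integral>\<^sup>+x. ennreal (\<bar>c\<bar> powr p) * ennreal (\<bar>fib i v x\<bar> powr p) \<partial>cubeM)"
    by (simp add: f abs_mult powr_mult ennreal_mult)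
  also have "\<dots> = ennreal (\<bar>c\<bar> powr p) * (\<integral>\<^sup>+x. ennreal (\<bar>fib i v x\<bar> powr p) \<partial>cubeM)"
    using v by (intro nn_integral_cmult) measurable
  also have "\<dots> \<le> ennreal (\<bar>c\<bar> powr p) * ennreal (B powr p)"
    using assms by (intro mult_left_mono) (auto simp: flow_piece_def)
  also have "\<dots> = ennreal ((\<bar>c\<bar> * B) powr p)"
    using assms by (simp add: powr_mult flow_piece_def flip: ennreal_mult)
  finally show ?thesis
    using assms v by (auto simp: flow_piece_def a intro!: continuous_intros)
qed

text \<open>The sup norms of all increments together are at most \<open>c / 2\<close>, so every
  partial sum leaves the density above \<open>3 * c / 2\<close> and each single flow is
  admissible.\<close>

lemma coupled_flow_sum:
  fixes v :: "'k \<Rightarrow> real ^ 'd \<Rightarrow> real"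
  assumes fin: "finite I" and c: "0 < c" and p: "1 \<le> p" and N: "sets N = sets cubeM"
    and v: "\<And>k. k \<in> I \<Longrightarrow> flow_piece p (i k) (v k) (B k)"
    and S: "\<And>k x. k \<in> I \<Longrightarrow> x \<in> Cube \<Longrightarrow> \<bar>v k x\<bar> \<le> S k" and SI: "(\<Sum>k\<in>I. S k) \<le> c / 2"
    and \<sigma>: "is_density \<sigma>" "continuous_on Cube \<sigma>" "\<And>x. x \<in> Cube \<Longrightarrow> 2 * c \<le> \<sigma> x"
    and cpl: "coupled p (law \<sigma>) N A" and A: "0 < A"
  shows "coupled p (law (\<lambda>x. \<sigma> x + (\<Sum>k\<in>I. v k x))) N (A + (3 / 2 * c powr (1 - p)) powr (1 / p) * (\<Sum>k\<in>I. B k))"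
proof -
  define \<kappa> where "\<kappa> = (3 / 2 * c powr (1 - p)) powr (1 / p)"
  have \<kappa>: "0 < \<kappa>" using c by (simp add: \<kappa>_def)
  have S0: "0 \<le> S k" if "k \<in> I" for k
    using S[OF that, of 0] by (auto simp: mem_Cube intro: order_trans[OF abs_ge_zero])
  have "coupled p (law (\<lambda>x. \<sigma> x + (\<Sum>k\<in>J. v k x))) N (A + \<kappa> * (\<Sum>k\<in>J. B k)) \<and>
      is_density (\<lambda>x. \<sigma> x + (\<Sum>k\<in>J. v k x))" if "J \<subseteq> I" for J
    using finite_subset[OF that fin] that
  proof (induction J)
    case empty
    then show ?case using cpl \<sigma> by simp
  next
    case (insert l J)
    then have IH: "coupled p (law (\<lambda>x. \<sigma> x + (\<Sum>k\<in>J. v k x))) N (A + \<kappa> * (\<Sum>k\<in>J. B k))"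
        "is_density (\<lambda>x. \<sigma> x + (\<Sum>k\<in>J. v k x))" by auto
    have vl: "continuous_on Cube (v l)" "\<And>x. x \<in> Cube \<Longrightarrow> avg (i l) (v l) x = 0" "0 < B l"
       "(\<integral>\<^sup>+x. ennreal (\<bar>fib (i l) (v l) x\<bar> powr p) \<partial>cubeM) \<le> ennreal (B l powr p)"
      using v[of l] insert by (auto simp: flow_piece_def)
    have cont: "continuous_on Cube (\<lambda>x. \<sigma> x + (\<Sum>k\<in>J. v k x))"
      using \<sigma> v insert by (intro continuous_intros) (auto simp: flow_piece_def)
    have bound: "\<sigma> x - (\<Sum>k\<in>I. S k) \<le> \<sigma> x + (\<Sum>k\<in>K. v k x)" if "K \<subseteq> I" "x \<in> Cube" for x K
    proof -
      have "- (\<Sum>k\<in>K. v k x) \<le> (\<Sum>k\<in>K. \<bar>v k x\<bar>)" by (simp add: sum_mono flip: sum_negf)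
      also have "\<dots> \<le> (\<Sum>k\<in>K. S k)" using that S by (intro sum_mono) auto
      also have "\<dots> \<le> (\<Sum>k\<in>I. S k)" using that S0 fin by (intro sum_mono2) auto
      finally show ?thesis by simp
    qed
    have SlI: "S l \<le> (\<Sum>k\<in>I. S k)" using insert fin S0 by (intro member_le_sum) auto
    have "coupled p (law (\<lambda>x. (\<sigma> x + (\<Sum>k\<in>J. v k x)) + v l x)) N ((A + \<kappa> * (\<Sum>k\<in>J. B k)) + \<kappa> * B l)"
      unfolding \<kappa>_def
    proof (rule coupled_flow[OF vl(1,2) c _ IH(2) _ vl(4,3) N _ _ p])
      show "\<bar>v l x\<bar> \<le> c / 2" if "x \<in> Cube" for x
        using S[of l x] SlI SI insert that by auto
      show "3 * c / 2 \<le> \<sigma> x + (\<Sum>k\<in>J. v k x)" if "x \<in> Cube" for x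
        using bound[of J x] \<sigma>(3)[OF that] SI insert that by auto
      show "coupled p (law (\<lambda>x. \<sigma> x + (\<Sum>k\<in>J. v k x))) N (A + (3 / 2 * c powr (1 - p)) powr (1 / p) * sum B J)"
        using IH by (simp add: \<kappa>_def)
      have "0 \<le> sum B J" using v insert by (intro sum_nonneg) (auto simp: flow_piece_def intro: less_imp_le)
      then show "0 < A + (3 / 2 * c powr (1 - p)) powr (1 / p) * sum B J"
        using A by (intro add_pos_nonneg) auto
    qed
    moreover have "is_density (\<lambda>x. (\<sigma> x + (\<Sum>k\<in>J. v k x)) + v l x)"
    proof (rule is_densityI)
      show "continuous_on Cube (\<lambda>x. (\<sigma> x + (\<Sum>k\<in>J. v k x)) + v l x)"
        by (rule continuous_on_add[OF cont vl(1)])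
      show "0 \<le> (\<sigma> x + (\<Sum>k\<in>J. v k x)) + v l x" if "x \<in> Cube" for x
        using bound[of "insert l J" x] that insert \<sigma>(3)[OF that] SI c by (auto simp: add_ac)
      show "(\<integral>x. (\<sigma> x + (\<Sum>k\<in>J. v k x)) + v l x \<partial>cubeM) = 1"
        using IH(2) integral_zero_avg[OF vl(1,2)] integrable_cubeM_cont[OF cont] integrable_cubeM_cont[OF vl(1)]
        by (simp add: is_density_def)
    qed
    moreover have "(\<lambda>x. (\<sigma> x + (\<Sum>k\<in>J. v k x)) + v l x) = (\<lambda>x. \<sigma> x + (\<Sum>k\<in>insert l J. v k x))"
      using insert by (auto simp: add_ac)
    moreover have "(A + \<kappa> * (\<Sum>k\<in>J. B k)) + \<kappa> * B l = A + \<kappa> * (\<Sum>k\<in>insert l J. B k)"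
      using insert by (auto simp: algebra_simps)
    ultimately show ?case by metis
  qed
  then show ?thesis by (auto simp: \<kappa>_def)
qed

text \<open>Moving in many small time steps keeps all intermediate densities bounded below, however
  large the increment is pointwise.\<close>

lemma coupled_flow_path:
  fixes v :: "'k \<Rightarrow> real ^ 'd \<Rightarrow> real"
  assumes fin: "finite I" and c: "0 < c" and p: "1 \<le> p" and N: "sets N = sets cubeM"
    and v: "\<And>k. k \<in> I \<Longrightarrow> flow_piece p (i k) (v k) (B k)"
    and h: "is_density h" "continuous_on Cube h" "\<And>x. x \<in> Cube \<Longrightarrow> 2 * c \<le> h x"
    and f: "\<And>x. x \<in> Cube \<Longrightarrow> f x = h x + (\<Sum>k\<in>I. v k x)" "\<And>x. x \<in> Cube \<Longrightarrow> 2 * c \<le> f x"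
    and cpl: "coupled p (law h) N A" and A: "0 < A"
  shows "coupled p (law f) N (A + (3 / 2 * c powr (1 - p)) powr (1 / p) * (\<Sum>k\<in>I. B k))"
proof -
  define \<kappa> where "\<kappa> = (3 / 2 * c powr (1 - p)) powr (1 / p)"
  have vc: "continuous_on Cube (v k)" if "k \<in> I" for k using v[OF that] by (simp add: flow_piece_def)
  then have "\<forall>k\<in>I. \<exists>S>0. \<forall>x\<in>Cube. \<bar>v k x\<bar> \<le> S" by (metis cont_bounded_Cube)
  then obtain S where S: "\<And>k. k \<in> I \<Longrightarrow> 0 < S k" "\<And>k x. k \<in> I \<Longrightarrow> x \<in> Cube \<Longrightarrow> \<bar>v k x\<bar> \<le> S k" by metis
  \<comment> \<open>So many time steps that the increments of one step have sup norms adding up to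
    at most \<open>c / 2\<close>. The cost is linear in the increments, so the number of steps does
    not enter the final bound.\<close>
  obtain T :: nat where T: "(\<Sum>k\<in>I. S k) / (c / 2) < real T" using reals_Archimedean2 by blast
  have "0 \<le> (\<Sum>k\<in>I. S k) / (c / 2)" using S c by (intro divide_nonneg_pos sum_nonneg) (auto intro: less_imp_le)
  then have T0: "0 < T" using T by linarith
  define \<rho> where "\<rho> = (\<lambda>n x. h x + real n / real T * (\<Sum>k\<in>I. v k x))"
  have \<rho>_cont: "continuous_on Cube (\<rho> n)" for n
    unfolding \<rho>_def using h vc by (intro continuous_intros) auto
  have int0: "(\<integral>x. (\<Sum>k\<in>I. v k x) \<partial>cubeM) = 0"
    using vc v by (subst Bochner_Integration.integral_sum) (auto intro!: integrable_cubeM_cont integral_zero_avg sum.neutral simp: flow_piece_def)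
  \<comment> \<open>Intermediate densities are convex combinations of \<open>h\<close> and
    \<open>f\<close>, both at least \<open>2 * c\<close>; this holds only at whole time steps, and
    inside a step the smallness of the increments takes over.\<close>
  have \<rho>_low: "2 * c \<le> \<rho> n x" if "n \<le> T" "x \<in> Cube" for n x
  proof -
    define s where "s = real n / real T"
    have s: "0 \<le> s" "s \<le> 1" using that T0 by (auto simp: s_def)
    have "\<rho> n x = (1 - s) * h x + s * f x"
      using f(1)[OF that(2)] by (simp add: \<rho>_def s_def algebra_simps)
    moreover have "(1 - s) * (2 * c) + s * (2 * c) \<le> (1 - s) * h x + s * f x"
      using s h(3)[OF that(2)] f(2)[OF that(2)] by (intro add_mono mult_left_mono) auto
    ultimately show ?thesis by (simp add: algebra_simps)
  qed
  have \<rho>_dens: "is_density (\<rho> n)" if "n \<le> T" for n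
  proof (rule is_densityI[OF \<rho>_cont])
    show "0 \<le> \<rho> n x" if "x \<in> Cube" for x using \<rho>_low[OF \<open>n \<le> T\<close> that] c by auto
    have "integrable cubeM h" "integrable cubeM (\<lambda>x. \<Sum>k\<in>I. v k x)"
      using h vc by (auto intro!: integrable_cubeM_cont continuous_intros)
    then show "(\<integral>x. \<rho> n x \<partial>cubeM) = 1"
      using h(1) int0 by (simp add: \<rho>_def is_density_def)
  qed
  have "coupled p (law (\<rho> n)) N (A + real n / real T * (\<kappa> * (\<Sum>k\<in>I. B k)))" if "n \<le> T" for n
    using that
  proof (induction n)
    case 0
    then show ?case using cpl by (simp add: \<rho>_def)
  next
    case (Suc n)
    have "coupled p (law (\<lambda>x. \<rho> n x + (\<Sum>k\<in>I. 1 / real T * v k x))) N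
       ((A + real n / real T * (\<kappa> * (\<Sum>k\<in>I. B k))) + \<kappa> * (\<Sum>k\<in>I. \<bar>1 / real T\<bar> * B k))"
      unfolding \<kappa>_def
    proof (rule coupled_flow_sum[OF fin c p N, where S = "\<lambda>k. S k / real T"])
      show "flow_piece p (i k) (\<lambda>x. 1 / real T * v k x) (\<bar>1 / real T\<bar> * B k)" if "k \<in> I" for k
        using T0 by (intro flow_piece_cmult v that) auto
      show "\<bar>1 / real T * v k x\<bar> \<le> S k / real T" if "k \<in> I" "x \<in> Cube" for k x
        using S(2)[OF that] T0 by (simp add: abs_mult divide_right_mono)
      show "(\<Sum>k\<in>I. S k / real T) \<le> c / 2"
        using T T0 c by (simp add: field_simps flip: sum_divide_distrib)
      show "is_density (\<rho> n)" "continuous_on Cube (\<rho> n)" using \<rho>_dens \<rho>_cont Suc by auto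
      show "2 * c \<le> \<rho> n x" if "x \<in> Cube" for x using \<rho>_low that Suc by auto
      show "coupled p (law (\<rho> n)) N (A + real n / real T * ((3 / 2 * c powr (1 - p)) powr (1 / p) * sum B I))"
        using Suc by (simp add: \<kappa>_def)
      have "0 \<le> sum B I" using v by (intro sum_nonneg) (auto simp: flow_piece_def intro: less_imp_le)
      then show "0 < A + real n / real T * ((3 / 2 * c powr (1 - p)) powr (1 / p) * sum B I)"
        using A by (intro add_pos_nonneg mult_nonneg_nonneg) auto
    qed
    moreover have "(\<lambda>x. \<rho> n x + (\<Sum>k\<in>I. 1 / real T * v k x)) = \<rho> (Suc n)"
      by (auto simp: \<rho>_def add_divide_distrib algebra_simps simp flip: sum_divide_distrib)
    moreover have "(A + real n / real T * (\<kappa> * (\<Sum>k\<in>I. B k))) + \<kappa> * (\<Sum>k\<in>I. \<bar>1 / real T\<bar> * B k) =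
        A + real (Suc n) / real T * (\<kappa> * (\<Sum>k\<in>I. B k))"
      by (simp add: add_divide_distrib algebra_simps flip: sum_divide_distrib)
    ultimately show ?case by metis
  qed
  from this[of T] have "coupled p (law (\<rho> T)) N (A + \<kappa> * (\<Sum>k\<in>I. B k))" using T0 by simp
  moreover have "law (\<rho> T) = law f"
  proof (rule law_cong)
    show "\<rho> T \<in> borel_measurable cubeM" using \<rho>_cont by (rule borel_measurable_cubeM_cont)
    have "continuous_on Cube f \<longleftrightarrow> continuous_on Cube (\<rho> T)"
      using f T0 by (intro continuous_on_cong) (auto simp: \<rho>_def)
    then show "f \<in> borel_measurable cubeM" using \<rho>_cont borel_measurable_cubeM_cont by auto
  qed (use f T0 in \<open>auto simp: \<rho>_def\<close>)
  ultimately show ?thesis by (simp add: \<kappa>_def)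
qed

section \<open>Averaging, and splitting a centred function into parts centred along
  coordinates\<close>

lemma avg_lipc:
  assumes "lipc h" shows "lipc (avg i h)"
proof -
  obtain K where K: "0 \<le> K" "\<And>x y. x \<in> Cube \<Longrightarrow> y \<in> Cube \<Longrightarrow> \<bar>h x - h y\<bar> \<le> K * norm (x - y)"
    using assms lipcE by metis
  obtain M where M: "\<And>x. x \<in> Cube \<Longrightarrow> \<bar>h x\<bar> \<le> M" using cont_bounded_Cube[OF lipc_cont[OF assms]] by metis
  note I = section_integrable(1)[OF borel_measurable_cubeM_cont[OF lipc_cont[OF assms]] M]
  have "\<bar>avg i h x - avg i h y\<bar> \<le> K * norm (x - y)" if xy: "x \<in> Cube" "y \<in> Cube" for x y
  proof -
    have "avg i h x - avg i h y = (\<integral>t. h (upd x i t) - h (upd y i t) \<partial>unitM)"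
      using I xy by (simp add: avg_def)
    also have "\<bar>\<dots>\<bar> \<le> (\<integral>t. \<bar>h (upd x i t) - h (upd y i t)\<bar> \<partial>unitM)" by (rule integral_abs_bound)
    also have "\<dots> \<le> (\<integral>t. K * norm (x - y) \<partial>unitM)"
    proof (rule integral_mono_AE)
      show "AE t in unitM. \<bar>h (upd x i t) - h (upd y i t)\<bar> \<le> K * norm (x - y)"
      proof (rule AE_I2)
        fix t assume "t \<in> space unitM"
        then have "\<bar>h (upd x i t) - h (upd y i t)\<bar> \<le> K * norm (upd x i t - upd y i t)"
          using xy by (intro K) (auto intro: upd_Cube)
        also have "\<dots> \<le> K * norm (x - y)" by (intro mult_left_mono norm_upd_diff_le K)
        finally show "\<bar>h (upd x i t) - h (upd y i t)\<bar> \<le> K * norm (x - y)" .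
      qed
    qed (use I xy in auto)
    also have "\<dots> = K * norm (x - y)" using unitM.prob_space by simp
    finally show ?thesis .
  qed
  then show ?thesis unfolding lipc_def by blast
qed

lemma avg_bound:
  assumes h: "h \<in> borel_measurable cubeM" "\<And>x. x \<in> Cube \<Longrightarrow> \<bar>h x\<bar> \<le> M" and x: "x \<in> Cube"
  shows "\<bar>avg i h x\<bar> \<le> M"
proof -
  have "\<bar>avg i h x\<bar> \<le> (\<integral>t. \<bar>h (upd x i t)\<bar> \<partial>unitM)" unfolding avg_def by (rule integral_abs_bound)
  also have "\<dots> \<le> (\<integral>t. M \<partial>unitM)"
    using section_integrable(1)[OF h x] h x by (intro integral_mono_AE) (auto intro!: AE_I2 simp: upd_Cube)
  finally show ?thesis using unitM.prob_space by simp
qed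

lemma avg_upd [simp]: "avg i h (upd x i t) = avg i h x"
  by (simp add: avg_def)

lemma upd_commute: "i \<noteq> l \<Longrightarrow> upd (upd x l s) i t = upd (upd x i t) l s"
  by (auto simp: vec_eq_iff)

text \<open>The coordinates are averaged out one after the other, and \<open>v l\<close> is the
  change caused by averaging in direction \<open>l\<close>. The sum telescopes; what remains in the
  end is constant with integral zero, hence zero. It handles the remainder of an expansion, which
  has no localisation but a controlled sup norm.\<close>

theorem knothe_decomposition:
  fixes h :: "real ^ 'd \<Rightarrow> real"
  assumes h: "lipc h" "\<And>x. x \<in> Cube \<Longrightarrow> \<bar>h x\<bar> \<le> M" and int: "(\<integral>x. h x \<partial>cubeM) = 0"
  obtains v where "\<And>i. lipc (v i)" "\<And>i x. x \<in> Cube \<Longrightarrow> avg i (v i) x = 0"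
    "\<And>i x. x \<in> Cube \<Longrightarrow> \<bar>fib i (v i) x\<bar> \<le> 2 * M" "\<And>x. x \<in> Cube \<Longrightarrow> h x = (\<Sum>i\<in>UNIV. v i x)"
proof -
  have M0: "0 \<le> M" using h(2)[of 0] by (auto simp: mem_Cube)
  \<comment> \<open>\<open>S\<close> is the set of directions averaged so far and \<open>g\<close>
    the partial average, which no longer depends on them.\<close>
  have "\<exists>v g. (\<forall>i\<in>S. lipc (v i) \<and> (\<forall>x\<in>Cube. avg i (v i) x = 0 \<and> \<bar>fib i (v i) x\<bar> \<le> 2 * M)) \<and>
      (\<forall>x\<in>Cube. h x = g x + (\<Sum>i\<in>S. v i x)) \<and> lipc g \<and> (\<forall>x\<in>Cube. \<bar>g x\<bar> \<le> M) \<and> (\<integral>x. g x \<partial>cubeM) = 0 \<and>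
      (\<forall>i\<in>S. \<forall>x\<in>Cube. \<forall>t\<in>{0..1}. g (upd x i t) = g x)" for S :: "'d set"
    using finite[of S]
  proof (induction S)
    case empty
    show ?case using h int by (intro exI[of _ undefined] exI[of _ h]) auto
  next
    case (insert l S)
    then obtain v g where vg: "\<forall>i\<in>S. lipc (v i) \<and> (\<forall>x\<in>Cube. avg i (v i) x = 0 \<and> \<bar>fib i (v i) x\<bar> \<le> 2 * M)"
      "\<forall>x\<in>Cube. h x = g x + (\<Sum>i\<in>S. v i x)" "lipc g" "\<forall>x\<in>Cube. \<bar>g x\<bar> \<le> M" "(\<integral>x. g x \<partial>cubeM) = 0"
      "\<forall>i\<in>S. \<forall>x\<in>Cube. \<forall>t\<in>{0..1}. g (upd x i t) = g x" by blast
    have gm: "g \<in> borel_measurable cubeM" using vg by (intro borel_measurable_cubeM_cont lipc_cont)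
    define w where "w = (\<lambda>x. g x - avg l g x)"
    have wl: "lipc w" unfolding w_def by (intro lipc_diff avg_lipc vg)
    have ab: "\<bar>avg l g x\<bar> \<le> M" if "x \<in> Cube" for x using avg_bound[OF gm _ that] vg by auto
    have wb: "\<bar>w x\<bar> \<le> 2 * M" if "x \<in> Cube" for x using ab[OF that] vg that by (auto simp: w_def)
    have wa: "avg l w x = 0" if "x \<in> Cube" for x
    proof -
      have "avg l w x = (\<integral>t. g (upd x l t) - avg l g x \<partial>unitM)" unfolding avg_def[of l w x] by (simp add: w_def)
      also have "\<dots> = avg l g x - avg l g x"
        using section_integrable(1)[OF gm _ that, of M l] vg unitM.prob_space by (simp add: avg_def)
      finally show ?thesis by simp
    qed
    have wf: "\<bar>fib l w x\<bar> \<le> 2 * M" if "x \<in> Cube" for x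
    proof -
      have "\<bar>fib l w x\<bar> \<le> 2 * M * x $ l"
        using fib_bound[OF borel_measurable_cubeM_cont[OF lipc_cont[OF wl]] wb that] M0 by auto
      also have "\<dots> \<le> 2 * M" using that M0 by (auto simp: mem_Cube intro: mult_left_le)
      finally show ?thesis .
    qed
    let ?v = "v(l := w)"
    have "\<forall>i\<in>insert l S. lipc (?v i) \<and> (\<forall>x\<in>Cube. avg i (?v i) x = 0 \<and> \<bar>fib i (?v i) x\<bar> \<le> 2 * M)"
      using vg wl wa wf insert by auto
    moreover have "(\<Sum>i\<in>S. ?v i x) = (\<Sum>i\<in>S. v i x)" for x using insert by (intro sum.cong) auto
    then have "\<forall>x\<in>Cube. h x = avg l g x + (\<Sum>i\<in>insert l S. ?v i x)"
      using vg insert by (auto simp: w_def)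
    moreover have "lipc (avg l g)" "\<forall>x\<in>Cube. \<bar>avg l g x\<bar> \<le> M" using vg ab by (auto intro: avg_lipc)
    moreover have "(\<integral>x. avg l g x \<partial>cubeM) = 0"
      using vg(5) integral_avg[OF integrable_cubeM_cont[OF lipc_cont[OF vg(3)]]] by simp
    moreover have "avg l g (upd x i t) = avg l g x" if "i \<in> insert l S" "x \<in> Cube" "t \<in> {0..1}" for i x t
    proof (cases "i = l")
      case False
      have "g (upd (upd x i t) l s) = g (upd x l s)" if "s \<in> {0..1}" for s
        using vg(6) \<open>i \<in> insert l S\<close> False \<open>x \<in> Cube\<close> \<open>t \<in> {0..1}\<close> that by (auto simp: upd_commute[of l i] upd_Cube)
      then show ?thesis unfolding avg_def by (intro Bochner_Integration.integral_cong) auto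
    qed simp
    ultimately show ?case by blast
  qed
  from this[of UNIV] obtain v g where vg: "\<forall>i\<in>UNIV. lipc (v i) \<and> (\<forall>x\<in>Cube. avg i (v i) x = 0 \<and> \<bar>fib i (v i) x\<bar> \<le> 2 * M)"
      "\<forall>x\<in>Cube. h x = g x + (\<Sum>i\<in>UNIV. v i x)" "(\<integral>x. g x \<partial>cubeM) = 0"
      "\<forall>i\<in>UNIV. \<forall>x\<in>Cube. \<forall>t\<in>{0..1}. g (upd x i t) = g x" by blast
  have g_const: "g x = g y" if x: "x \<in> Cube" and y: "y \<in> Cube" for x y
  proof -
    have "g (\<chi> l. if l \<in> S then y $ l else x $ l) = g x" for S :: "'d set"
      using finite[of S]
    proof (induction S)
      case (insert l S)
      have "(\<chi> k. if k \<in> insert l S then y $ k else x $ k) = upd (\<chi> k. if k \<in> S then y $ k else x $ k) l (y $ l)"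
        by (auto simp: vec_eq_iff)
      moreover have "(\<chi> k. if k \<in> S then y $ k else x $ k) \<in> Cube" using x y by (auto simp: mem_Cube)
      ultimately show ?case using vg(4) insert y by (auto simp: mem_Cube)
    qed simp
    from this[of UNIV] show ?thesis by simp
  qed
  have g0: "g x = 0" if x: "x \<in> Cube" for x
  proof -
    have "(\<integral>y. g y \<partial>cubeM) = (\<integral>y. g x \<partial>(cubeM :: (real ^ 'd) measure))"
      by (rule integral_cubeM_cong) (rule g_const[OF _ x])
    moreover have "measure (cubeM :: (real ^ 'd) measure) Cube = 1" using cubeM.prob_space by simp
    ultimately show ?thesis using vg(3) by simp
  qed
  show ?thesis by (rule that[of v]) (use vg g0 in auto)
qed

section \<open>Wavelet frames\<close>

lemma measure_Cube [simp]: "measure cubeM Cube = 1"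
  using cubeM.prob_space by simp

lemma holder_smooth_continuous: "holder_smooth a S k f \<Longrightarrow> continuous_on S f"
  by (cases k) (auto intro: has_derivative_continuous_on)

lemma C_class_derivative:
  assumes "r > 1" "f \<in> C_class r Cube"
  shows "\<exists>g. continuous_on Cube g \<and> (\<forall>x\<in>Cube. (f has_derivative (\<lambda>h. g x \<bullet> h)) (at x within Cube))"
proof -
  have "nat \<lfloor>r\<rfloor> \<noteq> 0" using assms(1) by linarith
  then obtain k where "nat \<lfloor>r\<rfloor> = Suc k" using not0_implies_Suc by blast
  then obtain g where g: "\<forall>x\<in>Cube. (f has_derivative (\<lambda>h. g x \<bullet> h)) (at x within Cube)"
      "\<forall>i. holder_smooth (frac r) Cube k (\<lambda>x. g x $ i)"
    using assms(2) by (auto simp: C_class_def)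
  have "continuous_on Cube (\<lambda>x. \<chi> i. g x $ i)"
    using g(2) holder_smooth_continuous by (intro continuous_on_vec_lambda) blast
  then show ?thesis using g(1) by (intro exI[of _ g]) simp
qed

lemma lipschitz_of_derivative:
  fixes f :: "real ^ 'd \<Rightarrow> real"
  assumes g: "\<And>x. x \<in> Cube \<Longrightarrow> (f has_derivative (\<lambda>h. g x \<bullet> h)) (at x within Cube)"
    and B: "\<And>x. x \<in> Cube \<Longrightarrow> norm (g x) \<le> B" and x: "x \<in> Cube" and y: "y \<in> Cube"
  shows "\<bar>f x - f y\<bar> \<le> B * norm (x - y)"
proof -
  have "norm (f x - f y) \<le> B * norm (x - y)"
  proof (rule differentiable_bound[OF convex_Cube g _ x y])
    fix z :: "real ^ 'd" assume z: "z \<in> Cube"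
    show "onorm (\<lambda>h. g z \<bullet> h) \<le> B"
    proof (rule onorm_bound)
      show "0 \<le> B" using B[OF z] norm_ge_zero order_trans by blast
      show "norm (g z \<bullet> h) \<le> B * norm h" for h
        using Cauchy_Schwarz_ineq2[of "g z" h] mult_right_mono[OF B[OF z], of "norm h"] by auto
    qed
  qed
  then show ?thesis by simp
qed

lemma C_class_lipc:
  assumes "r > 1" "f \<in> C_class r Cube" shows "lipc f"
proof -
  obtain g where g: "continuous_on Cube g" "\<And>x. x \<in> Cube \<Longrightarrow> (f has_derivative (\<lambda>h. g x \<bullet> h)) (at x within Cube)"
    using C_class_derivative[OF assms] by blast
  obtain B where "\<And>x. x \<in> Cube \<Longrightarrow> \<bar>norm (g x)\<bar> \<le> B"
    using cont_bounded_Cube[OF continuous_on_norm[OF g(1)]] by metis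
  then have "\<bar>f x - f y\<bar> \<le> B * norm (x - y)" if "x \<in> Cube" "y \<in> Cube" for x y
    using that by (intro lipschitz_of_derivative[OF g(2)]) auto
  then show ?thesis unfolding lipc_def by blast
qed

text \<open>Derivatives within the cube are unique, at boundary points too, because the cube has
  sides of positive length. Thus the gradient of the Bernstein inequality is the continuous
  derivative supplied by the smoothness class.\<close>

lemma grad_eq:
  fixes f :: "real ^ 'd \<Rightarrow> real"
  assumes "(f has_derivative (\<lambda>h. v \<bullet> h)) (at x within Cube)" "x \<in> Cube"
  shows "grad f x = v"
proof -
  have "(f has_derivative frechet_derivative f (at x within Cube)) (at x within Cube)"
    using assms(1) differentiableI frechet_derivative_works by blast
  then have "frechet_derivative f (at x within Cube) = (\<lambda>h. v \<bullet> h)"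
    using assms unfolding Cube_def
    by (intro frechet_derivative_unique_within_closed_interval[of 0 1 x f]) (auto simp: Basis_vec_def inner_axis)
  then show ?thesis by (simp add: grad_def vec_eq_iff inner_axis)
qed

lemma Lnorm_infinity_le:
  assumes "f \<in> borel_measurable cubeM" "\<And>x. x \<in> Cube \<Longrightarrow> \<bar>f x\<bar> \<le> M"
  shows "Lnorm cubeM \<infinity> (f :: real ^ 'd \<Rightarrow> real) \<le> ennreal M"
  using assms unfolding Lnorm_def eLnorm_def by (auto intro!: esssup_I AE_I2 ennreal_leI)

lemma Lnorm_infinity_AE:
  fixes f :: "real ^ 'd \<Rightarrow> 'b :: real_normed_vector"
  assumes "Lnorm cubeM \<infinity> f \<le> ennreal M" "0 \<le> M"
  shows "AE x in cubeM. norm (f x) \<le> M"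
proof -
  have "AE x in cubeM. ennreal (norm (f x)) \<le> Lnorm cubeM \<infinity> f"
    unfolding Lnorm_def eLnorm_def using esssup_AE[of "\<lambda>x. ennreal (norm (f x))" cubeM] by simp
  then show ?thesis
    by eventually_elim (use assms in \<open>meson ennreal_le_iff order_trans\<close>)
qed

lemma sets_cubeM_iff: "S \<in> sets (cubeM :: (real ^ 'd) measure) \<longleftrightarrow> S \<subseteq> Cube \<and> S \<in> sets borel"
  using sets_restrict_space_iff[of "Cube :: (real ^ 'd) set" lborel] by (auto simp: cubeM_def)

text \<open>A small cube of side \<open>\<eta>\<close> near \<open>x\<close> is shifted inward where
  necessary, so that its volume inside the unit cube does not deteriorate at the boundary.\<close>

lemma cube_neighbourhood_volume:
  fixes x :: "real ^ 'd"
  assumes x: "x \<in> Cube" and \<eta>: "0 < \<eta>" "\<eta> \<le> 1"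
  obtains S where "S \<in> sets cubeM" "S \<subseteq> Cube" "\<And>y. y \<in> S \<Longrightarrow> norm (y - x) \<le> real CARD('d) * \<eta>"
    "measure cubeM S = \<eta> ^ CARD('d)"
proof -
  define l where "l = (\<chi> i. min (x $ i) (1 - \<eta>))"
  define u where "u = (\<chi> i. l $ i + \<eta>)"
  have sub: "cbox l u \<subseteq> Cube"
    using x \<eta> by (auto simp: mem_Cube mem_box_cart l_def u_def) (smt (verit))+
  have "norm (y - x) \<le> real CARD('d) * \<eta>" if "y \<in> cbox l u" for y
  proof -
    have "norm (y - x) \<le> (\<Sum>i\<in>UNIV. \<bar>(y - x) $ i\<bar>)" by (rule norm_le_l1_cart)
    also have "\<dots> \<le> (\<Sum>i\<in>(UNIV::'d set). \<eta>)"
    proof (intro sum_mono)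
      fix i
      have "l $ i \<le> y $ i" "y $ i \<le> u $ i" "0 \<le> x $ i" "x $ i \<le> 1" using that x by (auto simp: mem_box_cart mem_Cube)
      then show "\<bar>(y - x) $ i\<bar> \<le> \<eta>" by (auto simp: l_def u_def min_def abs_le_iff split: if_splits)
    qed
    finally show ?thesis by simp
  qed
  moreover have "cbox l u \<in> sets cubeM"
    using sub by (simp add: sets_cubeM_iff)
  moreover have "measure cubeM (cbox l u) = \<eta> ^ CARD('d)"
  proof -
    have "emeasure cubeM (cbox l u) = emeasure lborel (cbox l u)"
      unfolding cubeM_def using sub by (intro emeasure_restrict_space) auto
    also have "\<dots> = ennreal (\<Prod>i\<in>(UNIV :: 'd set). \<eta>)"
      using \<eta> by (subst emeasure_lborel_cbox_cart) (auto simp: u_def)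
    finally show ?thesis using \<eta> by (simp add: measure_def)
  qed
  ultimately show ?thesis using that sub by blast
qed

text \<open>The consequences of a wavelet system that the transport and the statistics rest on:
  pointwise bounds instead of essential ones, all with a single constant \<open>C \<ge> 1\<close>, a
  finite set \<Phi>, disjoint levels, and mean zero of the wavelets.\<close>

locale wavelet_frame =
  fixes \<Phi> :: "(real ^ 'd \<Rightarrow> real) set" and \<Psi> :: "nat \<Rightarrow> (real ^ 'd \<Rightarrow> real) set"
    and I :: "nat \<Rightarrow> (real ^ 'd \<Rightarrow> real) \<Rightarrow> (real ^ 'd) set" and C :: real
  assumes C1: "1 \<le> C"
    and fin_\<Phi>: "finite \<Phi>"
    and lip: "\<And>b. b \<in> \<Phi> \<union> (\<Union>j. \<Psi> j) \<Longrightarrow> lipc b"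
    and \<Phi>_bound: "\<And>b x. b \<in> \<Phi> \<Longrightarrow> x \<in> Cube \<Longrightarrow> \<bar>b x\<bar> \<le> C"
    and \<Psi>_bound: "\<And>j b x. b \<in> \<Psi> j \<Longrightarrow> x \<in> Cube \<Longrightarrow> \<bar>b x\<bar> \<le> C * 2 powr (real CARD('d) * real j / 2)"
    and \<Psi>_lip: "\<And>j b x y. b \<in> \<Psi> j \<Longrightarrow> x \<in> Cube \<Longrightarrow> y \<in> Cube \<Longrightarrow>
       \<bar>b x - b y\<bar> \<le> C * 2 powr (real CARD('d) * real j / 2) * 2 ^ j * norm (x - y)"
    and I_interval: "\<And>j b. b \<in> \<Psi> j \<Longrightarrow> is_interval (I j b)"
    and I_Cube: "\<And>j b. b \<in> \<Psi> j \<Longrightarrow> I j b \<subseteq> Cube"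
    and I_supp: "\<And>j b x. b \<in> \<Psi> j \<Longrightarrow> x \<in> Cube \<Longrightarrow> b x \<noteq> 0 \<Longrightarrow> x \<in> I j b"
    and I_diam: "\<And>j b x y. b \<in> \<Psi> j \<Longrightarrow> x \<in> I j b \<Longrightarrow> y \<in> I j b \<Longrightarrow> norm (x - y) \<le> C / 2 ^ j"
    and I_overlap: "\<And>j. AE x in cubeM. finite {b\<in>\<Psi> j. x \<in> I j b} \<and> real (card {b\<in>\<Psi> j. x \<in> I j b}) \<le> C"
    and orth: "\<And>b b'. b \<in> \<Phi> \<union> (\<Union>j. \<Psi> j) \<Longrightarrow> b' \<in> \<Phi> \<union> (\<Union>j. \<Psi> j) \<Longrightarrow> inner_L2 b b' = (if b = b' then 1 else 0)"
    and dense: "\<And>f \<epsilon>. f \<in> Lspace cubeM 2 \<Longrightarrow> 0 < \<epsilon> \<Longrightarrow>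
       \<exists>u\<in>lin_span (\<Phi> \<union> (\<Union>j. \<Psi> j)). Lnorm cubeM 2 (\<lambda>x. f x - u x) < ennreal \<epsilon>"
    and disj: "\<And>j. \<Phi> \<inter> \<Psi> j = {}" "\<And>j k. j \<noteq> k \<Longrightarrow> \<Psi> j \<inter> \<Psi> k = {}"
    and mean_zero: "\<And>j b. b \<in> \<Psi> j \<Longrightarrow> (\<integral>x. b x \<partial>cubeM) = 0"
    and tensor: "\<And>j b. b \<in> \<Psi> j \<Longrightarrow> \<exists>h. \<forall>x\<in>Cube. b x = (\<Prod>i\<in>UNIV. h i (x $ i))"

lemma finite_of_bounded_card:
  assumes "\<And>F. finite F \<Longrightarrow> F \<subseteq> S \<Longrightarrow> real (card F) \<le> c"
  shows "finite S"
proof (rule ccontr)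
  assume "infinite S"
  then obtain F where "F \<subseteq> S" "finite F" "card F = nat \<lceil>c\<rceil> + 1"
    using infinite_arbitrarily_large by blast
  then show False using assms[of F] by linarith
qed

text \<open>The reproducing kernel of a finite part of \<open>\<Phi>\<close> is bounded, because functions in the span
  of \<open>\<Phi>\<close> cannot be large on small sets only; its trace is the number of functions.\<close>

lemma finite_orthonormal_of_bernstein:
  fixes B :: "(real ^ 'd \<Rightarrow> real) set"
  assumes cont: "\<And>b. b \<in> B \<Longrightarrow> continuous_on Cube b"
    and orth: "\<And>b b'. b \<in> B \<Longrightarrow> b' \<in> B \<Longrightarrow> inner_L2 b b' = (if b = b' then 1 else 0)"
    and L: "1 \<le> L" and lip: "\<And>u M x y. u \<in> lin_span B \<Longrightarrow> (\<And>z. z \<in> Cube \<Longrightarrow> \<bar>u z\<bar> \<le> M) \<Longrightarrow> x \<in> Cube \<Longrightarrow> y \<in> Cube \<Longrightarrow>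
      \<bar>u x - u y\<bar> \<le> L * M * norm (x - y)"
  shows "finite B"
proof (rule finite_of_bounded_card)
  \<comment> \<open>On a neighbourhood of this size a function of the span drops by at most half of
    its maximum.\<close>
  define \<eta> where "\<eta> = 1 / (2 * L * real CARD('d))"
  have card1: "1 \<le> real CARD('d)" by (simp add: Suc_leI)
  have "1 * 1 \<le> 2 * L * real CARD('d)" using L card1 by (intro mult_mono) auto
  then have \<eta>: "0 < \<eta>" "\<eta> \<le> 1" using L card1 by (auto simp: \<eta>_def)
  define V where "V = \<eta> ^ CARD('d)"
  have V: "0 < V" using \<eta> by (simp add: V_def)
  fix F assume F: "finite F" "F \<subseteq> B"
  have s_le: "(\<Sum>b\<in>F. (b x)\<^sup>2) \<le> 4 / V" if x: "x \<in> Cube" for x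
  proof -
    \<comment> \<open>The kernel with one variable frozen at \<open>x\<close>. Its value at
      \<open>x\<close> and the square of its L2 norm are both \<open>s\<close>, so a lower bound on
      the L2 norm in terms of the maximum \<open>M \<ge> s\<close> yields
      \<open>M \<le> 4 / V\<close>.\<close>
    define u where "u = (\<lambda>y. \<Sum>b\<in>F. b x * b y)"
    define s where "s = (\<Sum>b\<in>F. (b x)\<^sup>2)"
    have us: "u \<in> lin_span B" unfolding lin_span_def u_def using F by (intro CollectI exI[of _ F] exI[of _ "\<lambda>b. b x"]) auto
    have uc: "continuous_on Cube u" unfolding u_def using cont F by (intro continuous_intros) auto
    have "continuous_on Cube (\<lambda>y. \<bar>u y\<bar>)" using uc by (intro continuous_intros)
    then obtain x0 where x0: "x0 \<in> Cube" "\<And>y. y \<in> Cube \<Longrightarrow> \<bar>u y\<bar> \<le> \<bar>u x0\<bar>"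
      using continuous_attains_sup[OF compact_Cube, of "\<lambda>y. \<bar>u y\<bar>"] x by blast
    define M where "M = \<bar>u x0\<bar>"
    have sM: "s \<le> M" using x0(2)[OF x] by (simp add: u_def s_def M_def power2_eq_square)
    obtain S where S: "S \<in> sets cubeM" "S \<subseteq> Cube" "\<And>y. y \<in> S \<Longrightarrow> norm (y - x0) \<le> real CARD('d) * \<eta>"
      "measure cubeM S = V" using cube_neighbourhood_volume[OF x0(1) \<eta>] unfolding V_def by blast
    have low: "(M / 2)\<^sup>2 \<le> (u y)\<^sup>2" if "y \<in> S" for y
    proof -
      have "\<bar>u y - u x0\<bar> \<le> L * M * norm (y - x0)"
        using S that x0 us by (intro lip) (auto simp: M_def)
      also have "\<dots> \<le> L * M * (real CARD('d) * \<eta>)"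
        using S that L by (intro mult_left_mono) (auto simp: M_def)
      also have "\<dots> = M / 2" using L by (simp add: \<eta>_def)
      finally have "\<bar>M / 2\<bar> \<le> \<bar>u y\<bar>"
        using abs_triangle_ineq2[of "u x0" "u y"] abs_minus_commute[of "u x0" "u y"] by (simp add: M_def)
      then show ?thesis by (rule abs_le_square_iff[THEN iffD1])
    qed
    have int_u: "integrable cubeM (\<lambda>y. (u y)\<^sup>2)" using uc by (intro integrable_cubeM_cont continuous_intros)
    have "(M / 2)\<^sup>2 * V = (\<integral>y. (M / 2)\<^sup>2 * indicator S y \<partial>cubeM)" using S sets.sets_into_space[OF S(1)] by (simp add: Int_absorb2)
    also have "\<dots> \<le> (\<integral>y. (u y)\<^sup>2 \<partial>cubeM)"
    proof (rule integral_mono)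
      have "integrable cubeM (indicator S :: real ^ 'd \<Rightarrow> real)"
        using S(1) by (intro integrable_real_indicator) (simp_all add: less_top[symmetric])
      then show "integrable cubeM (\<lambda>y. (M / 2)\<^sup>2 * indicator S y)" by (rule integrable_mult_right)
      show "(M / 2)\<^sup>2 * indicator S y \<le> (u y)\<^sup>2" for y
        using low[of y] by (cases "y \<in> S") auto
    qed (rule int_u)
    also have "\<dots> = (\<integral>y. (\<Sum>b\<in>F. \<Sum>b'\<in>F. b x * b' x * (b y * b' y)) \<partial>cubeM)"
      by (intro Bochner_Integration.integral_cong) (auto simp: u_def power2_eq_square sum_product mult_ac)
    also have "\<dots> = (\<Sum>b\<in>F. \<Sum>b'\<in>F. b x * b' x * inner_L2 b b')"
      unfolding inner_L2_def using cont F
      by (subst Bochner_Integration.integral_sum, fastforce intro!: integrable_cubeM_cont continuous_intros)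
        (intro sum.cong refl, subst Bochner_Integration.integral_sum, fastforce intro!: integrable_cubeM_cont continuous_intros, simp)
    also have "\<dots> = (\<Sum>b\<in>F. \<Sum>b'\<in>F. if b = b' then b x * b' x else 0)"
      using orth F by (intro sum.cong refl) (auto simp: subset_iff)
    also have "\<dots> = s" using F by (simp add: s_def power2_eq_square)
    finally have "M\<^sup>2 * V / 4 \<le> s" by (simp add: power2_eq_square)
    then have 1: "M * (M * V) \<le> M * 4" using sM by (simp add: power2_eq_square)
    have "M \<le> 4 / V"
    proof (cases "M = 0")
      case False
      then have "0 < M" by (simp add: M_def)
      then have "M * V \<le> 4" using 1 mult_le_cancel_left_pos by blast
      then show ?thesis using V by (simp add: field_simps)
    qed (use V in auto)
    then show ?thesis using sM by (simp add: s_def)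
  qed
  have "real (card F) = (\<Sum>b\<in>F. inner_L2 b b)" using orth F by (simp add: subset_iff)
  also have "\<dots> = (\<integral>x. (\<Sum>b\<in>F. (b x)\<^sup>2) \<partial>cubeM)"
    unfolding inner_L2_def power2_eq_square using cont F
    by (subst Bochner_Integration.integral_sum) (auto intro!: integrable_cubeM_cont continuous_intros simp: subset_iff)
  also have "\<dots> \<le> (\<integral>x. 4 / V \<partial>(cubeM :: (real ^ 'd) measure))"
    using s_le cont F by (intro integral_mono) (auto intro!: integrable_cubeM_cont continuous_intros simp: subset_iff)
  also have "\<dots> = 4 / V" by simp
  finally show "real (card F) \<le> 4 / V" .
qed

definition disjoint_levels :: "'a set \<Rightarrow> (nat \<Rightarrow> 'a set) \<Rightarrow> nat \<Rightarrow> 'a set" where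
  "disjoint_levels \<Phi> \<Psi> j = \<Psi> j - \<Phi> - (\<Union>k<j. \<Psi> k)"

lemma disjoint_levels_subset: "disjoint_levels \<Phi> \<Psi> j \<subseteq> \<Psi> j"
  by (auto simp: disjoint_levels_def)

lemma disjoint_levels_Union: "\<Phi> \<union> (\<Union>j. disjoint_levels \<Phi> \<Psi> j) = \<Phi> \<union> (\<Union>j. \<Psi> j)"
proof -
  have *: "x \<in> \<Phi> \<union> (\<Union>j. disjoint_levels \<Phi> \<Psi> j)" if "x \<in> \<Psi> j" for x j
  proof -
    define k where "k = (LEAST k. x \<in> \<Psi> k)"
    have "x \<in> \<Psi> k" unfolding k_def using that by (rule LeastI)
    moreover have "x \<notin> \<Psi> l" if "l < k" for l using not_less_Least that unfolding k_def by blast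
    ultimately show ?thesis by (auto simp: disjoint_levels_def)
  qed
  show ?thesis
  proof (intro equalityI subsetI)
    fix x assume "x \<in> \<Phi> \<union> (\<Union>j. disjoint_levels \<Phi> \<Psi> j)"
    then show "x \<in> \<Phi> \<union> (\<Union>j. \<Psi> j)" by (auto simp: disjoint_levels_def)
  next
    fix x assume "x \<in> \<Phi> \<union> (\<Union>j. \<Psi> j)"
    then show "x \<in> \<Phi> \<union> (\<Union>j. disjoint_levels \<Phi> \<Psi> j)" using * by (elim UnE UN_E) auto
  qed
qed

text \<open>The definition of a wavelet system does not ask the levels to be disjoint from each other
  and from \<open>\<Phi>\<close>; repeated functions are dropped.\<close>

theorem wavelet_frame_of_system:
  fixes \<Phi> :: "(real ^ 'd \<Rightarrow> real) set"
  assumes r: "r > 1" and W: "wavelet_system r \<Phi> \<Psi>"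
  obtains I C where "wavelet_frame \<Phi> (disjoint_levels \<Phi> \<Psi>) I C"
proof -
  let ?B = "\<Phi> \<union> (\<Union>j. \<Psi> j)"
  let ?\<Psi> = "disjoint_levels \<Phi> \<Psi>"
  note W' = W[unfolded wavelet_system_def]
  have onb: "orthonormal_basis_L2 ?B" and CC: "?B \<subseteq> C_class r Cube"
    and pol: "\<forall>P\<in>polynomials r. \<exists>u\<in>lin_span \<Phi>. \<forall>x\<in>Cube. P x = u x"
    and tens: "\<forall>j. \<forall>\<psi>\<in>\<Psi> j. \<exists>h :: 'd \<Rightarrow> real \<Rightarrow> real. \<forall>x\<in>Cube. \<psi> x = (\<Prod>i\<in>UNIV. h i (x $ i))"
    using W' by blast+
  obtain I C1 where C1: "0 < C1" and I: "\<And>j \<psi>. \<psi> \<in> \<Psi> j \<Longrightarrow> is_interval (I j \<psi>) \<and> I j \<psi> \<subseteq> Cube \<and>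
           closure {x\<in>Cube. \<psi> x \<noteq> 0} \<subseteq> I j \<psi> \<and> diameter (I j \<psi>) \<le> C1 * 2 powr (- real j)"
    and ov: "\<And>j. AE x in cubeM. finite {\<psi>\<in>\<Psi> j. x \<in> I j \<psi>} \<and> real (card {\<psi>\<in>\<Psi> j. x \<in> I j \<psi>}) \<le> C1"
    using W'[THEN conjunct2, THEN conjunct2, THEN conjunct2, THEN conjunct2, THEN conjunct1] by blast
  obtain C2 where C2: "0 < C2" and N: "\<And>j \<psi> t. \<psi> \<in> \<Psi> j \<Longrightarrow> t \<ge> 1 \<Longrightarrow>
        Lnorm cubeM t \<psi> \<le> ennreal (C2 * 2 powr (real CARD('d) * real j * (1/2 - enn2real (1 / t))))"
    using W'[THEN conjunct2, THEN conjunct2, THEN conjunct2, THEN conjunct2, THEN conjunct2, THEN conjunct1] by blast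
  obtain C3 where C3: "0 < C3" and Be: "\<And>j u t. u\<in>lin_span (\<Phi> \<union> (\<Union>k<j. \<Psi> k)) \<Longrightarrow> t \<ge> 1 \<Longrightarrow>
        Lnorm cubeM t (grad u) \<le> ennreal (C3 * 2 ^ j) * Lnorm cubeM t u"
    using W'[THEN conjunct2, THEN conjunct2, THEN conjunct2, THEN conjunct2, THEN conjunct2, THEN conjunct2] by blast
  have lip: "lipc b" if "b \<in> ?B" for b using C_class_lipc[OF r] CC that by blast
  have cont: "continuous_on Cube b" if "b \<in> ?B" for b using lipc_cont lip that by blast
  \<comment> \<open>The Bernstein inequality with exponent infinity bounds the gradient essentially,
    hence everywhere by continuity; convexity of the cube turns this into a Lipschitz bound.\<close>
  have span_lip: "\<bar>u x - u y\<bar> \<le> C3 * 2 ^ j * M * norm (x - y)"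
    if u: "u \<in> lin_span (\<Phi> \<union> (\<Union>k<j. \<Psi> k))" and M: "\<And>z. z \<in> Cube \<Longrightarrow> \<bar>u z\<bar> \<le> M" and x: "x \<in> Cube" and y: "y \<in> Cube"
    for u j M x y
  proof -
    obtain F c where F: "finite F" "F \<subseteq> \<Phi> \<union> (\<Union>k<j. \<Psi> k)" "u = (\<lambda>x. \<Sum>b\<in>F. c b * b x)"
      using u by (auto simp: lin_span_def)
    have "\<exists>g. continuous_on Cube g \<and> (\<forall>x\<in>Cube. (b has_derivative (\<lambda>h. g x \<bullet> h)) (at x within Cube))"
      if "b \<in> F" for b
    proof -
      have "b \<in> C_class r Cube" using that F(2) CC by blast
      then show ?thesis by (rule C_class_derivative[OF r])
    qed
    then obtain g where g: "\<And>b. b \<in> F \<Longrightarrow> continuous_on Cube (g b)"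
      "\<And>b x. b \<in> F \<Longrightarrow> x \<in> Cube \<Longrightarrow> (b has_derivative (\<lambda>h. g b x \<bullet> h)) (at x within Cube)" by metis
    define G where "G = (\<lambda>x. \<Sum>b\<in>F. c b *\<^sub>R g b x)"
    have Gc: "continuous_on Cube G" unfolding G_def using g by (intro continuous_intros)
    have ud: "(u has_derivative (\<lambda>h. G x \<bullet> h)) (at x within Cube)" if "x \<in> Cube" for x
    proof -
      have "(u has_derivative (\<lambda>h. \<Sum>b\<in>F. c b * (g b x \<bullet> h))) (at x within Cube)"
        unfolding F(3) using g(2)[OF _ that] by (intro has_derivative_sum has_derivative_mult_right)
      then show ?thesis by (simp add: G_def inner_sum_left)
    qed
    have uc: "continuous_on Cube u" using ud by (rule has_derivative_continuous_on)
    have M0: "0 \<le> M" using M[OF x] by linarith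
    have "Lnorm cubeM \<infinity> (grad u) \<le> ennreal (C3 * 2 ^ j) * Lnorm cubeM \<infinity> u"
      by (rule Be[OF u]) simp
    also have "\<dots> \<le> ennreal (C3 * 2 ^ j) * ennreal M"
      by (intro mult_left_mono Lnorm_infinity_le borel_measurable_cubeM_cont uc M) auto
    finally have "Lnorm cubeM \<infinity> (grad u) \<le> ennreal (C3 * 2 ^ j) * ennreal M" .
    then have "Lnorm cubeM \<infinity> (grad u) \<le> ennreal (C3 * 2 ^ j * M)"
      using C3 M0 by (simp add: ennreal_mult)
    then have "AE x in cubeM. norm (grad u x) \<le> C3 * 2 ^ j * M"
      using C3 M0 by (intro Lnorm_infinity_AE) auto
    then have "AE x in cubeM. norm (G x) \<le> C3 * 2 ^ j * M"
      using AE_space by eventually_elim (use grad_eq[OF ud] in auto)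
    then have "norm (G z) \<le> C3 * 2 ^ j * M" if "z \<in> Cube" for z
      using that Gc by (intro AE_cubeM_le_imp_le[of "\<lambda>z. norm (G z)" "\<lambda>_. C3 * 2 ^ j * M"]) (auto intro!: continuous_intros)
    from lipschitz_of_derivative[OF ud this x y] show ?thesis .
  qed
  have fin: "finite \<Phi>"
  proof (rule finite_orthonormal_of_bernstein)
    show "1 \<le> max 1 C3" by simp
    fix u :: "real ^ 'd \<Rightarrow> real" and M and x y :: "real ^ 'd"
    assume A: "u \<in> lin_span \<Phi>" "\<And>z. z \<in> Cube \<Longrightarrow> \<bar>u z\<bar> \<le> M" "x \<in> Cube" "y \<in> Cube"
    have "\<bar>u x - u y\<bar> \<le> C3 * 2 ^ 0 * M * norm (x - y)" using A by (intro span_lip) auto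
    also have "\<dots> \<le> max 1 C3 * M * norm (x - y)"
      using A(2)[OF A(3)] by (intro mult_right_mono) auto
    finally show "\<bar>u x - u y\<bar> \<le> max 1 C3 * M * norm (x - y)" .
  qed (use cont onb in \<open>auto simp: orthonormal_basis_L2_def\<close>)
  have "\<forall>b\<in>\<Phi>. \<exists>K>0. \<forall>x\<in>Cube. \<bar>b x\<bar> \<le> K" using cont cont_bounded_Cube by (metis UnI1)
  then obtain K where K: "\<And>b. b \<in> \<Phi> \<Longrightarrow> 0 < K b" "\<And>b x. b \<in> \<Phi> \<Longrightarrow> x \<in> Cube \<Longrightarrow> \<bar>b x\<bar> \<le> K b" by metis
  have bnd: "\<bar>b x\<bar> \<le> C2 * 2 powr (real CARD('d) * real j / 2)" if b: "b \<in> \<Psi> j" and x: "x \<in> Cube" for j b x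
  proof -
    have "Lnorm cubeM \<infinity> b \<le> ennreal (C2 * 2 powr (real CARD('d) * real j / 2))"
      using N[OF b, of \<infinity>] by (simp add: infinity_ennreal_def)
    then have "AE x in cubeM. norm (b x) \<le> C2 * 2 powr (real CARD('d) * real j / 2)"
      using C2 by (intro Lnorm_infinity_AE) auto
    then show ?thesis
      using cont[of b] b x by (intro AE_cubeM_le_imp_le[of "\<lambda>x. \<bar>b x\<bar>" "\<lambda>_. C2 * 2 powr (real CARD('d) * real j / 2)"])
        (auto intro!: continuous_intros)
  qed
  \<comment> \<open>One constant for all purposes. The term \<open>2 * C3 * C2\<close> is the
    Lipschitz bound of a wavelet, and the sum bounds the finitely many functions in \<Phi>.\<close>
  define C where "C = 1 + C1 + C2 + 2 * C3 * C2 + (\<Sum>b\<in>\<Phi>. K b)"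
  have K0: "0 \<le> (\<Sum>b\<in>\<Phi>. K b)" using K by (intro sum_nonneg) (auto intro: less_imp_le)
  have C: "1 \<le> C" "C1 \<le> C" "C2 \<le> C" "2 * C3 * C2 \<le> C" using C1 C2 C3 K0 by (auto simp: C_def)
  have sub: "b \<in> \<Psi> j" if "b \<in> ?\<Psi> j" for b j using that by (simp add: disjoint_levels_def)
  have "wavelet_frame \<Phi> ?\<Psi> I C"
  proof
    show "1 \<le> C" by (rule C)
    show "finite \<Phi>" by (rule fin)
    show "lipc b" if "b \<in> \<Phi> \<union> (\<Union>j. ?\<Psi> j)" for b using that lip by (simp only: disjoint_levels_Union)
    show "\<bar>b x\<bar> \<le> C" if "b \<in> \<Phi>" "x \<in> Cube" for b x
    proof -
      have "K b \<le> (\<Sum>b\<in>\<Phi>. K b)" using that K fin by (intro member_le_sum) (auto intro: less_imp_le)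
      then show ?thesis using K(2)[OF that] C1 C2 C3 by (simp add: C_def) (smt (verit) mult_pos_pos)
    qed
    show "\<bar>b x\<bar> \<le> C * 2 powr (real CARD('d) * real j / 2)" if "b \<in> ?\<Psi> j" "x \<in> Cube" for j b x
      by (rule order_trans[OF bnd[OF sub[OF that(1)] that(2)] mult_right_mono[OF C(3)]]) simp
    show "\<bar>b x - b y\<bar> \<le> C * 2 powr (real CARD('d) * real j / 2) * 2 ^ j * norm (x - y)"
      if b: "b \<in> ?\<Psi> j" and x: "x \<in> Cube" and y: "y \<in> Cube" for j b x y
    proof -
      \<comment> \<open>The Bernstein inequality at index \<open>Suc j\<close> covers level
        \<open>j\<close>; this is the origin of the factor 2 in front of
        \<open>C3 * C2\<close>.\<close>
      have "b \<in> lin_span (\<Phi> \<union> (\<Union>k<Suc j. \<Psi> k))"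
        unfolding lin_span_def using sub[OF b] by (intro CollectI exI[of _ "{b}"] exI[of _ "\<lambda>_. 1"]) auto
      from span_lip[OF this bnd[OF sub[OF b]] x y]
      have "\<bar>b x - b y\<bar> \<le> (2 * C3 * C2) * (2 powr (real CARD('d) * real j / 2) * 2 ^ j * norm (x - y))"
        by (simp add: mult_ac)
      also have "\<dots> \<le> C * (2 powr (real CARD('d) * real j / 2) * 2 ^ j * norm (x - y))"
        by (intro mult_right_mono C) auto
      finally show ?thesis by (simp add: mult_ac)
    qed
    show "is_interval (I j b)" "I j b \<subseteq> Cube" if "b \<in> ?\<Psi> j" for j b using I[OF sub[OF that]] by auto
    show "x \<in> I j b" if "b \<in> ?\<Psi> j" "x \<in> Cube" "b x \<noteq> 0" for j b x
      using I[OF sub[OF that(1)]] that closure_subset[of "{x\<in>Cube. b x \<noteq> 0}"] by blast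
    show "norm (x - y) \<le> C / 2 ^ j" if "b \<in> ?\<Psi> j" "x \<in> I j b" "y \<in> I j b" for j b x y
    proof -
      have "bounded (I j b)"
        using I[OF sub[OF that(1)]] bounded_subset compact_imp_bounded[OF compact_Cube] by blast
      then have "norm (x - y) \<le> diameter (I j b)"
        using diameter_bounded_bound that by (metis dist_norm)
      also have "\<dots> \<le> C1 / 2 ^ j" using I[OF sub[OF that(1)]] by (simp add: powr_minus_divide powr_realpow)
      also have "\<dots> \<le> C / 2 ^ j" by (intro divide_right_mono C) auto
      finally show ?thesis .
    qed
    show "AE x in cubeM. finite {b\<in>?\<Psi> j. x \<in> I j b} \<and> real (card {b\<in>?\<Psi> j. x \<in> I j b}) \<le> C" for j
      using ov[of j]
    proof eventually_elim
      case (elim x)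
      have "{b\<in>?\<Psi> j. x \<in> I j b} \<subseteq> {b\<in>\<Psi> j. x \<in> I j b}" using sub by auto
      then have "finite {b\<in>?\<Psi> j. x \<in> I j b}" "card {b\<in>?\<Psi> j. x \<in> I j b} \<le> card {b\<in>\<Psi> j. x \<in> I j b}"
        using elim by (auto intro: finite_subset card_mono)
      then show ?case using elim C by linarith
    qed
    show "inner_L2 b b' = (if b = b' then 1 else 0)"
      if "b \<in> \<Phi> \<union> (\<Union>j. ?\<Psi> j)" "b' \<in> \<Phi> \<union> (\<Union>j. ?\<Psi> j)" for b b'
      using onb that unfolding disjoint_levels_Union by (auto simp: orthonormal_basis_L2_def)
    show "\<exists>u\<in>lin_span (\<Phi> \<union> (\<Union>j. ?\<Psi> j)). Lnorm cubeM 2 (\<lambda>x. f x - u x) < ennreal \<epsilon>"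
      if "f \<in> Lspace cubeM 2" "0 < \<epsilon>" for f \<epsilon>
      using onb that unfolding disjoint_levels_Union by (auto simp: orthonormal_basis_L2_def)
    show "\<Phi> \<inter> ?\<Psi> j = {}" for j by (auto simp: disjoint_levels_def)
    show "?\<Psi> j \<inter> ?\<Psi> k = {}" if "j \<noteq> k" for j k
      using that by (cases j k rule: linorder_cases) (auto simp: disjoint_levels_def)
    show "\<exists>h. \<forall>x\<in>Cube. b x = (\<Prod>i\<in>UNIV. h i (x $ i))" if "b \<in> ?\<Psi> j" for j b
      using tens sub[OF that] by blast
    show "(\<integral>x. b x \<partial>cubeM) = 0" if b: "b \<in> ?\<Psi> j" for j b
    proof -
      \<comment> \<open>Constants are polynomials, so they lie in the span of \<Phi>, to which every
        remaining wavelet is orthogonal.\<close>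
      have "(\<lambda>x. 1) \<in> (polynomials r :: (real ^ 'd \<Rightarrow> real) set)"
        unfolding polynomials_def lin_span_def
      proof (intro CollectI exI conjI)
        show "finite {\<lambda>x :: real ^ 'd. \<Prod>i\<in>(UNIV :: 'd set). (x $ i) ^ (0::nat)}" by simp
        show "{\<lambda>x. \<Prod>i\<in>(UNIV :: 'd set). (x $ i) ^ (0::nat)} \<subseteq>
          {\<lambda>x :: real ^ 'd. \<Prod>i\<in>UNIV. (x $ i) ^ k i | k. real (\<Sum>i\<in>UNIV. k i) \<le> r}"
          using r by (intro subsetI CollectI exI[of _ "\<lambda>_. 0"]) auto
        show "(\<lambda>x. 1) = (\<lambda>x. \<Sum>b\<in>{\<lambda>x :: real ^ 'd. \<Prod>i\<in>(UNIV :: 'd set). (x $ i) ^ (0::nat)}. 1 * b x)" by simp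
      qed
      then obtain F c where F: "finite F" "F \<subseteq> \<Phi>" and one: "\<And>x. x \<in> Cube \<Longrightarrow> 1 = (\<Sum>f\<in>F. c f * f x)"
        using pol by (fastforce simp: lin_span_def)
      have bB: "b \<in> ?B" using sub[OF b] by auto
      have ne: "inner_L2 b f = 0" if "f \<in> F" for f
      proof -
        have "f \<noteq> b" using that b F by (auto simp: disjoint_levels_def)
        moreover have "f \<in> ?B" using that F by auto
        ultimately show ?thesis using onb bB by (auto simp: orthonormal_basis_L2_def)
      qed
      have "(\<integral>x. b x \<partial>cubeM) = (\<integral>x. (\<Sum>f\<in>F. c f * (b x * f x)) \<partial>cubeM)"
      proof (rule Bochner_Integration.integral_cong)
        fix x assume "x \<in> space (cubeM :: (real ^ 'd) measure)"
        then have "b x * 1 = b x * (\<Sum>f\<in>F. c f * f x)" using one[of x] by simp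
        then show "b x = (\<Sum>f\<in>F. c f * (b x * f x))" by (simp add: sum_distrib_left mult_ac)
      qed simp
      also have "\<dots> = (\<Sum>f\<in>F. c f * inner_L2 b f)"
        unfolding inner_L2_def using cont F bB
        by (subst Bochner_Integration.integral_sum) (auto intro!: integrable_cubeM_cont continuous_intros simp: subset_iff)
      also have "\<dots> = 0" using ne by simp
      finally show ?thesis .
    qed
  qed
  then show ?thesis by (rule that)
qed

section \<open>Localization of coefficients\<close>

text \<open>A union of rectangles is replaced by one measurable box around any of its points, at the
  price of doubling the diameter.\<close>

lemma box_cover:
  fixes S :: "(real ^ 'd) set"
  assumes S: "S \<subseteq> Cube" and \<rho>: "0 \<le> \<rho>" "\<And>x y. x \<in> S \<Longrightarrow> y \<in> S \<Longrightarrow> norm (x - y) \<le> \<rho>"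
  shows "\<exists>R\<in>sets cubeM. S \<subseteq> R \<and> measure cubeM R \<le> (2 * \<rho>) ^ CARD('d)"
proof (cases "S = {}")
  case False
  then obtain z where z: "z \<in> S" by blast
  define l where "l = (\<chi> i. z $ i - \<rho>)"
  define u where "u = (\<chi> i. z $ i + \<rho>)"
  let ?R = "Cube \<inter> cbox l u"
  have R: "?R \<in> sets cubeM" by (simp add: sets_cubeM_iff)
  have "S \<subseteq> cbox l u"
  proof
    fix x assume "x \<in> S"
    then have "\<bar>(x - z) $ i\<bar> \<le> \<rho>" for i
      using \<rho>(2)[OF _ z] component_le_norm_cart[of "x - z" i] by fastforce
    then have "z $ i - \<rho> \<le> x $ i \<and> x $ i \<le> z $ i + \<rho>" for i
      by (simp add: abs_le_iff) (metis add.commute diff_le_eq)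
    then show "x \<in> cbox l u" by (auto simp: mem_box_cart l_def u_def)
  qed
  moreover have "measure cubeM ?R \<le> (2 * \<rho>) ^ CARD('d)"
  proof -
    have "emeasure cubeM ?R = emeasure lborel ?R"
      unfolding cubeM_def by (intro emeasure_restrict_space) auto
    also have "\<dots> \<le> emeasure lborel (cbox l u)" by (intro emeasure_mono) auto
    also have "\<dots> = ennreal (\<Prod>i\<in>(UNIV :: 'd set). 2 * \<rho>)"
      using \<rho> by (subst emeasure_lborel_cbox_cart) (auto simp: u_def l_def)
    finally have "emeasure cubeM ?R \<le> ennreal ((2 * \<rho>) ^ CARD('d))" by simp
    then show ?thesis unfolding measure_def using \<rho> by (intro enn2real_leI) auto
  qed
  ultimately show ?thesis using R S by (intro bexI[of _ ?R]) auto
qed (use \<rho> in \<open>auto intro!: bexI[of _ "{}"]\<close>)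

lemma inner_L2_sum_right:
  assumes "\<And>b. b \<in> A \<Longrightarrow> integrable cubeM (\<lambda>x. f x * b x)"
  shows "inner_L2 f (\<lambda>x. \<Sum>b\<in>A. c b * b x) = (\<Sum>b\<in>A. c b * inner_L2 f b)"
proof -
  have "inner_L2 f (\<lambda>x. \<Sum>b\<in>A. c b * b x) = (\<integral>x. (\<Sum>b\<in>A. c b * (f x * b x)) \<partial>cubeM)"
    unfolding inner_L2_def by (intro Bochner_Integration.integral_cong) (auto simp: sum_distrib_left mult_ac)
  also have "\<dots> = (\<Sum>b\<in>A. c b * inner_L2 f b)"
    unfolding inner_L2_def using assms by (subst Bochner_Integration.integral_sum) auto
  finally show ?thesis .
qed

lemma integrable_mult_cont:
  fixes f b :: "real ^ 'd \<Rightarrow> real"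
  assumes f: "integrable cubeM f" and b: "continuous_on Cube b"
  shows "integrable cubeM (\<lambda>x. f x * b x)"
proof -
  obtain K where K: "0 < K" "\<And>x. x \<in> Cube \<Longrightarrow> \<bar>b x\<bar> \<le> K" using cont_bounded_Cube[OF b] by metis
  show ?thesis
  proof (rule Bochner_Integration.integrable_bound)
    show "integrable cubeM (\<lambda>x. K * f x)" using f by simp
    show "(\<lambda>x. f x * b x) \<in> borel_measurable cubeM"
      using f borel_measurable_cubeM_cont[OF b] by (intro borel_measurable_times) auto
    show "AE x in cubeM. norm (f x * b x) \<le> norm (K * f x)"
    proof (rule AE_I2)
      fix x :: "real ^ 'd" assume "x \<in> space cubeM"
      then have "\<bar>f x\<bar> * \<bar>b x\<bar> \<le> \<bar>f x\<bar> * K" using K by (intro mult_left_mono) auto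
      then show "norm (f x * b x) \<le> norm (K * f x)" using K by (simp add: abs_mult mult.commute)
    qed
  qed
qed

section \<open>Counting wavelets and their overlaps\<close>

context wavelet_frame
begin

text \<open>The height of an L2-normalised wavelet of level \<open>j\<close>. Its square is, up to
  constants, the number of wavelets of the level and the reciprocal of the volume of a
  support.\<close>

definition Hn :: "nat \<Rightarrow> real" where
  "Hn j = 2 powr (real CARD('d) * real j / 2)"

lemma Hn_pos [simp]: "0 < Hn j" by (simp add: Hn_def)

lemma Hn_nonneg [simp]: "0 \<le> Hn j" "\<bar>Hn j\<bar> = Hn j"
  by (simp_all add: Hn_def)

lemma Hn_nz [simp]: "Hn j \<noteq> 0" by (simp add: Hn_def)

lemma Hn_sq: "(Hn j)\<^sup>2 = 2 powr (real CARD('d) * real j)"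
  by (simp add: Hn_def power2_eq_square mult.commute flip: powr_add)

lemma two_pow_card: "(2 ^ j) ^ CARD('d) = (Hn j)\<^sup>2"
proof -
  have "(2 ^ j) ^ CARD('d) = (2 :: real) powr real (j * CARD('d))"
    by (simp only: power_mult[symmetric] powr_realpow zero_less_numeral)
  then show ?thesis by (simp add: Hn_sq mult.commute)
qed

lemma Hn_ge_1: "1 \<le> Hn j" by (simp add: Hn_def ge_one_powr_ge_zero)

lemma C_pos [simp]: "0 < C" "0 \<le> C" using C1 by auto

lemma cont_basis: "b \<in> \<Phi> \<Longrightarrow> continuous_on Cube b" "b \<in> \<Psi> j \<Longrightarrow> continuous_on Cube b"
  using lip lipc_cont by blast+

lemma meas_basis: "b \<in> \<Phi> \<Longrightarrow> b \<in> borel_measurable cubeM" "b \<in> \<Psi> j \<Longrightarrow> b \<in> borel_measurable cubeM"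
  using cont_basis borel_measurable_cubeM_cont by blast+

lemma \<Psi>_bound': "b \<in> \<Psi> j \<Longrightarrow> x \<in> Cube \<Longrightarrow> \<bar>b x\<bar> \<le> C * Hn j"
  using \<Psi>_bound by (simp add: Hn_def)

text \<open>The set where \<open>b\<close> does not vanish. Its volume has a lower bound from the
  normalisation, which makes counting possible, while it inherits the diameter and the overlap bound
  from the rectangle.\<close>

definition nz :: "(real ^ 'd \<Rightarrow> real) \<Rightarrow> (real ^ 'd) set" where
  "nz b = {x\<in>Cube. b x \<noteq> 0}"

lemma nz_sets: "b \<in> \<Psi> j \<Longrightarrow> nz b \<in> sets cubeM"
  using meas_basis(2)[of b j] measurable_sets[of b cubeM borel "- {0}"]
  by (auto simp: nz_def vimage_def Int_def conj_commute)

lemma nz_I: "b \<in> \<Psi> j \<Longrightarrow> nz b \<subseteq> I j b"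
  using I_supp by (auto simp: nz_def)

definition Vc :: real where "Vc = (2 * C) ^ CARD('d)"

lemma Vc_pos [simp]: "0 < Vc" "0 \<le> Vc" by (auto simp: Vc_def)

lemma I_box: "b \<in> \<Psi> j \<Longrightarrow> \<exists>R\<in>sets cubeM. I j b \<subseteq> R \<and> measure cubeM R \<le> Vc / (Hn j)\<^sup>2"
  using box_cover[OF I_Cube, of b j "C / 2 ^ j"] I_diam[of b j]
  by (simp add: Vc_def power_divide two_pow_card)

lemma nz_upper: "b \<in> \<Psi> j \<Longrightarrow> measure cubeM (nz b) \<le> Vc / (Hn j)\<^sup>2"
proof -
  assume b: "b \<in> \<Psi> j"
  then obtain R where R: "R \<in> sets cubeM" "I j b \<subseteq> R" "measure cubeM R \<le> Vc / (Hn j)\<^sup>2"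
    using I_box by blast
  have "measure cubeM (nz b) \<le> measure cubeM R"
    using R nz_I[OF b] by (intro cubeM.finite_measure_mono) auto
  then show ?thesis using R by simp
qed

lemma integrable_indicator_cubeM: "S \<in> sets cubeM \<Longrightarrow> integrable cubeM (indicator S :: real ^ 'd \<Rightarrow> real)"
  by (intro integrable_real_indicator) (simp_all add: less_top[symmetric])

lemma nz_Int [simp]: "nz b \<inter> Cube = nz b"
  by (auto simp: nz_def)

lemma integral_indicator_cubeM: "S \<in> sets cubeM \<Longrightarrow> (\<integral>x. indicator S x \<partial>(cubeM :: (real ^ 'd) measure)) = measure cubeM S"
  by (metis Bochner_Integration.integral_indicator Int_absorb2 sets.sets_into_space)

text \<open>A function of height at most \<open>C * Hn j\<close> and L2 norm one cannot live on too
  small a set.\<close>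

lemma nz_lower:
  assumes b: "b \<in> \<Psi> j" shows "1 \<le> C\<^sup>2 * (Hn j)\<^sup>2 * measure cubeM (nz b)"
proof -
  have "1 = inner_L2 b b" using orth[of b b] b by auto
  also have "\<dots> = (\<integral>x. b x * b x \<partial>cubeM)" by (simp add: inner_L2_def)
  also have "\<dots> \<le> (\<integral>x. (C * Hn j)\<^sup>2 * indicator (nz b) x \<partial>cubeM)"
  proof (rule integral_mono)
    show "integrable cubeM (\<lambda>x. b x * b x)"
      using cont_basis(2)[OF b] by (intro integrable_cubeM_cont continuous_intros)
    show "integrable cubeM (\<lambda>x. (C * Hn j)\<^sup>2 * indicator (nz b) x)"
      using integrable_indicator_cubeM[OF nz_sets[OF b]] by (rule integrable_mult_right)
    fix x :: "real ^ 'd" assume x: "x \<in> space cubeM"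
    have "b x * b x \<le> (C * Hn j)\<^sup>2"
      using \<Psi>_bound'[OF b, of x] x abs_le_square_iff[of "b x" "C * Hn j"] by (simp add: power2_eq_square abs_mult)
    then show "b x * b x \<le> (C * Hn j)\<^sup>2 * indicator (nz b) x"
      using x by (auto simp: nz_def indicator_def)
  qed
  also have "\<dots> = C\<^sup>2 * (Hn j)\<^sup>2 * measure cubeM (nz b)"
    by (simp add: integral_indicator_cubeM[OF nz_sets[OF b]] power_mult_distrib)
  finally show ?thesis .
qed

lemma AE_overlap_sum:
  assumes F: "finite F" "F \<subseteq> \<Psi> j"
  shows "AE x in cubeM. (\<Sum>b\<in>F. indicator (nz b) x) \<le> C"
  using I_overlap[of j]
proof eventually_elim
  case (elim x)
  have "(\<Sum>b\<in>F. indicator (nz b) x :: real) = (\<Sum>b\<in>{b\<in>F. x \<in> nz b}. 1)"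
    using F by (simp add: sum.If_cases indicator_def Int_def)
  also have "\<dots> \<le> real (card {b\<in>\<Psi> j. x \<in> I j b})"
    using elim F nz_I by (auto intro!: card_mono)
  finally show ?case using elim by simp
qed

lemma sum_nz_le:
  assumes F: "finite F" "F \<subseteq> \<Psi> j" and R: "R \<in> sets cubeM" "\<And>b. b \<in> F \<Longrightarrow> nz b \<subseteq> R"
  shows "(\<Sum>b\<in>F. measure cubeM (nz b)) \<le> C * measure cubeM R"
proof -
  have nzF: "nz b \<in> sets cubeM" if "b \<in> F" for b using nz_sets F that by blast
  have "(\<Sum>b\<in>F. measure cubeM (nz b)) = (\<integral>x. (\<Sum>b\<in>F. indicator (nz b) x) \<partial>cubeM)"
    using nzF by (subst Bochner_Integration.integral_sum) (auto simp: integral_indicator_cubeM intro: integrable_indicator_cubeM)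
  also have "\<dots> \<le> (\<integral>x. C * indicator R x \<partial>cubeM)"
  proof (rule integral_mono_AE)
    show "integrable cubeM (\<lambda>x. \<Sum>b\<in>F. indicator (nz b) x :: real)"
      using nzF by (intro Bochner_Integration.integrable_sum integrable_indicator_cubeM)
    show "integrable cubeM (\<lambda>x. C * indicator R x)"
      using integrable_indicator_cubeM[OF R(1)] by (rule integrable_mult_right)
    show "AE x in cubeM. (\<Sum>b\<in>F. indicator (nz b) x) \<le> C * indicator R x"
      using AE_overlap_sum[OF F]
    proof eventually_elim
      case (elim x)
      show ?case
      proof (cases "x \<in> R")
        case False
        then have "(\<Sum>b\<in>F. indicator (nz b) x :: real) = 0"
          using R(2) by (intro sum.neutral ballI) (auto simp: indicator_def)
        then show ?thesis using False by simp
      qed (use elim in simp)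
    qed
  qed
  also have "\<dots> = C * measure cubeM R"
    using integral_indicator_cubeM[OF R(1)] by (simp del: Bochner_Integration.integral_indicator)
  finally show ?thesis .
qed

text \<open>Volume count: each support occupies at least a fixed multiple of
  \<open>1 / (Hn j)\<^sup>2\<close>, and almost every point is covered at most \<open>C\<close>
  times.\<close>

lemma card_le_region:
  assumes F: "finite F" "F \<subseteq> \<Psi> j" and R: "R \<in> sets cubeM" "\<And>b. b \<in> F \<Longrightarrow> nz b \<subseteq> R"
  shows "real (card F) \<le> C ^ 3 * (Hn j)\<^sup>2 * measure cubeM R"
proof -
  have "real (card F) \<le> (\<Sum>b\<in>F. C\<^sup>2 * (Hn j)\<^sup>2 * measure cubeM (nz b))"
    using F nz_lower by (subst real_of_card) (intro sum_mono, blast)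
  also have "\<dots> = C\<^sup>2 * (Hn j)\<^sup>2 * (\<Sum>b\<in>F. measure cubeM (nz b))" by (simp add: sum_distrib_left)
  also have "\<dots> \<le> C\<^sup>2 * (Hn j)\<^sup>2 * (C * measure cubeM R)"
    by (intro mult_left_mono sum_nz_le[OF F R]) auto
  finally show ?thesis by (simp add: power2_eq_square power3_eq_cube mult_ac)
qed

lemma finite_\<Psi>: "finite (\<Psi> j)"
proof (rule finite_of_bounded_card)
  fix F assume "finite F" "F \<subseteq> \<Psi> j"
  then show "real (card F) \<le> C ^ 3 * (Hn j)\<^sup>2 * measure cubeM (Cube :: (real ^ 'd) set)"
    by (rule card_le_region) (use sets.top[of "cubeM :: (real ^ 'd) measure"] in \<open>auto simp: nz_def\<close>)
qed

lemma card_\<Psi>: "real (card (\<Psi> j)) \<le> C ^ 3 * (Hn j)\<^sup>2"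
  using card_le_region[of "\<Psi> j" j Cube, OF finite_\<Psi> order_refl] sets.top[of "cubeM :: (real ^ 'd) measure"]
  by (auto simp: nz_def)

definition N0 :: real where "N0 = C ^ 3 * (6 * C) ^ CARD('d)"

lemma N0_pos [simp]: "0 < N0" "0 \<le> N0" by (auto simp: N0_def)

text \<open>The rectangles of level \<open>k\<close> that meet a fixed one of level \<open>j\<close>
  lie in a box whose side is at most \<open>6 * C\<close> times the larger of the two scales, and a
  volume count in that box gives the bound.\<close>

lemma card_meet:
  assumes b: "b \<in> \<Psi> j"
  shows "real (card {b'\<in>\<Psi> k. I k b' \<inter> I j b \<noteq> {}}) \<le> N0 * max 1 ((Hn k)\<^sup>2 / (Hn j)\<^sup>2)"
proof -
  let ?F = "{b'\<in>\<Psi> k. I k b' \<inter> I j b \<noteq> {}}"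
  let ?S = "\<Union>b'\<in>?F. I k b'"
  define \<rho> where "\<rho> = C / 2 ^ k + C / 2 ^ j + C / 2 ^ k"
  have \<rho>0: "0 \<le> \<rho>" by (simp add: \<rho>_def)
  have "norm (x - y) \<le> \<rho>" if xy: "x \<in> ?S" "y \<in> ?S" for x y
  proof -
    obtain b1 where b1: "b1 \<in> \<Psi> k" "x \<in> I k b1" "I k b1 \<inter> I j b \<noteq> {}" using xy(1) by blast
    then obtain z1 where 1: "z1 \<in> I k b1" "z1 \<in> I j b" by blast
    obtain b2 where b2: "b2 \<in> \<Psi> k" "y \<in> I k b2" "I k b2 \<inter> I j b \<noteq> {}" using xy(2) by blast
    then obtain z2 where 2: "z2 \<in> I k b2" "z2 \<in> I j b" by blast
    have "x - y = (x - z1) + (z1 - z2) + (z2 - y)" by simp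
    also have "norm \<dots> \<le> norm (x - z1) + norm (z1 - z2) + norm (z2 - y)"
      by (meson norm_triangle_mono order_refl norm_triangle_ineq add_mono order_trans)
    also have "\<dots> \<le> \<rho>" unfolding \<rho>_def using 1 2 b1 b2 b by (intro add_mono I_diam) auto
    finally show ?thesis .
  qed
  moreover have "?S \<subseteq> Cube" using I_Cube by blast
  ultimately obtain R where R: "R \<in> sets cubeM" "?S \<subseteq> R" "measure cubeM R \<le> (2 * \<rho>) ^ CARD('d)"
    using box_cover[of ?S \<rho>] \<rho>0 by blast
  have "real (card ?F) \<le> C ^ 3 * (Hn k)\<^sup>2 * measure cubeM R"
  proof (rule card_le_region)
    show "nz b' \<subseteq> R" if "b' \<in> ?F" for b'
      using that R(2) nz_I[of b' k] by blast
  qed (use finite_\<Psi> R in auto)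
  also have "\<dots> \<le> C ^ 3 * (Hn k)\<^sup>2 * (2 * \<rho>) ^ CARD('d)"
    using R by (intro mult_left_mono) auto
  also have "\<dots> \<le> N0 * max 1 ((Hn k)\<^sup>2 / (Hn j)\<^sup>2)"
  proof (cases "j \<le> k")
    case True
    then have "C / 2 ^ k \<le> C / 2 ^ j" by (intro divide_left_mono power_increasing) auto
    then have "2 * \<rho> \<le> 6 * C / 2 ^ j" by (simp add: \<rho>_def)
    then have "(2 * \<rho>) ^ CARD('d) \<le> (6 * C / 2 ^ j) ^ CARD('d)" using \<rho>0 by (intro power_mono) auto
    also have "\<dots> = (6 * C) ^ CARD('d) / (Hn j)\<^sup>2" by (simp add: power_divide two_pow_card)
    finally have "C ^ 3 * (Hn k)\<^sup>2 * (2 * \<rho>) ^ CARD('d) \<le> C ^ 3 * (Hn k)\<^sup>2 * ((6 * C) ^ CARD('d) / (Hn j)\<^sup>2)"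
      by (intro mult_left_mono) auto
    also have "\<dots> = N0 * ((Hn k)\<^sup>2 / (Hn j)\<^sup>2)" by (simp add: N0_def)
    also have "\<dots> \<le> N0 * max 1 ((Hn k)\<^sup>2 / (Hn j)\<^sup>2)" by (intro mult_left_mono) auto
    finally show ?thesis .
  next
    case False
    then have "C / 2 ^ j \<le> C / 2 ^ k" by (intro divide_left_mono power_increasing) auto
    then have "2 * \<rho> \<le> 6 * C / 2 ^ k" by (simp add: \<rho>_def)
    then have "(2 * \<rho>) ^ CARD('d) \<le> (6 * C / 2 ^ k) ^ CARD('d)" using \<rho>0 by (intro power_mono) auto
    also have "\<dots> = (6 * C) ^ CARD('d) / (Hn k)\<^sup>2" by (simp add: power_divide two_pow_card)
    finally have "C ^ 3 * (Hn k)\<^sup>2 * (2 * \<rho>) ^ CARD('d) \<le> C ^ 3 * (Hn k)\<^sup>2 * ((6 * C) ^ CARD('d) / (Hn k)\<^sup>2)"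
      by (intro mult_left_mono) auto
    also have "\<dots> = N0 * 1" by (simp add: N0_def)
    also have "\<dots> \<le> N0 * max 1 ((Hn k)\<^sup>2 / (Hn j)\<^sup>2)" by (intro mult_left_mono) auto
    finally show ?thesis .
  qed
  finally show ?thesis .
qed

text \<open>Bounded overlap holds almost everywhere only; continuity of the finite sum extends the
  bound to all points.\<close>

lemma sum_abs_level:
  assumes x: "x \<in> Cube"
  shows "(\<Sum>b\<in>\<Psi> j. \<bar>b x\<bar>) \<le> C\<^sup>2 * Hn j"
proof -
  have "AE x in cubeM. (\<Sum>b\<in>\<Psi> j. \<bar>b x\<bar>) \<le> C\<^sup>2 * Hn j"
    using AE_overlap_sum[OF finite_\<Psi> order_refl, of j] AE_space
  proof eventually_elim
    case (elim x)
    have "(\<Sum>b\<in>\<Psi> j. \<bar>b x\<bar>) \<le> (\<Sum>b\<in>\<Psi> j. C * Hn j * indicator (nz b) x)"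
      using elim \<Psi>_bound' by (intro sum_mono) (auto simp: nz_def indicator_def)
    also have "\<dots> = C * Hn j * (\<Sum>b\<in>\<Psi> j. indicator (nz b) x)" by (simp add: sum_distrib_left)
    also have "\<dots> \<le> C * Hn j * C" using elim by (intro mult_left_mono) (auto simp: less_imp_le)
    finally show ?case by (simp add: power2_eq_square mult_ac)
  qed
  then show ?thesis
    using x cont_basis(2) by (intro AE_cubeM_le_imp_le[of "\<lambda>x. \<Sum>b\<in>\<Psi> j. \<bar>b x\<bar>" "\<lambda>_. C\<^sup>2 * Hn j"]) (auto intro!: continuous_intros)
qed

section \<open>Coefficients of Lipschitz functions and uniform convergence of their
  expansions\<close>

definition Lip_on :: "real \<Rightarrow> (real ^ 'd \<Rightarrow> real) \<Rightarrow> bool" where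
  "Lip_on K u \<longleftrightarrow> 0 \<le> K \<and> (\<forall>x\<in>Cube. \<forall>y\<in>Cube. \<bar>u x - u y\<bar> \<le> K * norm (x - y))"

lemma Lip_on_cont: "Lip_on K u \<Longrightarrow> continuous_on Cube u"
  by (intro lipc_cont) (auto simp: Lip_on_def lipc_def)

text \<open>As the wavelet has mean zero, the value of \<open>u\<close> at a point of the support
  may be subtracted, so only the oscillation over the rectangle counts. Height times volume of the
  support gives \<open>C * Vc / Hn j\<close>.\<close>

lemma coef_localized:
  assumes b: "b \<in> \<Psi> j" and u: "continuous_on Cube u"
    and v: "\<And>x y. x \<in> I j b \<Longrightarrow> y \<in> I j b \<Longrightarrow> \<bar>u x - u y\<bar> \<le> v"
  shows "\<bar>inner_L2 u b\<bar> \<le> v * (C * Vc / Hn j)"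
proof (cases "nz b = {}")
  case True
  then have "inner_L2 u b = (\<integral>x. 0 \<partial>(cubeM :: (real ^ 'd) measure))"
    unfolding inner_L2_def by (intro Bochner_Integration.integral_cong) (auto simp: nz_def)
  \<comment> \<open>An empty support contradicts the lower volume bound.\<close>
  moreover have "False" using nz_lower[OF b] True by simp
  ultimately show ?thesis by simp
next
  case False
  then obtain z where z: "z \<in> nz b" by blast
  have zI: "z \<in> I j b" using nz_I[OF b] z by blast
  have v0: "0 \<le> v" using v[OF zI zI] by simp
  have int: "integrable cubeM (\<lambda>x. u x * b x)" "integrable cubeM b"
    using u cont_basis(2)[OF b] by (auto intro!: integrable_cubeM_cont continuous_intros)
  have "inner_L2 u b = (\<integral>x. u x * b x - u z * b x \<partial>cubeM)"
    using int mean_zero[OF b] by (simp add: inner_L2_def)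
  also have "\<bar>\<dots>\<bar> \<le> (\<integral>x. \<bar>u x * b x - u z * b x\<bar> \<partial>cubeM)" by (rule integral_abs_bound)
  also have "\<dots> \<le> (\<integral>x. v * (C * Hn j) * indicator (nz b) x \<partial>cubeM)"
  proof (rule integral_mono)
    show "integrable cubeM (\<lambda>x. \<bar>u x * b x - u z * b x\<bar>)" using int by simp
    show "integrable cubeM (\<lambda>x. v * (C * Hn j) * indicator (nz b) x)"
      using integrable_indicator_cubeM[OF nz_sets[OF b]] by (rule integrable_mult_right)
    fix x :: "real ^ 'd" assume x: "x \<in> space cubeM"
    show "\<bar>u x * b x - u z * b x\<bar> \<le> v * (C * Hn j) * indicator (nz b) x"
    proof (cases "x \<in> nz b")
      case True
      then have "\<bar>u x - u z\<bar> * \<bar>b x\<bar> \<le> v * (C * Hn j)"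
        using v[OF _ zI, of x] nz_I[OF b] \<Psi>_bound'[OF b] x v0 by (intro mult_mono) auto
      then show ?thesis using True by (simp add: left_diff_distrib flip: abs_mult)
    qed (use x in \<open>auto simp: nz_def\<close>)
  qed
  also have "\<dots> = v * (C * Hn j) * measure cubeM (nz b)"
    by (simp add: integral_indicator_cubeM[OF nz_sets[OF b]])
  also have "\<dots> \<le> v * (C * Hn j) * (Vc / (Hn j)\<^sup>2)"
    using v0 by (intro mult_left_mono nz_upper[OF b]) (auto simp: less_imp_le)
  also have "\<dots> = v * (C * Vc / Hn j)" by (simp add: power2_eq_square)
  finally show ?thesis .
qed

lemma coef_Lip:
  assumes b: "b \<in> \<Psi> j" and u: "Lip_on K u"
  shows "\<bar>inner_L2 u b\<bar> \<le> K * (C / 2 ^ j) * (C * Vc / Hn j)"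
proof (rule coef_localized[OF b Lip_on_cont[OF u]])
  fix x y assume "x \<in> I j b" "y \<in> I j b"
  then have "x \<in> Cube" "y \<in> Cube" "norm (x - y) \<le> C / 2 ^ j"
    using I_Cube[OF b] I_diam[OF b] by auto
  then have "\<bar>u x - u y\<bar> \<le> K * norm (x - y)" "norm (x - y) \<le> C / 2 ^ j"
    using u by (simp_all add: Lip_on_def)
  moreover have "0 \<le> K" using u by (simp add: Lip_on_def)
  ultimately show "\<bar>u x - u y\<bar> \<le> K * (C / 2 ^ j)" by (meson mult_left_mono order_trans)
qed

definition proj :: "(real ^ 'd \<Rightarrow> real) \<Rightarrow> nat \<Rightarrow> real ^ 'd \<Rightarrow> real" where
  "proj u k x = (\<Sum>b\<in>\<Phi>. inner_L2 u b * b x) + (\<Sum>j<k. \<Sum>b\<in>\<Psi> j. inner_L2 u b * b x)"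

definition Bk :: "nat \<Rightarrow> (real ^ 'd \<Rightarrow> real) set" where
  "Bk k = \<Phi> \<union> (\<Union>j<k. \<Psi> j)"

lemma finite_Bk: "finite (Bk k)" using fin_\<Phi> finite_\<Psi> by (auto simp: Bk_def)

lemma Bk_subset: "Bk k \<subseteq> \<Phi> \<union> (\<Union>j. \<Psi> j)" by (auto simp: Bk_def)

lemma Bk_cont: "b \<in> Bk k \<Longrightarrow> continuous_on Cube b"
  using cont_basis by (auto simp: Bk_def)

lemma sum_Bk: "(\<Sum>b\<in>Bk k. g b) = (\<Sum>b\<in>\<Phi>. g b) + (\<Sum>j<k. \<Sum>b\<in>\<Psi> j. g b)"
proof -
  have "(\<Sum>b\<in>Bk k. g b) = (\<Sum>b\<in>\<Phi>. g b) + (\<Sum>b\<in>(\<Union>j<k. \<Psi> j). g b)"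
    unfolding Bk_def using fin_\<Phi> finite_\<Psi> disj(1) by (intro sum.union_disjoint) auto
  also have "(\<Sum>b\<in>(\<Union>j<k. \<Psi> j). g b) = (\<Sum>j<k. \<Sum>b\<in>\<Psi> j. g b)"
    using finite_\<Psi> disj(2) by (intro sum.UNION_disjoint) auto
  finally show ?thesis .
qed

lemma proj_Bk: "proj u k x = (\<Sum>b\<in>Bk k. inner_L2 u b * b x)"
  by (simp add: proj_def sum_Bk)

lemma proj_cont: "continuous_on Cube (proj u k)"
  unfolding proj_Bk[abs_def] using Bk_cont by (intro continuous_intros)

lemma proj_lipc: "lipc (proj u k)"
  unfolding proj_Bk[abs_def] using Bk_subset lip by (intro lipc_sum lipc_cmult) blast

lemma proj_orth:
  assumes u: "continuous_on Cube u" and b: "b \<in> Bk k"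
  shows "(\<integral>x. (u x - proj u k x) * b x \<partial>cubeM) = 0"
proof -
  have int: "integrable cubeM (\<lambda>x. u x * b x)" "integrable cubeM (\<lambda>x. b x * proj u k x)"
    using u b Bk_cont proj_cont by (auto intro!: integrable_cubeM_cont continuous_intros)
  have "inner_L2 b (proj u k) = (\<Sum>b'\<in>Bk k. inner_L2 u b' * inner_L2 b b')"
    unfolding proj_Bk[abs_def] using b Bk_cont
    by (intro inner_L2_sum_right integrable_cubeM_cont continuous_intros) auto
  also have "\<dots> = (\<Sum>b'\<in>Bk k. if b' = b then inner_L2 u b' else 0)"
    using b Bk_subset orth by (intro sum.cong) (auto simp: subset_iff)
  also have "\<dots> = inner_L2 u b" using b finite_Bk by simp
  finally have "inner_L2 b (proj u k) = inner_L2 u b" .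
  moreover have "(\<integral>x. (u x - proj u k x) * b x \<partial>cubeM) = (\<integral>x. u x * b x - b x * proj u k x \<partial>cubeM)"
    by (intro Bochner_Integration.integral_cong) (auto simp: algebra_simps)
  moreover have "\<dots> = inner_L2 u b - inner_L2 b (proj u k)"
    using int by (simp add: inner_L2_def)
  ultimately show ?thesis by simp
qed

text \<open>Pythagoras: the error of the projection is orthogonal to the difference between the
  projection and any other element of the span.\<close>

lemma proj_best:
  assumes u: "continuous_on Cube u"
  shows "(\<integral>x. (u x - proj u k x)\<^sup>2 \<partial>cubeM) \<le> (\<integral>x. (u x - (\<Sum>b\<in>Bk k. c b * b x))\<^sup>2 \<partial>cubeM)"
proof -
  define e where "e = (\<lambda>x. u x - proj u k x)"
  define w where "w = (\<lambda>x. \<Sum>b\<in>Bk k. (inner_L2 u b - c b) * b x)"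
  have ec: "continuous_on Cube e" unfolding e_def using u proj_cont by (intro continuous_intros)
  have wc: "continuous_on Cube w" unfolding w_def using Bk_cont by (intro continuous_intros)
  have int: "integrable cubeM (\<lambda>x. (e x)\<^sup>2)" "integrable cubeM (\<lambda>x. (w x)\<^sup>2)" "integrable cubeM (\<lambda>x. e x * w x)"
    using ec wc by (auto intro!: integrable_cubeM_cont continuous_intros)
  have "(\<integral>x. e x * w x \<partial>cubeM) = (\<Sum>b\<in>Bk k. (inner_L2 u b - c b) * inner_L2 e b)"
    using inner_L2_sum_right[of "Bk k" e "\<lambda>b. inner_L2 u b - c b"] ec Bk_cont
    by (simp add: inner_L2_def w_def integrable_cubeM_cont continuous_on_mult)
  also have "\<dots> = 0" using proj_orth[OF u] by (intro sum.neutral) (auto simp: inner_L2_def e_def)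
  finally have ew: "(\<integral>x. e x * w x \<partial>cubeM) = 0" .
  have "(\<integral>x. (e x)\<^sup>2 \<partial>cubeM) \<le> (\<integral>x. (e x)\<^sup>2 \<partial>cubeM) + 2 * (\<integral>x. e x * w x \<partial>cubeM) + (\<integral>x. (w x)\<^sup>2 \<partial>cubeM)"
    using ew by simp
  also have "\<dots> = (\<integral>x. (e x)\<^sup>2 + 2 * (e x * w x) + (w x)\<^sup>2 \<partial>cubeM)" using int by simp
  also have "\<dots> = (\<integral>x. (u x - (\<Sum>b\<in>Bk k. c b * b x))\<^sup>2 \<partial>cubeM)"
  proof (rule integral_cubeM_cong)
    fix x
    have "u x - (\<Sum>b\<in>Bk k. c b * b x) = e x + w x"
      by (simp add: e_def w_def proj_Bk left_diff_distrib sum_subtractf)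
    then show "(e x)\<^sup>2 + 2 * (e x * w x) + (w x)\<^sup>2 = (u x - (\<Sum>b\<in>Bk k. c b * b x))\<^sup>2"
      by (simp add: power2_sum)
  qed
  finally show ?thesis by (simp add: e_def)
qed

end

lemma epowr_ennreal: "0 \<le> x \<Longrightarrow> epowr (ennreal x) a = ennreal (x powr a)"
  by (simp add: epowr_def)

lemma enn2real_numeral [simp]: "enn2real 2 = 2"
  by (metis enn2real_ennreal ennreal_numeral zero_le_numeral)

lemma Lnorm2_less_iff:
  assumes "continuous_on Cube f" "0 < \<epsilon>"
  shows "Lnorm cubeM 2 f < ennreal \<epsilon> \<longleftrightarrow> (\<integral>x. (f x :: real)\<^sup>2 \<partial>cubeM) < \<epsilon>\<^sup>2"
proof -
  have int: "integrable cubeM (\<lambda>x. (f x)\<^sup>2)" using assms by (intro integrable_cubeM_cont continuous_intros)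
  have nn: "0 \<le> (\<integral>x. (f x)\<^sup>2 \<partial>cubeM)" by simp
  have "(\<integral>\<^sup>+x. epowr (ennreal (norm (f x))) (enn2real 2) \<partial>cubeM) = (\<integral>\<^sup>+x. ennreal ((f x)\<^sup>2) \<partial>cubeM)"
    by (intro nn_integral_cong) (simp add: epowr_ennreal)
  also have "\<dots> = ennreal (\<integral>x. (f x)\<^sup>2 \<partial>cubeM)" by (rule nn_integral_eq_integral[OF int]) simp
  finally have "Lnorm cubeM 2 f = ennreal (sqrt (\<integral>x. (f x)\<^sup>2 \<partial>cubeM))"
    using nn by (simp add: Lnorm_def eLnorm_def epowr_ennreal powr_half_sqrt)
  then show ?thesis using assms(2) nn
    by (simp add: ennreal_less_iff real_less_lsqrt real_sqrt_less_iff)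
      (metis abs_of_pos real_sqrt_abs real_sqrt_less_iff)
qed

context wavelet_frame
begin

lemma proj_L2:
  assumes u: "continuous_on Cube u" and \<epsilon>: "0 < \<epsilon>"
  shows "\<exists>k0. \<forall>k\<ge>k0. (\<integral>x. (u x - proj u k x)\<^sup>2 \<partial>cubeM) < \<epsilon>\<^sup>2"
proof -
  have "u \<in> Lspace cubeM 2"
  proof -
    define K where "K = sqrt (\<integral>x. (u x)\<^sup>2 \<partial>cubeM) + 1"
    have "0 \<le> sqrt (\<integral>x. (u x)\<^sup>2 \<partial>cubeM)" by simp
    then have K: "0 < K" "(\<integral>x. (u x)\<^sup>2 \<partial>cubeM) < K\<^sup>2"
      unfolding K_def by linarith (simp add: power2_sum add_pos_nonneg)
    have "Lnorm cubeM 2 u < ennreal K" using Lnorm2_less_iff[OF u K(1)] K(2) by simp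
    then show ?thesis using borel_measurable_cubeM_cont[OF u] by (simp add: Lspace_def order_less_trans[OF _ ennreal_less_top])
  qed
  then obtain v where v: "v \<in> lin_span (\<Phi> \<union> (\<Union>j. \<Psi> j))" "Lnorm cubeM 2 (\<lambda>x. u x - v x) < ennreal \<epsilon>"
    using dense \<epsilon> by blast
  then obtain F c where F: "finite F" "F \<subseteq> \<Phi> \<union> (\<Union>j. \<Psi> j)" "v = (\<lambda>x. \<Sum>b\<in>F. c b * b x)"
    by (auto simp: lin_span_def)
  have vc: "continuous_on Cube v"
    unfolding F(3) using F(2) lip lipc_cont by (intro continuous_intros) blast
  have "\<forall>b\<in>F. \<exists>k. b \<in> Bk k"
  proof
    fix b assume "b \<in> F"
    then consider "b \<in> \<Phi>" | j where "b \<in> \<Psi> j" using F(2) by blast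
    then show "\<exists>k. b \<in> Bk k"
      by cases (auto simp: Bk_def intro: exI[of _ 0] exI[of _ "Suc _"])
  qed
  then obtain kf where kf: "\<And>b. b \<in> F \<Longrightarrow> b \<in> Bk (kf b)" by metis
  have mono: "Bk k \<subseteq> Bk k'" if "k \<le> k'" for k k' using that by (auto simp: Bk_def intro: less_le_trans)
  \<comment> \<open>The sum serves as an upper bound for the finitely many levels that occur in
    \<open>v\<close>.\<close>
  define k0 where "k0 = (\<Sum>b\<in>F. kf b)"
  have "(\<integral>x. (u x - proj u k x)\<^sup>2 \<partial>cubeM) < \<epsilon>\<^sup>2" if "k0 \<le> k" for k
  proof -
    have sub: "F \<subseteq> Bk k"
    proof
      fix b assume b: "b \<in> F"
      have "kf b \<le> k0" unfolding k0_def using F b by (intro member_le_sum) auto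
      then show "b \<in> Bk k" using kf[OF b] mono[of "kf b" k] that by auto
    qed
    define c' where "c' = (\<lambda>b. if b \<in> F then c b else 0)"
    have veq: "v x = (\<Sum>b\<in>Bk k. c' b * b x)" for x
    proof -
      have "(\<Sum>b\<in>Bk k. c' b * b x) = (\<Sum>b\<in>F. c' b * b x)"
        using sub finite_Bk by (intro sum.mono_neutral_right) (auto simp: c'_def)
      then show ?thesis by (simp add: F(3) c'_def)
    qed
    have "(\<integral>x. (u x - proj u k x)\<^sup>2 \<partial>cubeM) \<le> (\<integral>x. (u x - v x)\<^sup>2 \<partial>cubeM)"
      unfolding veq by (rule proj_best[OF u])
    also have "\<dots> < \<epsilon>\<^sup>2"
      using v(2) Lnorm2_less_iff[of "\<lambda>x. u x - v x" \<epsilon>] u vc \<epsilon> by (simp add: continuous_on_diff)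
    finally show ?thesis .
  qed
  then show ?thesis by blast
qed

definition Cl :: real where "Cl = C * (C * Vc) * C\<^sup>2"

lemma Cl_pos [simp]: "0 < Cl" "0 \<le> Cl" by (auto simp: Cl_def intro!: mult_pos_pos zero_less_power)

lemma level_Lip:
  assumes u: "Lip_on K u" and x: "x \<in> Cube"
  shows "\<bar>\<Sum>b\<in>\<Psi> j. inner_L2 u b * b x\<bar> \<le> K * Cl / 2 ^ j"
proof -
  have K: "0 \<le> K" using u by (simp add: Lip_on_def)
  have "\<bar>\<Sum>b\<in>\<Psi> j. inner_L2 u b * b x\<bar> \<le> (\<Sum>b\<in>\<Psi> j. \<bar>inner_L2 u b * b x\<bar>)" by (rule sum_abs)
  also have "\<dots> \<le> (\<Sum>b\<in>\<Psi> j. K * (C / 2 ^ j) * (C * Vc / Hn j) * \<bar>b x\<bar>)"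
    unfolding abs_mult using coef_Lip[OF _ u] by (intro sum_mono mult_right_mono) auto
  also have "\<dots> = K * (C / 2 ^ j) * (C * Vc / Hn j) * (\<Sum>b\<in>\<Psi> j. \<bar>b x\<bar>)" by (simp add: sum_distrib_left)
  also have "\<dots> \<le> K * (C / 2 ^ j) * (C * Vc / Hn j) * (C\<^sup>2 * Hn j)"
    using K by (intro mult_left_mono sum_abs_level x mult_nonneg_nonneg) (auto simp: less_imp_le)
  also have "\<dots> = K * Cl / 2 ^ j" by (simp add: Cl_def)
  finally show ?thesis .
qed

lemma sum_half_powers: "k \<le> k' \<Longrightarrow> (\<Sum>j=k..<k'. a / 2 ^ j) = 2 * a / 2 ^ k - 2 * a / (2::real) ^ k'"
  by (induction k' rule: dec_induct) auto

text \<open>By the oscillation bound, level \<open>j\<close> contributes at most a multiple of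
  \<open>1 / 2 ^ j\<close> in sup norm, so the expansion converges uniformly; convergence in L2
  identifies the limit as \<open>u\<close>.\<close>

theorem proj_uniform:
  assumes u: "Lip_on K u" and x: "x \<in> Cube"
  shows "\<bar>u x - proj u k x\<bar> \<le> 2 * K * Cl / 2 ^ k"
proof -
  define \<delta> where "\<delta> = 2 * K * Cl / 2 ^ k"
  have K: "0 \<le> K" using u by (simp add: Lip_on_def)
  have \<delta>: "0 \<le> \<delta>" using K by (simp add: \<delta>_def)
  note uc = Lip_on_cont[OF u]
  define e where "e = (\<lambda>k x. u x - proj u k x)"
  have ec: "continuous_on Cube (e k)" for k unfolding e_def using uc proj_cont by (intro continuous_intros)
  have step: "\<bar>e k y\<bar> \<le> \<bar>e k' y\<bar> + \<delta>" if "k \<le> k'" "y \<in> Cube" for k' y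
  proof -
    have "proj u k' y - proj u k y = (\<Sum>j=k..<k'. \<Sum>b\<in>\<Psi> j. inner_L2 u b * b y)"
      unfolding proj_def using that(1) by (simp add: lessThan_atLeast0 sum_diff_nat_ivl)
    also have "\<bar>\<dots>\<bar> \<le> (\<Sum>j=k..<k'. K * Cl / 2 ^ j)"
      by (rule order_trans[OF sum_abs sum_mono[OF level_Lip[OF u that(2)]]])
    also have "\<dots> \<le> \<delta>" using sum_half_powers[OF that(1), of "K * Cl"] K by (simp add: \<delta>_def mult.assoc)
    finally show ?thesis by (simp add: e_def)
  qed
  \<comment> \<open>The part of the error exceeding \<open>\<delta>\<close>. It is dominated by the
    error of every later projection, whose L2 norm becomes arbitrarily small, so it
    vanishes.\<close>
  define m where "m = (\<lambda>y. max 0 (\<bar>e k y\<bar> - \<delta>))"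
  have mc: "continuous_on Cube m" unfolding m_def using ec by (intro continuous_intros)
  have mint: "integrable cubeM (\<lambda>y. (m y)\<^sup>2)" using mc by (intro integrable_cubeM_cont continuous_intros)
  have "(\<integral>y. (m y)\<^sup>2 \<partial>cubeM) \<le> \<epsilon>\<^sup>2" if \<epsilon>: "0 < \<epsilon>" for \<epsilon>
  proof -
    obtain k0 where k0: "\<And>k. k \<ge> k0 \<Longrightarrow> (\<integral>x. (u x - proj u k x)\<^sup>2 \<partial>cubeM) < \<epsilon>\<^sup>2"
      using proj_L2[OF uc \<epsilon>] by blast
    define k' where "k' = max k k0"
    have "(\<integral>y. (m y)\<^sup>2 \<partial>cubeM) \<le> (\<integral>y. (e k' y)\<^sup>2 \<partial>cubeM)"
    proof (rule integral_mono[OF mint])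
      show "integrable cubeM (\<lambda>y. (e k' y)\<^sup>2)" using ec by (intro integrable_cubeM_cont continuous_intros)
      fix y :: "real ^ 'd" assume "y \<in> space cubeM"
      then have "\<bar>m y\<bar> \<le> \<bar>e k' y\<bar>" using step[of k' y] by (auto simp: m_def k'_def)
      then show "(m y)\<^sup>2 \<le> (e k' y)\<^sup>2" by (simp add: abs_le_square_iff)
    qed
    also have "\<dots> < \<epsilon>\<^sup>2" using k0[of k'] by (simp add: e_def k'_def)
    finally show ?thesis by simp
  qed
  then have small: "(\<integral>y. (m y)\<^sup>2 \<partial>cubeM) \<le> \<epsilon>" if "0 < \<epsilon>" for \<epsilon>
    using that by (metis real_sqrt_gt_0_iff real_sqrt_pow2 less_imp_le)
  have "(\<integral>y. (m y)\<^sup>2 \<partial>cubeM) = 0"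
    using small by (intro antisym) (auto intro: field_le_epsilon)
  then have "AE y in cubeM. (m y)\<^sup>2 = 0"
    using integral_nonneg_eq_0_iff_AE[OF mint] by simp
  then have "AE y in cubeM. \<bar>e k y\<bar> \<le> \<delta>"
    by eventually_elim (auto simp: m_def max_def split: if_splits)
  then have "\<bar>e k x\<bar> \<le> \<delta>"
    using ec x by (intro AE_cubeM_le_imp_le[of "\<lambda>y. \<bar>e k y\<bar>" "\<lambda>_. \<delta>"]) (auto intro!: continuous_intros)
  then show ?thesis by (simp add: e_def \<delta>_def)
qed

text \<open>A Parseval identity with error term for a density \<open>f\<close> that is merely
  integrable: uniform convergence on the side of \<open>u\<close> suffices, since \<open>f\<close>
  has integral one.\<close>

lemma inner_expansion:
  assumes f: "is_density f" and u: "Lip_on K u"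
  shows "\<bar>inner_L2 f u - ((\<Sum>b\<in>\<Phi>. inner_L2 f b * inner_L2 u b) +
    (\<Sum>j<k. \<Sum>b\<in>\<Psi> j. inner_L2 f b * inner_L2 u b))\<bar> \<le> 2 * K * Cl / 2 ^ k"
proof -
  have fi: "integrable cubeM f" "AE x in cubeM. 0 \<le> f x" "(\<integral>x. f x \<partial>cubeM) = 1" using f by (auto simp: is_density_def)
  define \<delta> where "\<delta> = 2 * K * Cl / 2 ^ k"
  note uc = Lip_on_cont[OF u]
  have "inner_L2 f (proj u k) = (\<Sum>b\<in>Bk k. inner_L2 u b * inner_L2 f b)"
    unfolding proj_Bk[abs_def] using fi Bk_cont by (intro inner_L2_sum_right integrable_mult_cont) auto
  then have "(\<Sum>b\<in>\<Phi>. inner_L2 f b * inner_L2 u b) + (\<Sum>j<k. \<Sum>b\<in>\<Psi> j. inner_L2 f b * inner_L2 u b) = inner_L2 f (proj u k)"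
    by (simp add: sum_Bk mult.commute)
  moreover have int: "integrable cubeM (\<lambda>x. f x * u x)" "integrable cubeM (\<lambda>x. f x * proj u k x)"
    using integrable_mult_cont[OF fi(1)] uc proj_cont by auto
  have "\<bar>inner_L2 f u - inner_L2 f (proj u k)\<bar> \<le> \<delta>"
  proof -
  have "inner_L2 f u - inner_L2 f (proj u k) = (\<integral>x. f x * u x - f x * proj u k x \<partial>cubeM)"
    using int by (simp add: inner_L2_def)
  also have "\<bar>\<dots>\<bar> \<le> (\<integral>x. \<bar>f x * u x - f x * proj u k x\<bar> \<partial>cubeM)" by (rule integral_abs_bound)
  also have "\<dots> \<le> (\<integral>x. \<delta> * f x \<partial>cubeM)"
  proof (rule integral_mono_AE)
    show "AE x in cubeM. \<bar>f x * u x - f x * proj u k x\<bar> \<le> \<delta> * f x"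
      using fi(2) AE_space
    proof eventually_elim
      case (elim x)
      have "\<bar>f x * u x - f x * proj u k x\<bar> = f x * \<bar>u x - proj u k x\<bar>"
        using elim by (simp add: abs_mult flip: right_diff_distrib)
      also have "\<dots> \<le> f x * \<delta>" using proj_uniform[OF u, of x k] elim by (intro mult_left_mono) (auto simp: \<delta>_def)
      finally show ?case by (simp add: mult.commute)
    qed
  qed (use int fi in auto)
  also have "\<dots> = \<delta>" using fi by simp
  finally show ?thesis .
  qed
  ultimately show ?thesis by (simp add: \<delta>_def)
qed

end

section \<open>Variances over one level\<close>

context wavelet_frame
begin

text \<open>The bound on each single level that a Besov norm implies, whatever \<open>q\<close>. The
  weight is the usual one, as \<open>Hn j powr (1 - 2 / p)\<close> equals
  \<open>2 powr (d * j * (1/2 - 1/p))\<close> with \<open>d\<close> the dimension.\<close>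

definition besov_ball :: "real \<Rightarrow> real \<Rightarrow> real \<Rightarrow> (real ^ 'd \<Rightarrow> real) \<Rightarrow> bool" where
  "besov_ball p L s f \<longleftrightarrow> is_density f \<and>
     (\<forall>j. lpn p (\<Psi> j) (inner_L2 f) \<le> L * 2 powr (- real j * s) * Hn j powr (2 / p - 1))"

lemma besov_ball_0:
  assumes "besov_ball p L s f" "0 \<le> s" "0 \<le> L"
  shows "besov_ball p L 0 f"
proof -
  have "lpn p (\<Psi> j) (inner_L2 f) \<le> L * Hn j powr (2 / p - 1)" for j
  proof -
    have "2 powr (- real j * s) \<le> 2 powr 0" using assms by (intro powr_mono) auto
    then have "L * 2 powr (- real j * s) * Hn j powr (2 / p - 1) \<le> L * 1 * Hn j powr (2 / p - 1)"
      using assms by (intro mult_right_mono mult_left_mono) auto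
    moreover have "lpn p (\<Psi> j) (inner_L2 f) \<le> L * 2 powr (- real j * s) * Hn j powr (2 / p - 1)"
      using assms(1) unfolding besov_ball_def by blast
    ultimately show ?thesis by simp
  qed
  then show ?thesis using assms by (simp add: besov_ball_def)
qed

text \<open>The second moment of \<open>b\<close> under the density \<open>f\<close>, which bounds
  its variance.\<close>

definition vr :: "(real ^ 'd \<Rightarrow> real) \<Rightarrow> (real ^ 'd \<Rightarrow> real) \<Rightarrow> real" where
  "vr f b = inner_L2 f (\<lambda>x. (b x)\<^sup>2)"

lemma integral_sq_basis: "b \<in> \<Phi> \<union> (\<Union>j. \<Psi> j) \<Longrightarrow> (\<integral>x. (b x)\<^sup>2 \<partial>cubeM) = 1"
  using orth[of b b] by (simp add: inner_L2_def power2_eq_square)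

lemma Lip_on_sq:
  assumes b: "b \<in> \<Psi> j"
  shows "Lip_on (2 * C\<^sup>2 * (Hn j)\<^sup>2 * 2 ^ j) (\<lambda>x. (b x)\<^sup>2)"
  unfolding Lip_on_def
proof (intro conjI ballI)
  fix x y :: "real ^ 'd" assume xy: "x \<in> Cube" "y \<in> Cube"
  have "(b x)\<^sup>2 - (b y)\<^sup>2 = (b x + b y) * (b x - b y)" by (simp add: power2_eq_square algebra_simps)
  then have "\<bar>(b x)\<^sup>2 - (b y)\<^sup>2\<bar> = \<bar>b x + b y\<bar> * \<bar>b x - b y\<bar>" by (simp add: abs_mult)
  also have "\<dots> \<le> (2 * (C * Hn j)) * (C * Hn j * 2 ^ j * norm (x - y))"
  proof (intro mult_mono)
    show "\<bar>b x + b y\<bar> \<le> 2 * (C * Hn j)"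
      using \<Psi>_bound'[OF b xy(1)] \<Psi>_bound'[OF b xy(2)] abs_triangle_ineq[of "b x" "b y"] by linarith
    show "\<bar>b x - b y\<bar> \<le> C * Hn j * 2 ^ j * norm (x - y)"
      using \<Psi>_lip[OF b xy] by (simp add: Hn_def)
  qed auto
  finally show "\<bar>(b x)\<^sup>2 - (b y)\<^sup>2\<bar> \<le> 2 * C\<^sup>2 * (Hn j)\<^sup>2 * 2 ^ j * norm (x - y)"
    by (simp add: power2_eq_square mult_ac)
qed auto

text \<open>The square of an L2-normalised function is a probability density.\<close>

lemma inner_sq_bound:
  assumes b: "b \<in> \<Psi> j" and e: "continuous_on Cube e" "\<And>x. x \<in> Cube \<Longrightarrow> \<bar>e x\<bar> \<le> M"
  shows "\<bar>inner_L2 (\<lambda>x. (b x)\<^sup>2) e\<bar> \<le> M"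
proof -
  have int: "integrable cubeM (\<lambda>x. (b x)\<^sup>2 * e x)" "integrable cubeM (\<lambda>x. (b x)\<^sup>2)"
    using cont_basis(2)[OF b] e by (auto intro!: integrable_cubeM_cont continuous_intros)
  have "\<bar>inner_L2 (\<lambda>x. (b x)\<^sup>2) e\<bar> \<le> (\<integral>x. \<bar>(b x)\<^sup>2 * e x\<bar> \<partial>cubeM)"
    unfolding inner_L2_def by (rule integral_abs_bound)
  also have "\<dots> \<le> (\<integral>x. (b x)\<^sup>2 * M \<partial>cubeM)"
  proof (rule integral_mono)
    show "integrable cubeM (\<lambda>x. \<bar>(b x)\<^sup>2 * e x\<bar>)" by (rule integrable_abs[OF int(1)])
    show "integrable cubeM (\<lambda>x. (b x)\<^sup>2 * M)" using int(2) by simp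
  qed (use e in \<open>auto simp: abs_mult intro!: mult_left_mono\<close>)
  also have "\<dots> = M" using integral_sq_basis[of b] b by auto
  finally show ?thesis .
qed

definition decay :: "nat \<Rightarrow> nat \<Rightarrow> real" where
  "decay j k = (if k \<le> j then 1 else 2 ^ j / 2 ^ k)"

lemma decay_pos [simp]: "0 < decay j k" "0 \<le> decay j k" by (auto simp: decay_def)

text \<open>The \<open>j + 1\<close> levels up to \<open>j\<close> contribute one each and the finer
  ones a geometric series. This is the origin of the factor \<open>j + 1\<close> in the variances,
  and so of a logarithm in the threshold and in dimension two.\<close>

lemma sum_decay: "(\<Sum>k<K. decay j k) \<le> real j + 2"
proof -
  define K' where "K' = max K (Suc j)"
  have "(\<Sum>k<K. decay j k) \<le> (\<Sum>k<K'. decay j k)" by (intro sum_mono2) (auto simp: K'_def)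
  also have "\<dots> = (\<Sum>k<Suc j. decay j k) + (\<Sum>k=Suc j..<K'. decay j k)"
    by (simp add: lessThan_atLeast0 sum.atLeastLessThan_concat K'_def del: sum.op_ivl_Suc)
  also have "(\<Sum>k<Suc j. decay j k) = real j + 1" by (simp add: decay_def)
  also have "(\<Sum>k=Suc j..<K'. decay j k) = (\<Sum>k=Suc j..<K'. 2 ^ j / 2 ^ k)"
    by (intro sum.cong) (auto simp: decay_def)
  also have "\<dots> \<le> 1" by (subst sum_half_powers) (auto simp: K'_def)
  finally show ?thesis by simp
qed

definition A0 :: real where "A0 = C + 2 * C ^ 4 * Vc"

lemma A0_pos [simp]: "0 < A0" "0 \<le> A0" by (auto simp: A0_def intro!: add_pos_pos mult_pos_pos zero_less_power add_nonneg_nonneg)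

text \<open>The square of a wavelet against a wavelet of a finer level gains a factor from the
  vanishing mean of the latter and the Lipschitz constant of the former.\<close>

lemma sq_coef:
  assumes b: "b \<in> \<Psi> j" and e: "e \<in> \<Psi> k"
  shows "\<bar>inner_L2 (\<lambda>x. (b x)\<^sup>2) e\<bar> \<le>
    (if I k e \<inter> I j b \<noteq> {} then A0 * decay j k * Hn k * min 1 ((Hn j)\<^sup>2 / (Hn k)\<^sup>2) else 0)"
proof (cases "I k e \<inter> I j b = {}")
  case True
  have "(b x)\<^sup>2 * e x = 0" if "x \<in> Cube" for x
    using I_supp[OF b that] I_supp[OF e that] True by auto
  then have "inner_L2 (\<lambda>x. (b x)\<^sup>2) e = (\<integral>x. 0 \<partial>(cubeM :: (real ^ 'd) measure))"
    unfolding inner_L2_def by (rule integral_cubeM_cong)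
  then show ?thesis using True by simp
next
  case False
  show ?thesis
  proof (cases "k \<le> j")
    case True
    have "Hn k \<le> Hn j" unfolding Hn_def using True by (intro powr_mono) auto
    then have m: "min 1 ((Hn j)\<^sup>2 / (Hn k)\<^sup>2) = 1" by (simp add: min_def power_mono)
    have "\<bar>inner_L2 (\<lambda>x. (b x)\<^sup>2) e\<bar> \<le> C * Hn k"
      using inner_sq_bound[OF b cont_basis(2)[OF e] \<Psi>_bound'[OF e]] .
    also have "\<dots> \<le> A0 * Hn k" by (intro mult_right_mono) (auto simp: A0_def)
    finally show ?thesis using False True by (simp add: m decay_def)
  next
    case kj: False
    have "Hn j \<le> Hn k" unfolding Hn_def using kj by (intro powr_mono) auto
    then have m: "min 1 ((Hn j)\<^sup>2 / (Hn k)\<^sup>2) = (Hn j)\<^sup>2 / (Hn k)\<^sup>2" by (simp add: min_def power_mono)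
    have "\<bar>inner_L2 (\<lambda>x. (b x)\<^sup>2) e\<bar> \<le> (2 * C\<^sup>2 * (Hn j)\<^sup>2 * 2 ^ j) * (C / 2 ^ k) * (C * Vc / Hn k)"
      by (rule coef_Lip[OF e Lip_on_sq[OF b]])
    also have "\<dots> = (2 * C ^ 4 * Vc) * (2 ^ j / 2 ^ k * Hn k * ((Hn j)\<^sup>2 / (Hn k)\<^sup>2))"
      by (simp add: power2_eq_square eval_nat_numeral)
    also have "\<dots> \<le> A0 * (2 ^ j / 2 ^ k * Hn k * ((Hn j)\<^sup>2 / (Hn k)\<^sup>2))"
      by (intro mult_right_mono) (auto simp: A0_def)
    finally show ?thesis using False kj by (simp add: m decay_def mult.assoc)
  qed
qed

text \<open>A Schur test: the matrix between levels \<open>j\<close> and \<open>k\<close> has at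
  most \<open>r1\<close> nonzero entries per row and at most \<open>r2\<close> per column, all
  bounded by \<open>g\<close>. The power mean inequality handles the rows, and exchanging the sums
  handles the columns.\<close>

lemma sum_sq_coef_powr:
  assumes p: "1 \<le> p" and L: "0 \<le> L" and f: "besov_ball p L 0 f"
  shows "lpn p (\<Psi> j) (\<lambda>b. \<Sum>e\<in>\<Psi> k. \<bar>inner_L2 f e\<bar> * \<bar>inner_L2 (\<lambda>x. (b x)\<^sup>2) e\<bar>)
    \<le> A0 * N0 * L * decay j k * Hn j powr (2 / p)"
proof -
  define g where "g = A0 * decay j k * Hn k * min 1 ((Hn j)\<^sup>2 / (Hn k)\<^sup>2)"
  define r1 where "r1 = N0 * max 1 ((Hn k)\<^sup>2 / (Hn j)\<^sup>2)"
  define r2 where "r2 = N0 * max 1 ((Hn j)\<^sup>2 / (Hn k)\<^sup>2)"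
  have N01: "1 \<le> N0"
  proof -
    have "1 * 1 \<le> C ^ 3 * (6 * C) ^ CARD('d)" using C1 by (intro mult_mono one_le_power) auto
    then show ?thesis by (simp add: N0_def)
  qed
  have r1: "1 \<le> r1"
  proof -
    have "1 * 1 \<le> N0 * max 1 ((Hn k)\<^sup>2 / (Hn j)\<^sup>2)" using N01 by (intro mult_mono) auto
    then show ?thesis by (simp add: r1_def)
  qed
  have g0: "0 \<le> g" unfolding g_def by (auto intro!: mult_nonneg_nonneg)
  define m where "m = (\<lambda>b. {e\<in>\<Psi> k. I k e \<inter> I j b \<noteq> {}})"
  define \<beta> where "\<beta> = (\<lambda>e. \<bar>inner_L2 f e\<bar>)"
  define T where "T = (\<lambda>b. \<Sum>e\<in>\<Psi> k. \<bar>inner_L2 f e\<bar> * \<bar>inner_L2 (\<lambda>x. (b x)\<^sup>2) e\<bar>)"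
  have T0: "0 \<le> T b" for b unfolding T_def by (intro sum_nonneg) auto
  have Tle: "T b powr p \<le> g powr p * (r1 powr (p - 1) * (\<Sum>e\<in>m b. \<beta> e powr p))" if b: "b \<in> \<Psi> j" for b
  proof -
    have "T b \<le> (\<Sum>e\<in>\<Psi> k. if e \<in> m b then g * \<beta> e else 0)"
      unfolding T_def
    proof (rule sum_mono)
      fix e assume e: "e \<in> \<Psi> k"
      show "\<bar>inner_L2 f e\<bar> * \<bar>inner_L2 (\<lambda>x. (b x)\<^sup>2) e\<bar> \<le> (if e \<in> m b then g * \<beta> e else 0)"
        using mult_left_mono[OF sq_coef[OF b e], of "\<beta> e"] e
        by (auto simp: m_def g_def \<beta>_def mult.commute split: if_splits)
    qed
    also have "\<dots> = g * (\<Sum>e\<in>m b. \<beta> e)"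
      using finite_\<Psi> by (simp add: sum.If_cases sum_distrib_left m_def Int_def)
    finally have "T b powr p \<le> (g * (\<Sum>e\<in>m b. \<beta> e)) powr p" using T0 p by (intro powr_mono2) auto
    also have "\<dots> = g powr p * (\<Sum>e\<in>m b. \<beta> e) powr p"
      by (rule powr_mult)
    also have "\<dots> \<le> g powr p * (r1 powr (p - 1) * (\<Sum>e\<in>m b. \<beta> e powr p))"
    proof (intro mult_left_mono sum_powr_le_card)
      show "real (card (m b)) \<le> r1" unfolding m_def r1_def by (rule card_meet[OF b])
    qed (use finite_\<Psi> p r1 in \<open>auto simp: \<beta>_def m_def\<close>)
    finally show ?thesis .
  qed
  have "(\<Sum>b\<in>\<Psi> j. \<bar>T b\<bar> powr p) \<le> (\<Sum>b\<in>\<Psi> j. g powr p * (r1 powr (p - 1) * (\<Sum>e\<in>m b. \<beta> e powr p)))"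
    using Tle T0 by (intro sum_mono) auto
  also have "\<dots> = g powr p * r1 powr (p - 1) * (\<Sum>b\<in>\<Psi> j. \<Sum>e\<in>m b. \<beta> e powr p)"
    by (simp add: sum_distrib_left mult.assoc)
  also have "(\<Sum>b\<in>\<Psi> j. \<Sum>e\<in>m b. \<beta> e powr p) = (\<Sum>e\<in>\<Psi> k. \<Sum>b\<in>{b\<in>\<Psi> j. I j b \<inter> I k e \<noteq> {}}. \<beta> e powr p)"
    unfolding m_def using finite_\<Psi> by (subst sum.swap_restrict) (auto simp: Int_commute)
  also have "\<dots> = (\<Sum>e\<in>\<Psi> k. real (card {b\<in>\<Psi> j. I j b \<inter> I k e \<noteq> {}}) * \<beta> e powr p)" by simp
  also have "g powr p * r1 powr (p - 1) * \<dots> \<le> g powr p * r1 powr (p - 1) * (\<Sum>e\<in>\<Psi> k. r2 * \<beta> e powr p)"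
    unfolding r2_def by (intro mult_left_mono sum_mono mult_right_mono card_meet) auto
  also have "\<dots> = g powr p * r1 powr (p - 1) * r2 * lpn p (\<Psi> k) (inner_L2 f) powr p"
    using p by (simp add: lpn_powr \<beta>_def sum_distrib_left mult_ac)
  also have "\<dots> \<le> g powr p * r1 powr (p - 1) * r2 * (L * Hn k powr (2 / p - 1)) powr p"
    using f p by (intro mult_left_mono powr_mono2) (auto simp: besov_ball_def r2_def)
  also have "\<dots> = (A0 * N0 * L * decay j k * Hn j powr (2 / p)) powr p"
  proof -
    \<comment> \<open>The ratio of the two level sizes cancels: the minimum in \<open>g\<close>
      compensates the maximum in \<open>r1\<close>, and \<open>r2 = r1 * \<rho>\<close> exchanges
      the size of level \<open>k\<close> for that of level \<open>j\<close>. Only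
      \<open>decay j k\<close> is left.\<close>
    define \<rho> where "\<rho> = (Hn j)\<^sup>2 / (Hn k)\<^sup>2"
    have \<rho>: "0 < \<rho>" "(Hn k)\<^sup>2 / (Hn j)\<^sup>2 = 1 / \<rho>" by (auto simp: \<rho>_def)
    have g_eq: "g = A0 * decay j k * Hn k * min 1 \<rho>" by (simp add: g_def \<rho>_def)
    have r1_eq: "r1 = N0 * max 1 (1 / \<rho>)" by (simp add: r1_def \<rho>)
    have r2_eq: "r2 = r1 * \<rho>" unfolding r1_eq r2_def \<rho>_def[symmetric]
      using \<rho>(1) by (auto simp: max_def field_simps)
    have "min 1 \<rho> * max 1 (1 / \<rho>) = 1" using \<rho>(1) by (auto simp: max_def min_def field_simps)
    then have gr: "g * r1 = A0 * N0 * decay j k * Hn k" by (simp add: g_eq r1_eq mult_ac)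
    have "g powr p * r1 powr (p - 1) * r2 = (g * r1) powr p * \<rho>"
      using r1 g0 by (simp add: r2_eq powr_mult powr_diff)
    then have "g powr p * r1 powr (p - 1) * r2 * (L * Hn k powr (2 / p - 1)) powr p =
        (A0 * N0 * decay j k * Hn k) powr p * \<rho> * (L * Hn k powr (2 / p - 1)) powr p"
      by (simp add: gr)
    also have "\<dots> = (A0 * N0 * decay j k * L) powr p * (Hn k powr p * \<rho> * (Hn k powr (2 / p - 1)) powr p)"
      using L by (simp add: powr_mult)
    also have "Hn k powr p * \<rho> * (Hn k powr (2 / p - 1)) powr p = (Hn j)\<^sup>2"
    proof -
      have e: "Hn k powr p * (Hn k powr (2 / p - 1)) powr p = (Hn k)\<^sup>2"
        using p by (simp add: powr_powr left_diff_distrib flip: powr_add)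
      have "Hn k powr p * \<rho> * (Hn k powr (2 / p - 1)) powr p = (Hn k powr p * (Hn k powr (2 / p - 1)) powr p) * \<rho>"
        by (simp only: mult_ac)
      then show ?thesis unfolding e by (simp add: \<rho>_def)
    qed
    also have "(Hn j)\<^sup>2 = (Hn j powr (2 / p)) powr p" using p by (simp add: powr_powr)
    finally show ?thesis using L by (simp add: powr_mult mult_ac)
  qed
  finally have "(\<Sum>b\<in>\<Psi> j. \<bar>T b\<bar> powr p) \<le> (A0 * N0 * L * decay j k * Hn j powr (2 / p)) powr p" .
  then show ?thesis using p L unfolding T_def[symmetric] by (subst lpn_le_iff) auto
qed

definition Cv :: "real \<Rightarrow> real" where
  "Cv L = (2 + real (card \<Phi>) * C\<^sup>2) * C ^ 3 + 2 * A0 * N0 * L"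

lemma \<Phi>_coef_bound:
  assumes f: "is_density f" and b: "b \<in> \<Phi>"
  shows "\<bar>inner_L2 f b\<bar> \<le> C"
proof -
  have fi: "integrable cubeM f" "AE x in cubeM. 0 \<le> f x" "(\<integral>x. f x \<partial>cubeM) = 1" using f by (auto simp: is_density_def)
  have int: "integrable cubeM (\<lambda>x. f x * b x)" by (rule integrable_mult_cont[OF fi(1) cont_basis(1)[OF b]])
  have "\<bar>inner_L2 f b\<bar> \<le> (\<integral>x. \<bar>f x * b x\<bar> \<partial>cubeM)" unfolding inner_L2_def by (rule integral_abs_bound)
  also have "\<dots> \<le> (\<integral>x. f x * C \<partial>cubeM)"
  proof (rule integral_mono_AE)
    show "AE x in cubeM. \<bar>f x * b x\<bar> \<le> f x * C"
      using fi(2) AE_space by eventually_elim (use \<Phi>_bound[OF b] in \<open>auto simp: abs_mult intro!: mult_left_mono\<close>)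
  qed (use int fi in auto)
  also have "\<dots> = C" using fi by simp
  finally show ?thesis .
qed

lemma vr_nonneg: "is_density f \<Longrightarrow> 0 \<le> vr f b"
  unfolding vr_def inner_L2_def is_density_def by (intro integral_nonneg_AE) auto

lemma lpn_const_level:
  assumes p: "1 \<le> p" and c0: "0 \<le> c0"
  shows "lpn p (\<Psi> j) (\<lambda>b. c0) \<le> c0 * C ^ 3 * Hn j powr (2 / p)"
proof -
  have "lpn p (\<Psi> j) (\<lambda>b. c0) = real (card (\<Psi> j)) powr (1 / p) * c0"
    using c0 p by (simp add: lpn_def powr_mult powr_powr)
  also have "\<dots> \<le> (C ^ 3 * (Hn j)\<^sup>2) powr (1 / p) * c0"
    using c0 p card_\<Psi> by (intro mult_right_mono powr_mono2) auto
  also have "(C ^ 3 * (Hn j)\<^sup>2) powr (1 / p) = (C ^ 3) powr (1 / p) * Hn j powr (2 / p)"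
    by (simp add: powr_mult powr_powr flip: powr_numeral)
  also have "\<dots> * c0 \<le> (C ^ 3) powr 1 * Hn j powr (2 / p) * c0"
    using c0 p C1 by (intro mult_right_mono powr_mono) auto
  finally show ?thesis by (simp add: mult_ac)
qed

text \<open>The squares of the wavelets of level \<open>j\<close> are expanded in the basis, and the
  contribution of each level is controlled by the Besov bound on \<open>f\<close>. The density may
  be unbounded, so no bound for a single \<open>vr f b\<close> by a constant is available. The added
  1 matches the form of the moment bound for empirical means.\<close>

theorem variance_level:
  assumes p: "1 \<le> p" and L: "0 \<le> L" and f: "besov_ball p L 0 f"
  shows "lpn p (\<Psi> j) (\<lambda>b. 1 + vr f b) \<le> Cv L * (real j + 1) * Hn j powr (2 / p)"
proof -
  have fd: "is_density f" using f by (simp add: besov_ball_def)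
  define \<Lambda> where "\<Lambda> = 2 * C\<^sup>2 * (Hn j)\<^sup>2 * 2 ^ j"
  \<comment> \<open>So many levels that the remainder of the expansion is below one.
    \<open>K\<close> depends on \<open>j\<close>, but the sum of the decay factors is bounded
    independently of it.\<close>
  obtain K where K: "2 * \<Lambda> * Cl < 2 ^ K" using real_arch_pow[of 2 "2 * \<Lambda> * Cl"] by auto
  define T where "T = (\<lambda>k b. \<Sum>e\<in>\<Psi> k. \<bar>inner_L2 f e\<bar> * \<bar>inner_L2 (\<lambda>x. (b x)\<^sup>2) e\<bar>)"
  have T0: "0 \<le> T k b" for k b unfolding T_def by (intro sum_nonneg) auto
  define c0 where "c0 = 2 + real (card \<Phi>) * C\<^sup>2"
  have c0: "0 \<le> c0" by (simp add: c0_def)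
  have v: "1 + vr f b \<le> c0 + (\<Sum>k<K. T k b)" if b: "b \<in> \<Psi> j" for b
  proof -
    let ?u = "\<lambda>x. (b x)\<^sup>2"
    have "\<bar>vr f b - ((\<Sum>e\<in>\<Phi>. inner_L2 f e * inner_L2 ?u e) + (\<Sum>k<K. \<Sum>e\<in>\<Psi> k. inner_L2 f e * inner_L2 ?u e))\<bar> \<le> 2 * \<Lambda> * Cl / 2 ^ K"
      unfolding vr_def \<Lambda>_def by (rule inner_expansion[OF fd Lip_on_sq[OF b]])
    also have "\<dots> \<le> 1" using K by simp
    finally have "vr f b \<le> 1 + ((\<Sum>e\<in>\<Phi>. inner_L2 f e * inner_L2 ?u e) + (\<Sum>k<K. \<Sum>e\<in>\<Psi> k. inner_L2 f e * inner_L2 ?u e))" by linarith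
    moreover have "(\<Sum>e\<in>\<Phi>. inner_L2 f e * inner_L2 ?u e) \<le> (\<Sum>e\<in>\<Phi>. C * C)"
    proof (rule sum_mono)
      fix e assume e: "e \<in> \<Phi>"
      have "inner_L2 f e * inner_L2 ?u e \<le> \<bar>inner_L2 f e\<bar> * \<bar>inner_L2 ?u e\<bar>" by (metis abs_ge_self abs_mult)
      also have "\<dots> \<le> C * C"
        using \<Phi>_coef_bound[OF fd e] inner_sq_bound[OF b cont_basis(1)[OF e] \<Phi>_bound[OF e]] by (intro mult_mono) auto
      finally show "inner_L2 f e * inner_L2 ?u e \<le> C * C" .
    qed
    moreover have "(\<Sum>k<K. \<Sum>e\<in>\<Psi> k. inner_L2 f e * inner_L2 ?u e) \<le> (\<Sum>k<K. T k b)"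
      unfolding T_def by (intro sum_mono) (metis abs_ge_self abs_mult)
    ultimately show ?thesis by (simp add: c0_def power2_eq_square)
  qed
  have "lpn p (\<Psi> j) (\<lambda>b. 1 + vr f b) \<le> lpn p (\<Psi> j) (\<lambda>b. c0 + (\<Sum>k<K. T k b))"
  proof (rule lpn_mono)
    fix b assume b: "b \<in> \<Psi> j"
    show "\<bar>1 + vr f b\<bar> \<le> \<bar>c0 + (\<Sum>k<K. T k b)\<bar>" using v[OF b] vr_nonneg[OF fd, of b] by simp
  qed (use p in auto)
  also have "\<dots> \<le> lpn p (\<Psi> j) (\<lambda>b. c0) + lpn p (\<Psi> j) (\<lambda>b. \<Sum>k<K. T k b)"
    by (rule lpn_triangle[OF finite_\<Psi> p])
  also have "\<dots> \<le> c0 * C ^ 3 * Hn j powr (2 / p) + A0 * N0 * L * (real j + 2) * Hn j powr (2 / p)"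
  proof (rule add_mono)
    show "lpn p (\<Psi> j) (\<lambda>b. c0) \<le> c0 * C ^ 3 * Hn j powr (2 / p)"
      by (rule lpn_const_level[OF p c0])
    have "lpn p (\<Psi> j) (\<lambda>b. \<Sum>k<K. T k b) \<le> (\<Sum>k<K. lpn p (\<Psi> j) (T k))"
      by (rule lpn_sum_le[OF finite_\<Psi> p]) simp
    also have "\<dots> \<le> (\<Sum>k<K. A0 * N0 * L * decay j k * Hn j powr (2 / p))"
      unfolding T_def by (intro sum_mono sum_sq_coef_powr p L f)
    also have "\<dots> = A0 * N0 * L * Hn j powr (2 / p) * (\<Sum>k<K. decay j k)"
      by (simp add: sum_distrib_left sum_distrib_right mult_ac)
    also have "\<dots> \<le> A0 * N0 * L * Hn j powr (2 / p) * (real j + 2)"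
      using L by (intro mult_left_mono sum_decay) auto
    finally show "lpn p (\<Psi> j) (\<lambda>b. \<Sum>k<K. T k b) \<le> A0 * N0 * L * (real j + 2) * Hn j powr (2 / p)"
      by (simp add: mult_ac)
  qed
  also have "\<dots> \<le> Cv L * (real j + 1) * Hn j powr (2 / p)"
  proof -
    have "c0 * C ^ 3 * 1 + A0 * N0 * L * (real j + 2) \<le> c0 * C ^ 3 * (real j + 1) + A0 * N0 * L * (2 * (real j + 1))"
      using c0 L by (intro add_mono mult_left_mono) auto
    also have "\<dots> = Cv L * (real j + 1)" by (simp add: Cv_def c0_def algebra_simps)
    finally show ?thesis by (simp flip: distrib_right add: mult_right_mono)
  qed
  finally show ?thesis .
qed

end

section \<open>Transport of a wavelet expansion\<close>

lemma emeasure_Cube [simp]: "emeasure cubeM Cube = 1"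
  using cubeM.emeasure_space_1 by simp

lemma avg_sum:
  assumes "\<And>b. b \<in> A \<Longrightarrow> continuous_on Cube b" "x \<in> Cube"
  shows "avg i (\<lambda>x. \<Sum>b\<in>A. c b * b x) x = (\<Sum>b\<in>A. c b * avg i b x)"
proof -
  have "integrable unitM (\<lambda>t. b (upd x i t))" if "b \<in> A" for b
    using cont_bounded_Cube[OF assms(1)[OF that]] section_integrable(1)[OF borel_measurable_cubeM_cont[OF assms(1)[OF that]] _ assms(2)]
    by metis
  then show ?thesis unfolding avg_def by (subst Bochner_Integration.integral_sum) auto
qed

lemma fib_sum:
  assumes "\<And>b. b \<in> A \<Longrightarrow> continuous_on Cube b" "x \<in> Cube"
  shows "fib i (\<lambda>x. \<Sum>b\<in>A. c b * b x) x = (\<Sum>b\<in>A. c b * fib i b x)"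
proof -
  have int: "integrable unitM (\<lambda>t. indicator {..x $ i} t * b (upd x i t) :: real)" if "b \<in> A" for b
    using cont_bounded_Cube[OF assms(1)[OF that]] section_integrable(2)[OF borel_measurable_cubeM_cont[OF assms(1)[OF that]] _ assms(2)]
    by metis
  have "fib i (\<lambda>x. \<Sum>b\<in>A. c b * b x) x = (\<integral>t. (\<Sum>b\<in>A. c b * (indicator {..x $ i} t * b (upd x i t))) \<partial>unitM)"
    unfolding fib_def by (intro Bochner_Integration.integral_cong) (auto simp: sum_distrib_left mult_ac)
  also have "\<dots> = (\<Sum>b\<in>A. c b * fib i b x)"
    unfolding fib_def using int by (subst Bochner_Integration.integral_sum) auto
  finally show ?thesis .
qed

context wavelet_frame
begin

text \<open>A product function with vanishing mean has a factor with vanishing mean.\<close>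

lemma exists_coord:
  assumes b: "b \<in> \<Psi> j"
  shows "\<exists>i. \<forall>x\<in>Cube. avg i b x = 0"
proof -
  obtain h where h: "\<And>x. x \<in> Cube \<Longrightarrow> b x = (\<Prod>i\<in>UNIV. h i (x $ i))" using tensor[OF b] by blast
  define c where "c = (\<lambda>i. \<integral>t. h i t \<partial>unitM)"
  \<comment> \<open>The univariate factors are arbitrary functions. Averaging \<open>b\<close>
    itself coordinate by coordinate and pulling out constants factorises the integral without any
    measurability of the factors.\<close>
  have "\<exists>g. lipc g \<and> (\<forall>x\<in>Cube. g x = (\<Prod>i\<in>S. c i) * (\<Prod>i\<in>-S. h i (x $ i))) \<and> (\<integral>x. g x \<partial>cubeM) = (\<integral>x. b x \<partial>cubeM)" for S :: "'d set"
    using finite[of S]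
  proof (induction S)
    case empty
    show ?case using h b lip by (intro exI[of _ b]) (auto simp: Compl_eq_Diff_UNIV)
  next
    case (insert l S)
    then obtain g where g: "lipc g" "\<And>x. x \<in> Cube \<Longrightarrow> g x = (\<Prod>i\<in>S. c i) * (\<Prod>i\<in>-S. h i (x $ i))"
      "(\<integral>x. g x \<partial>cubeM) = (\<integral>x. b x \<partial>cubeM)" by blast
    have eq: "avg l g x = (\<Prod>i\<in>insert l S. c i) * (\<Prod>i\<in>-insert l S. h i (x $ i))" if x: "x \<in> Cube" for x
    proof -
      have S: "- S = insert l (- insert l S)" using insert by auto
      have "avg l g x = (\<integral>t. h l t * ((\<Prod>i\<in>S. c i) * (\<Prod>i\<in>-insert l S. h i (x $ i))) \<partial>unitM)"
        unfolding avg_def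
      proof (rule Bochner_Integration.integral_cong)
        fix t assume "t \<in> space unitM"
        then have "g (upd x l t) = (\<Prod>i\<in>S. c i) * (\<Prod>i\<in>-S. h i (upd x l t $ i))"
          using x by (intro g) (auto intro: upd_Cube)
        also have "(\<Prod>i\<in>-S. h i (upd x l t $ i)) = h l t * (\<Prod>i\<in>-insert l S. h i (x $ i))"
          by (subst S, subst prod.insert) (auto intro!: prod.cong)
        finally show "g (upd x l t) = h l t * ((\<Prod>i\<in>S. c i) * (\<Prod>i\<in>-insert l S. h i (x $ i)))" by simp
      qed simp
      also have "\<dots> = c l * ((\<Prod>i\<in>S. c i) * (\<Prod>i\<in>-insert l S. h i (x $ i)))"
        unfolding c_def by (rule integral_mult_left_zero)
      finally show ?thesis using insert by simp
    qed
    show ?case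
      using avg_lipc[OF g(1)] eq integral_avg[OF integrable_cubeM_cont[OF lipc_cont[OF g(1)]]] g(3)
      by (intro exI[of _ "avg l g"]) auto
  qed
  from this[of UNIV] obtain g where
    "lipc g \<and> (\<forall>x\<in>Cube. g x = (\<Prod>i\<in>UNIV. c i) * (\<Prod>i\<in>-UNIV. h i (x $ i))) \<and> (\<integral>x. g x \<partial>cubeM) = (\<integral>x. b x \<partial>cubeM)"
    by blast
  then have g: "\<forall>x\<in>Cube. g x = (\<Prod>i\<in>UNIV. c i)" "(\<integral>x. g x \<partial>cubeM) = (\<integral>x. b x \<partial>cubeM)"
    by simp_all
  have "(\<integral>x. g x \<partial>cubeM) = (\<integral>x. (\<Prod>i\<in>UNIV. c i) \<partial>(cubeM :: (real ^ 'd) measure))"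
    by (rule integral_cubeM_cong) (use g(1) in blast)
  then have "(\<Prod>i\<in>UNIV. c i) = 0" using g(2) mean_zero[OF b] by simp
  then obtain i where i: "c i = 0" by auto
  have "avg i b x = 0" if x: "x \<in> Cube" for x
  proof -
    have "avg i b x = (\<integral>t. h i t * (\<Prod>k\<in>UNIV-{i}. h k (x $ k)) \<partial>unitM)"
      unfolding avg_def
    proof (rule Bochner_Integration.integral_cong)
      fix t assume "t \<in> space unitM"
      then have "b (upd x i t) = (\<Prod>k\<in>UNIV. h k (upd x i t $ k))" using x by (intro h) (auto intro: upd_Cube)
      also have "\<dots> = h i t * (\<Prod>k\<in>UNIV-{i}. h k (x $ k))"
        by (subst prod.remove[of _ i]) (auto intro!: prod.cong)
      finally show "b (upd x i t) = h i t * (\<Prod>k\<in>UNIV-{i}. h k (x $ k))" .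
    qed simp
    also have "\<dots> = c i * (\<Prod>k\<in>UNIV-{i}. h k (x $ k))"
      unfolding c_def by (rule integral_mult_left_zero)
    finally show ?thesis using i by simp
  qed
  then show ?thesis by blast
qed

definition coord :: "(real ^ 'd \<Rightarrow> real) \<Rightarrow> 'd" where
  "coord b = (SOME i. \<forall>x\<in>Cube. avg i b x = 0)"

lemma coord: "b \<in> \<Psi> j \<Longrightarrow> x \<in> Cube \<Longrightarrow> avg (coord b) b x = 0"
  unfolding coord_def using someI_ex[OF exists_coord] by blast

text \<open>A rectangle not containing \<open>x\<close> meets the line through \<open>x\<close> on
  one side of \<open>x\<close> only, so the primitive at \<open>x\<close> is either zero or the full
  integral over the line, which vanishes as well. Thus the flux of a wavelet stays in its
  rectangle.\<close>

lemma fib_outside: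
  assumes b: "b \<in> \<Psi> j" and x: "x \<in> Cube" and xI: "x \<notin> I j b" and a: "avg i b x = 0"
  shows "fib i b x = 0"
proof -
  have between: False if s: "s \<in> {0..1}" "b (upd x i s) \<noteq> 0" "s \<le> x $ i" and t: "t \<in> {0..1}" "b (upd x i t) \<noteq> 0" "x $ i \<le> t" for s t
  proof -
    have "upd x i s \<in> Cube" "upd x i t \<in> Cube" using x s(1) t(1) by (auto intro: upd_Cube)
    then have "upd x i s \<in> I j b" "upd x i t \<in> I j b" using I_supp[OF b] s(2) t(2) by blast+
    moreover have "\<forall>k\<in>Basis. (upd x i s \<bullet> k \<le> x \<bullet> k \<and> x \<bullet> k \<le> upd x i t \<bullet> k) \<or> (upd x i t \<bullet> k \<le> x \<bullet> k \<and> x \<bullet> k \<le> upd x i s \<bullet> k)"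
      using s t by (auto elim!: Basis_cartE simp: inner_axis)
    ultimately have "x \<in> I j b" using I_interval[OF b] unfolding is_interval_def by blast
    then show False using xI by simp
  qed
  show ?thesis
  proof (cases "\<exists>s\<in>{0..1}. b (upd x i s) \<noteq> 0 \<and> s \<le> x $ i")
    case True
    then have *: "b (upd x i t) = 0" if "t \<in> {0..1}" "x $ i \<le> t" for t using between that by blast
    have "fib i b x = avg i b x"
      unfolding fib_def avg_def
    proof (rule Bochner_Integration.integral_cong)
      fix t assume "t \<in> space unitM"
      then show "indicator {..x $ i} t * b (upd x i t) = b (upd x i t)"
        using *[of t] by (cases "t \<le> x $ i") auto
    qed simp
    then show ?thesis using a by simp
  next
    case False
    have "fib i b x = (\<integral>t. 0 \<partial>unitM)"
      unfolding fib_def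
    proof (rule Bochner_Integration.integral_cong)
      fix t assume "t \<in> space unitM"
      then show "indicator {..x $ i} t * b (upd x i t) = 0"
        using False by (cases "t \<le> x $ i") auto
    qed simp
    then show ?thesis by simp
  qed
qed

text \<open>The height of the wavelet is integrated over a stretch of length at most
  \<open>2 * C / 2 ^ j\<close>; this is the gain of one power of the scale.\<close>

lemma fib_inside:
  assumes b: "b \<in> \<Psi> j" and x: "x \<in> Cube" and xI: "x \<in> I j b"
  shows "\<bar>fib i b x\<bar> \<le> 2 * C\<^sup>2 * Hn j / 2 ^ j"
proof -
  define \<rho> where "\<rho> = C / 2 ^ j"
  have \<rho>: "0 \<le> \<rho>" by (simp add: \<rho>_def)
  let ?J = "{x $ i - \<rho>..x $ i + \<rho>}"
  have mJ: "indicator ?J \<in> borel_measurable unitM"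
    by (rule measurable_compose[OF measurable_id_unitM]) simp
  have iJ: "integrable unitM (indicator ?J :: real \<Rightarrow> real)"
    by (rule unitM.integrable_const_bound[of _ 1]) (use mJ in auto)
  have "\<bar>fib i b x\<bar> \<le> (\<integral>t. \<bar>indicator {..x $ i} t * b (upd x i t)\<bar> \<partial>unitM)"
    unfolding fib_def by (rule integral_abs_bound)
  also have "\<dots> \<le> (\<integral>t. C * Hn j * indicator ?J t \<partial>unitM)"
  proof (rule integral_mono)
    show "integrable unitM (\<lambda>t. \<bar>indicator {..x $ i} t * b (upd x i t)\<bar>)"
      using section_integrable(2)[OF meas_basis(2)[OF b] \<Psi>_bound'[OF b] x] by (rule integrable_abs)
    show "integrable unitM (\<lambda>t. C * Hn j * indicator ?J t)" using iJ by (rule integrable_mult_right)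
    fix t assume "t \<in> space unitM"
    then have tC: "upd x i t \<in> Cube" using x by (auto intro: upd_Cube)
    show "\<bar>indicator {..x $ i} t * b (upd x i t)\<bar> \<le> C * Hn j * indicator ?J t"
    proof (cases "b (upd x i t) = 0")
      case False
      then have "norm (upd x i t - x) \<le> \<rho>"
        unfolding \<rho>_def using I_diam[OF b I_supp[OF b tC] xI] by simp
      then have "t \<in> ?J" by (simp add: norm_upd_diff_self abs_le_iff)
      then show ?thesis using \<Psi>_bound'[OF b tC] by (auto simp: indicator_def)
    qed simp
  qed
  also have "\<dots> = C * Hn j * measure unitM (?J \<inter> {0..1})" by simp
  also have "\<dots> \<le> C * Hn j * (2 * \<rho>)"
  proof (intro mult_left_mono)
    have "emeasure unitM (?J \<inter> {0..1}) = emeasure lborel (?J \<inter> {0..1})"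
      by (intro emeasure_restrict_space) auto
    also have "\<dots> \<le> emeasure lborel ?J" by (intro emeasure_mono) auto
    also have "\<dots> = ennreal (2 * \<rho>)" using \<rho> by simp
    finally show "measure unitM (?J \<inter> {0..1}) \<le> 2 * \<rho>" unfolding measure_def using \<rho> by (intro enn2real_leI) auto
  qed auto
  also have "\<dots> = 2 * C\<^sup>2 * Hn j / 2 ^ j" by (simp add: \<rho>_def power2_eq_square)
  finally show ?thesis .
qed

text \<open>The weight of a Besov norm of smoothness -1 and integrability \<open>p\<close>; adding
  the levels up gives the norm with third index 1.\<close>

definition wt :: "real \<Rightarrow> nat \<Rightarrow> real" where
  "wt p j = Hn j powr (1 - 2 / p) / 2 ^ j"

lemma wt_pos [simp]: "0 < wt p j" "0 \<le> wt p j" by (auto simp: wt_def)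

definition W0 :: real where "W0 = 2 * C ^ 3 * (Vc + 1)"

lemma W0_pos [simp]: "0 < W0" "0 \<le> W0" by (auto simp: W0_def intro!: mult_pos_pos add_pos_pos)

text \<open>The wavelets of one level that are centred in the same direction move together: their
  fluxes are supported in rectangles of bounded overlap, so the p-th powers add up to a constant.
  The \<open>\<epsilon>\<close> makes the bound positive even if all coefficients vanish.\<close>

lemma level_piece:
  fixes \<beta> :: "(real ^ 'd \<Rightarrow> real) \<Rightarrow> real"
  assumes p: "1 \<le> p" and \<epsilon>: "0 < \<epsilon>"
  shows "flow_piece p i (\<lambda>x. \<Sum>b\<in>{b\<in>\<Psi> j. coord b = i}. \<beta> b * b x) (W0 * wt p j * lpn p (\<Psi> j) \<beta> + \<epsilon>)"
proof -
  define A where "A = {b\<in>\<Psi> j. coord b = i}"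
  have A: "finite A" "A \<subseteq> \<Psi> j" using finite_\<Psi> by (auto simp: A_def)
  have Ac: "continuous_on Cube b" if "b \<in> A" for b using that A cont_basis by blast
  define v where "v = (\<lambda>x. \<Sum>b\<in>A. \<beta> b * b x)"
  have vc: "continuous_on Cube v" unfolding v_def using Ac by (intro continuous_intros)
  have va: "avg i v x = 0" if "x \<in> Cube" for x
  proof -
    have "avg i v x = (\<Sum>b\<in>A. \<beta> b * avg i b x)" unfolding v_def by (rule avg_sum[OF Ac that])
    also have "\<dots> = 0" using coord[OF _ that] by (intro sum.neutral) (auto simp: A_def)
    finally show ?thesis .
  qed
  define q where "q = 2 * C\<^sup>2 * Hn j / 2 ^ j"
  have q0: "0 < q" unfolding q_def using C1 by (intro divide_pos_pos mult_pos_pos) auto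
  have "\<forall>b\<in>A. \<exists>R. R\<in>sets cubeM \<and> I j b \<subseteq> R \<and> measure cubeM R \<le> Vc / (Hn j)\<^sup>2"
  proof
    fix b assume "b \<in> A"
    then have "b \<in> \<Psi> j" by (simp add: A_def)
    from I_box[OF this] show "\<exists>R. R\<in>sets cubeM \<and> I j b \<subseteq> R \<and> measure cubeM R \<le> Vc / (Hn j)\<^sup>2" by blast
  qed
  then obtain R where R: "\<And>b. b \<in> A \<Longrightarrow> R b \<in> sets cubeM" "\<And>b. b \<in> A \<Longrightarrow> I j b \<subseteq> R b"
    "\<And>b. b \<in> A \<Longrightarrow> measure cubeM (R b) \<le> Vc / (Hn j)\<^sup>2" by metis
  \<comment> \<open>An integrable majorant, with measurable boxes in place of the
    rectangles.\<close>
  define G where "G = (\<lambda>x. C powr (p - 1) * (q powr p * (\<Sum>b\<in>A. \<bar>\<beta> b\<bar> powr p * indicator (R b) x)))"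
  have AE: "AE x in cubeM. \<bar>fib i v x\<bar> powr p \<le> G x"
    using I_overlap[of j] AE_space
  proof eventually_elim
    case (elim x)
    then have x: "x \<in> Cube" by simp
    define S where "S = {b\<in>A. x \<in> I j b}"
    have "card S \<le> card {b\<in>\<Psi> j. x \<in> I j b}" using elim A by (intro card_mono) (auto simp: S_def)
    then have cS: "real (card S) \<le> C" using elim by linarith
    have fS: "finite S" using A by (auto simp: S_def)
    have fo: "fib i b x = 0" if "b \<in> A - S" for b
      using that A coord[of b j x] x by (intro fib_outside[of b j]) (auto simp: S_def A_def)
    have "fib i v x = (\<Sum>b\<in>A. \<beta> b * fib i b x)" unfolding v_def by (rule fib_sum[OF Ac x])
    also have "\<dots> = (\<Sum>b\<in>S. \<beta> b * fib i b x)" using A fo by (intro sum.mono_neutral_right) (auto simp: S_def)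
    finally have "\<bar>fib i v x\<bar> \<le> (\<Sum>b\<in>S. \<bar>\<beta> b\<bar> * \<bar>fib i b x\<bar>)" by (simp add: sum_abs flip: abs_mult)
    then have "\<bar>fib i v x\<bar> powr p \<le> (\<Sum>b\<in>S. \<bar>\<beta> b\<bar> * \<bar>fib i b x\<bar>) powr p" using p by (intro powr_mono2) auto
    also have "\<dots> \<le> C powr (p - 1) * (\<Sum>b\<in>S. (\<bar>\<beta> b\<bar> * \<bar>fib i b x\<bar>) powr p)"
      by (rule sum_powr_le_card[OF fS p _ cS C1]) simp
    also have "\<dots> \<le> C powr (p - 1) * (\<Sum>b\<in>S. q powr p * (\<bar>\<beta> b\<bar> powr p * indicator (R b) x))"
    proof (intro mult_left_mono sum_mono)
      fix b assume b: "b \<in> S"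
      then have "\<bar>fib i b x\<bar> \<le> q" unfolding q_def using A x by (intro fib_inside) (auto simp: S_def)
      then have "(\<bar>\<beta> b\<bar> * \<bar>fib i b x\<bar>) powr p \<le> (\<bar>\<beta> b\<bar> * q) powr p" using p by (intro powr_mono2 mult_left_mono) auto
      also have "\<dots> = q powr p * (\<bar>\<beta> b\<bar> powr p * indicator (R b) x)"
        using b R(2)[of b] q0 by (auto simp: S_def powr_mult)
      finally show "(\<bar>\<beta> b\<bar> * \<bar>fib i b x\<bar>) powr p \<le> q powr p * (\<bar>\<beta> b\<bar> powr p * indicator (R b) x)" .
    qed auto
    also have "\<dots> \<le> C powr (p - 1) * (\<Sum>b\<in>A. q powr p * (\<bar>\<beta> b\<bar> powr p * indicator (R b) x))"
      using A by (intro mult_left_mono sum_mono2) (auto simp: S_def)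
    finally show ?case by (simp add: G_def sum_distrib_left)
  qed
  have Gint: "integrable cubeM G"
    unfolding G_def using R(1) by (intro integrable_mult_right Bochner_Integration.integrable_sum integrable_indicator_cubeM)
  have "(\<integral>\<^sup>+x. ennreal (\<bar>fib i v x\<bar> powr p) \<partial>cubeM) \<le> (\<integral>\<^sup>+x. ennreal (G x) \<partial>cubeM)"
    using AE by (intro nn_integral_mono_AE) (auto intro: ennreal_leI elim!: eventually_mono)
  also have "\<dots> = ennreal (\<integral>x. G x \<partial>cubeM)"
    by (rule nn_integral_eq_integral[OF Gint]) (auto intro!: AE_I2 mult_nonneg_nonneg sum_nonneg simp: G_def)
  also have "(\<integral>x. G x \<partial>cubeM) = C powr (p - 1) * (q powr p * (\<Sum>b\<in>A. \<bar>\<beta> b\<bar> powr p * measure cubeM (R b)))"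
  proof -
    have "(\<integral>x. (\<Sum>b\<in>A. \<bar>\<beta> b\<bar> powr p * indicator (R b) x) \<partial>cubeM) = (\<Sum>b\<in>A. \<integral>x. \<bar>\<beta> b\<bar> powr p * indicator (R b) x \<partial>cubeM)"
      using R(1) by (intro Bochner_Integration.integral_sum integrable_mult_right integrable_indicator_cubeM)
    also have "\<dots> = (\<Sum>b\<in>A. \<bar>\<beta> b\<bar> powr p * measure cubeM (R b))"
    proof (rule sum.cong)
      fix b assume "b \<in> A"
      then show "(\<integral>x. \<bar>\<beta> b\<bar> powr p * indicator (R b) x \<partial>cubeM) = \<bar>\<beta> b\<bar> powr p * measure cubeM (R b)"
        using integral_indicator_cubeM[OF R(1)[of b]] by (simp del: Bochner_Integration.integral_indicator)
    qed simp
    finally show ?thesis by (simp add: G_def)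
  qed
  also have "ennreal \<dots> \<le> ennreal ((W0 * wt p j * lpn p (\<Psi> j) \<beta>) powr p)"
  proof (rule ennreal_leI)
    have "(\<Sum>b\<in>A. \<bar>\<beta> b\<bar> powr p * measure cubeM (R b)) \<le> (\<Sum>b\<in>A. \<bar>\<beta> b\<bar> powr p * (Vc / (Hn j)\<^sup>2))"
      using R(3) by (intro sum_mono mult_left_mono) auto
    also have "\<dots> \<le> (\<Sum>b\<in>\<Psi> j. \<bar>\<beta> b\<bar> powr p * (Vc / (Hn j)\<^sup>2))"
      using A finite_\<Psi> by (intro sum_mono2) auto
    also have "\<dots> = (Vc / (Hn j)\<^sup>2) * lpn p (\<Psi> j) \<beta> powr p"
      using p by (simp add: lpn_powr sum_distrib_left sum_divide_distrib mult.commute)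
    finally have "C powr (p - 1) * (q powr p * (\<Sum>b\<in>A. \<bar>\<beta> b\<bar> powr p * measure cubeM (R b))) \<le>
        C powr (p - 1) * (q powr p * ((Vc / (Hn j)\<^sup>2) * lpn p (\<Psi> j) \<beta> powr p))"
      by (intro mult_left_mono) auto
    also have "\<dots> = (C powr (p - 1) * Vc) * (q powr p * (1 / (Hn j)\<^sup>2 * lpn p (\<Psi> j) \<beta> powr p))" by (simp add: mult_ac)
    \<comment> \<open>The constants are forced into a p-th power. Since \<open>Vc\<close> may be
      below one, \<open>Vc + 1\<close> is used.\<close>
    also have "\<dots> \<le> (C * (Vc + 1)) powr p * (q powr p * (1 / (Hn j)\<^sup>2 * lpn p (\<Psi> j) \<beta> powr p))"
    proof (rule mult_right_mono)
      have "C powr (p - 1) \<le> C powr p" using C1 by (intro powr_mono) auto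
      moreover have "Vc \<le> (Vc + 1) powr p"
      proof -
        have "Vc \<le> (Vc + 1) powr 1" by (simp add: less_imp_le[OF Vc_pos(1)] abs_of_pos add_pos_pos)
        also have "\<dots> \<le> (Vc + 1) powr p" using p Vc_pos by (intro powr_mono) auto
        finally show ?thesis .
      qed
      ultimately show "C powr (p - 1) * Vc \<le> (C * (Vc + 1)) powr p"
        by (simp add: powr_mult mult_mono)
    qed auto
    also have "\<dots> = (W0 * wt p j * lpn p (\<Psi> j) \<beta>) powr p"
    proof -
      have "q powr p * (1 / (Hn j)\<^sup>2) = (2 * C\<^sup>2 * wt p j) powr p"
      proof -
        have e: "(Hn j powr (1 - 2 / p)) powr p = Hn j powr p / (Hn j)\<^sup>2"
        proof -
          have "(1 - 2 / p) * p = p - 2" using p by (simp add: field_simps)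
          then have "(Hn j powr (1 - 2 / p)) powr p = Hn j powr (p - 2)" by (simp only: powr_powr)
          then show ?thesis by (simp only: powr_diff) simp
        qed
        show ?thesis unfolding q_def wt_def by (simp add: powr_mult powr_divide e)
      qed
      then have "(C * (Vc + 1)) powr p * (q powr p * (1 / (Hn j)\<^sup>2 * lpn p (\<Psi> j) \<beta> powr p)) =
          (C * (Vc + 1)) powr p * ((2 * C\<^sup>2 * wt p j) powr p * lpn p (\<Psi> j) \<beta> powr p)"
        by (simp only: mult.assoc[symmetric])
      also have "\<dots> = (C * (Vc + 1) * (2 * C\<^sup>2 * wt p j * lpn p (\<Psi> j) \<beta>)) powr p"
        by (simp only: powr_mult)
      also have "C * (Vc + 1) * (2 * C\<^sup>2 * wt p j * lpn p (\<Psi> j) \<beta>) = W0 * wt p j * lpn p (\<Psi> j) \<beta>"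
        by (simp add: W0_def power2_eq_square power3_eq_cube)
      finally show ?thesis .
    qed
    finally show "C powr (p - 1) * (q powr p * (\<Sum>b\<in>A. \<bar>\<beta> b\<bar> powr p * measure cubeM (R b))) \<le> (W0 * wt p j * lpn p (\<Psi> j) \<beta>) powr p" .
  qed
  also have "\<dots> \<le> ennreal ((W0 * wt p j * lpn p (\<Psi> j) \<beta> + \<epsilon>) powr p)"
    using p \<epsilon> by (intro ennreal_leI powr_mono2) (auto intro!: mult_nonneg_nonneg)
  finally have "(\<integral>\<^sup>+x. ennreal (\<bar>fib i v x\<bar> powr p) \<partial>cubeM) \<le> ennreal ((W0 * wt p j * lpn p (\<Psi> j) \<beta> + \<epsilon>) powr p)" .
  moreover have "0 < W0 * wt p j * lpn p (\<Psi> j) \<beta> + \<epsilon>"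
    using \<epsilon> by (intro add_nonneg_pos mult_nonneg_nonneg) auto
  ultimately have "flow_piece p i v (W0 * wt p j * lpn p (\<Psi> j) \<beta> + \<epsilon>)"
    using vc va by (simp add: flow_piece_def)
  then show ?thesis by (simp add: v_def A_def)
qed

section \<open>One transport step between Lipschitz densities, and its iteration\<close>

definition Nk :: "real \<Rightarrow> ((real ^ 'd \<Rightarrow> real) \<Rightarrow> real) \<Rightarrow> nat \<Rightarrow> real" where
  "Nk p a K = lpn p \<Phi> a + (\<Sum>j<K. wt p j * lpn p (\<Psi> j) a)"

definition W1 :: real where
  "W1 = real CARD('d) * (2 * C * real (card \<Phi>) + W0)"

lemma W1_pos [simp]: "0 < W1" "0 \<le> W1"
  by (auto simp: W1_def intro!: mult_pos_pos add_nonneg_pos mult_nonneg_nonneg add_nonneg_nonneg)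

text \<open>A coupling of cost \<open>A\<close> is improved. The midpoint \<open>h\<close> of
  \<open>f\<close> and \<open>g\<close> is at least \<open>m / 2\<close> although \<open>g\<close>
  may vanish; \<open>coupled_mixture\<close> couples it with \<open>g\<close> at reduced cost, and
  the remaining increment \<open>(f - g) / 2\<close> is moved through the pieces of its wavelet
  expansion.\<close>

lemma coupled_wavelet_step:
  fixes f g :: "real ^ 'd \<Rightarrow> real"
  assumes p: "1 \<le> p" and f: "lipc f" "is_density f" and g: "lipc g" "is_density g"
    and m: "0 < m" "\<And>x. x \<in> Cube \<Longrightarrow> m \<le> f x" and g0: "\<And>x. x \<in> Cube \<Longrightarrow> 0 \<le> g x"
    and Z: "\<And>K. Nk p (inner_L2 (\<lambda>x. f x - g x)) K \<le> Z" and \<eta>: "0 < \<eta>"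
    and cpl: "coupled p (law f) (law g) A" and A: "0 < A"
  shows "coupled p (law f) (law g) (A * 2 powr (- 1 / p) + (3 / 2 * (m / 4) powr (1 - p)) powr (1 / p) * (W1 * Z + \<eta>))"
proof -
  let ?d = "real CARD('d)"
  have d0: "0 < ?d" by simp
  define D where "D = (\<lambda>x. (1 / 2) * (f x - g x))"
  have Dl: "lipc D" unfolding D_def using f g by (intro lipc_cmult lipc_diff)
  define \<beta> where "\<beta> = inner_L2 D"
  have \<beta>: "\<bar>\<beta> b\<bar> \<le> \<bar>inner_L2 (\<lambda>x. f x - g x) b\<bar>" for b
  proof -
    have "\<beta> b = (1 / 2) * inner_L2 (\<lambda>x. f x - g x) b"
      unfolding \<beta>_def D_def inner_L2_def by (subst integral_mult_right_zero[symmetric]) (simp add: mult_ac)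
    then show ?thesis by simp
  qed
  have fgc: "continuous_on Cube f" "continuous_on Cube g" using f g by (auto intro: lipc_cont)
  have intD: "(\<integral>x. D x \<partial>cubeM) = 0"
    using f(2) g(2) by (simp add: D_def is_density_def)
  obtain \<Lambda> where \<Lambda>: "Lip_on \<Lambda> D" using lipcE[OF Dl] unfolding Lip_on_def by metis
  have \<Lambda>0: "0 \<le> \<Lambda>" using \<Lambda> by (simp add: Lip_on_def)
  \<comment> \<open>The expansion is cut where the fluxes of its remainder cost at most
    \<open>\<eta> / 2\<close> in total.\<close>
  obtain K where K: "2 * ?d * (2 * \<Lambda> * Cl) * (2 / \<eta>) < 2 ^ K" using real_arch_pow[of 2] by auto
  define \<delta> where "\<delta> = 2 * \<Lambda> * Cl / 2 ^ K"
  have \<delta>0: "0 \<le> \<delta>" using \<Lambda>0 by (simp add: \<delta>_def)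
  have \<delta>: "2 * ?d * \<delta> \<le> \<eta> / 2" using K \<eta> by (simp add: \<delta>_def field_simps)
  \<comment> \<open>What is not localised: the coarse part from \<Phi> and the remainder of the
    expansion. It has mean zero and a sup norm controlled by the coefficients of \<Phi>, up to
    \<open>\<delta>\<close>, so the coordinatewise decomposition applies.\<close>
  define E where "E = (\<lambda>x. (\<Sum>b\<in>\<Phi>. \<beta> b * b x) + (D x - proj D K x))"
  define M where "M = C * real (card \<Phi>) * lpn p \<Phi> \<beta> + \<delta>"
  have M0: "0 \<le> M" using \<delta>0 by (auto simp: M_def intro!: add_nonneg_nonneg mult_nonneg_nonneg)
  have El: "lipc E" unfolding E_def using lip Dl proj_lipc by (intro lipc_add lipc_sum lipc_cmult lipc_diff) auto
  have EM: "\<bar>E x\<bar> \<le> M" if x: "x \<in> Cube" for x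
  proof -
    have "\<bar>\<Sum>b\<in>\<Phi>. \<beta> b * b x\<bar> \<le> (\<Sum>b\<in>\<Phi>. \<bar>\<beta> b * b x\<bar>)" by (rule sum_abs)
    also have "\<dots> \<le> (\<Sum>b\<in>\<Phi>. lpn p \<Phi> \<beta> * C)"
      unfolding abs_mult using \<Phi>_bound x fin_\<Phi> p by (intro sum_mono mult_mono abs_le_lpn) auto
    also have "\<dots> = C * real (card \<Phi>) * lpn p \<Phi> \<beta>" by simp
    finally show ?thesis using proj_uniform[OF \<Lambda> x, of K] by (simp add: E_def M_def \<delta>_def)
  qed
  have DE: "D x = E x + (\<Sum>j<K. \<Sum>b\<in>\<Psi> j. \<beta> b * b x)" for x
    by (simp add: E_def proj_def \<beta>_def)
  have intE: "(\<integral>x. E x \<partial>cubeM) = 0"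
  proof -
    have bi: "integrable cubeM b" if "b \<in> \<Psi> j" for b j using cont_basis(2)[OF that] by (rule integrable_cubeM_cont)
    have "(\<integral>x. (\<Sum>j<K. \<Sum>b\<in>\<Psi> j. \<beta> b * b x) \<partial>cubeM) = (\<Sum>j<K. \<Sum>b\<in>\<Psi> j. \<beta> b * (\<integral>x. b x \<partial>cubeM))"
      using bi by (subst Bochner_Integration.integral_sum, force)
        (intro sum.cong refl, subst Bochner_Integration.integral_sum, auto)
    also have "\<dots> = 0" using mean_zero by simp
    finally have "(\<integral>x. (\<Sum>j<K. \<Sum>b\<in>\<Psi> j. \<beta> b * b x) \<partial>cubeM) = 0" .
    moreover have "(\<integral>x. D x \<partial>cubeM) = (\<integral>x. E x \<partial>cubeM) + (\<integral>x. (\<Sum>j<K. \<Sum>b\<in>\<Psi> j. \<beta> b * b x) \<partial>cubeM)"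
      unfolding DE using integrable_cubeM_cont[OF lipc_cont[OF El]] bi by (subst Bochner_Integration.integral_add) auto
    ultimately show ?thesis using intD by simp
  qed
  obtain v where v: "\<And>i. lipc (v i)" "\<And>i x. x \<in> Cube \<Longrightarrow> avg i (v i) x = 0"
    "\<And>i x. x \<in> Cube \<Longrightarrow> \<bar>fib i (v i) x\<bar> \<le> 2 * M" "\<And>x. x \<in> Cube \<Longrightarrow> E x = (\<Sum>i\<in>UNIV. v i x)"
    using knothe_decomposition[OF El EM intE] by metis
  \<comment> \<open>The number of pieces: one per direction for \<open>E\<close> and one per
    direction for each of the \<open>K\<close> levels. Each receives an \<open>\<epsilon>\<close>,
    together the other \<open>\<eta> / 2\<close>.\<close>
  define dK where "dK = ?d * (real K + 1)"
  have dK: "0 < dK" by (simp add: dK_def)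
  define \<epsilon> where "\<epsilon> = (\<eta> / 2) / dK"
  have \<epsilon>: "0 < \<epsilon>" using \<eta> dK by (simp add: \<epsilon>_def)
  define Idx where "Idx = (UNIV :: 'd set) <+> ({..<K} \<times> (UNIV :: 'd set))"
  define V where "V = (\<lambda>k. case k of Inl i \<Rightarrow> v i | Inr (j, i) \<Rightarrow> (\<lambda>x. \<Sum>b\<in>{b\<in>\<Psi> j. coord b = i}. \<beta> b * b x))"
  define Ii where "Ii = (\<lambda>k :: 'd + nat \<times> 'd. case k of Inl i \<Rightarrow> i | Inr (j, i) \<Rightarrow> i)"
  define BB where "BB = (\<lambda>k :: 'd + nat \<times> 'd. case k of Inl i \<Rightarrow> 2 * M + \<epsilon> | Inr (j, i) \<Rightarrow> W0 * wt p j * lpn p (\<Psi> j) \<beta> + \<epsilon>)"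
  define h where "h = (\<lambda>x. (f x + g x) / 2)"
  have hc: "continuous_on Cube h" unfolding h_def using fgc by (intro continuous_intros) auto
  have hd: "is_density h"
  proof (rule is_densityI[OF hc])
    show "0 \<le> h x" if "x \<in> Cube" for x using m(2)[OF that] g0[OF that] m(1) by (simp add: h_def)
    show "(\<integral>x. h x \<partial>cubeM) = 1" using f(2) g(2) by (simp add: h_def is_density_def)
  qed
  have cplh: "coupled p (law h) (law g) (A * 2 powr (- 1 / p))"
    unfolding h_def using m g0 A by (intro coupled_mixture f g cpl p) (auto intro: order_trans[of 0 m])
  have "coupled p (law f) (law g) (A * 2 powr (- 1 / p) + (3 / 2 * (m / 4) powr (1 - p)) powr (1 / p) * (\<Sum>k\<in>Idx. BB k))"
  proof (rule coupled_flow_path[where h = h and v = V and i = Ii])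
    show "finite Idx" by (auto simp: Idx_def)
    show "flow_piece p (Ii k) (V k) (BB k)" if "k \<in> Idx" for k
    proof (cases k)
      case (Inl i)
      have "(\<integral>\<^sup>+x. ennreal (\<bar>fib i (v i) x\<bar> powr p) \<partial>cubeM) \<le> (\<integral>\<^sup>+x. ennreal ((2 * M + \<epsilon>) powr p) \<partial>(cubeM :: (real ^ 'd) measure))"
      proof (intro nn_integral_mono ennreal_leI powr_mono2)
        fix x :: "real ^ 'd" assume "x \<in> space cubeM"
        then show "\<bar>fib i (v i) x\<bar> \<le> 2 * M + \<epsilon>" using v(3)[of x i] \<epsilon> by simp
      qed (use p in auto)
      also have "\<dots> = ennreal ((2 * M + \<epsilon>) powr p)" by simp
      finally show ?thesis using Inl v(1)[THEN lipc_cont] v(2) M0 \<epsilon> by (auto simp: flow_piece_def V_def Ii_def BB_def)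
    next
      case (Inr ji)
      obtain j i where "ji = (j, i)" by fastforce
      then show ?thesis using Inr level_piece[OF p \<epsilon>, where i = i and j = j and \<beta> = \<beta>] by (simp add: V_def Ii_def BB_def)
    qed
    show "f x = h x + (\<Sum>k\<in>Idx. V k x)" if x: "x \<in> Cube" for x
    proof -
      have "(\<Sum>k\<in>Idx. V k x) = (\<Sum>i\<in>UNIV. v i x) + (\<Sum>(j, i)\<in>{..<K} \<times> UNIV. \<Sum>b\<in>{b\<in>\<Psi> j. coord b = i}. \<beta> b * b x)"
        unfolding Idx_def by (subst sum.Plus) (auto simp: V_def intro!: arg_cong2[where f="(+)"] sum.cong)
      also have "(\<Sum>(j, i)\<in>{..<K} \<times> UNIV. \<Sum>b\<in>{b\<in>\<Psi> j. coord b = i}. \<beta> b * b x) = (\<Sum>j<K. \<Sum>i\<in>UNIV. \<Sum>b\<in>{b\<in>\<Psi> j. coord b = i}. \<beta> b * b x)"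
        by (simp add: sum.cartesian_product)
      also have "\<dots> = (\<Sum>j<K. \<Sum>b\<in>\<Psi> j. \<beta> b * b x)"
        using finite_\<Psi> by (intro sum.cong refl sum.group) auto
      also have "(\<Sum>i\<in>UNIV. v i x) + \<dots> = D x" using v(4)[OF x] DE[of x] by simp
      finally show ?thesis by (simp add: h_def D_def field_simps)
    qed
    show "2 * (m / 4) \<le> h x" if "x \<in> Cube" for x using m(2)[OF that] g0[OF that] by (simp add: h_def)
    show "2 * (m / 4) \<le> f x" if "x \<in> Cube" for x using m(1) m(2)[OF that] by simp
    show "0 < A * 2 powr (- 1 / p)" using A by simp
  qed (use m p hd hc cplh in auto)
  moreover have "(\<Sum>k\<in>Idx. BB k) \<le> W1 * Z + \<eta>"
  proof -
    have "(\<Sum>k\<in>Idx. BB k) = (\<Sum>i\<in>(UNIV::'d set). 2 * M + \<epsilon>) + (\<Sum>(j, i)\<in>{..<K} \<times> (UNIV::'d set). W0 * wt p j * lpn p (\<Psi> j) \<beta> + \<epsilon>)"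
      unfolding Idx_def by (subst sum.Plus) (auto simp: BB_def intro!: arg_cong2[where f="(+)"] sum.cong)
    also have "(\<Sum>(j, i)\<in>{..<K} \<times> (UNIV::'d set). W0 * wt p j * lpn p (\<Psi> j) \<beta> + \<epsilon>) = (\<Sum>j<K. ?d * (W0 * wt p j * lpn p (\<Psi> j) \<beta> + \<epsilon>))"
      by (simp add: sum.cartesian_product[symmetric])
    also have "\<dots> = ?d * W0 * (\<Sum>j<K. wt p j * lpn p (\<Psi> j) \<beta>) + ?d * real K * \<epsilon>"
      by (simp add: distrib_left sum.distrib sum_distrib_left mult_ac)
    also have "(\<Sum>i\<in>(UNIV::'d set). 2 * M + \<epsilon>) = ?d * (2 * C * real (card \<Phi>)) * lpn p \<Phi> \<beta> + 2 * ?d * \<delta> + ?d * \<epsilon>"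
      by (simp add: M_def algebra_simps)
    finally have eq: "(\<Sum>k\<in>Idx. BB k) = ?d * (2 * C * real (card \<Phi>)) * lpn p \<Phi> \<beta> + ?d * W0 * (\<Sum>j<K. wt p j * lpn p (\<Psi> j) \<beta>)
        + 2 * ?d * \<delta> + ?d * (real K + 1) * \<epsilon>" by (simp add: algebra_simps)
    have "?d * (2 * C * real (card \<Phi>)) * lpn p \<Phi> \<beta> \<le> W1 * lpn p \<Phi> \<beta>"
      by (intro mult_right_mono) (auto simp: W1_def distrib_left)
    moreover have "?d * W0 * (\<Sum>j<K. wt p j * lpn p (\<Psi> j) \<beta>) \<le> W1 * (\<Sum>j<K. wt p j * lpn p (\<Psi> j) \<beta>)"
      by (intro mult_right_mono sum_nonneg) (auto simp: W1_def distrib_left)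
    moreover have "?d * (real K + 1) * \<epsilon> = \<eta> / 2" using dK unfolding \<epsilon>_def dK_def[symmetric] by simp
    ultimately have "(\<Sum>k\<in>Idx. BB k) \<le> W1 * Nk p \<beta> K + \<eta>"
      using \<delta> unfolding eq Nk_def distrib_left by linarith
    moreover have "Nk p \<beta> K \<le> Nk p (inner_L2 (\<lambda>x. f x - g x)) K"
      unfolding Nk_def using \<beta> p by (intro add_mono sum_mono mult_left_mono lpn_mono) auto
    then have "W1 * Nk p \<beta> K \<le> W1 * Z" by (intro mult_left_mono order_trans[OF _ Z[of K]]) auto
    ultimately show ?thesis by linarith
  qed
  then have "A * 2 powr (- 1 / p) + (3 / 2 * (m / 4) powr (1 - p)) powr (1 / p) * (\<Sum>k\<in>Idx. BB k)
      \<le> A * 2 powr (- 1 / p) + (3 / 2 * (m / 4) powr (1 - p)) powr (1 / p) * (W1 * Z + \<eta>)"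
    by (intro add_left_mono mult_left_mono) auto
  moreover have "0 \<le> (\<Sum>k\<in>Idx. BB k)"
    using M0 \<epsilon> by (intro sum_nonneg) (auto simp: BB_def split: sum.splits intro!: add_nonneg_nonneg mult_nonneg_nonneg)
  ultimately show ?thesis
    using coupled_mono[of p "law f" "law g"] A p by (meson add_nonneg_nonneg less_imp_le mult_nonneg_nonneg powr_ge_zero order_trans zero_le_one)
qed

text \<open>The factor of \<open>Z\<close> in the fixed point of the recursion
  \<open>A \<mapsto> A * 2 powr (- 1 / p) + ...\<close> of the transport step.\<close>

definition Cm :: "real \<Rightarrow> real \<Rightarrow> real" where
  "Cm p m = (3 / 2 * (m / 4) powr (1 - p)) powr (1 / p) * W1 / (1 - 2 powr (- 1 / p))"

lemma two_powr_neg_less_1: "1 \<le> p \<Longrightarrow> 2 powr (- 1 / p) < (1 :: real)"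
  using powr_less_mono[of "- 1 / p" 0 2] by simp

lemma Cm_nonneg: "1 \<le> p \<Longrightarrow> 0 \<le> Cm p m"
  unfolding Cm_def using two_powr_neg_less_1[of p] by (intro divide_nonneg_nonneg mult_nonneg_nonneg) auto

text \<open>Starting from the independent coupling, the transport step is iterated; the initial cost
  is forgotten geometrically and the bound approaches the fixed point of the recursion.\<close>

theorem coupled_wavelet_lip:
  fixes f g :: "real ^ 'd \<Rightarrow> real"
  assumes p: "1 \<le> p" and f: "lipc f" "is_density f" and g: "lipc g" "is_density g"
    and m: "0 < m" "\<And>x. x \<in> Cube \<Longrightarrow> m \<le> f x" and g0: "\<And>x. x \<in> Cube \<Longrightarrow> 0 \<le> g x"
    and Z: "\<And>K. Nk p (inner_L2 (\<lambda>x. f x - g x)) K \<le> Z" and \<zeta>: "0 < \<zeta>"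
  shows "coupled p (law f) (law g) (Cm p m * Z + \<zeta>)"
proof -
  define \<theta> :: real where "\<theta> = 2 powr (- 1 / p)"
  have \<theta>: "0 < \<theta>" "\<theta> < 1" using two_powr_neg_less_1[OF p] by (auto simp: \<theta>_def)
  define \<kappa> where "\<kappa> = (3 / 2 * (m / 4) powr (1 - p)) powr (1 / p)"
  have \<kappa>: "0 < \<kappa>" using m by (simp add: \<kappa>_def)
  have Z0: "0 \<le> Z" using Z[of 0] by (auto simp: Nk_def intro: order_trans[OF lpn_nonneg])
  \<comment> \<open>Chosen so that its contribution to the fixed point is
    \<open>\<zeta> / 2\<close>; the other half covers the initial cost.\<close>
  define \<eta> where "\<eta> = \<zeta> * (1 - \<theta>) / (2 * \<kappa>)"
  have \<eta>: "0 < \<eta>" using \<zeta> \<theta> \<kappa> by (simp add: \<eta>_def)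
  define Q where "Q = \<kappa> * (W1 * Z + \<eta>) / (1 - \<theta>)"
  have Q0: "0 < Q" unfolding Q_def using \<kappa> Z0 \<eta> \<theta> by (intro divide_pos_pos mult_pos_pos add_nonneg_pos mult_nonneg_nonneg) auto
  have it: "coupled p (law f) (law g) (real CARD('d) * \<theta> ^ n + Q)" for n
  proof (induction n)
    case 0
    have "coupled p (law f) (law g) (real CARD('d))"
      using f g p by (intro coupled_trivial prob_space_law) auto
    then show ?case using Q0 p by (auto intro: coupled_mono)
  next
    case (Suc n)
    have "coupled p (law f) (law g) ((real CARD('d) * \<theta> ^ n + Q) * 2 powr (- 1 / p) + (3 / 2 * (m / 4) powr (1 - p)) powr (1 / p) * (W1 * Z + \<eta>))"
      using Suc Q0 \<theta> by (intro coupled_wavelet_step p f g m g0 Z \<eta>) (auto intro!: add_nonneg_pos)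
    also have "(real CARD('d) * \<theta> ^ n + Q) * 2 powr (- 1 / p) + (3 / 2 * (m / 4) powr (1 - p)) powr (1 / p) * (W1 * Z + \<eta>) =
        real CARD('d) * \<theta> ^ Suc n + (Q * \<theta> + \<kappa> * (W1 * Z + \<eta>))"
      unfolding \<theta>_def[symmetric] \<kappa>_def[symmetric] by (simp add: algebra_simps)
    also have "Q * \<theta> + \<kappa> * (W1 * Z + \<eta>) = Q"
    proof -
      have "\<kappa> * (W1 * Z + \<eta>) = Q * (1 - \<theta>)" using \<theta> by (simp add: Q_def)
      then show ?thesis by (simp add: algebra_simps)
    qed
    finally show ?case .
  qed
  have "Q = Cm p m * Z + \<zeta> / 2"
    using \<theta> \<kappa> unfolding Q_def Cm_def \<theta>_def[symmetric] \<kappa>_def[symmetric] by (simp add: \<eta>_def field_simps)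
  moreover obtain n where "real CARD('d) * \<theta> ^ n < \<zeta> / 2"
  proof -
    obtain n where "\<theta> ^ n < \<zeta> / 2 / real CARD('d)" using real_arch_pow_inv[of "\<zeta> / 2 / real CARD('d)" \<theta>] \<zeta> \<theta> by auto
    then show ?thesis using that[of n] by (simp add: field_simps)
  qed
  ultimately have "real CARD('d) * \<theta> ^ n + Q \<le> Cm p m * Z + \<zeta>" by simp
  then show ?thesis using it[of n] Q0 \<theta> p by (auto intro!: coupled_mono[OF it[of n]] add_nonneg_nonneg simp: less_imp_le)
qed

end

section \<open>The dual norm\<close>

definition lpb :: "real \<Rightarrow> (real ^ 'd \<Rightarrow> real) \<Rightarrow> real \<Rightarrow> bool" where
  "lpb p h e \<longleftrightarrow> h \<in> borel_measurable cubeM \<and> (\<integral>\<^sup>+x. ennreal (\<bar>h x\<bar> powr p) \<partial>cubeM) \<le> ennreal (e powr p)"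

lemma lpb_mono: "lpb p h e \<Longrightarrow> 0 \<le> e \<Longrightarrow> e \<le> e' \<Longrightarrow> 0 \<le> p \<Longrightarrow> lpb p h e'"
  unfolding lpb_def by (meson ennreal_leI order_trans powr_mono2)

lemma lpb_add:
  assumes h: "lpb p h e" and h': "lpb p h' e'" and e: "0 < e" "0 < e'" and p: "1 \<le> p"
  shows "lpb p (\<lambda>x. h x + h' x) (e + e')"
proof -
  have [measurable]: "h \<in> borel_measurable cubeM" "h' \<in> borel_measurable cubeM" using h h' by (auto simp: lpb_def)
  have "(\<integral>\<^sup>+x. ennreal (\<bar>h x + h' x\<bar> powr p) \<partial>cubeM) \<le> (\<integral>\<^sup>+x. ennreal ((\<bar>h x\<bar> + \<bar>h' x\<bar>) powr p) \<partial>cubeM)"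
    using p by (intro nn_integral_mono ennreal_leI powr_mono2) auto
  also have "\<dots> \<le> ennreal ((e + e') powr p)"
    using h h' e p by (intro nn_integral_minkowski) (auto simp: lpb_def)
  finally show ?thesis by (simp add: lpb_def)
qed

lemma lpb_cmult:
  assumes h: "lpb p h e" and e: "0 \<le> e"
  shows "lpb p (\<lambda>x. c * h x) (\<bar>c\<bar> * e)"
proof -
  have [measurable]: "h \<in> borel_measurable cubeM" using h by (auto simp: lpb_def)
  have "(\<integral>\<^sup>+x. ennreal (\<bar>c * h x\<bar> powr p) \<partial>cubeM) = ennreal (\<bar>c\<bar> powr p) * (\<integral>\<^sup>+x. ennreal (\<bar>h x\<bar> powr p) \<partial>cubeM)"
    by (subst nn_integral_cmult[symmetric]) (auto simp: abs_mult powr_mult ennreal_mult)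
  also have "\<dots> \<le> ennreal (\<bar>c\<bar> powr p) * ennreal (e powr p)"
    using h by (intro mult_left_mono) (auto simp: lpb_def)
  also have "\<dots> = ennreal ((\<bar>c\<bar> * e) powr p)" by (simp add: powr_mult flip: ennreal_mult)
  finally show ?thesis by (simp add: lpb_def)
qed

lemma lpb_integrable:
  assumes "lpb p h e" "1 \<le> p"
  shows "integrable cubeM (\<lambda>x. \<bar>h x\<bar> powr p)" "(\<integral>x. \<bar>h x\<bar> powr p \<partial>cubeM) \<le> e powr p" "integrable cubeM h"
proof -
  have [measurable]: "h \<in> borel_measurable cubeM" using assms by (auto simp: lpb_def)
  have le: "(\<integral>\<^sup>+x. ennreal (\<bar>h x\<bar> powr p) \<partial>cubeM) \<le> ennreal (e powr p)" using assms by (auto simp: lpb_def)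
  then have "(\<integral>\<^sup>+x. ennreal (\<bar>h x\<bar> powr p) \<partial>cubeM) < \<infinity>" by (rule order_le_less_trans) simp
  then show 1: "integrable cubeM (\<lambda>x. \<bar>h x\<bar> powr p)" by (intro integrableI_nonneg) auto
  show "(\<integral>x. \<bar>h x\<bar> powr p \<partial>cubeM) \<le> e powr p"
    using le by (subst (asm) nn_integral_eq_integral[OF 1]) auto
  show "integrable cubeM h"
  proof (rule Bochner_Integration.integrable_bound)
    show "integrable cubeM (\<lambda>x. 1 + \<bar>h x\<bar> powr p)" using 1 by simp
    have "\<bar>h x\<bar> \<le> 1 + \<bar>h x\<bar> powr p" for x
    proof (cases "\<bar>h x\<bar> \<le> 1")
      case False
      then have "\<bar>h x\<bar> powr 1 \<le> \<bar>h x\<bar> powr p" using assms by (intro powr_mono) auto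
      then show ?thesis by simp
    qed (simp add: add_increasing2)
    then show "AE x in cubeM. norm (h x) \<le> norm (1 + \<bar>h x\<bar> powr p)" by (intro AE_I2) (simp add: abs_of_nonneg)
  qed simp
qed

text \<open>Hoelder's inequality up to a factor, from
  \<open>y \<le> y\<^sup>p t\<^sup>1\<^sup>-\<^sup>p + t\<close> for an optimal \<open>t\<close>.\<close>

lemma integral_indicator_powr:
  fixes h :: "real ^ 'd \<Rightarrow> real"
  assumes h: "lpb p h e" and p: "1 \<le> p" and S: "S \<in> sets cubeM"
  shows "(\<integral>x. \<bar>h x\<bar> * indicator S x \<partial>cubeM) powr p \<le> 2 powr p * measure cubeM S powr (p - 1) * (\<integral>x. \<bar>h x\<bar> powr p * indicator S x \<partial>cubeM)"
proof -
  note I = lpb_integrable[OF h p]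
  have iS: "integrable cubeM (indicator S :: real ^ 'd \<Rightarrow> real)"
    using S by (intro integrable_real_indicator) (simp_all add: less_top[symmetric])
  define a where "a = (\<integral>x. \<bar>h x\<bar> powr p * indicator S x \<partial>cubeM)"
  define \<mu> where "\<mu> = measure cubeM S"
  define X where "X = (\<integral>x. \<bar>h x\<bar> * indicator S x \<partial>cubeM)"
  have a0: "0 \<le> a" unfolding a_def by (intro integral_nonneg_AE) auto
  have X0: "0 \<le> X" unfolding X_def by (intro integral_nonneg_AE) auto
  have ia: "integrable cubeM (\<lambda>x. \<bar>h x\<bar> powr p * indicator S x)" "integrable cubeM (\<lambda>x. \<bar>h x\<bar> * indicator S x)"
    using integrable_real_mult_indicator[OF S I(1)] integrable_real_mult_indicator[OF S integrable_abs[OF I(3)]]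
    by (auto simp: mult.commute)
  have bd: "X \<le> t powr (1 - p) * a + t * \<mu>" if t: "0 < t" for t
  proof -
    have y: "\<bar>y\<bar> \<le> t powr (1 - p) * \<bar>y\<bar> powr p + t" for y :: real
    proof (cases "\<bar>y\<bar> \<le> t")
      case False
      have "\<bar>y\<bar> = \<bar>y\<bar> powr (1 - p) * \<bar>y\<bar> powr p" using False t by (simp flip: powr_add)
      also have "\<dots> \<le> t powr (1 - p) * \<bar>y\<bar> powr p"
        using False t p by (intro mult_right_mono powr_mono2') auto
      finally show ?thesis using t by simp
    qed (use t in \<open>simp add: add_increasing\<close>)
    have "X \<le> (\<integral>x. t powr (1 - p) * (\<bar>h x\<bar> powr p * indicator S x) + t * indicator S x \<partial>cubeM)"
      unfolding X_def
    proof (rule integral_mono)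
      show "integrable cubeM (\<lambda>x. t powr (1 - p) * (\<bar>h x\<bar> powr p * indicator S x) + t * indicator S x)"
        by (intro Bochner_Integration.integrable_add integrable_mult_right ia(1) iS)
      show "\<bar>h x\<bar> * indicator S x \<le> t powr (1 - p) * (\<bar>h x\<bar> powr p * indicator S x) + t * indicator S x" for x
        using y[of "h x"] by (simp add: indicator_def)
    qed (rule ia(2))
    also have "\<dots> = t powr (1 - p) * a + t * \<mu>"
    proof -
      have "(\<integral>x. indicator S x \<partial>cubeM) = \<mu>" unfolding \<mu>_def using S by (metis Bochner_Integration.integral_indicator Int_absorb2 sets.sets_into_space)
      then show ?thesis using ia iS by (simp add: a_def del: Bochner_Integration.integral_indicator)
    qed
    finally show ?thesis .
  qed
  show ?thesis
  \<comment> \<open>In the degenerate cases no optimal \<open>t\<close> exists: either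
    \<open>t\<close> is made arbitrarily small, or \<open>S\<close> is a null set.\<close>
  proof (cases "a = 0 \<or> \<mu> = 0")
    case True
    have "X \<le> 0 + \<xi>" if \<xi>: "0 < \<xi>" for \<xi>
    proof (cases "a = 0")
      case True
      have \<mu>0: "0 \<le> \<mu>" by (simp add: \<mu>_def)
      have "\<xi> / (\<mu> + 1) * \<mu> = \<xi> * (\<mu> / (\<mu> + 1))" by simp
      also have "\<dots> \<le> \<xi> * 1" using \<xi> \<mu>0 by (intro mult_left_mono) (auto simp: divide_le_eq_1)
      finally have "\<xi> / (\<mu> + 1) * \<mu> \<le> \<xi>" by simp
      then show ?thesis using bd[of "\<xi> / (\<mu> + 1)"] True \<xi> by (simp add: \<mu>_def add_nonneg_pos)
    next
      case False
      have "AE x in cubeM. \<not> x \<in> S" using True False S unfolding \<mu>_def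
        by (intro AE_not_in) (auto simp: null_sets_def measure_def enn2real_eq_0_iff)
      then have "AE x in cubeM. \<bar>h x\<bar> * indicator S x = 0" by eventually_elim auto
      then have "X = 0" unfolding X_def using integral_nonneg_eq_0_iff_AE[OF ia(2)] by auto
      then show ?thesis using \<xi> by simp
    qed
    then have "X \<le> 0" by (rule field_le_epsilon)
    then have "X = 0" using X0 by simp
    then show ?thesis using a0 by (simp add: X_def[symmetric] a_def[symmetric])
  next
    case False
    then have a: "0 < a" "0 < \<mu>" using a0 by (auto simp: \<mu>_def less_le)
    define t where "t = (a / \<mu>) powr (1 / p)"
    have t: "0 < t" using a by (simp add: t_def)
    have tp: "t powr p = a / \<mu>" using a p by (simp add: t_def powr_powr)
    have "t powr (1 - p) * a = t * \<mu>"
    proof -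
      have "t powr (1 - p) = t / (a / \<mu>)" using t tp by (simp add: powr_diff)
      then show ?thesis using a by simp
    qed
    then have "X \<le> 2 * (t * \<mu>)" using bd[OF t] by linarith
    then have "X powr p \<le> (2 * (t * \<mu>)) powr p" using X0 p by (intro powr_mono2) auto
    also have "\<dots> = 2 powr p * \<mu> powr (p - 1) * a"
      using a t tp by (simp add: powr_mult powr_diff)
    finally show ?thesis by (simp add: X_def a_def \<mu>_def)
  qed
qed

lemma lpb_integral_abs:
  fixes h :: "real ^ 'd \<Rightarrow> real"
  assumes h: "lpb p h e" and p: "1 \<le> p" and e: "0 \<le> e"
  shows "(\<integral>x. \<bar>h x\<bar> \<partial>cubeM) \<le> 2 * e"
proof -
  have C: "Cube \<in> sets (cubeM :: (real ^ 'd) measure)" using sets.top[of "cubeM :: (real ^ 'd) measure"] by simp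
  have eq: "(\<integral>x. g x * indicator Cube x \<partial>cubeM) = (\<integral>x. g x \<partial>cubeM)" for g :: "real ^ 'd \<Rightarrow> real"
    by (rule integral_cubeM_cong) simp
  have "(\<integral>x. \<bar>h x\<bar> \<partial>cubeM) powr p \<le> 2 powr p * (\<integral>x. \<bar>h x\<bar> powr p \<partial>cubeM)"
    using integral_indicator_powr[OF h p C] by (simp add: eq)
  also have "\<dots> \<le> 2 powr p * e powr p" using lpb_integrable(2)[OF h p] by (intro mult_left_mono) auto
  also have "\<dots> = (2 * e) powr p" by (simp add: powr_mult)
  finally have le: "(\<integral>x. \<bar>h x\<bar> \<partial>cubeM) powr p \<le> (2 * e) powr p" .
  show ?thesis
  proof (rule ccontr)
    assume "\<not> ?thesis"
    then have "(2 * e) powr p < (\<integral>x. \<bar>h x\<bar> \<partial>cubeM) powr p" using e p by (intro powr_less_mono2) auto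
    then show False using le by simp
  qed
qed

text \<open>Only the part of the mass in which two densities differ has to be moved.\<close>

lemma coupled_total_variation:
  fixes f f' :: "real ^ 'd \<Rightarrow> real"
  assumes f: "is_density f" and f': "is_density f'" and nn: "\<And>x. x \<in> Cube \<Longrightarrow> 0 \<le> f x" "\<And>x. x \<in> Cube \<Longrightarrow> 0 \<le> f' x"
    and e: "(\<integral>x. \<bar>f x - f' x\<bar> \<partial>cubeM) \<le> e" "0 < e"
    and N: "sets N = sets cubeM" and cpl: "coupled p (law f') N A" and A: "0 < A" and p: "1 \<le> p"
  shows "coupled p (law f) N (A + real CARD('d) * e powr (1 / p))"
proof -
  define a where "a = (\<lambda>x. max 0 (f' x - f x))"
  define b where "b = (\<lambda>x. max 0 (f x - f' x))"
  have fi: "integrable cubeM f" "integrable cubeM f'" "(\<integral>x. f x \<partial>cubeM) = 1" "(\<integral>x. f' x \<partial>cubeM) = 1"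
    using f f' by (auto simp: is_density_def)
  have [measurable]: "f \<in> borel_measurable cubeM" "f' \<in> borel_measurable cubeM" using f f' by (auto simp: is_density_def)
  have am[measurable]: "a \<in> borel_measurable cubeM" unfolding a_def by measurable
  have bm[measurable]: "b \<in> borel_measurable cubeM" unfolding b_def by measurable
  have ab: "0 \<le> a x" "0 \<le> b x" "f' x - a x + b x = f x" "b x - a x = f x - f' x" "b x \<le> \<bar>f x - f' x\<bar>" "a x \<le> \<bar>f x - f' x\<bar>" for x
    by (auto simp: a_def b_def)
  have int: "integrable cubeM (\<lambda>x. \<bar>f x - f' x\<bar>)" using fi by auto
  have ai: "integrable cubeM a" by (rule Bochner_Integration.integrable_bound[OF int am]) (use ab in \<open>auto intro!: AE_I2\<close>)
  have bi: "integrable cubeM b" by (rule Bochner_Integration.integrable_bound[OF int bm]) (use ab in \<open>auto intro!: AE_I2\<close>)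
  define c where "c = (\<integral>x. b x \<partial>cubeM)"
  have "(\<integral>x. b x \<partial>cubeM) - (\<integral>x. a x \<partial>cubeM) = (\<integral>x. b x - a x \<partial>cubeM)" using ai bi by simp
  also have "\<dots> = (\<integral>x. f x - f' x \<partial>cubeM)" by (simp only: ab)
  also have "\<dots> = 0" using fi by simp
  finally have ca: "(\<integral>x. a x \<partial>cubeM) = c" by (simp add: c_def)
  have c0: "0 \<le> c" unfolding c_def using ab by (intro integral_nonneg_AE) auto
  have ce: "c \<le> e"
  proof -
    have "c \<le> (\<integral>x. \<bar>f x - f' x\<bar> \<partial>cubeM)" unfolding c_def using bi int ab by (intro integral_mono) auto
    then show ?thesis using e by simp
  qed
  have B0: "0 < real CARD('d) * e powr (1 / p)" using e by simp
  show ?thesis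
  proof (cases "c = 0")
    case True
    have "AE x in cubeM. a x = 0" "AE x in cubeM. b x = 0"
      using integral_nonneg_eq_0_iff_AE[OF ai] integral_nonneg_eq_0_iff_AE[OF bi] ab ca True by (auto simp: c_def)
    then have "AE x in cubeM. f x = f' x" by eventually_elim (use ab(4) in \<open>metis diff_zero eq_iff_diff_eq_0\<close>)
    then have "law f = law f'" by (intro law_cong) auto
    then show ?thesis using cpl A B0 p by (auto intro: coupled_mono)
  next
    case False
    then have c: "0 < c" using c0 by simp
    have bd: "is_density (\<lambda>x. b x / c)"
      using bi c ab by (auto simp: is_density_def c_def[symmetric])
    define K where "K = law (\<lambda>x. b x / c)"
    have K: "prob_space K" unfolding K_def by (rule prob_space_law[OF bd])
    interpret K: prob_space K by fact
    have [measurable_cong]: "sets K = sets cubeM" by (simp add: K_def)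
    have spK: "space K = Cube" by (simp add: K_def)
    have a_nn: "(\<integral>\<^sup>+x. ennreal (a x) \<partial>cubeM) = ennreal c"
      using nn_integral_eq_integral[OF ai] ab by (simp add: ca)
    \<comment> \<open>The excess \<open>a\<close> of \<open>f'\<close> is sent to a point drawn from
      the normalised deficit \<open>b / c\<close>, independently of where it came from; only the
      diameter of the cube enters.\<close>
    have "coupled p (law (\<lambda>x. f' x - a x + b x)) N (A + real CARD('d) * e powr (1 / p))"
    proof (rule coupled_transport_part[OF f' am bm _ _ _ K, where T = snd])
      show "snd \<in> measurable (cubeM \<Otimes>\<^sub>M K) cubeM" by measurable
      show "a x \<le> f' x" if "x \<in> Cube" for x using nn[OF that] by (auto simp: a_def)
      fix S :: "(real ^ 'd) set" assume S[measurable]: "S \<in> sets cubeM"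
      have "(\<integral>\<^sup>+k. indicator S k \<partial>K) = (\<integral>\<^sup>+x. ennreal (b x / c) * indicator S x \<partial>cubeM)"
        unfolding K_def by (rule nn_integral_law) auto
      then have "(\<integral>\<^sup>+x. ennreal (a x) * (\<integral>\<^sup>+k. indicator S (snd (x, k)) \<partial>K) \<partial>cubeM) =
          (\<integral>\<^sup>+x. ennreal (a x) * (\<integral>\<^sup>+x. ennreal (b x / c) * indicator S x \<partial>cubeM) \<partial>cubeM)" by simp
      also have "\<dots> = ennreal c * (\<integral>\<^sup>+x. ennreal (b x / c) * indicator S x \<partial>cubeM)"
        by (subst nn_integral_multc) (auto simp: a_nn)
      also have "\<dots> = (\<integral>\<^sup>+x. ennreal c * (ennreal (b x / c) * indicator S x) \<partial>cubeM)"
        by (rule nn_integral_cmult[symmetric]) measurable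
      also have "\<dots> = (\<integral>\<^sup>+x. ennreal (b x) * indicator S x \<partial>cubeM)"
        using c ab by (intro nn_integral_cong) (simp add: mult.assoc[symmetric] flip: ennreal_mult)
      finally show "(\<integral>\<^sup>+x. ennreal (a x) * (\<integral>\<^sup>+k. indicator S (snd (x, k)) \<partial>K) \<partial>cubeM) = (\<integral>\<^sup>+x. ennreal (b x) * indicator S x \<partial>cubeM)" .
    next
      have dist: "norm (k - x) \<le> real CARD('d)" if "k \<in> Cube" "x \<in> Cube" for k x :: "real ^ 'd"
      proof -
        have "norm (k - x) \<le> (\<Sum>i\<in>UNIV. \<bar>(k - x) $ i\<bar>)" by (rule norm_le_l1_cart)
        also have "\<dots> \<le> (\<Sum>i\<in>(UNIV::'d set). 1)"
        proof (intro sum_mono)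
          fix i
          have "0 \<le> k $ i" "k $ i \<le> 1" "0 \<le> x $ i" "x $ i \<le> 1" using that by (auto simp: mem_Cube)
          then show "\<bar>(k - x) $ i\<bar> \<le> 1" by (simp add: abs_le_iff)
        qed
        finally show ?thesis by simp
      qed
      have "(\<integral>\<^sup>+x. ennreal (a x) * (\<integral>\<^sup>+k. ennreal (norm (snd (x, k) - x) powr p) \<partial>K) \<partial>cubeM)
          \<le> (\<integral>\<^sup>+x. ennreal (a x) * ennreal (real CARD('d) powr p) \<partial>cubeM)"
      proof (intro nn_integral_mono mult_left_mono)
        fix x :: "real ^ 'd" assume x: "x \<in> space cubeM"
        have "(\<integral>\<^sup>+k. ennreal (norm (snd (x, k) - x) powr p) \<partial>K) \<le> (\<integral>\<^sup>+k. ennreal (real CARD('d) powr p) \<partial>K)"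
          using dist x p by (intro nn_integral_mono ennreal_leI powr_mono2) (auto simp: spK)
        then show "(\<integral>\<^sup>+k. ennreal (norm (snd (x, k) - x) powr p) \<partial>K) \<le> ennreal (real CARD('d) powr p)"
          by (simp add: K.emeasure_space_1)
      qed auto
      also have "\<dots> = ennreal c * ennreal (real CARD('d) powr p)" by (subst nn_integral_multc) (auto simp: a_nn)
      also have "\<dots> \<le> ennreal e * ennreal (real CARD('d) powr p)" using ce by (intro mult_right_mono ennreal_leI) auto
      also have "\<dots> = ennreal ((real CARD('d) * e powr (1 / p)) powr p)"
        using e p by (simp add: powr_mult powr_powr mult.commute flip: ennreal_mult)
      finally show "(\<integral>\<^sup>+x. ennreal (a x) * (\<integral>\<^sup>+k. ennreal (norm (snd (x, k) - x) powr p) \<partial>K) \<partial>cubeM)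
          \<le> ennreal ((real CARD('d) * e powr (1 / p)) powr p)" .
    qed (use ab N cpl A B0 p in auto)
    then show ?thesis by (simp only: ab)
  qed
qed

section \<open>The dual norm, and its bound by the p-norm\<close>

context wavelet_frame
begin

text \<open>The full dual norm, infinite if the series diverges. It takes families of numbers rather
  than a function, since estimated coefficients need not be those of a function; the levels have
  their own argument because thresholding depends on the level.\<close>

definition NN :: "real \<Rightarrow> ((real ^ 'd \<Rightarrow> real) \<Rightarrow> real) \<Rightarrow> (nat \<Rightarrow> (real ^ 'd \<Rightarrow> real) \<Rightarrow> real) \<Rightarrow> ennreal" where
  "NN p a b = ennreal (lpn p \<Phi> a) + (\<Sum>j. ennreal (wt p j * lpn p (\<Psi> j) (b j)))"

lemma NN_cong: "(\<And>x. x \<in> \<Phi> \<Longrightarrow> a x = a' x) \<Longrightarrow> (\<And>j x. x \<in> \<Psi> j \<Longrightarrow> b j x = b' j x) \<Longrightarrow> NN p a b = NN p a' b'"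
  unfolding NN_def by (intro arg_cong2[where f="(+)"] arg_cong[where f=ennreal] arg_cong[where f=suminf] ext lpn_cong)
    (auto intro: lpn_cong)

lemma NN_triangle:
  assumes p: "1 \<le> p"
  shows "NN p (\<lambda>x. a x + a' x) (\<lambda>j x. b j x + b' j x) \<le> NN p a b + NN p a' b'"
proof -
  have 1: "ennreal (lpn p \<Phi> (\<lambda>x. a x + a' x)) \<le> ennreal (lpn p \<Phi> a) + ennreal (lpn p \<Phi> a')"
    using lpn_triangle[OF fin_\<Phi> p, of a a'] by (simp add: ennreal_leI flip: ennreal_plus)
  have "(\<Sum>j. ennreal (wt p j * lpn p (\<Psi> j) (\<lambda>x. b j x + b' j x))) \<le>
      (\<Sum>j. ennreal (wt p j * lpn p (\<Psi> j) (b j)) + ennreal (wt p j * lpn p (\<Psi> j) (b' j)))"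
  proof (rule suminf_le)
    fix j
    have "wt p j * lpn p (\<Psi> j) (\<lambda>x. b j x + b' j x) \<le> wt p j * (lpn p (\<Psi> j) (b j) + lpn p (\<Psi> j) (b' j))"
      by (intro mult_left_mono lpn_triangle finite_\<Psi> p) auto
    then show "ennreal (wt p j * lpn p (\<Psi> j) (\<lambda>x. b j x + b' j x)) \<le> ennreal (wt p j * lpn p (\<Psi> j) (b j)) + ennreal (wt p j * lpn p (\<Psi> j) (b' j))"
      by (simp add: ennreal_leI distrib_left flip: ennreal_plus)
  qed auto
  also have "\<dots> = (\<Sum>j. ennreal (wt p j * lpn p (\<Psi> j) (b j))) + (\<Sum>j. ennreal (wt p j * lpn p (\<Psi> j) (b' j)))"
    by (rule suminf_add[symmetric]) auto
  finally have 2: "(\<Sum>j. ennreal (wt p j * lpn p (\<Psi> j) (\<lambda>x. b j x + b' j x))) \<le> \<dots>" .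
  show ?thesis unfolding NN_def using add_mono[OF 1 2] by (simp only: add_ac)
qed

lemma Nk_le_NN:
  assumes "NN p a (\<lambda>_. a) \<le> ennreal Z" "0 \<le> Z"
  shows "Nk p a K \<le> Z"
proof -
  have "ennreal (Nk p a K) = ennreal (lpn p \<Phi> a) + (\<Sum>j<K. ennreal (wt p j * lpn p (\<Psi> j) a))"
    unfolding Nk_def by (subst ennreal_plus) (auto intro: sum_nonneg simp: sum_ennreal)
  also have "\<dots> \<le> NN p a (\<lambda>_. a)"
    unfolding NN_def by (intro add_left_mono sum_le_suminf) auto
  finally show ?thesis using assms by (metis ennreal_le_iff order_trans)
qed

definition Cn :: real where
  "Cn = real (card \<Phi>) * (2 * C) + 4 * C\<^sup>2 * (Vc + 1)"

lemma Cn_nonneg [simp]: "0 \<le> Cn"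
  by (auto simp: Cn_def intro!: add_nonneg_nonneg mult_nonneg_nonneg)

text \<open>Hoelder's inequality on each support, whose volume is of order
  \<open>1 / (Hn j)\<^sup>2\<close>, and bounded overlap when summing. The powers of
  \<open>Hn j\<close> cancel against the weight except for \<open>1 / 2 ^ j\<close>.\<close>

lemma lpn_level_Lp:
  assumes h: "lpb p h e" and p: "1 \<le> p" and e: "0 \<le> e"
  shows "wt p j * lpn p (\<Psi> j) (inner_L2 h) \<le> 2 * C\<^sup>2 * (Vc + 1) * e / 2 ^ j"
proof -
  note I = lpb_integrable[OF h p]
  have one: "\<bar>inner_L2 h b\<bar> powr p \<le> (2 * C * Hn j) powr p * (Vc / (Hn j)\<^sup>2) powr (p - 1) * (\<integral>x. \<bar>h x\<bar> powr p * indicator (nz b) x \<partial>cubeM)"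
    if b: "b \<in> \<Psi> j" for b
  proof -
    have "\<bar>inner_L2 h b\<bar> \<le> (\<integral>x. \<bar>h x * b x\<bar> \<partial>cubeM)" unfolding inner_L2_def by (rule integral_abs_bound)
    also have "\<dots> \<le> (\<integral>x. C * Hn j * (\<bar>h x\<bar> * indicator (nz b) x) \<partial>cubeM)"
    proof (rule integral_mono)
      show "integrable cubeM (\<lambda>x. \<bar>h x * b x\<bar>)" using integrable_mult_cont[OF I(3) cont_basis(2)[OF b]] by (rule integrable_abs)
      show "integrable cubeM (\<lambda>x. C * Hn j * (\<bar>h x\<bar> * indicator (nz b) x))"
        using integrable_real_mult_indicator[OF nz_sets[OF b] integrable_abs[OF I(3)]] by (intro integrable_mult_right) (simp add: mult.commute)
      fix x :: "real ^ 'd" assume x: "x \<in> space cubeM"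
      show "\<bar>h x * b x\<bar> \<le> C * Hn j * (\<bar>h x\<bar> * indicator (nz b) x)"
        using \<Psi>_bound'[OF b, of x] x mult_right_mono[of "\<bar>b x\<bar>" "C * Hn j" "\<bar>h x\<bar>"] by (auto simp: nz_def abs_mult mult_ac indicator_def)
    qed
    also have "\<dots> = C * Hn j * (\<integral>x. \<bar>h x\<bar> * indicator (nz b) x \<partial>cubeM)" by simp
    finally have "\<bar>inner_L2 h b\<bar> powr p \<le> (C * Hn j * (\<integral>x. \<bar>h x\<bar> * indicator (nz b) x \<partial>cubeM)) powr p"
      using p by (intro powr_mono2) auto
    also have "\<dots> = (C * Hn j) powr p * (\<integral>x. \<bar>h x\<bar> * indicator (nz b) x \<partial>cubeM) powr p" by (rule powr_mult)
    also have "\<dots> \<le> (C * Hn j) powr p * (2 powr p * measure cubeM (nz b) powr (p - 1) * (\<integral>x. \<bar>h x\<bar> powr p * indicator (nz b) x \<partial>cubeM))"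
      by (intro mult_left_mono integral_indicator_powr[OF h p nz_sets[OF b]]) auto
    also have "\<dots> \<le> (C * Hn j) powr p * (2 powr p * (Vc / (Hn j)\<^sup>2) powr (p - 1) * (\<integral>x. \<bar>h x\<bar> powr p * indicator (nz b) x \<partial>cubeM))"
      using p nz_upper[OF b] by (intro mult_left_mono mult_right_mono powr_mono2 integral_nonneg_AE) auto
    finally show ?thesis by (simp add: powr_mult mult_ac)
  qed
  have sum_int: "(\<Sum>b\<in>\<Psi> j. \<integral>x. \<bar>h x\<bar> powr p * indicator (nz b) x \<partial>cubeM) \<le> C * e powr p"
  proof -
    have ii: "integrable cubeM (\<lambda>x. \<bar>h x\<bar> powr p * indicator (nz b) x)" if "b \<in> \<Psi> j" for b
      using integrable_real_mult_indicator[OF nz_sets[OF that] I(1)] by (simp add: mult.commute)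
    have "(\<Sum>b\<in>\<Psi> j. \<integral>x. \<bar>h x\<bar> powr p * indicator (nz b) x \<partial>cubeM) = (\<integral>x. (\<Sum>b\<in>\<Psi> j. \<bar>h x\<bar> powr p * indicator (nz b) x) \<partial>cubeM)"
      using ii by (rule Bochner_Integration.integral_sum[symmetric])
    also have "\<dots> \<le> (\<integral>x. \<bar>h x\<bar> powr p * C \<partial>cubeM)"
    proof (rule integral_mono_AE)
      show "integrable cubeM (\<lambda>x. \<Sum>b\<in>\<Psi> j. \<bar>h x\<bar> powr p * indicator (nz b) x)" using ii by (rule Bochner_Integration.integrable_sum)
      show "integrable cubeM (\<lambda>x. \<bar>h x\<bar> powr p * C)" using I(1) by simp
      show "AE x in cubeM. (\<Sum>b\<in>\<Psi> j. \<bar>h x\<bar> powr p * indicator (nz b) x) \<le> \<bar>h x\<bar> powr p * C"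
        using AE_overlap_sum[OF finite_\<Psi> order_refl, of j]
        by eventually_elim (auto simp: sum_distrib_left[symmetric] intro!: mult_left_mono)
    qed
    also have "\<dots> = C * (\<integral>x. \<bar>h x\<bar> powr p \<partial>cubeM)" by simp
    also have "\<dots> \<le> C * e powr p" using I(2) by (intro mult_left_mono) auto
    finally show ?thesis .
  qed
  have "(\<Sum>b\<in>\<Psi> j. \<bar>inner_L2 h b\<bar> powr p) \<le> (\<Sum>b\<in>\<Psi> j. (2 * C * Hn j) powr p * (Vc / (Hn j)\<^sup>2) powr (p - 1) * (\<integral>x. \<bar>h x\<bar> powr p * indicator (nz b) x \<partial>cubeM))"
    by (intro sum_mono one)
  also have "\<dots> = (2 * C * Hn j) powr p * (Vc / (Hn j)\<^sup>2) powr (p - 1) * (\<Sum>b\<in>\<Psi> j. \<integral>x. \<bar>h x\<bar> powr p * indicator (nz b) x \<partial>cubeM)"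
    by (simp add: sum_distrib_left)
  also have "\<dots> \<le> (2 * C * Hn j) powr p * (Vc / (Hn j)\<^sup>2) powr (p - 1) * (C * e powr p)"
    by (intro mult_left_mono sum_int) auto
  also have "\<dots> \<le> (2 * C * Hn j) powr p * ((Vc + 1) powr p * (Hn j powr (2 / p - 2)) powr p) * (C powr p * e powr p)"
  proof (intro mult_mono)
    have "(Vc / (Hn j)\<^sup>2) powr (p - 1) = Vc powr (p - 1) * ((Hn j)\<^sup>2) powr (1 - p)"
      by (simp add: powr_divide powr_minus_divide[symmetric] divide_powr_uminus)
    also have "((Hn j)\<^sup>2) powr (1 - p) = (Hn j powr (2 / p - 2)) powr p"
      using p by (simp add: powr_powr left_diff_distrib algebra_simps flip: powr_numeral)
    also have "Vc powr (p - 1) \<le> (Vc + 1) powr p"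
    proof -
      have "Vc powr (p - 1) \<le> (Vc + 1) powr (p - 1)" using p by (intro powr_mono2) auto
      also have "\<dots> \<le> (Vc + 1) powr p" using Vc_pos by (intro powr_mono) auto
      finally show ?thesis .
    qed
    finally show "(Vc / (Hn j)\<^sup>2) powr (p - 1) \<le> (Vc + 1) powr p * (Hn j powr (2 / p - 2)) powr p" by (simp add: mult_right_mono)
    have "C powr 1 \<le> C powr p" using C1 p by (intro powr_mono) auto
    then show "C \<le> C powr p" by simp
  qed auto
  also have "\<dots> = (2 * C\<^sup>2 * (Vc + 1) * e * (Hn j * Hn j powr (2 / p - 2))) powr p"
    by (simp only: powr_mult power2_eq_square) (simp only: mult_ac)
  also have "Hn j * Hn j powr (2 / p - 2) = Hn j powr (2 / p - 1)"
  proof -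
    have "Hn j * Hn j powr (2 / p - 2) = Hn j powr 1 * Hn j powr (2 / p - 2)" by simp
    also have "\<dots> = Hn j powr (2 / p - 1)" by (simp only: powr_add[symmetric]) simp
    finally show ?thesis .
  qed
  finally have "lpn p (\<Psi> j) (inner_L2 h) \<le> 2 * C\<^sup>2 * (Vc + 1) * e * Hn j powr (2 / p - 1)"
    using p e by (subst lpn_le_iff) (auto intro!: mult_nonneg_nonneg)
  then have "wt p j * lpn p (\<Psi> j) (inner_L2 h) \<le> wt p j * (2 * C\<^sup>2 * (Vc + 1) * e * Hn j powr (2 / p - 1))"
    by (intro mult_left_mono) auto
  also have "\<dots> = 2 * C\<^sup>2 * (Vc + 1) * e / 2 ^ j * (Hn j powr (1 - 2 / p) * Hn j powr (2 / p - 1))"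
    by (simp add: wt_def)
  also have "Hn j powr (1 - 2 / p) * Hn j powr (2 / p - 1) = 1" by (simp flip: powr_add)
  finally show ?thesis by simp
qed

lemma suminf_geometric_half: "0 \<le> a \<Longrightarrow> (\<Sum>j. ennreal (a / 2 ^ j)) = ennreal (2 * a)"
proof -
  assume a: "0 \<le> a"
  have "(\<lambda>j. a * (1 / 2) ^ j) sums (a * (1 / (1 - 1 / 2)))"
    by (intro sums_mult geometric_sums) simp
  then have "(\<lambda>j. a / 2 ^ j) sums (2 * a)" by (simp add: power_one_over field_simps)
  then show ?thesis using a by (intro sums_unique[symmetric]) (simp add: sums_ennreal)
qed

text \<open>The surplus \<open>1 / 2 ^ j\<close> makes the levels summable. Approximation in the
  p-norm therefore is approximation in the dual norm.\<close>

theorem NN_le_Lp: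
  assumes h: "lpb p h e" and p: "1 \<le> p" and e: "0 \<le> e"
  shows "NN p (inner_L2 h) (\<lambda>_. inner_L2 h) \<le> ennreal (Cn * e)"
proof -
  note I = lpb_integrable[OF h p]
  have c: "\<bar>inner_L2 h b\<bar> \<le> 2 * C * e" if b: "b \<in> \<Phi>" for b
  proof -
    have "\<bar>inner_L2 h b\<bar> \<le> (\<integral>x. \<bar>h x * b x\<bar> \<partial>cubeM)" unfolding inner_L2_def by (rule integral_abs_bound)
    also have "\<dots> \<le> (\<integral>x. C * \<bar>h x\<bar> \<partial>cubeM)"
    proof (rule integral_mono)
      show "integrable cubeM (\<lambda>x. \<bar>h x * b x\<bar>)" using integrable_mult_cont[OF I(3) cont_basis(1)[OF b]] by (rule integrable_abs)
      show "\<bar>h x * b x\<bar> \<le> C * \<bar>h x\<bar>" if "x \<in> space cubeM" for x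
        using \<Phi>_bound[OF b, of x] that mult_right_mono[of "\<bar>b x\<bar>" C "\<bar>h x\<bar>"] by (simp add: abs_mult mult.commute)
    qed (use I in auto)
    also have "\<dots> \<le> C * (2 * e)" using lpb_integral_abs[OF h p e] by (simp add: mult_left_mono)
    finally show ?thesis by simp
  qed
  have "lpn p \<Phi> (inner_L2 h) \<le> real (card \<Phi>) powr (1 / p) * (2 * C * e)"
  proof -
    have "lpn p \<Phi> (inner_L2 h) \<le> lpn p \<Phi> (\<lambda>_. 2 * C * e)" using p c e by (intro lpn_mono) auto
    also have "\<dots> = real (card \<Phi>) powr (1 / p) * (2 * C * e)"
      using p e by (simp add: lpn_def powr_mult powr_powr)
    finally show ?thesis .
  qed
  also have "\<dots> \<le> real (card \<Phi>) * (2 * C * e)"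
  proof (cases "card \<Phi> = 0")
    case False
    then have "real (card \<Phi>) powr (1 / p) \<le> real (card \<Phi>) powr 1" using p by (intro powr_mono) auto
    then show ?thesis using e False by (intro mult_right_mono) auto
  qed simp
  finally have A: "ennreal (lpn p \<Phi> (inner_L2 h)) \<le> ennreal (real (card \<Phi>) * (2 * C * e))" by (rule ennreal_leI)
  have B: "(\<Sum>j. ennreal (wt p j * lpn p (\<Psi> j) (inner_L2 h))) \<le> (\<Sum>j. ennreal (2 * C\<^sup>2 * (Vc + 1) * e / 2 ^ j))"
    by (intro suminf_le ennreal_leI lpn_level_Lp h p e) auto
  have D: "(\<Sum>j. ennreal (2 * C\<^sup>2 * (Vc + 1) * e / 2 ^ j)) = ennreal (2 * (2 * C\<^sup>2 * (Vc + 1) * e))"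
    using e by (intro suminf_geometric_half mult_nonneg_nonneg) auto
  have "NN p (inner_L2 h) (\<lambda>_. inner_L2 h) \<le> ennreal (real (card \<Phi>) * (2 * C * e)) + ennreal (2 * (2 * C\<^sup>2 * (Vc + 1) * e))"
    unfolding NN_def by (rule add_mono[OF A B[unfolded D]])
  also have "\<dots> = ennreal (Cn * e)"
    using e by (subst ennreal_plus[symmetric]) (auto simp: Cn_def algebra_simps intro!: mult_nonneg_nonneg add_nonneg_nonneg)
  finally show ?thesis .
qed

end

section \<open>A countable dense family of densities\<close>

lemma Lnorm2_less:
  assumes h: "h \<in> borel_measurable cubeM" and \<epsilon>: "0 < \<epsilon>" and less: "Lnorm cubeM 2 h < ennreal \<epsilon>"
  shows "(\<integral>\<^sup>+x. ennreal ((h x :: real)\<^sup>2) \<partial>cubeM) \<le> ennreal (\<epsilon>\<^sup>2)"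
proof -
  define J where "J = (\<integral>\<^sup>+x. ennreal ((h x)\<^sup>2) \<partial>cubeM)"
  have eq: "(\<integral>\<^sup>+x. epowr (ennreal (norm (h x))) (enn2real 2) \<partial>cubeM) = J"
    unfolding J_def by (intro nn_integral_cong) (simp add: epowr_ennreal)
  have L: "Lnorm cubeM 2 h = epowr J (1 / 2)" unfolding Lnorm_def eLnorm_def eq by simp
  show ?thesis
  proof (cases J rule: ennreal_cases)
    case (real y)
    then have "sqrt y < \<epsilon>" using less \<epsilon> by (simp add: L epowr_ennreal powr_half_sqrt ennreal_less_iff)
    then have "(sqrt y)\<^sup>2 < \<epsilon>\<^sup>2" using real by (intro power_strict_mono) auto
    then show ?thesis using real by (simp add: J_def[symmetric] ennreal_leI)
  next
    case top
    then show ?thesis using less by (simp add: L epowr_def)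
  qed
qed

lemma bounded_Lspace2:
  assumes h: "h \<in> borel_measurable cubeM" and b: "AE x in cubeM. \<bar>h x :: real\<bar> \<le> M"
  shows "h \<in> Lspace cubeM 2"
proof -
  define J where "J = (\<integral>\<^sup>+x. ennreal ((h x)\<^sup>2) \<partial>cubeM)"
  have eq: "(\<integral>\<^sup>+x. epowr (ennreal (norm (h x))) (enn2real 2) \<partial>cubeM) = J"
    unfolding J_def by (intro nn_integral_cong) (simp add: epowr_ennreal)
  have "J \<le> (\<integral>\<^sup>+x. ennreal (M\<^sup>2) \<partial>(cubeM :: (real ^ 'a) measure))"
    unfolding J_def using b by (intro nn_integral_mono_AE) (auto elim!: eventually_mono intro!: ennreal_leI simp: abs_le_square_iff[symmetric])
  then have "J \<noteq> \<top>" by (auto simp: top_unique)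
  then have "Lnorm cubeM 2 h < \<infinity>" unfolding Lnorm_def eLnorm_def eq by (simp add: epowr_def)
  then show ?thesis using h by (simp add: Lspace_def)
qed

lemma ennreal_affine:
  "0 \<le> a \<Longrightarrow> 0 \<le> c \<Longrightarrow> 0 \<le> y \<Longrightarrow> ennreal a + ennreal c * ennreal y = ennreal (a + c * y)"
  by (simp add: ennreal_mult)

text \<open>Values below \<open>s\<close> are counted as \<open>s powr p\<close>, larger ones as
  \<open>R powr p\<close> with a Chebyshev factor. For bounded functions this converts closeness in
  L2 into closeness in the p-norm, for \<open>p\<close> on either side of 2.\<close>

lemma powr_le_split:
  fixes y :: real
  assumes "0 \<le> y" "y \<le> R" "y \<le> w" "0 < s" "1 \<le> p"
  shows "y powr p \<le> s powr p + R powr p / s\<^sup>2 * w\<^sup>2"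
proof (cases "y \<le> s")
  case True
  then have "y powr p \<le> s powr p" using assms by (intro powr_mono2) auto
  moreover have "0 \<le> R powr p / s\<^sup>2 * w\<^sup>2" by simp
  ultimately show ?thesis by linarith
next
  case False
  then have "s\<^sup>2 \<le> w\<^sup>2" using assms by (intro power_mono) auto
  then have 1: "1 \<le> w\<^sup>2 / s\<^sup>2" using assms by (simp add: field_simps)
  have "y powr p \<le> R powr p * 1" using assms by (simp add: powr_mono2)
  also have "\<dots> \<le> R powr p * (w\<^sup>2 / s\<^sup>2)" using 1 by (intro mult_left_mono) auto
  also have "\<dots> = R powr p / s\<^sup>2 * w\<^sup>2" by simp
  finally show ?thesis by (simp add: add_increasing)
qed

lemma lpb_truncate:
  fixes f :: "real ^ 'd \<Rightarrow> real"
  assumes f: "lpb p f F" "AE x in cubeM. 0 \<le> f x" and p: "1 \<le> p" and e: "0 < e"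
  shows "\<exists>R0. \<forall>R\<ge>R0. lpb p (\<lambda>x. f x - min (f x) (real R)) e"
proof -
  have [measurable]: "f \<in> borel_measurable cubeM" using f by (simp add: lpb_def)
  note I = lpb_integrable[OF f(1) p]
  have "(\<lambda>R. \<integral>x. \<bar>f x - min (f x) (real R)\<bar> powr p \<partial>cubeM) \<longlonglongrightarrow> (\<integral>x. 0 \<partial>(cubeM :: (real ^ 'd) measure))"
  proof (rule integral_dominated_convergence)
    show "integrable cubeM (\<lambda>x. \<bar>f x\<bar> powr p)" by (rule I(1))
    show "AE x in cubeM. (\<lambda>R. \<bar>f x - min (f x) (real R)\<bar> powr p) \<longlonglongrightarrow> 0"
    proof (rule AE_I2)
      fix x
      obtain R0 where R0: "f x \<le> real R0" using real_arch_simple by blast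
      have "\<forall>\<^sub>F R in sequentially. \<bar>f x - min (f x) (real R)\<bar> powr p = 0"
        unfolding eventually_sequentially
      proof (intro exI[of _ R0] allI impI)
        fix R assume "R0 \<le> R"
        then have "f x \<le> real R" using R0 by linarith
        then show "\<bar>f x - min (f x) (real R)\<bar> powr p = 0" by (simp add: min_def)
      qed
      then show "(\<lambda>R. \<bar>f x - min (f x) (real R)\<bar> powr p) \<longlonglongrightarrow> 0" by (rule tendsto_eventually)
    qed
    show "AE x in cubeM. norm (\<bar>f x - min (f x) (real R)\<bar> powr p) \<le> \<bar>f x\<bar> powr p" for R
      using f(2) by eventually_elim (use p in \<open>auto intro!: powr_mono2 simp: min_def\<close>)
  qed auto
  then have "\<forall>\<^sub>F R in sequentially. (\<integral>x. \<bar>f x - min (f x) (real R)\<bar> powr p \<partial>cubeM) < e powr p"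
    using e by (intro order_tendstoD) auto
  then obtain R0 where R0: "\<And>R. R \<ge> R0 \<Longrightarrow> (\<integral>x. \<bar>f x - min (f x) (real R)\<bar> powr p \<partial>cubeM) < e powr p"
    by (auto simp: eventually_sequentially)
  have "lpb p (\<lambda>x. f x - min (f x) (real R)) e" if "R \<ge> R0" for R
  proof -
    have "integrable cubeM (\<lambda>x. \<bar>f x - min (f x) (real R)\<bar> powr p)"
      by (rule Bochner_Integration.integrable_bound[OF I(1)])
        (use f(2) p in \<open>auto intro!: powr_mono2 simp: min_def elim!: eventually_mono\<close>)
    then have "(\<integral>\<^sup>+x. ennreal (\<bar>f x - min (f x) (real R)\<bar> powr p) \<partial>cubeM) = ennreal (\<integral>x. \<bar>f x - min (f x) (real R)\<bar> powr p \<partial>cubeM)"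
      by (rule nn_integral_eq_integral) simp
    also have "\<dots> \<le> ennreal (e powr p)" using R0[OF that] by (intro ennreal_leI) simp
    finally show ?thesis by (simp add: lpb_def)
  qed
  then show ?thesis by blast
qed

context wavelet_frame
begin

definition base :: "(real ^ 'd \<Rightarrow> real) set" where
  "base = \<Phi> \<union> (\<Union>j. \<Psi> j)"

lemma countable_base: "countable base"
  unfolding base_def using fin_\<Phi> finite_\<Psi> by (auto intro: countable_finite)

definition rat_comb :: "((real ^ 'd \<Rightarrow> real) \<times> rat) list \<Rightarrow> real ^ 'd \<Rightarrow> real" where
  "rat_comb xs x = (\<Sum>(b, c)\<leftarrow>xs. real_of_rat c * b x)"

text \<open>The lower clamp ensures \<open>q\<close> as a lower bound; the upper one keeps the
  approximation bounded, so that the L2 density of the basis can be used for every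
  \<open>p\<close>.\<close>

definition clamped :: "real \<Rightarrow> ((real ^ 'd \<Rightarrow> real) \<times> rat) list \<Rightarrow> nat \<Rightarrow> real ^ 'd \<Rightarrow> real" where
  "clamped q xs R x = max q (min (rat_comb xs x) (real R))"

definition normalised :: "(real ^ 'd \<Rightarrow> real) \<Rightarrow> real ^ 'd \<Rightarrow> real" where
  "normalised v x = v x / (\<integral>y. v y \<partial>cubeM)"

text \<open>Rational coefficients and integer cut-offs keep the family countable, hence the
  selection measurable. The estimator uses \<open>q = 0\<close>; \<open>q = m\<close> serves to
  approximate the unknown density by Lipschitz densities bounded below.\<close>

definition candidates :: "real \<Rightarrow> (real ^ 'd \<Rightarrow> real) set" where
  "candidates q = (\<lambda>(xs, R). normalised (clamped q xs R)) `
     {(xs, R). xs \<in> lists (base \<times> UNIV) \<and> 0 < (\<integral>y. clamped q xs R y \<partial>cubeM)}"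

lemma countable_candidates: "countable (candidates q)"
proof -
  have "countable (lists (base \<times> (UNIV :: rat set)) \<times> (UNIV :: nat set))"
    using countable_base by (intro countable_SIGMA countable_lists) auto
  then show ?thesis unfolding candidates_def
    by (intro countable_image) (auto elim!: countable_subset[rotated])
qed

lemma rat_comb_lipc: "xs \<in> lists (base \<times> UNIV) \<Longrightarrow> lipc (rat_comb xs)"
proof (induction xs)
  case Nil
  then show ?case by (simp add: rat_comb_def[abs_def])
next
  case (Cons a xs)
  obtain b c where a: "a = (b, c)" "b \<in> base" using Cons by (cases a) auto
  have "lipc (\<lambda>x. real_of_rat c * b x + rat_comb xs x)"
    using Cons a lip by (intro lipc_add lipc_cmult) (auto simp: base_def)
  then show ?case using a by (simp add: rat_comb_def[abs_def])
qed

lemma clamped_lipc: "xs \<in> lists (base \<times> UNIV) \<Longrightarrow> lipc (clamped q xs R)"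
  unfolding clamped_def[abs_def] by (intro lipc_max_const lipc_min_const rat_comb_lipc)

lemma candidates_props:
  assumes "g \<in> candidates q" "0 \<le> q"
  shows "lipc g" "is_density g" "\<And>x. x \<in> Cube \<Longrightarrow> 0 \<le> g x"
proof -
  obtain xs R where g: "g = normalised (clamped q xs R)" "xs \<in> lists (base \<times> UNIV)" "0 < (\<integral>y. clamped q xs R y \<partial>cubeM)"
    using assms by (auto simp: candidates_def)
  have eq: "g = (\<lambda>x. (1 / (\<integral>y. clamped q xs R y \<partial>cubeM)) * clamped q xs R x)"
    by (simp add: g normalised_def fun_eq_iff)
  show l: "lipc g" unfolding eq using g by (intro lipc_cmult clamped_lipc)
  show nn: "0 \<le> g x" for x
    unfolding eq using g(3) assms(2) by (intro mult_nonneg_nonneg) (auto simp: clamped_def)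
  show "is_density g"
  proof (rule is_densityI[OF lipc_cont[OF l]])
    show "(\<integral>x. g x \<partial>cubeM) = 1" unfolding eq using g(3) by simp
  qed (rule nn)
qed

lemma approx_rat_comb:
  assumes u: "u \<in> lin_span base" and \<epsilon>: "0 < \<epsilon>"
  shows "\<exists>xs\<in>lists (base \<times> UNIV). \<forall>x\<in>Cube. \<bar>u x - rat_comb xs x\<bar> \<le> \<epsilon>"
proof -
  obtain F c where F: "finite F" "F \<subseteq> base" "u = (\<lambda>x. \<Sum>b\<in>F. c b * b x)" using u by (auto simp: lin_span_def)
  have "\<forall>b\<in>F. \<exists>K>0. \<forall>x\<in>Cube. \<bar>b x\<bar> \<le> K"
  proof
    fix b assume "b \<in> F"
    then have "continuous_on Cube b" using F lip lipc_cont by (auto simp: base_def)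
    then show "\<exists>K>0. \<forall>x\<in>Cube. \<bar>b x\<bar> \<le> K" using cont_bounded_Cube by metis
  qed
  then obtain K where K: "\<And>b. b \<in> F \<Longrightarrow> 0 < K b" "\<And>b x. b \<in> F \<Longrightarrow> x \<in> Cube \<Longrightarrow> \<bar>b x\<bar> \<le> K b" by metis
  define S where "S = (\<Sum>b\<in>F. K b) + 1"
  have S: "0 < S" unfolding S_def using K by (intro add_nonneg_pos sum_nonneg) (auto intro: less_imp_le)
  have "\<exists>r. \<bar>c b - real_of_rat r\<bar> \<le> \<epsilon> / S" for b
  proof -
    have "0 < \<epsilon> / S" using \<epsilon> S by simp
    then obtain r where "c b - \<epsilon> / S < real_of_rat r" "real_of_rat r < c b"
      using of_rat_dense[of "c b - \<epsilon> / S" "c b"] by auto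
    then show ?thesis by (intro exI[of _ r]) auto
  qed
  then obtain r where r: "\<And>b. \<bar>c b - real_of_rat (r b)\<bar> \<le> \<epsilon> / S" by metis
  obtain bs where bs: "set bs = F" "distinct bs" using F(1) finite_distinct_list by blast
  define xs where "xs = map (\<lambda>b. (b, r b)) bs"
  have "xs \<in> lists (base \<times> UNIV)" using bs F by (auto simp: xs_def)
  moreover have "\<bar>u x - rat_comb xs x\<bar> \<le> \<epsilon>" if x: "x \<in> Cube" for x
  proof -
    have "rat_comb xs x = (\<Sum>b\<leftarrow>bs. real_of_rat (r b) * b x)" by (simp add: rat_comb_def xs_def comp_def)
    also have "\<dots> = (\<Sum>b\<in>F. real_of_rat (r b) * b x)" using bs by (simp add: sum_list_distinct_conv_sum_set)
    finally have "u x - rat_comb xs x = (\<Sum>b\<in>F. (c b - real_of_rat (r b)) * b x)" by (simp add: F(3) sum_subtractf left_diff_distrib)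
    also have "\<bar>\<dots>\<bar> \<le> (\<Sum>b\<in>F. \<bar>(c b - real_of_rat (r b)) * b x\<bar>)" by (rule sum_abs)
    also have "\<dots> \<le> (\<Sum>b\<in>F. \<epsilon> / S * K b)"
      unfolding abs_mult using r K x \<epsilon> S by (intro sum_mono mult_mono) auto
    also have "\<dots> = \<epsilon> * ((\<Sum>b\<in>F. K b) / S)" by (simp add: sum_distrib_left sum_divide_distrib)
    also have "\<dots> \<le> \<epsilon> * 1" using \<epsilon> S by (intro mult_left_mono) (auto simp: S_def)
    finally show ?thesis by simp
  qed
  ultimately show ?thesis by blast
qed

text \<open>The truncation of \<open>f\<close> is approximated in L2 by the span and then with
  rational coefficients. Clamping is a contraction fixing the truncation, whose values lie between
  \<open>q\<close> and \<open>R\<close>, so it does not increase the error.\<close>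

lemma approx_clamped:
  assumes f: "lpb p f F" "AE x in cubeM. q \<le> f x" "0 \<le> q" and p: "1 \<le> p" and e: "0 < e"
  shows "\<exists>xs\<in>lists (base \<times> UNIV). \<exists>R. lpb p (\<lambda>x. f x - clamped q xs R x) e"
proof -
  have [measurable]: "f \<in> borel_measurable cubeM" using f by (simp add: lpb_def)
  have f0: "AE x in cubeM. 0 \<le> f x" using f(2) by eventually_elim (use f(3) in auto)
  obtain R0 where R0: "\<And>R. R \<ge> R0 \<Longrightarrow> lpb p (\<lambda>x. f x - min (f x) (real R)) (e / 2)"
    using lpb_truncate[OF f(1) f0 p, of "e / 2"] e by auto
  obtain R1 where R1: "max 1 q \<le> real R1" using real_arch_simple by blast
  define R where "R = max R0 R1"
  have R: "R0 \<le> R" "1 \<le> real R" "q \<le> real R" using R1 by (auto simp: R_def)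
  define t where "t = (\<lambda>x. min (f x) (real R))"
  have tm[measurable]: "t \<in> borel_measurable cubeM" unfolding t_def by measurable
  have t: "AE x in cubeM. q \<le> t x \<and> t x \<le> real R" using f(2) by eventually_elim (use R in \<open>auto simp: t_def\<close>)
  then have tb: "AE x in cubeM. \<bar>t x\<bar> \<le> real R" by eventually_elim (use f(3) in auto)
  define A where "A = (e / 2) powr p / 2"
  have A: "0 < A" using e by (simp add: A_def)
  define s where "s = A powr (1 / p)"
  have s: "0 < s" "s powr p = A" using A p by (auto simp: s_def powr_powr)
  \<comment> \<open>With this choice the two terms of \<open>powr_le_split\<close> equal
    \<open>A\<close>, half of \<open>(e / 2) powr p\<close>, each; the factor 4 accounts for the L2
    error and the rounding of the coefficients.\<close>
  define \<epsilon> where "\<epsilon> = sqrt (A * s\<^sup>2 / (4 * real R powr p))"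
  have Rp: "0 < real R powr p" using R by simp
  have \<epsilon>: "0 < \<epsilon>" "\<epsilon>\<^sup>2 = A * s\<^sup>2 / (4 * real R powr p)" using A s(1) Rp by (auto simp: \<epsilon>_def)
  obtain u where u: "u \<in> lin_span base" "Lnorm cubeM 2 (\<lambda>x. t x - u x) < ennreal \<epsilon>"
    using dense[OF bounded_Lspace2[OF tm tb] \<epsilon>(1)] by (auto simp: base_def)
  have [measurable]: "u \<in> borel_measurable cubeM"
  proof -
    obtain F c where F: "finite F" "F \<subseteq> base" "u = (\<lambda>x. \<Sum>b\<in>F. c b * b x)" using u by (auto simp: lin_span_def)
    have "continuous_on Cube u" unfolding F(3) using F(2) lip lipc_cont by (intro continuous_intros) (auto simp: base_def)
    then show ?thesis by (rule borel_measurable_cubeM_cont)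
  qed
  obtain xs where xs: "xs \<in> lists (base \<times> UNIV)" "\<And>x. x \<in> Cube \<Longrightarrow> \<bar>u x - rat_comb xs x\<bar> \<le> \<epsilon>"
    using approx_rat_comb[OF u(1) \<epsilon>(1)] by blast
  have [measurable]: "rat_comb xs \<in> borel_measurable cubeM" "clamped q xs R \<in> borel_measurable cubeM"
    by (rule borel_measurable_cubeM_cont[OF lipc_cont[OF rat_comb_lipc[OF xs(1)]]],
        rule borel_measurable_cubeM_cont[OF lipc_cont[OF clamped_lipc[OF xs(1)]]])
  have w: "(\<integral>\<^sup>+x. ennreal ((t x - rat_comb xs x)\<^sup>2) \<partial>cubeM) \<le> ennreal (4 * \<epsilon>\<^sup>2)"
  proof -
    have "(\<integral>\<^sup>+x. ennreal ((t x - rat_comb xs x)\<^sup>2) \<partial>cubeM) \<le> (\<integral>\<^sup>+x. ennreal 2 * ennreal ((t x - u x)\<^sup>2) + ennreal (2 * \<epsilon>\<^sup>2) \<partial>cubeM)"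
    proof (rule nn_integral_mono)
      fix x :: "real ^ 'd" assume "x \<in> space cubeM"
      then have "(u x - rat_comb xs x)\<^sup>2 \<le> \<epsilon>\<^sup>2" using xs(2)[of x] \<epsilon>(1) by (simp add: abs_le_square_iff[symmetric])
      moreover have "(t x - rat_comb xs x)\<^sup>2 \<le> 2 * (t x - u x)\<^sup>2 + 2 * (u x - rat_comb xs x)\<^sup>2"
        using sum_squares_bound[of "t x - u x" "u x - rat_comb xs x"]
        by (simp add: power2_eq_square algebra_simps)
      ultimately have "(t x - rat_comb xs x)\<^sup>2 \<le> 2 * (t x - u x)\<^sup>2 + 2 * \<epsilon>\<^sup>2" by linarith
      then have "ennreal ((t x - rat_comb xs x)\<^sup>2) \<le> ennreal (2 * (t x - u x)\<^sup>2 + 2 * \<epsilon>\<^sup>2)" by (rule ennreal_leI)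
      also have "\<dots> = ennreal 2 * ennreal ((t x - u x)\<^sup>2) + ennreal (2 * \<epsilon>\<^sup>2)" by (simp add: ennreal_mult)
      finally show "ennreal ((t x - rat_comb xs x)\<^sup>2) \<le> ennreal 2 * ennreal ((t x - u x)\<^sup>2) + ennreal (2 * \<epsilon>\<^sup>2)" .
    qed
    also have "\<dots> = ennreal 2 * (\<integral>\<^sup>+x. ennreal ((t x - u x)\<^sup>2) \<partial>cubeM) + ennreal (2 * \<epsilon>\<^sup>2)"
      by (subst nn_integral_add, simp, simp, subst nn_integral_cmult) auto
    also have "\<dots> \<le> ennreal 2 * ennreal (\<epsilon>\<^sup>2) + ennreal (2 * \<epsilon>\<^sup>2)"
      using u(2) \<epsilon>(1) by (intro add_right_mono mult_left_mono Lnorm2_less) auto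
    also have "\<dots> = ennreal (2 * \<epsilon>\<^sup>2) + ennreal (2 * \<epsilon>\<^sup>2)" by (subst ennreal_mult[symmetric]) auto
    also have "\<dots> = ennreal (4 * \<epsilon>\<^sup>2)" by (subst ennreal_plus[symmetric]) auto
    finally show ?thesis .
  qed
  have "lpb p (\<lambda>x. t x - clamped q xs R x) (e / 2)"
    unfolding lpb_def
  proof (intro conjI)
    have "(\<integral>\<^sup>+x. ennreal (\<bar>t x - clamped q xs R x\<bar> powr p) \<partial>cubeM) \<le>
        (\<integral>\<^sup>+x. ennreal (s powr p) + ennreal (real R powr p / s\<^sup>2) * ennreal ((t x - rat_comb xs x)\<^sup>2) \<partial>cubeM)"
    proof (rule nn_integral_mono_AE)
      show "AE x in cubeM. ennreal (\<bar>t x - clamped q xs R x\<bar> powr p) \<le> ennreal (s powr p) + ennreal (real R powr p / s\<^sup>2) * ennreal ((t x - rat_comb xs x)\<^sup>2)"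
        using t
      proof eventually_elim
        case (elim x)
        have "\<bar>t x - clamped q xs R x\<bar> \<le> real R" "\<bar>t x - clamped q xs R x\<bar> \<le> \<bar>t x - rat_comb xs x\<bar>"
          using elim f(3) R(3) by (auto simp: clamped_def max_def min_def abs_if)
        then have "\<bar>t x - clamped q xs R x\<bar> powr p \<le> s powr p + real R powr p / s\<^sup>2 * \<bar>t x - rat_comb xs x\<bar>\<^sup>2"
          using s p by (intro powr_le_split) auto
        then have "ennreal (\<bar>t x - clamped q xs R x\<bar> powr p) \<le> ennreal (s powr p + real R powr p / s\<^sup>2 * (t x - rat_comb xs x)\<^sup>2)"
          by (intro ennreal_leI) simp
        then show ?case by (subst ennreal_affine) auto
      qed
    qed
    also have "\<dots> = ennreal (s powr p) + ennreal (real R powr p / s\<^sup>2) * (\<integral>\<^sup>+x. ennreal ((t x - rat_comb xs x)\<^sup>2) \<partial>cubeM)"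
      by (subst nn_integral_add, simp, simp, subst nn_integral_cmult) auto
    also have "\<dots> \<le> ennreal (s powr p) + ennreal (real R powr p / s\<^sup>2) * ennreal (4 * \<epsilon>\<^sup>2)"
      by (intro add_left_mono mult_left_mono w) auto
    also have "\<dots> = ennreal (s powr p + real R powr p / s\<^sup>2 * (4 * \<epsilon>\<^sup>2))"
      by (rule ennreal_affine) auto
    also have "s powr p + real R powr p / s\<^sup>2 * (4 * \<epsilon>\<^sup>2) = (e / 2) powr p"
    proof -
      have "real R powr p / s\<^sup>2 * (4 * \<epsilon>\<^sup>2) = A" using Rp s(1) by (simp add: \<epsilon>(2))
      then show ?thesis using s(2) by (simp add: A_def)
    qed
    finally show "(\<integral>\<^sup>+x. ennreal (\<bar>t x - clamped q xs R x\<bar> powr p) \<partial>cubeM) \<le> ennreal ((e / 2) powr p)" .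
  qed measurable
  then have "lpb p (\<lambda>x. (f x - min (f x) (real R)) + (t x - clamped q xs R x)) (e / 2 + e / 2)"
    using R0[OF R(1)] e p by (intro lpb_add) auto
  then show ?thesis using xs(1) by (auto simp: t_def)
qed

text \<open>Approximation in the p-norm moves the integral by at most \<open>2 * \<eta>\<close>, so
  normalising changes the function little; the integral is at most 2, which leaves half of the lower
  bound.\<close>

theorem candidates_dense:
  assumes f: "is_density f" "lpb p f F" "AE x in cubeM. q \<le> f x" "0 \<le> q" and F: "0 \<le> F"
    and p: "1 \<le> p" and e: "0 < e"
  shows "\<exists>g\<in>candidates q. lpb p (\<lambda>x. f x - g x) e \<and> (\<forall>x\<in>Cube. q / 2 \<le> g x)"
proof -
  define F' where "F' = max 1 F"
  have fF: "lpb p f F'" by (rule lpb_mono[OF f(2)]) (use F p in \<open>auto simp: F'_def\<close>)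
  have F0: "1 \<le> F'" by (simp add: F'_def)
  \<comment> \<open>The total error \<open>\<eta> + 4 * \<eta> * (F' + 1)\<close> of approximating
    and normalising must be at most \<open>e\<close>, and the integral must stay between
    \<open>1 / 2\<close> and 2.\<close>
  define \<eta> where "\<eta> = min (1 / 4) (e / (4 * F' + 5))"
  have "4 * F' + 5 > 0" using F0 by simp
  moreover have "\<eta> \<le> e / (4 * F' + 5)" by (simp add: \<eta>_def)
  ultimately have "\<eta> * (4 * F' + 5) \<le> e" by (simp only: pos_le_divide_eq)
  moreover have "0 < \<eta>" using e \<open>4 * F' + 5 > 0\<close> by (simp add: \<eta>_def)
  moreover have "\<eta> \<le> 1 / 4" unfolding \<eta>_def by (rule min.cobounded1)
  ultimately have \<eta>: "0 < \<eta>" "\<eta> \<le> 1 / 4" "\<eta> * (4 * F' + 5) \<le> e" by blast+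
  obtain xs R where v: "xs \<in> lists (base \<times> UNIV)" "lpb p (\<lambda>x. f x - clamped q xs R x) \<eta>"
    using approx_clamped[OF f(2,3,4) p \<eta>(1)] by blast
  define v where "v = clamped q xs R"
  have vl: "lipc v" unfolding v_def by (rule clamped_lipc[OF v(1)])
  note vi = integrable_cubeM_cont[OF lipc_cont[OF vl]]
  have fi: "integrable cubeM f" "(\<integral>x. f x \<partial>cubeM) = 1" using f(1) by (auto simp: is_density_def)
  define a where "a = (\<integral>x. v x \<partial>cubeM)"
  have a1: "\<bar>1 - a\<bar> \<le> 2 * \<eta>"
  proof -
    have "1 - a = (\<integral>x. f x - v x \<partial>cubeM)" using fi vi by (simp add: a_def)
    also have "\<bar>\<dots>\<bar> \<le> (\<integral>x. \<bar>f x - v x\<bar> \<partial>cubeM)" by (rule integral_abs_bound)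
    also have "\<dots> \<le> 2 * \<eta>" using v(2) \<eta> p by (intro lpb_integral_abs) (auto simp: v_def)
    finally show ?thesis .
  qed
  then have a: "1 / 2 \<le> a" "a \<le> 2" using \<eta>(2) by (auto simp: abs_le_iff)
  have g: "normalised v \<in> candidates q"
    unfolding candidates_def using v(1) a by (intro image_eqI[of _ _ "(xs, R)"]) (auto simp: v_def a_def)
  have vF: "lpb p v (F' + \<eta>)"
  proof -
    have "lpb p (\<lambda>x. - 1 * (f x - v x)) (\<bar>- 1\<bar> * \<eta>)" using v(2) \<eta> by (intro lpb_cmult) (auto simp: v_def)
    then have "lpb p (\<lambda>x. f x + (- 1 * (f x - v x))) (F' + \<eta>)" using fF F0 \<eta> p by (intro lpb_add) auto
    then show ?thesis by simp
  qed
  have "lpb p (\<lambda>x. (a - 1) / a * v x) (4 * \<eta> * (F' + 1))"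
  proof -
    have "lpb p (\<lambda>x. (a - 1) / a * v x) (\<bar>(a - 1) / a\<bar> * (F' + \<eta>))" using vF F0 \<eta> by (intro lpb_cmult) auto
    moreover have "\<bar>(a - 1) / a\<bar> * (F' + \<eta>) \<le> (4 * \<eta>) * (F' + 1)"
    proof (rule mult_mono)
      have "\<bar>(a - 1) / a\<bar> = \<bar>1 - a\<bar> / a" using a by (simp add: abs_divide abs_minus_commute)
      also have "\<dots> \<le> (2 * \<eta>) / (1 / 2)" using a1 a by (intro frac_le) auto
      finally show "\<bar>(a - 1) / a\<bar> \<le> 4 * \<eta>" by simp
    qed (use \<eta> F0 in auto)
    moreover have "0 \<le> \<bar>(a - 1) / a\<bar> * (F' + \<eta>)" using F0 \<eta> by auto
    ultimately show ?thesis using lpb_mono p by (meson order_trans zero_le_one)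
  qed
  then have "lpb p (\<lambda>x. (f x - v x) + (a - 1) / a * v x) (\<eta> + 4 * \<eta> * (F' + 1))"
    using v(2) \<eta> F0 p by (intro lpb_add) (auto simp: v_def)
  moreover have "(\<lambda>x. (f x - v x) + (a - 1) / a * v x) = (\<lambda>x. f x - normalised v x)"
    using a by (auto simp: normalised_def a_def[symmetric] field_simps)
  ultimately have "lpb p (\<lambda>x. f x - normalised v x) (\<eta> + 4 * \<eta> * (F' + 1))" by simp
  then have "lpb p (\<lambda>x. f x - normalised v x) e"
  proof (rule lpb_mono)
    show "\<eta> + 4 * \<eta> * (F' + 1) \<le> e" using \<eta>(3) by (simp add: algebra_simps)
    show "0 \<le> \<eta> + 4 * \<eta> * (F' + 1)" using \<eta>(1) F0 by auto
  qed (use p in simp)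
  moreover have "q / 2 \<le> normalised v x" for x
  proof -
    have "q \<le> v x" by (simp add: v_def clamped_def)
    then have "q / 2 \<le> v x / a" using a f(4) by (intro frac_le) auto
    then show ?thesis by (simp add: normalised_def a_def)
  qed
  ultimately show ?thesis using g by blast
qed

text \<open>The density \<open>f\<close> is replaced by a Lipschitz candidate close in the p-norm
  and at least \<open>m / 2\<close>. The replacement costs little in the dual norm by
  \<open>NN_le_Lp\<close> and little in transport by moving the differing mass only; then the
  tolerance tends to zero.\<close>

theorem wasserstein_le_NN:
  assumes f: "is_density f" "lpb p f F" "AE x in cubeM. m \<le> f x" "0 < m" and F: "0 \<le> F"
    and p: "1 \<le> p" and g: "lipc g" "is_density g" "\<And>x. x \<in> Cube \<Longrightarrow> 0 \<le> g x"
  shows "wasserstein p (law f) (law g) \<le>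
    ennreal (Cm p (m / 2)) * NN p (inner_L2 (\<lambda>x. f x - g x)) (\<lambda>_. inner_L2 (\<lambda>x. f x - g x))"
proof -
  let ?d = "real CARD('d)"
  have fi: "integrable cubeM f" and [measurable]: "f \<in> borel_measurable cubeM" using f(1) by (auto simp: is_density_def)
  have Cm0: "0 < Cm p (m / 2)"
    unfolding Cm_def using two_powr_neg_less_1[OF p] f(4) by (intro divide_pos_pos mult_pos_pos) auto
  \<comment> \<open>A version of \<open>f\<close> that is nonnegative at every point of the cube,
    with the same law.\<close>
  define f1 where "f1 = (\<lambda>x. max 0 (f x))"
  have f1AE: "AE x in cubeM. f1 x = f x" using f(3) by eventually_elim (use f(4) in \<open>auto simp: f1_def\<close>)
  have f1m: "f1 \<in> borel_measurable cubeM" unfolding f1_def by measurable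
  have f1law: "law f1 = law f" using f1AE by (intro law_cong f1m) auto
  have f1d: "is_density f1"
  proof -
    have "integrable cubeM f1" using fi f1m f1AE by (subst integrable_cong_AE[of _ _ f]) auto
    moreover have "(\<integral>x. f1 x \<partial>cubeM) = (\<integral>x. f x \<partial>cubeM)" using f1AE f1m by (intro integral_cong_AE) auto
    ultimately show ?thesis using f(1) f1m by (auto simp: is_density_def f1_def)
  qed
  show ?thesis
  proof (cases "NN p (inner_L2 (\<lambda>x. f x - g x)) (\<lambda>_. inner_L2 (\<lambda>x. f x - g x))" rule: ennreal_cases)
    case top
    then show ?thesis using Cm0 by (simp add: ennreal_mult_top)
  next
    case (real Z)
    have eps: "wasserstein p (law f) (law g) \<le> ennreal (Cm p (m / 2) * Z) + ennreal \<zeta>" if \<zeta>: "0 < \<zeta>" for \<zeta>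
    proof -
      \<comment> \<open>The first entry keeps the change of the dual norm, the second the transport
        of the differing mass, below \<open>\<zeta> / 3\<close>.\<close>
      define e where "e = min (\<zeta> / (3 * (Cm p (m / 2) * Cn + 1))) ((\<zeta> / (3 * ?d)) powr p / 2)"
      have c1: "0 < 3 * (Cm p (m / 2) * Cn + 1)" using Cm0 by (auto intro!: mult_pos_pos add_nonneg_pos)
      have e: "0 < e" using \<zeta> c1 by (simp add: e_def)
      have "e \<le> \<zeta> / (3 * (Cm p (m / 2) * Cn + 1))" by (simp add: e_def)
      then have "e * (3 * (Cm p (m / 2) * Cn + 1)) \<le> \<zeta>" using c1 by (simp only: pos_le_divide_eq)
      then have e1: "Cm p (m / 2) * (Cn * e) \<le> \<zeta> / 3" using e by (simp add: algebra_simps)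
      have "(2 * e) powr (1 / p) \<le> ((\<zeta> / (3 * ?d)) powr p) powr (1 / p)" using e p by (intro powr_mono2) (auto simp: e_def)
      also have "\<dots> = \<zeta> / (3 * ?d)" using \<zeta> p by (simp add: powr_powr)
      finally have e2: "?d * (2 * e) powr (1 / p) \<le> \<zeta> / 3" by (simp add: field_simps)
      obtain h where h: "h \<in> candidates m" "lpb p (\<lambda>x. f x - h x) e" "\<And>x. x \<in> Cube \<Longrightarrow> m / 2 \<le> h x"
        using candidates_dense[OF f(1,2,3) _ F p e] f(4) by auto
      note hp = candidates_props[OF h(1) less_imp_le[OF f(4)]]
      have hi: "integrable cubeM h" and hm: "h \<in> borel_measurable cubeM" using hp(2) by (auto simp: is_density_def)
      have gi: "integrable cubeM g" using g by (simp add: is_density_def)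
      have hf: "lpb p (\<lambda>x. h x - f x) e" using h(2) unfolding lpb_def using hm by (simp add: abs_minus_commute)
      have lin: "inner_L2 (\<lambda>x. h x - g x) b = inner_L2 (\<lambda>x. f x - g x) b + inner_L2 (\<lambda>x. h x - f x) b" if "continuous_on Cube b" for b
      proof -
        have int: "integrable cubeM (\<lambda>x. (f x - g x) * b x)" "integrable cubeM (\<lambda>x. (h x - f x) * b x)"
          using fi gi hi that by (auto intro!: integrable_mult_cont)
        have "inner_L2 (\<lambda>x. h x - g x) b = (\<integral>x. (f x - g x) * b x + (h x - f x) * b x \<partial>cubeM)"
          unfolding inner_L2_def by (intro Bochner_Integration.integral_cong) (auto simp: algebra_simps)
        then show ?thesis using int by (simp add: inner_L2_def)
      qed
      have "NN p (inner_L2 (\<lambda>x. h x - g x)) (\<lambda>_. inner_L2 (\<lambda>x. h x - g x)) =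
          NN p (\<lambda>b. inner_L2 (\<lambda>x. f x - g x) b + inner_L2 (\<lambda>x. h x - f x) b) (\<lambda>j b. inner_L2 (\<lambda>x. f x - g x) b + inner_L2 (\<lambda>x. h x - f x) b)"
        by (intro NN_cong lin cont_basis)
      also have "\<dots> \<le> NN p (inner_L2 (\<lambda>x. f x - g x)) (\<lambda>_. inner_L2 (\<lambda>x. f x - g x)) +
          NN p (inner_L2 (\<lambda>x. h x - f x)) (\<lambda>_. inner_L2 (\<lambda>x. h x - f x))"
        by (rule NN_triangle[OF p])
      also have "\<dots> \<le> ennreal Z + ennreal (Cn * e)"
        by (intro add_mono NN_le_Lp hf p less_imp_le[OF e]) (simp add: real)
      also have "\<dots> = ennreal (Z + Cn * e)" using real e by (subst ennreal_plus) auto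
      finally have NNh: "NN p (inner_L2 (\<lambda>x. h x - g x)) (\<lambda>_. inner_L2 (\<lambda>x. h x - g x)) \<le> ennreal (Z + Cn * e)" .
      have ZZ: "0 \<le> Z + Cn * e" using real e by simp
      have m2: "0 < m / 2" using f(4) by simp
      have \<zeta>3: "0 < \<zeta> / 3" using \<zeta> by simp
      have cpl: "coupled p (law h) (law g) (Cm p (m / 2) * (Z + Cn * e) + \<zeta> / 3)"
        by (rule coupled_wavelet_lip[OF p hp(1,2) g(1,2) m2 h(3) g(3) Nk_le_NN[OF NNh ZZ] \<zeta>3])
      have "coupled p (law f1) (law g) ((Cm p (m / 2) * (Z + Cn * e) + \<zeta> / 3) + ?d * (2 * e) powr (1 / p))"
      proof (rule coupled_total_variation[OF f1d hp(2) _ hp(3) _ _ _ cpl _ p])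
        have "(\<integral>x. \<bar>f1 x - h x\<bar> \<partial>cubeM) = (\<integral>x. \<bar>f x - h x\<bar> \<partial>cubeM)"
          using f1AE f1m hm by (intro integral_cong_AE) auto
        also have "\<dots> \<le> 2 * e" by (rule lpb_integral_abs[OF h(2) p less_imp_le[OF e]])
        finally show "(\<integral>x. \<bar>f1 x - h x\<bar> \<partial>cubeM) \<le> 2 * e" .
        show "0 < Cm p (m / 2) * (Z + Cn * e) + \<zeta> / 3" using Cm0 ZZ \<zeta> by (intro add_nonneg_pos mult_nonneg_nonneg) auto
      qed (use e in \<open>auto simp: f1_def\<close>)
      then have "coupled p (law f1) (law g) (Cm p (m / 2) * Z + \<zeta>)"
      proof (rule coupled_mono)
        show "0 \<le> (Cm p (m / 2) * (Z + Cn * e) + \<zeta> / 3) + ?d * (2 * e) powr (1 / p)"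
          using Cm0 real e \<zeta> by (intro add_nonneg_nonneg mult_nonneg_nonneg) auto
        show "(Cm p (m / 2) * (Z + Cn * e) + \<zeta> / 3) + ?d * (2 * e) powr (1 / p) \<le> Cm p (m / 2) * Z + \<zeta>"
          using e1 e2 by (simp add: distrib_left)
      qed (use p in simp)
      then have "wasserstein p (law f) (law g) \<le> ennreal (Cm p (m / 2) * Z + \<zeta>)"
        using Cm0 real \<zeta> p unfolding f1law by (intro wasserstein_le_coupled) auto
      then show ?thesis using Cm0 real \<zeta> by (subst ennreal_plus[symmetric]) auto
    qed
    have "wasserstein p (law f) (law g) \<le> ennreal (Cm p (m / 2) * Z)"
      by (rule ennreal_le_epsilon) (rule eps)
    then show ?thesis using Cm0 real by (simp add: ennreal_mult)
  qed
qed

end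

section \<open>Empirical means\<close>

lemma exp_le_quadratic: "exp y \<le> 1 + y + y\<^sup>2 * exp \<bar>y :: real\<bar>"
proof -
  obtain t where t: "\<bar>t\<bar> \<le> \<bar>y\<bar>" "exp y = (\<Sum>m<2. y ^ m / fact m) + exp t / fact 2 * y ^ 2"
    using Maclaurin_exp_le[of y 2] by auto
  have "exp t / fact 2 * y ^ 2 \<le> exp \<bar>y\<bar> * y\<^sup>2"
  proof (rule mult_right_mono)
    have "exp t \<le> exp \<bar>y\<bar>" using t(1) by simp
    moreover have "exp t / fact 2 \<le> exp t" by simp
    ultimately show "exp t / fact 2 \<le> exp \<bar>y\<bar>" by linarith
  qed simp
  then show ?thesis using t(2) by (simp add: numeral_2_eq_2 mult.commute)
qed

text \<open>It suffices to raise \<open>y / p \<le> exp (y / p)\<close> to the power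
  \<open>p\<close>.\<close>

lemma powr_le_exp:
  fixes y p :: real
  assumes "0 \<le> y" "1 \<le> p"
  shows "y powr p \<le> p powr p * exp y"
proof -
  have "y / p \<le> exp (y / p)" using exp_ge_add_one_self[of "y / p"] by linarith
  then have "(y / p) powr p \<le> exp (y / p) powr p" using assms by (intro powr_mono2) auto
  also have "\<dots> = exp y" using assms by (simp add: powr_def)
  finally have "y powr p / p powr p \<le> exp y" using assms by (simp add: powr_divide)
  then show ?thesis using assms by (simp add: field_simps)
qed

section \<open>Exponential moments of normalised empirical means\<close>

definition sampleM :: "(real ^ 'd \<Rightarrow> real) \<Rightarrow> nat \<Rightarrow> (nat \<Rightarrow> real ^ 'd) measure" where
  "sampleM f n = PiM {..<n} (\<lambda>_. law f)"

definition emp :: "nat \<Rightarrow> (real ^ 'd \<Rightarrow> real) \<Rightarrow> (nat \<Rightarrow> real ^ 'd) \<Rightarrow> real" where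
  "emp n b X = (\<Sum>i<n. b (X i)) / real n"

lemma sets_sampleM [measurable_cong]: "sets (sampleM f n) = sets (PiM {..<n} (\<lambda>_. cubeM))"
  unfolding sampleM_def by (intro sets_PiM_cong) auto

lemma prob_space_sampleM: "is_density f \<Longrightarrow> prob_space (sampleM f n)"
  unfolding sampleM_def by (intro prob_space_PiM prob_space_law)

lemma measurable_emp [measurable]:
  assumes b: "b \<in> borel_measurable cubeM"
  shows "emp n b \<in> borel_measurable (PiM {..<n} (\<lambda>_. cubeM))"
proof -
  have "(\<lambda>X. b (X i)) \<in> borel_measurable (PiM {..<n} (\<lambda>_. cubeM))" if "i < n" for i
    by (rule measurable_compose[OF measurable_component_singleton[of i "{..<n}" "\<lambda>_. cubeM"] b]) (use that in simp)
  then show ?thesis unfolding emp_def[abs_def] by (intro borel_measurable_divide borel_measurable_sum) auto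
qed

lemma sample_nn_integral_prod:
  assumes f: "is_density f" and h: "h \<in> borel_measurable cubeM"
  shows "(\<integral>\<^sup>+X. (\<Prod>i<n. h (X i)) \<partial>sampleM f n) = (\<integral>\<^sup>+x. h x \<partial>law f) ^ n"
proof -
  interpret L: prob_space "law f" by (rule prob_space_law[OF f])
  interpret product_sigma_finite "\<lambda>_ :: nat. law f" by unfold_locales
  have "h \<in> borel_measurable (law f)" using h by (simp add: measurable_cong_sets[OF sets_law refl])
  then show ?thesis unfolding sampleM_def by (subst product_nn_integral_prod) auto
qed

locale sampling =
  fixes f b :: "real ^ 'd \<Rightarrow> real" and n :: nat and K :: real
  assumes f: "is_density f" and b: "continuous_on Cube b" and n: "1 \<le> n"
    and K: "\<And>x. x \<in> Cube \<Longrightarrow> \<bar>b x\<bar> \<le> K * sqrt (real n)"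
begin

definition \<beta> where "\<beta> = inner_L2 f b"
definition v where "v = inner_L2 f (\<lambda>x. (b x)\<^sup>2)"
definition Z where "Z X = sqrt (real n) * (emp n b X - \<beta>)"

lemma bm [measurable]: "b \<in> borel_measurable cubeM" by (rule borel_measurable_cubeM_cont[OF b])

lemma Z_measurable [measurable]: "Z \<in> borel_measurable (sampleM f n)"
  unfolding Z_def[abs_def] by measurable

lemma f_props: "integrable cubeM f" "AE x in cubeM. 0 \<le> f x" "(\<integral>x. f x \<partial>cubeM) = 1" "f \<in> borel_measurable cubeM"
  using f by (auto simp: is_density_def)

lemma fb_int: "integrable cubeM (\<lambda>x. f x * b x)" "integrable cubeM (\<lambda>x. f x * (b x)\<^sup>2)"
  using f_props b by (auto intro!: integrable_mult_cont continuous_intros)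

lemma v_nonneg: "0 \<le> v"
  unfolding v_def inner_L2_def using f_props(2) by (intro integral_nonneg_AE) auto

lemma \<beta>_bound: "\<bar>\<beta>\<bar> \<le> K * sqrt (real n)"
proof -
  have "\<bar>\<beta>\<bar> \<le> (\<integral>x. \<bar>f x * b x\<bar> \<partial>cubeM)" unfolding \<beta>_def inner_L2_def by (rule integral_abs_bound)
  also have "\<dots> \<le> (\<integral>x. f x * (K * sqrt (real n)) \<partial>cubeM)"
  proof (rule integral_mono_AE)
    show "AE x in cubeM. \<bar>f x * b x\<bar> \<le> f x * (K * sqrt (real n))"
      using f_props(2) AE_space by eventually_elim (use K in \<open>auto simp: abs_mult intro!: mult_left_mono\<close>)
  qed (use fb_int f_props in auto)
  also have "\<dots> = K * sqrt (real n)" using f_props by simp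
  finally show ?thesis .
qed

text \<open>The exponential is bounded by a quadratic polynomial with coefficient
  \<open>exp (2 * K)\<close>; the linear term has mean zero, and the quadratic one the second moment
  as an upper bound.\<close>

lemma mgf_single:
  assumes s: "\<bar>s\<bar> \<le> 1"
  shows "(\<integral>\<^sup>+x. ennreal (exp (s / sqrt (real n) * (b x - \<beta>))) \<partial>law f) \<le> ennreal (exp (s\<^sup>2 * v * exp (2 * K) / real n))"
proof -
  define \<tau> where "\<tau> = s / sqrt (real n)"
  define E where "E = exp (2 * K)"
  have n0: "0 < sqrt (real n)" using n by simp
  have \<tau>2: "\<tau>\<^sup>2 = s\<^sup>2 / real n" using n by (simp add: \<tau>_def power_divide)
  have pt: "exp (\<tau> * (b x - \<beta>)) \<le> 1 + \<tau> * (b x - \<beta>) + \<tau>\<^sup>2 * E * (b x - \<beta>)\<^sup>2" if x: "x \<in> Cube" for x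
  proof -
    have "\<bar>\<tau> * (b x - \<beta>)\<bar> \<le> (1 / sqrt (real n)) * (2 * (K * sqrt (real n)))"
      unfolding abs_mult
    proof (rule mult_mono)
      show "\<bar>\<tau>\<bar> \<le> 1 / sqrt (real n)" using s n0 by (simp add: \<tau>_def divide_right_mono)
      show "\<bar>b x - \<beta>\<bar> \<le> 2 * (K * sqrt (real n))" using K[OF x] \<beta>_bound by linarith
    qed auto
    also have "\<dots> = 2 * K" using n0 by simp
    finally have "exp \<bar>\<tau> * (b x - \<beta>)\<bar> \<le> E" by (simp add: E_def)
    then have "(\<tau> * (b x - \<beta>))\<^sup>2 * exp \<bar>\<tau> * (b x - \<beta>)\<bar> \<le> (\<tau> * (b x - \<beta>))\<^sup>2 * E" by (intro mult_left_mono) auto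
    then show ?thesis using exp_le_quadratic[of "\<tau> * (b x - \<beta>)"] by (simp add: power_mult_distrib mult_ac)
  qed
  define w where "w = (\<lambda>x. (1 - \<tau> * \<beta> + \<tau>\<^sup>2 * E * \<beta>\<^sup>2) * f x + (\<tau> - 2 * \<tau>\<^sup>2 * E * \<beta>) * (f x * b x) + \<tau>\<^sup>2 * E * (f x * (b x)\<^sup>2))"
  have weq: "w x = f x * (1 + \<tau> * (b x - \<beta>) + \<tau>\<^sup>2 * E * (b x - \<beta>)\<^sup>2)" for x
    by (simp add: w_def power2_eq_square algebra_simps)
  have wi: "integrable cubeM w" unfolding w_def using f_props fb_int by auto
  have wnn: "AE x in cubeM. f x * exp (\<tau> * (b x - \<beta>)) \<le> w x \<and> 0 \<le> w x"
    using f_props(2) AE_space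
  proof eventually_elim
    case (elim x)
    have "f x * exp (\<tau> * (b x - \<beta>)) \<le> w x" unfolding weq using elim pt[of x] by (intro mult_left_mono) auto
    moreover have "0 \<le> f x * exp (\<tau> * (b x - \<beta>))" using elim by simp
    ultimately show ?case by linarith
  qed
  have "(\<integral>\<^sup>+x. ennreal (exp (\<tau> * (b x - \<beta>))) \<partial>law f) = (\<integral>\<^sup>+x. ennreal (f x) * ennreal (exp (\<tau> * (b x - \<beta>))) \<partial>cubeM)"
    by (rule nn_integral_law) (use f_props in auto)
  also have "\<dots> \<le> (\<integral>\<^sup>+x. ennreal (w x) \<partial>cubeM)"
  proof (rule nn_integral_mono_AE)
    show "AE x in cubeM. ennreal (f x) * ennreal (exp (\<tau> * (b x - \<beta>))) \<le> ennreal (w x)"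
      using wnn f_props(2) by eventually_elim (simp add: ennreal_leI flip: ennreal_mult)
  qed
  also have "\<dots> = ennreal (\<integral>x. w x \<partial>cubeM)"
    by (rule nn_integral_eq_integral[OF wi]) (use wnn in \<open>auto elim: eventually_mono\<close>)
  also have "(\<integral>x. w x \<partial>cubeM) = 1 + \<tau>\<^sup>2 * E * (v - \<beta>\<^sup>2)"
  proof -
    have "(\<integral>x. w x \<partial>cubeM) = (1 - \<tau> * \<beta> + \<tau>\<^sup>2 * E * \<beta>\<^sup>2) * 1 + (\<tau> - 2 * \<tau>\<^sup>2 * E * \<beta>) * \<beta> + \<tau>\<^sup>2 * E * v"
      unfolding w_def using f_props fb_int by (simp add: \<beta>_def v_def inner_L2_def)
    then show ?thesis by (simp add: power2_eq_square algebra_simps)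
  qed
  also have "ennreal \<dots> \<le> ennreal (exp (s\<^sup>2 * v * exp (2 * K) / real n))"
  proof (rule ennreal_leI)
    have "1 + \<tau>\<^sup>2 * E * (v - \<beta>\<^sup>2) \<le> 1 + \<tau>\<^sup>2 * E * v"
      by (intro add_left_mono mult_left_mono) (auto simp: E_def)
    also have "\<dots> \<le> exp (\<tau>\<^sup>2 * E * v)" by (rule exp_ge_add_one_self)
    also have "\<tau>\<^sup>2 * E * v = s\<^sup>2 * v * exp (2 * K) / real n" by (simp add: \<tau>2 E_def)
    finally show "1 + \<tau>\<^sup>2 * E * (v - \<beta>\<^sup>2) \<le> exp (s\<^sup>2 * v * exp (2 * K) / real n)" .
  qed
  finally show ?thesis by (simp add: \<tau>_def)
qed

lemma mgf:
  assumes s: "\<bar>s\<bar> \<le> 1"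
  shows "(\<integral>\<^sup>+X. ennreal (exp (s * Z X)) \<partial>sampleM f n) \<le> ennreal (exp (s\<^sup>2 * v * exp (2 * K)))"
proof -
  have n0: "0 < sqrt (real n)" "sqrt (real n) * sqrt (real n) = real n" using n by auto
  have eq: "ennreal (exp (s * Z X)) = (\<Prod>i<n. ennreal (exp (s / sqrt (real n) * (b (X i) - \<beta>))))" for X
  proof -
    have "emp n b X - \<beta> = (\<Sum>i<n. b (X i) - \<beta>) / real n"
      using n by (simp add: emp_def sum_subtractf diff_divide_distrib)
    then have "s * Z X = s * (sqrt (real n) / real n) * (\<Sum>i<n. b (X i) - \<beta>)"
      by (simp add: Z_def)
    also have "sqrt (real n) / real n = 1 / sqrt (real n)"
      using n0 by (metis divide_divide_eq_left divide_self_if less_irrefl mult.commute)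
    finally have "s * Z X = (\<Sum>i<n. s / sqrt (real n) * (b (X i) - \<beta>))" by (simp add: sum_distrib_left)
    then show ?thesis by (simp add: exp_sum prod_ennreal)
  qed
  have "(\<integral>\<^sup>+X. ennreal (exp (s * Z X)) \<partial>sampleM f n) =
      (\<integral>\<^sup>+x. ennreal (exp (s / sqrt (real n) * (b x - \<beta>))) \<partial>law f) ^ n"
    unfolding eq by (rule sample_nn_integral_prod[OF f]) measurable
  also have "\<dots> \<le> ennreal (exp (s\<^sup>2 * v * exp (2 * K) / real n)) ^ n"
    by (intro power_mono mgf_single s) auto
  also have "\<dots> = ennreal (exp (s\<^sup>2 * v * exp (2 * K)))"
    using n by (simp add: ennreal_power flip: exp_of_nat_mult)
  finally show ?thesis .
qed

text \<open>Powers are bounded by exponentials. The bound is linear in \<open>1 + v\<close> rather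
  than in its root, which is the form in which the second moments of one level can be
  summed.\<close>

lemma moment:
  assumes p: "1 \<le> p"
  shows "(\<integral>\<^sup>+X. ennreal (\<bar>Z X\<bar> powr p) \<partial>sampleM f n) \<le> ennreal (2 * p powr p * exp (exp (2 * K)) * (1 + v) powr p)"
proof -
  \<comment> \<open>This parameter satisfies both \<open>s \<le> 1\<close>, as the exponential
    moments require, and \<open>s * s * v \<le> 1\<close>, so these moments are bounded by a
    constant.\<close>
  define s where "s = 1 / (1 + v)"
  have v1: "0 < 1 + v" using v_nonneg by linarith
  have s: "0 < s" "\<bar>s\<bar> \<le> 1" using v_nonneg by (auto simp: s_def)
  have s2v: "s\<^sup>2 * v \<le> 1"
  proof -
    have "s * v \<le> 1" using v_nonneg by (simp add: s_def)
    then have "s * (s * v) \<le> 1 * 1" using s v_nonneg by (intro mult_mono) auto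
    then show ?thesis by (simp add: power2_eq_square mult.assoc)
  qed
  define A where "A = p powr p * (1 + v) powr p"
  have A: "0 \<le> A" by (simp add: A_def)
  have pt: "\<bar>Z X\<bar> powr p \<le> A * (exp (s * Z X) + exp (- s * Z X))" for X
  proof -
    have "\<bar>Z X\<bar> powr p = (1 + v) powr p * (s * \<bar>Z X\<bar>) powr p"
      using v1 by (simp add: s_def powr_divide)
    also have "\<dots> \<le> (1 + v) powr p * (p powr p * exp (s * \<bar>Z X\<bar>))"
      using s p by (intro mult_left_mono powr_le_exp) auto
    also have "\<dots> = A * exp (s * \<bar>Z X\<bar>)" by (simp add: A_def)
    also have "\<dots> \<le> A * (exp (s * Z X) + exp (- s * Z X))"
      using A by (intro mult_left_mono) (auto simp: abs_if)
    finally show ?thesis .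
  qed
  have "(\<integral>\<^sup>+X. ennreal (\<bar>Z X\<bar> powr p) \<partial>sampleM f n) \<le>
      (\<integral>\<^sup>+X. ennreal A * (ennreal (exp (s * Z X)) + ennreal (exp (- s * Z X))) \<partial>sampleM f n)"
    using pt A by (intro nn_integral_mono) (simp add: ennreal_leI flip: ennreal_plus ennreal_mult)
  also have "\<dots> = ennreal A * ((\<integral>\<^sup>+X. ennreal (exp (s * Z X)) \<partial>sampleM f n) + (\<integral>\<^sup>+X. ennreal (exp (- s * Z X)) \<partial>sampleM f n))"
    by (subst nn_integral_cmult, measurable, subst nn_integral_add, auto)
  also have "\<dots> \<le> ennreal A * (ennreal (exp (exp (2 * K))) + ennreal (exp (exp (2 * K))))"
  proof (intro mult_left_mono add_mono)
    have le: "exp (s\<^sup>2 * v * exp (2 * K)) \<le> exp (exp (2 * K))" using s2v by (simp add: mult_left_le_one_le v_nonneg)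
    show "(\<integral>\<^sup>+X. ennreal (exp (s * Z X)) \<partial>sampleM f n) \<le> ennreal (exp (exp (2 * K)))"
      using mgf[OF s(2)] le by (meson ennreal_leI order_trans)
    show "(\<integral>\<^sup>+X. ennreal (exp (- s * Z X)) \<partial>sampleM f n) \<le> ennreal (exp (exp (2 * K)))"
      using mgf[of "- s"] s(2) le by (simp add: order_trans[OF _ ennreal_leI])
  qed auto
  also have "\<dots> = ennreal (A * (exp (exp (2 * K)) + exp (exp (2 * K))))"
    using A by (subst ennreal_plus[symmetric], simp, simp, subst ennreal_mult) auto
  also have "A * (exp (exp (2 * K)) + exp (exp (2 * K))) = 2 * p powr p * exp (exp (2 * K)) * (1 + v) powr p"
    by (simp add: A_def)
  finally show ?thesis .
qed

text \<open>The exponential Markov inequality with parameters 1 and -1; the deviation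
  \<open>v * exp (2 * K)\<close> pays for the exponential moment itself.\<close>

lemma chernoff:
  shows "emeasure (sampleM f n) {X\<in>space (sampleM f n). v * exp (2 * K) + t < \<bar>Z X\<bar>} \<le> ennreal (2 * exp (- t))"
proof -
  define E where "E = exp (2 * K)"
  have "emeasure (sampleM f n) {X\<in>space (sampleM f n). v * E + t < \<bar>Z X\<bar>} =
      (\<integral>\<^sup>+X. indicator {X\<in>space (sampleM f n). v * E + t < \<bar>Z X\<bar>} X \<partial>sampleM f n)"
    by (rule nn_integral_indicator[symmetric]) measurable
  also have "\<dots> \<le> (\<integral>\<^sup>+X. ennreal (exp (- (v * E + t))) * (ennreal (exp (1 * Z X)) + ennreal (exp (- 1 * Z X))) \<partial>sampleM f n)"
  proof (rule nn_integral_mono)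
    fix X assume "X \<in> space (sampleM f n)"
    have "1 \<le> exp (- (v * E + t)) * (exp (1 * Z X) + exp (- 1 * Z X))" if "v * E + t < \<bar>Z X\<bar>"
    proof -
      have "1 \<le> exp (- (v * E + t) + \<bar>Z X\<bar>)" using that by simp
      also have "\<dots> = exp (- (v * E + t)) * exp \<bar>Z X\<bar>" by (rule exp_add)
      also have "\<dots> \<le> exp (- (v * E + t)) * (exp (1 * Z X) + exp (- 1 * Z X))"
        by (intro mult_left_mono) (auto simp: abs_if)
      finally show ?thesis .
    qed
    then have "ennreal 1 \<le> ennreal (exp (- (v * E + t)) * (exp (1 * Z X) + exp (- 1 * Z X)))" if "v * E + t < \<bar>Z X\<bar>"
      using that by (intro ennreal_leI)
    then show "indicator {X\<in>space (sampleM f n). v * E + t < \<bar>Z X\<bar>} X \<le>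
        ennreal (exp (- (v * E + t))) * (ennreal (exp (1 * Z X)) + ennreal (exp (- 1 * Z X)))"
      by (auto simp: indicator_def ennreal_mult ennreal_plus)
  qed
  also have "\<dots> = ennreal (exp (- (v * E + t))) * ((\<integral>\<^sup>+X. ennreal (exp (1 * Z X)) \<partial>sampleM f n) + (\<integral>\<^sup>+X. ennreal (exp (- 1 * Z X)) \<partial>sampleM f n))"
    by (subst nn_integral_cmult, measurable, subst nn_integral_add, auto)
  also have "\<dots> \<le> ennreal (exp (- (v * E + t))) * (ennreal (exp (v * E)) + ennreal (exp (v * E)))"
    using mgf[of 1] mgf[of "-1"] by (intro mult_left_mono add_mono) (auto simp: E_def)
  also have "\<dots> = ennreal (exp (- (v * E + t)) * (exp (v * E) + exp (v * E)))"
    by (subst ennreal_plus[symmetric], simp, simp, subst ennreal_mult) auto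
  also have "exp (- (v * E + t)) * (exp (v * E) + exp (v * E)) = 2 * exp (- t)"
    by (simp add: exp_add exp_minus exp_diff field_simps)
  finally show ?thesis by (simp add: E_def)
qed

end

text \<open>The expectation is passed through the root by \<open>x \<le> A + A\<^sup>1\<^sup>-\<^sup>p x\<^sup>p\<close>.\<close>

lemma lpn_moment:
  fixes S :: "(real ^ 'd \<Rightarrow> real) set"
  assumes S: "finite S" "\<And>b. b \<in> S \<Longrightarrow> sampling f b n K" and p: "1 \<le> p"
  shows "(\<integral>\<^sup>+X. ennreal (lpn p S (\<lambda>b. emp n b X - inner_L2 f b)) \<partial>sampleM f n) \<le>
    ennreal (2 * (2 * p powr p * exp (exp (2 * K))) powr (1 / p) * lpn p S (\<lambda>b. 1 + inner_L2 f (\<lambda>x. (b x)\<^sup>2)) / sqrt (real n))"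
proof (cases "S = {}")
  case True
  then show ?thesis by (simp add: lpn_def)
next
  case False
  then obtain b0 where b0: "b0 \<in> S" by blast
  have n: "1 \<le> n" and f: "is_density f" using S(2)[OF b0] by (auto simp: sampling_def)
  have n0: "0 < sqrt (real n)" using n by simp
  define V where "V = (\<lambda>b. inner_L2 f (\<lambda>x. (b x)\<^sup>2))"
  define c where "c = 2 * p powr p * exp (exp (2 * K))"
  have c: "0 < c" using p by (simp add: c_def)
  have V0: "0 \<le> V b" if "b \<in> S" for b using sampling.v_nonneg[OF S(2)[OF that]] sampling.v_def[OF S(2)[OF that]] by (simp add: V_def)
  \<comment> \<open>\<open>A powr p\<close> is the sum of the moment bounds over \<open>S\<close>,
    so both terms of the Young-type inequality are equal to \<open>A\<close>.\<close>
  define A where "A = c powr (1 / p) * lpn p S (\<lambda>b. 1 + V b)"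
  have "1 \<le> \<bar>1 + V b0\<bar>" using V0[OF b0] by simp
  also have "\<dots> \<le> lpn p S (\<lambda>b. 1 + V b)" using S(1) p b0 by (intro abs_le_lpn) auto
  finally have A: "0 < A" using c by (simp add: A_def)
  define Z where "Z = (\<lambda>b X. sqrt (real n) * (emp n b X - inner_L2 f b))"
  have Zeq: "Z b = sampling.Z f b n" if "b \<in> S" for b
    using sampling.Z_def[OF S(2)[OF that]] sampling.\<beta>_def[OF S(2)[OF that]] by (auto simp: Z_def)
  have Zm: "Z b \<in> borel_measurable (sampleM f n)" if "b \<in> S" for b
    using sampling.Z_measurable[OF S(2)[OF that]] Zeq[OF that] by simp
  have young: "x \<le> A + A powr (1 - p) * x powr p" if x: "0 \<le> x" for x
  proof (cases "x \<le> A")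
    case False
    have "x = x powr (1 - p) * x powr p" using False A by (simp flip: powr_add)
    also have "\<dots> \<le> A powr (1 - p) * x powr p" using False A p by (intro mult_right_mono powr_mono2') auto
    finally show ?thesis using A by simp
  qed (simp add: add_increasing2)
  have "(\<integral>\<^sup>+X. ennreal (lpn p S (\<lambda>b. Z b X)) \<partial>sampleM f n) \<le>
      (\<integral>\<^sup>+X. ennreal A + ennreal (A powr (1 - p)) * (\<Sum>b\<in>S. ennreal (\<bar>Z b X\<bar> powr p)) \<partial>sampleM f n)"
  proof (rule nn_integral_mono)
    fix X
    have "lpn p S (\<lambda>b. Z b X) \<le> A + A powr (1 - p) * (\<Sum>b\<in>S. \<bar>Z b X\<bar> powr p)"
      using young[of "lpn p S (\<lambda>b. Z b X)"] p by (simp add: lpn_powr)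
    then have "ennreal (lpn p S (\<lambda>b. Z b X)) \<le> ennreal (A + A powr (1 - p) * (\<Sum>b\<in>S. \<bar>Z b X\<bar> powr p))" by (rule ennreal_leI)
    then show "ennreal (lpn p S (\<lambda>b. Z b X)) \<le> ennreal A + ennreal (A powr (1 - p)) * (\<Sum>b\<in>S. ennreal (\<bar>Z b X\<bar> powr p))"
      using A by (simp add: ennreal_plus ennreal_mult sum_nonneg sum_ennreal)
  qed
  also have "\<dots> = ennreal A + ennreal (A powr (1 - p)) * (\<Sum>b\<in>S. \<integral>\<^sup>+X. ennreal (\<bar>Z b X\<bar> powr p) \<partial>sampleM f n)"
  proof -
    interpret P: prob_space "sampleM f n" by (rule prob_space_sampleM[OF f])
    have m: "(\<lambda>X. ennreal (\<bar>Z b X\<bar> powr p)) \<in> borel_measurable (sampleM f n)" if "b \<in> S" for b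
    proof -
      note [measurable] = Zm[OF that]
      show ?thesis by measurable
    qed
    then have ms: "(\<lambda>X. \<Sum>b\<in>S. ennreal (\<bar>Z b X\<bar> powr p)) \<in> borel_measurable (sampleM f n)" by (rule borel_measurable_sum)
    show ?thesis
      using m ms by (simp add: nn_integral_add nn_integral_cmult nn_integral_sum P.emeasure_space_1 del: sum_ennreal)
  qed
  also have "\<dots> \<le> ennreal A + ennreal (A powr (1 - p)) * (\<Sum>b\<in>S. ennreal (c * \<bar>1 + V b\<bar> powr p))"
  proof (intro add_left_mono mult_left_mono sum_mono)
    fix b assume bS: "b \<in> S"
    then show "(\<integral>\<^sup>+X. ennreal (\<bar>Z b X\<bar> powr p) \<partial>sampleM f n) \<le> ennreal (c * \<bar>1 + V b\<bar> powr p)"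
      using sampling.moment[OF S(2)[OF bS] p] V0[OF bS] sampling.v_def[OF S(2)[OF bS]] by (simp add: Zeq c_def V_def)
  qed auto
  also have "\<dots> = ennreal (A + A powr (1 - p) * A powr p)"
  proof -
    have "(\<Sum>b\<in>S. c * \<bar>1 + V b\<bar> powr p) = A powr p"
      using c p by (simp add: A_def powr_mult powr_powr lpn_powr sum_distrib_left)
    then have "(\<Sum>b\<in>S. ennreal (c * \<bar>1 + V b\<bar> powr p)) = ennreal (A powr p)"
      using c by (subst sum_ennreal) auto
    then show ?thesis using A by (simp add: ennreal_plus ennreal_mult)
  qed
  also have "A + A powr (1 - p) * A powr p = 2 * A" using A by (simp flip: powr_add)
  finally have le: "(\<integral>\<^sup>+X. ennreal (lpn p S (\<lambda>b. Z b X)) \<partial>sampleM f n) \<le> ennreal (2 * A)" .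
  have scale: "lpn p S (\<lambda>b. emp n b X - inner_L2 f b) = 1 / sqrt (real n) * lpn p S (\<lambda>b. Z b X)" for X
    unfolding Z_def using p n0 by (subst lpn_cmult) auto
  have "(\<integral>\<^sup>+X. ennreal (lpn p S (\<lambda>b. emp n b X - inner_L2 f b)) \<partial>sampleM f n) =
      (\<integral>\<^sup>+X. ennreal (1 / sqrt (real n)) * ennreal (lpn p S (\<lambda>b. Z b X)) \<partial>sampleM f n)"
    unfolding scale by (intro nn_integral_cong ennreal_mult) auto
  also have "\<dots> = ennreal (1 / sqrt (real n)) * (\<integral>\<^sup>+X. ennreal (lpn p S (\<lambda>b. Z b X)) \<partial>sampleM f n)"
  proof (rule nn_integral_cmult)
    show "(\<lambda>X. ennreal (lpn p S (\<lambda>b. Z b X))) \<in> borel_measurable (sampleM f n)"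
    proof -
      note [measurable] = Zm
      show ?thesis unfolding lpn_def by measurable
    qed
  qed
  also have "\<dots> \<le> ennreal (1 / sqrt (real n)) * ennreal (2 * A)" by (intro mult_left_mono le) auto
  also have "\<dots> = ennreal (2 * c powr (1 / p) * lpn p S (\<lambda>b. 1 + V b) / sqrt (real n))"
    using A by (subst ennreal_mult[symmetric]) (auto simp: A_def mult_ac)
  finally show ?thesis by (simp add: c_def V_def)
qed

section \<open>The estimator\<close>

context wavelet_frame
begin

text \<open>For \<open>n \<ge> 1\<close>, the last level whose size \<open>(Hn j)\<^sup>2\<close>
  does not exceed \<open>n\<close>; up to it the wavelets satisfy the height bound of
  \<open>sampling\<close>.\<close>

definition Jn :: "nat \<Rightarrow> nat" where
  "Jn n = nat \<lfloor>log 2 (real n) / real CARD('d)\<rfloor>"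

lemma Jn_le:
  assumes "1 \<le> n" shows "(Hn (Jn n))\<^sup>2 \<le> real n"
proof -
  have l0: "0 \<le> log 2 (real n) / real CARD('d)" using assms by (intro divide_nonneg_nonneg) (auto simp: zero_le_log_cancel_iff)
  then have "real (Jn n) \<le> log 2 (real n) / real CARD('d)" by (simp add: Jn_def)
  then have "real CARD('d) * real (Jn n) \<le> log 2 (real n)" by (simp add: field_simps)
  then have "(Hn (Jn n))\<^sup>2 \<le> 2 powr log 2 (real n)" unfolding Hn_sq by (intro powr_mono) auto
  then show ?thesis using assms by simp
qed

lemma Jn_gt:
  assumes "1 \<le> n" shows "real n < (Hn (Suc (Jn n)))\<^sup>2"
proof -
  have l0: "0 \<le> log 2 (real n) / real CARD('d)" using assms by (intro divide_nonneg_nonneg) (auto simp: zero_le_log_cancel_iff)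
  then have "log 2 (real n) / real CARD('d) < real (Suc (Jn n))" unfolding Jn_def by linarith
  then have "log 2 (real n) < real CARD('d) * real (Suc (Jn n))" by (simp add: field_simps)
  then have "2 powr log 2 (real n) < (Hn (Suc (Jn n)))\<^sup>2" unfolding Hn_sq by (intro powr_less_mono) auto
  then show ?thesis using assms by simp
qed

lemma Hn_mono: "i \<le> j \<Longrightarrow> Hn i \<le> Hn j"
  unfolding Hn_def by (intro powr_mono) auto

lemma half_le_ln_2: "1 / 2 \<le> ln (2 :: real)"
  using ln_le_minus_one[of "1 / 2 :: real"] by (simp add: ln_div)

lemma ln_ge_half:
  assumes "2 \<le> n" shows "1 / 2 \<le> ln (real n)"
proof -
  have "ln 2 \<le> ln (real n)" using assms by simp
  then show ?thesis using half_le_ln_2 by linarith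
qed

lemma Jn_ln:
  assumes "2 \<le> n" shows "real (Jn n) + 1 \<le> 4 * ln (real n)"
proof -
  have l0: "0 \<le> log 2 (real n)" using assms by (auto simp: zero_le_log_cancel_iff)
  then have "real (Jn n) \<le> log 2 (real n) / real CARD('d)" by (simp add: Jn_def)
  also have "\<dots> \<le> log 2 (real n) / 1" using l0 by (intro divide_left_mono) (auto simp: Suc_leI)
  also have "\<dots> = ln (real n) / ln 2" by (simp add: log_def)
  also have "\<dots> \<le> ln (real n) / (1 / 2)" using half_le_ln_2 assms by (intro divide_left_mono) auto
  finally have "real (Jn n) \<le> 2 * ln (real n)" by simp
  then show ?thesis using ln_ge_half[OF assms] by argo
qed

lemma sampling_basis:
  assumes f: "is_density f" and n: "1 \<le> n" and b: "b \<in> Bk (Suc (Jn n))"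
  shows "sampling f b n C"
proof
  show "continuous_on Cube b" by (rule Bk_cont[OF b])
  fix x :: "real ^ 'd" assume x: "x \<in> Cube"
  have H: "Hn j \<le> sqrt (real n)" if "j \<le> Jn n" for j
  proof -
    have "Hn j \<le> Hn (Jn n)" by (rule Hn_mono[OF that])
    also have "\<dots> \<le> sqrt (real n)" using Jn_le[OF n] by (rule real_le_rsqrt)
    finally show ?thesis .
  qed
  from b consider "b \<in> \<Phi>" | j where "j \<le> Jn n" "b \<in> \<Psi> j" by (auto simp: Bk_def less_Suc_eq_le)
  then show "\<bar>b x\<bar> \<le> C * sqrt (real n)"
  proof cases
    case 1
    then have "\<bar>b x\<bar> \<le> C * 1" using \<Phi>_bound x by simp
    also have "\<dots> \<le> C * sqrt (real n)" using n by (intro mult_left_mono) auto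
    finally show ?thesis .
  next
    case 2
    have "\<bar>b x\<bar> \<le> C * Hn j" by (rule \<Psi>_bound'[OF 2(2) x])
    also have "\<dots> \<le> C * sqrt (real n)" using H[OF 2(1)] by (intro mult_left_mono) auto
    finally show ?thesis .
  qed
qed (use f n in auto)

text \<open>The first term comes from the variances of a level with
  \<open>j + 1 \<le> 4 * ln n\<close>, the second from the deviation \<open>2 * ln n\<close> granted
  to each coefficient.\<close>

definition Kt :: "real \<Rightarrow> real" where
  "Kt L = 4 * exp (2 * C) * Cv L + 2 * C ^ 3"

definition thr :: "real \<Rightarrow> real \<Rightarrow> nat \<Rightarrow> nat \<Rightarrow> real" where
  "thr p L n j = Kt L * Hn j powr (2 / p) * ln (real n) / sqrt (real n)"

text \<open>Levels are thresholded as a whole. This is what makes the estimator adapt to the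
  smoothness, and it is needed in dimension three and higher only.\<close>

definition est :: "real \<Rightarrow> real \<Rightarrow> nat \<Rightarrow> (nat \<Rightarrow> real ^ 'd) \<Rightarrow> nat \<Rightarrow> (real ^ 'd \<Rightarrow> real) \<Rightarrow> real" where
  "est p L n X j b = (if Jn n < j \<or> 3 \<le> CARD('d) \<and> lpn p (\<Psi> j) (\<lambda>b. emp n b X) \<le> 2 * thr p L n j
     then 0 else emp n b X)"

definition cand :: "nat \<Rightarrow> real ^ 'd \<Rightarrow> real" where
  "cand = from_nat_into (candidates 0)"

definition obj :: "real \<Rightarrow> real \<Rightarrow> nat \<Rightarrow> nat \<Rightarrow> (nat \<Rightarrow> real ^ 'd) \<Rightarrow> ennreal" where
  "obj p L n k X = NN p (\<lambda>b. emp n b X - inner_L2 (cand k) b) (\<lambda>j b. est p L n X j b - inner_L2 (cand k) b)"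

text \<open>The infimum over the candidates need not be attained, so a slack is granted;
  \<open>Suc n\<close> keeps it positive for \<open>n = 0\<close>, where \<open>1 / 0\<close> would
  be 0. Taking the least index makes the choice measurable.\<close>

definition sel :: "real \<Rightarrow> real \<Rightarrow> nat \<Rightarrow> (nat \<Rightarrow> real ^ 'd) \<Rightarrow> nat" where
  "sel p L n X = (LEAST k. \<forall>k'. obj p L n k X \<le> obj p L n k' X + ennreal (1 / real (Suc n)))"

definition fit :: "real \<Rightarrow> real \<Rightarrow> nat \<Rightarrow> (nat \<Rightarrow> real ^ 'd) \<Rightarrow> real ^ 'd \<Rightarrow> real" where
  "fit p L n X = cand (sel p L n X)"

definition err :: "real \<Rightarrow> real \<Rightarrow> nat \<Rightarrow> (real ^ 'd \<Rightarrow> real) \<Rightarrow> (nat \<Rightarrow> real ^ 'd) \<Rightarrow> ennreal" where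
  "err p L n f X = NN p (\<lambda>b. emp n b X - inner_L2 f b) (\<lambda>j b. est p L n X j b - inner_L2 f b)"

lemma candidates_nonempty: "candidates 0 \<noteq> ({} :: (real ^ 'd \<Rightarrow> real) set)"
proof -
  have "is_density (\<lambda>_ :: real ^ 'd. 1)" by (intro is_densityI) auto
  moreover have "lpb 1 (\<lambda>_ :: real ^ 'd. 1) 1" by (simp add: lpb_def)
  ultimately show ?thesis using candidates_dense[of "\<lambda>_. 1" 1 1 0 1] by auto
qed

lemma cand_props: "lipc (cand k)" "is_density (cand k)" "x \<in> Cube \<Longrightarrow> 0 \<le> cand k x"
proof -
  have "cand k \<in> candidates 0" unfolding cand_def by (rule from_nat_into[OF candidates_nonempty])
  from candidates_props[OF this order_refl]
  show "lipc (cand k)" "is_density (cand k)" "x \<in> Cube \<Longrightarrow> 0 \<le> cand k x" by auto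
qed

lemma sel_le: "obj p L n (sel p L n X) X \<le> obj p L n k' X + ennreal (1 / real (Suc n))"
proof -
  have "\<exists>k. \<forall>k'. obj p L n k X \<le> obj p L n k' X + ennreal (1 / real (Suc n))"
  proof (cases "(INF k. obj p L n k X) = \<top>")
    case True
    then have "obj p L n k X = \<top>" for k using INF_lower[of k UNIV "\<lambda>k. obj p L n k X"] by (simp add: top_unique)
    then show ?thesis by simp
  next
    case False
    then have "(INF k. obj p L n k X) < (INF k. obj p L n k X) + ennreal (1 / real (Suc n))"
      by (simp add: ennreal_add_left_cancel_less[of _ 0, simplified] less_top)
    then obtain k where k: "obj p L n k X < (INF k. obj p L n k X) + ennreal (1 / real (Suc n))"
      by (auto simp: INF_less_iff)
    have "obj p L n k X \<le> obj p L n k' X + ennreal (1 / real (Suc n))" for k'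
      by (rule order_trans[OF less_imp_le[OF k]]) (intro add_right_mono INF_lower UNIV_I)
    then show ?thesis by blast
  qed
  then have "\<forall>k'. obj p L n (sel p L n X) X \<le> obj p L n k' X + ennreal (1 / real (Suc n))"
    unfolding sel_def by (rule LeastI_ex)
  then show ?thesis by blast
qed

section \<open>Measurability of the estimator\<close>

lemma measurable_lpn:
  assumes "\<And>b. b \<in> S \<Longrightarrow> (\<lambda>X. g X b) \<in> borel_measurable M"
  shows "(\<lambda>X. lpn p S (g X)) \<in> borel_measurable M"
  unfolding lpn_def
  by (intro powr_real_measurable borel_measurable_sum borel_measurable_abs borel_measurable_const assms)

lemma measurable_est:
  assumes b: "b \<in> \<Psi> j"
  shows "(\<lambda>X. est p L n X j b) \<in> borel_measurable (PiM {..<n} (\<lambda>_. cubeM))"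
proof -
  have 1: "(\<lambda>X. lpn p (\<Psi> j) (\<lambda>b. emp n b X)) \<in> borel_measurable (PiM {..<n} (\<lambda>_. cubeM))"
    by (intro measurable_lpn measurable_emp meas_basis(2))
  have e: "emp n b \<in> borel_measurable (PiM {..<n} (\<lambda>_. cubeM))" by (rule measurable_emp[OF meas_basis(2)[OF b]])
  consider "Jn n < j" | "\<not> Jn n < j" "\<not> 3 \<le> CARD('d)" | "\<not> Jn n < j" "3 \<le> CARD('d)" by blast
  then show ?thesis
  proof cases
    case 3
    show ?thesis unfolding est_def if_distrib using 3
      by (simp, intro measurable_If borel_measurable_le borel_measurable_const e 1)
  qed (use e in \<open>simp_all add: est_def\<close>)
qed

lemma measurable_NN:
  assumes "\<And>b. b \<in> \<Phi> \<Longrightarrow> (\<lambda>X. g X b) \<in> borel_measurable M"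
    and "\<And>j b. b \<in> \<Psi> j \<Longrightarrow> (\<lambda>X. h X j b) \<in> borel_measurable M"
  shows "(\<lambda>X. NN p (g X) (h X)) \<in> borel_measurable M"
  unfolding NN_def
  by (intro borel_measurable_add measurable_ennreal borel_measurable_suminf_order borel_measurable_times
      borel_measurable_const measurable_lpn assms measurable_compose[OF _ measurable_ennreal]) auto

lemma measurable_obj: "obj p L n k \<in> borel_measurable (PiM {..<n} (\<lambda>_. cubeM))"
  unfolding obj_def[abs_def]
  by (intro measurable_NN borel_measurable_diff measurable_emp measurable_est meas_basis(1) borel_measurable_const)

lemma measurable_err: "err p L n f \<in> borel_measurable (PiM {..<n} (\<lambda>_. cubeM))"
  unfolding err_def[abs_def]
  by (intro measurable_NN borel_measurable_diff measurable_emp measurable_est meas_basis(1) borel_measurable_const)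

text \<open>The selected index results from countably many comparisons of measurable objectives, and
  the estimator is one of countably many continuous functions according to this index.\<close>

lemma density_estimator_fit: "density_estimator n (fit p L n)"
proof -
  let ?M = "PiM {..<n} (\<lambda>_. cubeM) :: (nat \<Rightarrow> real ^ 'd) measure"
  have le: "Measurable.pred ?M (\<lambda>X. obj p L n k X \<le> obj p L n k' X + ennreal (1 / real (Suc n)))" for k k'
    unfolding pred_def by (intro borel_measurable_le borel_measurable_add borel_measurable_const measurable_obj)
  have s: "sel p L n \<in> measurable ?M (count_space UNIV)"
    unfolding sel_def[abs_def] by (intro measurable_Least pred_intros_countable(1) le)
  have "(\<lambda>z. cand (sel p L n (fst z)) (snd z)) \<in> borel_measurable (?M \<Otimes>\<^sub>M cubeM)"
  proof (rule measurable_compose_countable[where f="\<lambda>k z. cand k (snd z)"])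
    show "(\<lambda>z. sel p L n (fst z)) \<in> measurable (?M \<Otimes>\<^sub>M cubeM) (count_space UNIV)"
      by (rule measurable_compose[OF measurable_fst s])
    show "(\<lambda>z. cand k (snd z)) \<in> borel_measurable (?M \<Otimes>\<^sub>M cubeM)" for k
      by (rule measurable_compose[OF measurable_snd borel_measurable_cubeM_cont[OF lipc_cont[OF cand_props(1)]]])
  qed
  then have "(\<lambda>(X, x). fit p L n X x) \<in> borel_measurable (?M \<Otimes>\<^sub>M cubeM)"
    by (simp add: fit_def case_prod_beta)
  then show ?thesis unfolding density_estimator_def
  proof (intro conjI ballI)
    show "is_density (fit p L n X)" for X unfolding fit_def by (rule cand_props(2))
  qed
qed

lemma NN_minus_commute: "NN p (\<lambda>b. u b - u' b) (\<lambda>j b. w j b - w' j b) = NN p (\<lambda>b. u' b - u b) (\<lambda>j b. w' j b - w j b)"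
  unfolding NN_def by (simp only: lpn_minus_commute[of p _ u u'] lpn_minus_commute[of p _ "w _" "w' _"])

text \<open>The minimum distance argument: the fit is about as close to the estimated coefficients
  as \<open>f\<close> is, because candidates come arbitrarily close to \<open>f\<close> in the dual
  norm. Two triangle inequalities give twice the error of the estimated coefficients plus the
  slack.\<close>

lemma wasserstein_fit:
  assumes f: "is_density f" "lpb p f F" "AE x in cubeM. m \<le> f x" "0 < m" and F: "0 \<le> F" and p: "1 \<le> p"
  shows "wasserstein p (law f) (law (fit p L n X)) \<le>
    ennreal (Cm p (m / 2)) * (err p L n f X + err p L n f X + ennreal (1 / real (Suc n)))"
proof -
  let ?co = "inner_L2 f" and ?e = "\<lambda>b. emp n b X" and ?t = "est p L n X" and ?g = "\<lambda>k. inner_L2 (cand k)"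
  have fi: "integrable cubeM f" using f(1) by (simp add: is_density_def)
  have lin: "inner_L2 (\<lambda>x. f x - cand k x) b = ?co b - ?g k b" if "continuous_on Cube b" for k b
  proof -
    have "integrable cubeM (cand k)" using cand_props(2) by (simp add: is_density_def)
    then have int: "integrable cubeM (\<lambda>x. f x * b x)" "integrable cubeM (\<lambda>x. cand k x * b x)"
      using fi that by (auto intro!: integrable_mult_cont)
    then show ?thesis by (simp add: inner_L2_def left_diff_distrib)
  qed
  have eq: "NN p (inner_L2 (\<lambda>x. f x - cand k x)) (\<lambda>_. inner_L2 (\<lambda>x. f x - cand k x)) =
      NN p (\<lambda>b. ?co b - ?g k b) (\<lambda>_ b. ?co b - ?g k b)" for k
    by (intro NN_cong lin cont_basis)
  have 1: "NN p (\<lambda>b. ?co b - ?g k b) (\<lambda>_ b. ?co b - ?g k b) \<le> err p L n f X + obj p L n k X" for k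
  proof -
    have "NN p (\<lambda>b. (?co b - ?e b) + (?e b - ?g k b)) (\<lambda>j b. (?co b - ?t j b) + (?t j b - ?g k b)) \<le>
      NN p (\<lambda>b. ?co b - ?e b) (\<lambda>j b. ?co b - ?t j b) + NN p (\<lambda>b. ?e b - ?g k b) (\<lambda>j b. ?t j b - ?g k b)"
      by (rule NN_triangle[OF p])
    also have "NN p (\<lambda>b. ?co b - ?e b) (\<lambda>j b. ?co b - ?t j b) = err p L n f X"
      unfolding err_def by (rule NN_minus_commute)
    finally show ?thesis by (simp add: obj_def)
  qed
  have 2: "obj p L n k X \<le> err p L n f X + NN p (\<lambda>b. ?co b - ?g k b) (\<lambda>_ b. ?co b - ?g k b)" for k
  proof -
    have "NN p (\<lambda>b. (?e b - ?co b) + (?co b - ?g k b)) (\<lambda>j b. (?t j b - ?co b) + (?co b - ?g k b)) \<le>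
      NN p (\<lambda>b. ?e b - ?co b) (\<lambda>j b. ?t j b - ?co b) + NN p (\<lambda>b. ?co b - ?g k b) (\<lambda>_ b. ?co b - ?g k b)"
      by (rule NN_triangle[OF p])
    then show ?thesis by (simp add: obj_def err_def)
  qed
  have nn: "AE x in cubeM. 0 \<le> f x" using f(1) by (simp add: is_density_def)
  \<comment> \<open>Compares the selected candidate with one close to \<open>f\<close> in the
    p-norm; clamping at 0 is compatible since \<open>f\<close> is nonnegative.\<close>
  have 3: "obj p L n (sel p L n X) X \<le> err p L n f X + ennreal (1 / real (Suc n))"
  proof (rule ennreal_le_epsilon)
    fix \<epsilon> :: real assume \<epsilon>: "0 < \<epsilon>"
    define e where "e = \<epsilon> / (Cn + 1)"
    have Cn1: "0 < Cn + 1" using Cn_nonneg by linarith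
    have e: "0 < e" using \<epsilon> Cn1 by (simp add: e_def)
    have "Cn * e \<le> (Cn + 1) * e" using e by (simp add: algebra_simps)
    also have "\<dots> = \<epsilon>" using Cn1 by (simp add: e_def)
    finally have Ce: "Cn * e \<le> \<epsilon>" .
    obtain g where g: "g \<in> candidates 0" "lpb p (\<lambda>x. f x - g x) e"
      using candidates_dense[OF f(1,2) nn order_refl F p e] by blast
    obtain k where k: "g = cand k" unfolding cand_def using from_nat_into_surj[OF countable_candidates g(1)] by metis
    have "NN p (\<lambda>b. ?co b - ?g k b) (\<lambda>_ b. ?co b - ?g k b) \<le> ennreal (Cn * e)"
      unfolding eq[symmetric] by (rule NN_le_Lp[OF g(2)[unfolded k] p less_imp_le[OF e]])
    also have "\<dots> \<le> ennreal \<epsilon>" by (rule ennreal_leI[OF Ce])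
    finally have N: "NN p (\<lambda>b. ?co b - ?g k b) (\<lambda>_ b. ?co b - ?g k b) \<le> ennreal \<epsilon>" .
    have "obj p L n (sel p L n X) X \<le> obj p L n k X + ennreal (1 / real (Suc n))" by (rule sel_le)
    also have "\<dots> \<le> (err p L n f X + ennreal \<epsilon>) + ennreal (1 / real (Suc n))"
      by (intro add_right_mono order_trans[OF 2] add_left_mono N)
    finally show "obj p L n (sel p L n X) X \<le> err p L n f X + ennreal (1 / real (Suc n)) + ennreal \<epsilon>"
      by (simp only: add_ac)
  qed
  have "wasserstein p (law f) (law (fit p L n X)) \<le> ennreal (Cm p (m / 2)) *
      NN p (\<lambda>b. ?co b - ?g (sel p L n X) b) (\<lambda>_ b. ?co b - ?g (sel p L n X) b)"
    unfolding fit_def eq[symmetric] by (rule wasserstein_le_NN[OF f F p cand_props])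
  also have "\<dots> \<le> ennreal (Cm p (m / 2)) * (err p L n f X + (err p L n f X + ennreal (1 / real (Suc n))))"
    by (intro mult_left_mono order_trans[OF 1] add_left_mono 3) auto
  finally show ?thesis by (simp only: add.assoc)
qed

end

section \<open>Risk bounds\<close>

context wavelet_frame
begin

lemma tail_sum:
  fixes s :: real
  assumes s: "0 \<le> s"
  shows "(\<Sum>j. ennreal (if k \<le> j then 2 powr (- (real j * (1 + s))) else 0)) \<le> ennreal (2 * 2 powr (- (real k * (1 + s))))"
proof -
  define g where "g = (\<lambda>j. if k \<le> j then 2 powr (- (real j * (1 + s))) else 0)"
  define A where "A = 2 powr (- (real k * (1 + s)))"
  define x where "x = 2 powr (- (1 + s))"
  have "x \<le> 2 powr (- 1)" unfolding x_def using s by (intro powr_mono) auto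
  then have x: "0 < x" "x \<le> 1 / 2" by (simp_all add: x_def powr_minus_divide)
  have shift: "g (i + k) = A * x ^ i" for i
    unfolding g_def A_def x_def by (simp add: powr_powr powr_add[symmetric] algebra_simps flip: powr_realpow)
  have "(\<lambda>i. g (i + k)) sums (A * (1 / (1 - x)))" unfolding shift using x by (intro sums_mult geometric_sums) auto
  moreover have "sum g {..<k} = 0" by (simp add: g_def)
  ultimately have "g sums (A * (1 / (1 - x)))" by (simp add: sums_iff_shift)
  moreover have "0 \<le> g j" for j by (simp add: g_def)
  ultimately have "(\<Sum>j. ennreal (g j)) = ennreal (A * (1 / (1 - x)))"
    using x by (intro sums_unique[symmetric]) (simp add: sums_ennreal A_def)
  also have "\<dots> \<le> ennreal (A * 2)" using x by (intro ennreal_leI mult_left_mono) (auto simp: A_def field_simps)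
  finally show ?thesis by (simp add: g_def A_def mult.commute)
qed

text \<open>The powers of \<open>Hn j\<close> in the weight and in the Besov bound cancel, so
  smoothness \<open>s\<close> yields decay of order \<open>1 + s\<close> in the dual norm.\<close>

lemma bias_level:
  assumes "besov_ball p L s f"
  shows "wt p j * lpn p (\<Psi> j) (inner_L2 f) \<le> L * 2 powr (- (real j * (1 + s)))"
proof -
  have "wt p j * lpn p (\<Psi> j) (inner_L2 f) \<le> wt p j * (L * 2 powr (- real j * s) * Hn j powr (2 / p - 1))"
    using assms by (intro mult_left_mono) (auto simp: besov_ball_def)
  also have "\<dots> = L * (2 powr (- real j * s) / 2 ^ j) * (Hn j powr (1 - 2 / p) * Hn j powr (2 / p - 1))"
    by (simp add: wt_def)
  also have "Hn j powr (1 - 2 / p) * Hn j powr (2 / p - 1) = 1" by (simp flip: powr_add)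
  also have "2 powr (- real j * s) / 2 ^ j = 2 powr (- (real j * (1 + s)))"
  proof -
    have "- (real j * (1 + s)) = - real j * s - real j" by (simp add: algebra_simps)
    then show ?thesis by (simp only: powr_diff) (simp add: powr_realpow)
  qed
  finally show ?thesis by simp
qed

text \<open>The split into noise and bias at an arbitrary level \<open>k\<close>. Above it the error
  only has to be at most the norm of the true coefficients, which sum up geometrically.\<close>

lemma err_split:
  assumes p: "1 \<le> p" and L: "0 \<le> L" and s: "0 \<le> s" and f: "besov_ball p L s f"
    and low: "\<And>j. j < k \<Longrightarrow> lpn p (\<Psi> j) (\<lambda>b. est p L n X j b - inner_L2 f b) \<le> a j"
    and high: "\<And>j. k \<le> j \<Longrightarrow> lpn p (\<Psi> j) (\<lambda>b. est p L n X j b - inner_L2 f b) \<le> lpn p (\<Psi> j) (inner_L2 f)"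
  shows "err p L n f X \<le> ennreal (lpn p \<Phi> (\<lambda>b. emp n b X - inner_L2 f b)) +
    (\<Sum>j<k. ennreal (wt p j * a j)) + ennreal (2 * L * 2 powr (- (real k * (1 + s))))"
proof -
  let ?g = "\<lambda>j. if k \<le> j then 2 powr (- (real j * (1 + s))) else 0"
  have "(\<Sum>j. ennreal (wt p j * lpn p (\<Psi> j) (\<lambda>b. est p L n X j b - inner_L2 f b))) \<le>
      (\<Sum>j. (if j < k then ennreal (wt p j * a j) else 0) + ennreal L * ennreal (?g j))"
  proof (rule suminf_le)
    fix j
    show "ennreal (wt p j * lpn p (\<Psi> j) (\<lambda>b. est p L n X j b - inner_L2 f b)) \<le>
        (if j < k then ennreal (wt p j * a j) else 0) + ennreal L * ennreal (?g j)"
    proof (cases "j < k")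
      case True
      then show ?thesis using low[OF True] by (simp add: ennreal_leI mult_left_mono)
    next
      case False
      have "wt p j * lpn p (\<Psi> j) (\<lambda>b. est p L n X j b - inner_L2 f b) \<le> wt p j * lpn p (\<Psi> j) (inner_L2 f)"
        using high[of j] False by (intro mult_left_mono) auto
      also have "\<dots> \<le> L * 2 powr (- (real j * (1 + s)))" by (rule bias_level[OF f])
      finally show ?thesis using False L by (simp add: ennreal_leI flip: ennreal_mult)
    qed
  qed auto
  also have "\<dots> = (\<Sum>j. if j < k then ennreal (wt p j * a j) else 0) + ennreal L * (\<Sum>j. ennreal (?g j))"
    by (subst suminf_add[symmetric]) (auto simp: ennreal_suminf_cmult)
  also have "(\<Sum>j. if j < k then ennreal (wt p j * a j) else 0) = (\<Sum>j<k. ennreal (wt p j * a j))"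
    by (subst suminf_finite[of "{..<k}"]) auto
  also have "(\<Sum>j<k. ennreal (wt p j * a j)) + ennreal L * (\<Sum>j. ennreal (?g j)) \<le> (\<Sum>j<k. ennreal (wt p j * a j)) + ennreal (2 * L * 2 powr (- (real k * (1 + s))))"
  proof (rule add_left_mono)
    have "ennreal L * (\<Sum>j. ennreal (?g j)) \<le> ennreal L * ennreal (2 * 2 powr (- (real k * (1 + s))))"
      by (intro mult_left_mono tail_sum s) auto
    also have "\<dots> = ennreal (2 * L * 2 powr (- (real k * (1 + s))))"
      using L by (simp add: mult_ac flip: ennreal_mult)
    finally show "ennreal L * (\<Sum>j. ennreal (?g j)) \<le> ennreal (2 * L * 2 powr (- (real k * (1 + s))))" .
  qed
  finally show ?thesis unfolding err_def NN_def add.assoc by (rule add_left_mono)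
qed

definition Mc :: "real \<Rightarrow> real" where
  "Mc p = 2 * (2 * p powr p * exp (exp (2 * C))) powr (1 / p)"

lemma Mc_nonneg [simp]: "0 \<le> Mc p" by (simp add: Mc_def)

definition Pc :: "real \<Rightarrow> real" where
  "Pc p = Mc p * lpn p \<Phi> (\<lambda>_. 1 + C\<^sup>2)"

lemma Pc_nonneg [simp]: "0 \<le> Pc p" by (simp add: Pc_def)

lemma noise_\<Phi>:
  assumes f: "is_density f" and n: "1 \<le> n" and p: "1 \<le> p"
  shows "(\<integral>\<^sup>+X. ennreal (lpn p \<Phi> (\<lambda>b. emp n b X - inner_L2 f b)) \<partial>sampleM f n) \<le> ennreal (Pc p / sqrt (real n))"
proof -
  have "(\<integral>\<^sup>+X. ennreal (lpn p \<Phi> (\<lambda>b. emp n b X - inner_L2 f b)) \<partial>sampleM f n) \<le>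
      ennreal (Mc p * lpn p \<Phi> (\<lambda>b. 1 + inner_L2 f (\<lambda>x. (b x)\<^sup>2)) / sqrt (real n))"
    unfolding Mc_def using sampling_basis[OF f n] by (intro lpn_moment fin_\<Phi> p) (auto simp: Bk_def)
  also have "\<dots> \<le> ennreal (Mc p * lpn p \<Phi> (\<lambda>_. 1 + C\<^sup>2) / sqrt (real n))"
  proof (intro ennreal_leI divide_right_mono mult_left_mono lpn_mono)
    fix b assume b: "b \<in> \<Phi>"
    have fi: "integrable cubeM f" "AE x in cubeM. 0 \<le> f x" "(\<integral>x. f x \<partial>cubeM) = 1" using f by (auto simp: is_density_def)
    have "vr f b \<le> (\<integral>x. f x * C\<^sup>2 \<partial>cubeM)" unfolding vr_def inner_L2_def
    proof (rule integral_mono_AE)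
      show "integrable cubeM (\<lambda>x. f x * (b x)\<^sup>2)" using fi(1) cont_basis(1)[OF b] by (auto intro!: integrable_mult_cont continuous_intros)
      show "AE x in cubeM. f x * (b x)\<^sup>2 \<le> f x * C\<^sup>2"
        using fi(2) AE_space
      proof eventually_elim
        case (elim x)
        then have "(b x)\<^sup>2 \<le> C\<^sup>2" using \<Phi>_bound[OF b, of x] abs_le_square_iff[of "b x" C] by simp
        then show ?case using elim by (intro mult_left_mono)
      qed
    qed (use fi in simp)
    also have "\<dots> = C\<^sup>2" using fi by simp
    finally show "\<bar>1 + inner_L2 f (\<lambda>x. (b x)\<^sup>2)\<bar> \<le> \<bar>1 + C\<^sup>2\<bar>" using vr_nonneg[OF f, of b] by (simp add: vr_def)
  qed (use p in auto)
  finally show ?thesis by (simp add: Pc_def)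
qed

text \<open>The exponent \<open>p\<close> cancels: the weight times \<open>Hn j powr (2 / p)\<close>
  is \<open>Hn j / 2 ^ j\<close>. Its growth rate \<open>d / 2 - 1\<close> in \<open>j\<close>, with
  \<open>d\<close> the dimension, separates the three cases of the rate.\<close>

lemma noise_\<Psi>:
  assumes f: "besov_ball p L 0 f" and L: "0 \<le> L" and n: "1 \<le> n" and p: "1 \<le> p" and j: "j \<le> Jn n"
  shows "(\<integral>\<^sup>+X. ennreal (wt p j * lpn p (\<Psi> j) (\<lambda>b. emp n b X - inner_L2 f b)) \<partial>sampleM f n) \<le>
    ennreal (Mc p * Cv L * (real j + 1) * (Hn j / 2 ^ j) / sqrt (real n))"
proof -
  have fd: "is_density f" using f by (simp add: besov_ball_def)
  have Bk: "b \<in> Bk (Suc (Jn n))" if "b \<in> \<Psi> j" for b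
    using that j by (auto simp: Bk_def less_Suc_eq_le)
  have "(\<integral>\<^sup>+X. ennreal (wt p j * lpn p (\<Psi> j) (\<lambda>b. emp n b X - inner_L2 f b)) \<partial>sampleM f n) =
      ennreal (wt p j) * (\<integral>\<^sup>+X. ennreal (lpn p (\<Psi> j) (\<lambda>b. emp n b X - inner_L2 f b)) \<partial>sampleM f n)"
  proof (subst nn_integral_cmult[symmetric])
    have "(\<lambda>X. lpn p (\<Psi> j) (\<lambda>b. emp n b X - inner_L2 f b)) \<in> borel_measurable (sampleM f n)"
      unfolding measurable_cong_sets[OF sets_sampleM refl]
      by (intro measurable_lpn borel_measurable_diff measurable_emp meas_basis(2) borel_measurable_const)
    then show "(\<lambda>X. ennreal (lpn p (\<Psi> j) (\<lambda>b. emp n b X - inner_L2 f b))) \<in> borel_measurable (sampleM f n)"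
      by (rule measurable_compose[OF _ measurable_ennreal])
  qed (simp add: ennreal_mult)
  also have "\<dots> \<le> ennreal (wt p j) * ennreal (Mc p * lpn p (\<Psi> j) (\<lambda>b. 1 + vr f b) / sqrt (real n))"
    unfolding Mc_def vr_def using sampling_basis[OF fd n, OF Bk]
    by (intro mult_left_mono lpn_moment finite_\<Psi> p) auto
  also have "\<dots> \<le> ennreal (wt p j) * ennreal (Mc p * (Cv L * (real j + 1) * Hn j powr (2 / p)) / sqrt (real n))"
    by (intro mult_left_mono ennreal_leI divide_right_mono variance_level p L f) auto
  also have "\<dots> = ennreal (wt p j * (Mc p * (Cv L * (real j + 1) * Hn j powr (2 / p)) / sqrt (real n)))"
    by (rule ennreal_mult'[symmetric]) simp
  also have "wt p j * (Mc p * (Cv L * (real j + 1) * Hn j powr (2 / p)) / sqrt (real n)) =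
      Mc p * Cv L * (real j + 1) * ((Hn j powr (1 - 2 / p) * Hn j powr (2 / p)) / 2 ^ j) / sqrt (real n)"
    by (simp add: wt_def)
  also have "Hn j powr (1 - 2 / p) * Hn j powr (2 / p) = Hn j" by (simp flip: powr_add)
  finally show ?thesis .
qed

lemma Cv_nonneg: "0 \<le> L \<Longrightarrow> 0 \<le> Cv L"
  unfolding Cv_def by (intro add_nonneg_nonneg mult_nonneg_nonneg) auto

section \<open>Dimensions one and two\<close>

lemma two_pow_Jn:
  assumes "CARD('d) \<le> 2" "1 \<le> n"
  shows "sqrt (real n) \<le> 2 ^ Suc (Jn n)"
proof -
  have "real n \<le> (2 ^ Suc (Jn n)) ^ CARD('d)" unfolding two_pow_card using Jn_gt[OF assms(2)] by simp
  also have "\<dots> \<le> ((2::real) ^ Suc (Jn n)) ^ 2" using assms by (intro power_increasing one_le_power) auto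
  finally show ?thesis by (intro real_le_lsqrt) auto
qed

text \<open>In dimension two \<open>Hn j / 2 ^ j = 1\<close>, and about \<open>ln n\<close> levels
  with a factor of the same order give the squared logarithm; in dimension one the factors decay
  geometrically and the derivative of the geometric series bounds the sum.\<close>

lemma level_sum_low_dimension:
  assumes d: "CARD('d) \<le> 2" and n: "2 \<le> n"
  shows "(\<Sum>j<Suc (Jn n). (real j + 1) * (Hn j / 2 ^ j)) \<le>
    (if CARD('d) = 2 then 16 * (ln (real n))\<^sup>2 else 1 / (1 - 2 powr (- 1 / 2))\<^sup>2)"
proof (cases "CARD('d) = 2")
  case True
  have H: "Hn j = 2 ^ j" for j by (simp add: Hn_def True powr_realpow)
  have "(\<Sum>j<Suc (Jn n). (real j + 1) * (Hn j / 2 ^ j)) \<le> (\<Sum>j<Suc (Jn n). real (Jn n) + 1)"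
    by (intro sum_mono) (auto simp: H)
  also have "\<dots> = (real (Jn n) + 1)\<^sup>2" by (simp add: power2_eq_square algebra_simps)
  also have "\<dots> \<le> (4 * ln (real n))\<^sup>2" using Jn_ln[OF n] by (intro power_mono) auto
  finally show ?thesis by (simp add: True power_mult_distrib)
next
  case False
  moreover have "CARD('d) \<noteq> 0" by simp
  ultimately have d1: "CARD('d) = 1" using d by linarith
  define x where "x = 2 powr (- 1 / 2 :: real)"
  have "x < 2 powr 0" unfolding x_def by (intro powr_less_mono) auto
  then have x: "0 < x" "x < 1" by (auto simp: x_def)
  have H: "Hn j / 2 ^ j = x ^ j" for j
    by (simp add: Hn_def d1 x_def powr_powr powr_diff[symmetric] flip: powr_realpow)
  have "(\<Sum>j<Suc (Jn n). (real j + 1) * (Hn j / 2 ^ j)) = (\<Sum>j<Suc (Jn n). of_nat (Suc j) * x ^ j)"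
    by (simp add: H add.commute del: sum.lessThan_Suc)
  also have "\<dots> \<le> 1 / (1 - x)\<^sup>2"
  proof -
    have S: "(\<lambda>j. of_nat (Suc j) * x ^ j) sums (1 / (1 - x)\<^sup>2)" using x by (intro geometric_deriv_sums) auto
    show ?thesis unfolding sums_unique[OF S]
      by (rule sum_le_suminf[OF sums_summable[OF S]]) (use x in auto)
  qed
  finally show ?thesis using False by (simp add: x_def)
qed

theorem err_low_dimension:
  assumes d: "CARD('d) \<le> 2" and p: "1 \<le> p" and L: "0 \<le> L" and s: "0 \<le> s" and f: "besov_ball p L s f" and n: "2 \<le> n"
  shows "(\<integral>\<^sup>+X. err p L n f X \<partial>sampleM f n) \<le>
    ennreal ((Pc p + Mc p * Cv L * (if CARD('d) = 2 then 16 * (ln (real n))\<^sup>2 else 1 / (1 - 2 powr (- 1 / 2))\<^sup>2) + 2 * L) / sqrt (real n))"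
proof -
  let ?N = "\<lambda>j X. lpn p (\<Psi> j) (\<lambda>b. emp n b X - inner_L2 f b)"
  let ?J = "Suc (Jn n)"
  define K where "K = (if CARD('d) = 2 then 16 * (ln (real n))\<^sup>2 else 1 / (1 - 2 powr (- 1 / 2))\<^sup>2)"
  have K0: "0 \<le> K" by (simp add: K_def)
  have n1: "1 \<le> n" using n by simp
  have fd: "is_density f" using f by (simp add: besov_ball_def)
  interpret P: prob_space "sampleM f n" by (rule prob_space_sampleM[OF fd])
  have f0: "besov_ball p L 0 f" by (rule besov_ball_0[OF f s L])
  \<comment> \<open>In these dimensions \<open>2 ^ Suc (Jn n)\<close> is at least
    \<open>sqrt n\<close>, so the levels that are left out cost \<open>1 / sqrt n\<close> already
    for smoothness zero; hence all levels up to \<open>Jn n\<close> are kept unthresholded.\<close>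
  have tail: "2 * L * 2 powr (- (real ?J * (1 + s))) \<le> 2 * L / sqrt (real n)"
  proof -
    have "2 powr (- (real ?J * (1 + s))) \<le> 2 powr (- real ?J)" using s by (intro powr_mono) (auto simp: algebra_simps)
    also have "\<dots> = 1 / 2 ^ ?J" by (simp add: powr_minus_divide powr_realpow del: power_Suc of_nat_Suc)
    also have "\<dots> \<le> 1 / sqrt (real n)" using two_pow_Jn[OF d n1] n by (intro divide_left_mono) auto
    finally show ?thesis using L mult_left_mono[of "2 powr (- (real ?J * (1 + s)))" "1 / sqrt (real n)" "2 * L"] by simp
  qed
  have mN: "(\<lambda>X. lpn p S (\<lambda>b. emp n b X - inner_L2 f b)) \<in> borel_measurable (sampleM f n)"
    if "\<And>b. b \<in> S \<Longrightarrow> b \<in> borel_measurable cubeM" for S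
    unfolding measurable_cong_sets[OF sets_sampleM refl]
    by (intro measurable_lpn borel_measurable_diff measurable_emp that borel_measurable_const)
  note [measurable] = mN[of \<Phi>, OF meas_basis(1)] mN[of "\<Psi> _", OF meas_basis(2)]
  have levels: "(\<Sum>j<?J. \<integral>\<^sup>+X. ennreal (wt p j * ?N j X) \<partial>sampleM f n) \<le> ennreal (Mc p * Cv L * K / sqrt (real n))"
  proof -
    have "(\<Sum>j<?J. \<integral>\<^sup>+X. ennreal (wt p j * ?N j X) \<partial>sampleM f n) \<le>
        (\<Sum>j<?J. ennreal (Mc p * Cv L * (real j + 1) * (Hn j / 2 ^ j) / sqrt (real n)))"
      by (intro sum_mono noise_\<Psi> n1 p f0 L) auto
    also have "\<dots> = ennreal (\<Sum>j<?J. Mc p * Cv L * (real j + 1) * (Hn j / 2 ^ j) / sqrt (real n))"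
      using Cv_nonneg[OF L] by (intro sum_ennreal) auto
    also have "(\<Sum>j<?J. Mc p * Cv L * (real j + 1) * (Hn j / 2 ^ j) / sqrt (real n)) =
        Mc p * Cv L * (\<Sum>j<?J. (real j + 1) * (Hn j / 2 ^ j)) / sqrt (real n)"
      by (simp only: sum_distrib_left sum_divide_distrib mult.assoc)
    also have "ennreal \<dots> \<le> ennreal (Mc p * Cv L * K / sqrt (real n))"
      unfolding K_def using Cv_nonneg[OF L]
      by (intro ennreal_leI divide_right_mono mult_left_mono level_sum_low_dimension d n) auto
    finally show ?thesis .
  qed
  have "(\<integral>\<^sup>+X. err p L n f X \<partial>sampleM f n) \<le>
      (\<integral>\<^sup>+X. ennreal (lpn p \<Phi> (\<lambda>b. emp n b X - inner_L2 f b)) + (\<Sum>j<?J. ennreal (wt p j * ?N j X)) +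
        ennreal (2 * L * 2 powr (- (real ?J * (1 + s)))) \<partial>sampleM f n)"
  proof (rule nn_integral_mono)
    fix X
    have est: "est p L n X j b = (if Jn n < j then 0 else emp n b X)" for j b using d by (simp add: est_def)
    show "err p L n f X \<le> ennreal (lpn p \<Phi> (\<lambda>b. emp n b X - inner_L2 f b)) + (\<Sum>j<?J. ennreal (wt p j * ?N j X)) +
        ennreal (2 * L * 2 powr (- (real ?J * (1 + s))))"
      by (rule err_split[OF p L s f]) (auto simp: est lpn_uminus)
  qed
  also have "\<dots> = (\<integral>\<^sup>+X. ennreal (lpn p \<Phi> (\<lambda>b. emp n b X - inner_L2 f b)) \<partial>sampleM f n) +
      (\<Sum>j<?J. \<integral>\<^sup>+X. ennreal (wt p j * ?N j X) \<partial>sampleM f n) + ennreal (2 * L * 2 powr (- (real ?J * (1 + s))))"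
    by (subst nn_integral_add, measurable, subst nn_integral_add, measurable, subst nn_integral_sum, measurable)
      (simp add: P.emeasure_space_1)
  also have "\<dots> \<le> ennreal (Pc p / sqrt (real n)) + ennreal (Mc p * Cv L * K / sqrt (real n)) + ennreal (2 * L / sqrt (real n))"
    by (intro add_mono noise_\<Phi> fd n1 p ennreal_leI tail levels)
  also have "\<dots> = ennreal ((Pc p + Mc p * Cv L * K + 2 * L) / sqrt (real n))"
  proof -
    have 0: "0 \<le> Pc p / sqrt (real n)" "0 \<le> Mc p * Cv L * K / sqrt (real n)" "0 \<le> 2 * L / sqrt (real n)"
      using L Cv_nonneg[OF L] K0 by auto
    show ?thesis by (simp only: ennreal_plus[symmetric] 0 add_nonneg_nonneg add_divide_distrib)
  qed
  finally show ?thesis by (simp only: K_def)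
qed

section \<open>Dimension three and higher\<close>

definition bad :: "nat \<Rightarrow> (real ^ 'd \<Rightarrow> real) \<Rightarrow> (nat \<Rightarrow> real ^ 'd) set" where
  "bad n f = (\<Union>b\<in>Bk (Suc (Jn n)). {X\<in>space (sampleM f n).
     vr f b * exp (2 * C) + 2 * ln (real n) < \<bar>sqrt (real n) * (emp n b X - inner_L2 f b)\<bar>})"

lemma sum_Hn_sq: "(\<Sum>j<Suc J. (Hn j)\<^sup>2) \<le> 2 * (Hn J)\<^sup>2"
proof (induction J)
  case (Suc J)
  have "2 * (Hn J)\<^sup>2 \<le> (Hn (Suc J))\<^sup>2"
  proof -
    have "(2::real) ^ 1 \<le> 2 ^ CARD('d)" by (intro power_increasing) (auto simp: Suc_leI)
    then have "2 * (2 ^ J) ^ CARD('d) \<le> ((2::real) ^ Suc J) ^ CARD('d)"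
      by (simp add: power_mult_distrib mult_right_mono)
    then show ?thesis by (simp only: two_pow_card)
  qed
  then show ?case using Suc.IH by simp
qed simp

lemma card_Bk: "1 \<le> n \<Longrightarrow> real (card (Bk (Suc (Jn n)))) \<le> real (card \<Phi>) + 2 * C ^ 3 * real n"
proof -
  assume n: "1 \<le> n"
  have "real (card (Bk (Suc (Jn n)))) = real (card \<Phi>) + (\<Sum>j<Suc (Jn n). real (card (\<Psi> j)))"
    using sum_Bk[of "\<lambda>_. 1 :: real" "Suc (Jn n)"] by simp
  also have "(\<Sum>j<Suc (Jn n). real (card (\<Psi> j))) \<le> (\<Sum>j<Suc (Jn n). C ^ 3 * (Hn j)\<^sup>2)"
    by (intro sum_mono card_\<Psi>)
  also have "\<dots> = C ^ 3 * (\<Sum>j<Suc (Jn n). (Hn j)\<^sup>2)" by (rule sum_distrib_left[symmetric])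
  also have "\<dots> \<le> C ^ 3 * (2 * real n)"
    using sum_Hn_sq[of "Jn n"] Jn_le[OF n] by (intro mult_left_mono) auto
  finally show ?thesis by (simp add: mult_ac)
qed

text \<open>A union bound over the coefficients up to level \<open>Jn n\<close>. Their number is of
  order \<open>n\<close>, and the deviation \<open>2 * ln n\<close> makes each failure have
  probability at most 2 divided by the square of \<open>n\<close>.\<close>

lemma bad_sets:
  assumes f: "is_density f" and n: "1 \<le> n"
  shows "bad n f \<in> sets (sampleM f n)"
    and "emeasure (sampleM f n) (bad n f) \<le> ennreal ((2 * real (card \<Phi>) + 4 * C ^ 3) / real n)"
proof -
  let ?B = "\<lambda>b. {X\<in>space (sampleM f n). vr f b * exp (2 * C) + 2 * ln (real n) < \<bar>sqrt (real n) * (emp n b X - inner_L2 f b)\<bar>}"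
  have B: "?B b \<in> sets (sampleM f n)" if "b \<in> Bk (Suc (Jn n))" for b
  proof -
    have "(\<lambda>X. \<bar>sqrt (real n) * (emp n b X - inner_L2 f b)\<bar>) \<in> borel_measurable (sampleM f n)"
      unfolding measurable_cong_sets[OF sets_sampleM refl]
      by (intro borel_measurable_abs borel_measurable_times borel_measurable_diff borel_measurable_const measurable_emp
          borel_measurable_cubeM_cont Bk_cont[OF that])
    then show ?thesis by (intro borel_measurable_less borel_measurable_const)
  qed
  have mB: "emeasure (sampleM f n) (?B b) \<le> ennreal (2 * exp (- (2 * ln (real n))))" if "b \<in> Bk (Suc (Jn n))" for b
  proof -
    interpret S: sampling f b n C by (rule sampling_basis[OF f n that])
    show ?thesis using S.chernoff[of "2 * ln (real n)"] by (simp add: S.Z_def S.v_def S.\<beta>_def vr_def)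
  qed
  show "bad n f \<in> sets (sampleM f n)" unfolding bad_def by (intro sets.finite_UN finite_Bk B)
  have "emeasure (sampleM f n) (bad n f) \<le> (\<Sum>b\<in>Bk (Suc (Jn n)). emeasure (sampleM f n) (?B b))"
    unfolding bad_def by (rule emeasure_subadditive_finite[OF finite_Bk]) (rule image_subsetI, rule B)
  also have "\<dots> \<le> (\<Sum>b\<in>Bk (Suc (Jn n)). ennreal (2 * exp (- (2 * ln (real n)))))"
    by (intro sum_mono mB)
  also have "\<dots> = ennreal (real (card (Bk (Suc (Jn n)))) * (2 * exp (- (2 * ln (real n)))))"
    by (subst sum_ennreal) auto
  also have "\<dots> \<le> ennreal ((2 * real (card \<Phi>) + 4 * C ^ 3) / real n)"
  proof (rule ennreal_leI)
    have "exp (ln (real n)) = real n" using n by simp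
    then have "exp (2 * ln (real n)) = real n * real n" by (simp only: mult_2 exp_add)
    then have e: "exp (- (2 * ln (real n))) = 1 / (real n * real n)"
      by (simp only: exp_minus inverse_eq_divide)
    have "real (card (Bk (Suc (Jn n)))) * (2 * exp (- (2 * ln (real n)))) \<le>
        (real (card \<Phi>) * real n + 2 * C ^ 3 * real n) * (2 * exp (- (2 * ln (real n))))"
    proof (rule mult_right_mono)
      have "real (card \<Phi>) * 1 \<le> real (card \<Phi>) * real n" using n by (intro mult_left_mono) auto
      then show "real (card (Bk (Suc (Jn n)))) \<le> real (card \<Phi>) * real n + 2 * C ^ 3 * real n"
        using card_Bk[OF n] by linarith
    qed simp
    also have "\<dots> = (2 * real (card \<Phi>) + 4 * C ^ 3) / real n"
      unfolding e using n by (simp add: field_simps)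
    finally show "real (card (Bk (Suc (Jn n)))) * (2 * exp (- (2 * ln (real n)))) \<le> (2 * real (card \<Phi>) + 4 * C ^ 3) / real n" .
  qed
  finally show "emeasure (sampleM f n) (bad n f) \<le> ennreal ((2 * real (card \<Phi>) + 4 * C ^ 3) / real n)" .
qed

lemma Kt_nonneg: "0 \<le> L \<Longrightarrow> 0 \<le> Kt L"
  unfolding Kt_def using Cv_nonneg by (intro add_nonneg_nonneg mult_nonneg_nonneg) auto

text \<open>Off the exceptional event each coefficient errs by at most a multiple of
  \<open>1 + vr f b\<close> plus a logarithm, over \<open>sqrt n\<close>. The norm over the level is
  then a matter of \<open>variance_level\<close> and of counting.\<close>

lemma noise_le_thr:
  assumes f: "besov_ball p L 0 f" and L: "0 \<le> L" and n: "2 \<le> n" and p: "1 \<le> p" and j: "j \<le> Jn n"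
    and X: "X \<in> space (sampleM f n)" "X \<notin> bad n f"
  shows "lpn p (\<Psi> j) (\<lambda>b. emp n b X - inner_L2 f b) \<le> thr p L n j"
proof -
  define E where "E = exp (2 * C)"
  define l where "l = ln (real n)"
  have fd: "is_density f" using f by (simp add: besov_ball_def)
  have n0: "0 < sqrt (real n)" using n by simp
  have l0: "0 \<le> l" using n by (simp add: l_def)
  have E0: "0 \<le> E" by (simp add: E_def)
  have pt: "\<bar>emp n b X - inner_L2 f b\<bar> \<le> \<bar>1 / sqrt (real n) * (E * (1 + vr f b) + 2 * l)\<bar>" if b: "b \<in> \<Psi> j" for b
  proof -
    have "b \<in> Bk (Suc (Jn n))" using b j by (auto simp: Bk_def less_Suc_eq_le)
    then have "\<not> vr f b * E + 2 * l < \<bar>sqrt (real n) * (emp n b X - inner_L2 f b)\<bar>"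
      using X unfolding bad_def E_def l_def by blast
    moreover have "\<bar>sqrt (real n) * (emp n b X - inner_L2 f b)\<bar> = sqrt (real n) * \<bar>emp n b X - inner_L2 f b\<bar>"
      using n0 by (simp add: abs_mult)
    moreover have "E * (1 + vr f b) = E + vr f b * E" by (simp add: algebra_simps)
    ultimately have "sqrt (real n) * \<bar>emp n b X - inner_L2 f b\<bar> \<le> E * (1 + vr f b) + 2 * l"
      using E0 by linarith
    then have "\<bar>emp n b X - inner_L2 f b\<bar> \<le> 1 / sqrt (real n) * (E * (1 + vr f b) + 2 * l)"
      using n0 by (simp add: field_simps)
    then show ?thesis by linarith
  qed
  have "lpn p (\<Psi> j) (\<lambda>b. emp n b X - inner_L2 f b) \<le> lpn p (\<Psi> j) (\<lambda>b. 1 / sqrt (real n) * (E * (1 + vr f b) + 2 * l))"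
    by (rule lpn_mono) (use p pt in auto)
  also have "\<dots> = \<bar>1 / sqrt (real n)\<bar> * lpn p (\<Psi> j) (\<lambda>b. E * (1 + vr f b) + 2 * l)"
    by (rule lpn_cmult) (use p in simp)
  also have "\<dots> \<le> \<bar>1 / sqrt (real n)\<bar> * (Kt L * Hn j powr (2 / p) * l)"
  proof (rule mult_left_mono)
    have "lpn p (\<Psi> j) (\<lambda>b. E * (1 + vr f b) + 2 * l) \<le> lpn p (\<Psi> j) (\<lambda>b. E * (1 + vr f b)) + lpn p (\<Psi> j) (\<lambda>b. 2 * l)"
      by (rule lpn_triangle[OF finite_\<Psi> p])
    also have "lpn p (\<Psi> j) (\<lambda>b. E * (1 + vr f b)) = \<bar>E\<bar> * lpn p (\<Psi> j) (\<lambda>b. 1 + vr f b)"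
      by (rule lpn_cmult) (use p in simp)
    also have "\<bar>E\<bar> * lpn p (\<Psi> j) (\<lambda>b. 1 + vr f b) + lpn p (\<Psi> j) (\<lambda>b. 2 * l) \<le>
        E * (Cv L * (4 * l) * Hn j powr (2 / p)) + 2 * l * C ^ 3 * Hn j powr (2 / p)"
    proof (rule add_mono)
      have "lpn p (\<Psi> j) (\<lambda>b. 1 + vr f b) \<le> Cv L * (real j + 1) * Hn j powr (2 / p)"
        by (rule variance_level[OF p L f])
      also have "\<dots> \<le> Cv L * (4 * l) * Hn j powr (2 / p)"
        using Jn_ln[OF n] j Cv_nonneg[OF L] by (intro mult_right_mono mult_left_mono) (auto simp: l_def)
      finally show "\<bar>E\<bar> * lpn p (\<Psi> j) (\<lambda>b. 1 + vr f b) \<le> E * (Cv L * (4 * l) * Hn j powr (2 / p))"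
        using E0 by (simp add: mult_left_mono)
      show "lpn p (\<Psi> j) (\<lambda>b. 2 * l) \<le> 2 * l * C ^ 3 * Hn j powr (2 / p)"
        by (rule lpn_const_level[OF p]) (use l0 in simp)
    qed
    also have "\<dots> = Kt L * Hn j powr (2 / p) * l" by (simp add: Kt_def E_def algebra_simps)
    finally show "lpn p (\<Psi> j) (\<lambda>b. E * (1 + vr f b) + 2 * l) \<le> Kt L * Hn j powr (2 / p) * l" .
  qed simp
  also have "\<dots> = thr p L n j" using n0 by (simp add: thr_def l_def)
  finally show ?thesis .
qed

text \<open>If a level is discarded, its true norm is at most threshold plus noise, three times
  \<open>thr\<close>. If it is kept, its true norm exceeds \<open>thr\<close>, hence the noise. So
  at every level the error obeys the noise bound and the bias bound simultaneously, as if the better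
  choice were known.\<close>

lemma thresholded_level:
  assumes f: "besov_ball p L 0 f" and L: "0 \<le> L" and n: "2 \<le> n" and p: "1 \<le> p" and j: "j \<le> Jn n"
    and X: "X \<in> space (sampleM f n)" "X \<notin> bad n f" and d: "3 \<le> CARD('d)"
  shows "lpn p (\<Psi> j) (\<lambda>b. est p L n X j b - inner_L2 f b) \<le> 3 * thr p L n j"
    and "lpn p (\<Psi> j) (\<lambda>b. est p L n X j b - inner_L2 f b) \<le> lpn p (\<Psi> j) (inner_L2 f)"
proof -
  let ?N = "lpn p (\<Psi> j) (\<lambda>b. emp n b X - inner_L2 f b)" and ?e = "lpn p (\<Psi> j) (\<lambda>b. emp n b X)"
    and ?c = "lpn p (\<Psi> j) (inner_L2 f)"
  have N: "?N \<le> thr p L n j" by (rule noise_le_thr[OF f L n p j X])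
  have ce: "?c \<le> ?e + ?N"
    using lpn_triangle[OF finite_\<Psi> p, of j "\<lambda>b. emp n b X" "\<lambda>b. inner_L2 f b - emp n b X"]
    by (simp add: lpn_minus_commute[of p _ "inner_L2 f"])
  have ec: "?e \<le> ?N + ?c"
    using lpn_triangle[OF finite_\<Psi> p, of j "\<lambda>b. emp n b X - inner_L2 f b" "inner_L2 f"] by simp
  have T0: "0 \<le> thr p L n j" using order_trans[OF lpn_nonneg N] .
  have est: "est p L n X j b = (if ?e \<le> 2 * thr p L n j then 0 else emp n b X)" for b
    using j d by (simp add: est_def)
  have *: "lpn p (\<Psi> j) (\<lambda>b. est p L n X j b - inner_L2 f b) = (if ?e \<le> 2 * thr p L n j then ?c else ?N)"
    unfolding est by (simp add: lpn_uminus)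
  show "lpn p (\<Psi> j) (\<lambda>b. est p L n X j b - inner_L2 f b) \<le> 3 * thr p L n j"
    unfolding * using N ce T0 by (auto split: if_split)
  show "lpn p (\<Psi> j) (\<lambda>b. est p L n X j b - inner_L2 f b) \<le> ?c"
    unfolding * using N ec by (auto split: if_split)
qed

text \<open>In dimension at least three the noise grows from level to level by a factor of at least
  \<open>sqrt 2 \<ge> 4 / 3\<close>, so the top level dominates.\<close>

lemma sum_geometric_top:
  fixes x :: real
  assumes "4 / 3 \<le> x"
  shows "(\<Sum>j<Suc J. x ^ j) \<le> 4 * x ^ J"
proof (induction J)
  case (Suc J)
  have "4 * x ^ J \<le> 3 * x * x ^ J" using assms by (intro mult_right_mono) auto
  then show ?case using Suc.IH by simp
qed simp

text \<open>The error is split at a level that depends on \<open>s\<close>, which the estimator does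
  not know: below it the noise bound of \<open>thresholded_level\<close> is used, above it the bias
  bound.\<close>

theorem err_high_dimension:
  assumes d: "3 \<le> CARD('d)" and p: "1 \<le> p" and L: "0 \<le> L" and s: "0 \<le> s" and f: "besov_ball p L s f"
    and n: "2 \<le> n" and X: "X \<in> space (sampleM f n)" "X \<notin> bad n f"
  shows "err p L n f X \<le> ennreal (lpn p \<Phi> (\<lambda>b. emp n b X - inner_L2 f b)) +
    ennreal ((12 * Kt L * ln (real n) + 2 * L) * real n powr (- ((1 + s) / (real CARD('d) + 2 * s))))"
proof -
  let ?d = "real CARD('d)"
  \<comment> \<open>The resolution at which noise and bias balance: both
    \<open>t powr (d / 2 - 1) / sqrt n\<close> and the bias equal \<open>t powr (- (1 + s))\<close>,
    with \<open>d\<close> the dimension.\<close>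
  define t where "t = real n powr (1 / (?d + 2 * s))"
  have ds: "0 < ?d + 2 * s" using d s by linarith
  have n1: "1 \<le> n" using n by simp
  have t1: "1 \<le> t" unfolding t_def using n s by (intro ge_one_powr_ge_zero) auto
  have rate: "real n powr (- ((1 + s) / (?d + 2 * s))) = t powr (- (1 + s))"
  proof -
    have "- ((1 + s) / (?d + 2 * s)) = 1 / (?d + 2 * s) * (- (1 + s))"
      by (simp only: mult_minus_right times_divide_eq_left mult_1)
    then show ?thesis by (simp only: t_def powr_powr)
  qed
  have sq: "sqrt (real n) = t powr (?d / 2 + s)"
  proof -
    have "1 / (?d + 2 * s) * (?d / 2 + s) = 1 / 2" using ds by (simp add: field_simps)
    then have "t powr (?d / 2 + s) = real n powr (1 / 2)" by (simp only: t_def powr_powr)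
    then show ?thesis by (simp add: powr_half_sqrt)
  qed
  \<comment> \<open>\<open>2 ^ k\<close> is \<open>t\<close> rounded down to a power of two. The
    split is made at \<open>Suc k\<close>, so that the noise uses \<open>2 ^ k \<le> t\<close> and
    the bias uses \<open>t \<le> 2 ^ Suc k\<close>.\<close>
  define k where "k = nat \<lfloor>log 2 t\<rfloor>"
  have l0: "0 \<le> log 2 t" using t1 by (simp add: zero_le_log_cancel_iff)
  have k1: "real k \<le> log 2 t" "log 2 t \<le> real (Suc k)" using l0 unfolding k_def by linarith+
  have "2 powr (log 2 t) = t" using t1 by simp
  then have k2: "2 powr real k \<le> t" "t \<le> 2 powr real (Suc k)"
    using powr_mono[OF k1(1), of 2] powr_mono[OF k1(2), of 2] by linarith+
  \<comment> \<open>The splitting level is among the estimated ones, since a nonnegative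
    \<open>s\<close> only lowers it.\<close>
  have kJ: "k \<le> Jn n"
  proof -
    have "log 2 t = log 2 (real n) / (?d + 2 * s)" using n by (simp add: t_def log_powr)
    also have "\<dots> \<le> log 2 (real n) / ?d" using n s ds by (intro divide_left_mono) auto
    finally show ?thesis unfolding k_def Jn_def by (intro nat_mono floor_mono)
  qed
  have f0: "besov_ball p L 0 f" by (rule besov_ball_0[OF f s L])
  have split: "err p L n f X \<le> ennreal (lpn p \<Phi> (\<lambda>b. emp n b X - inner_L2 f b)) +
    (\<Sum>j<Suc k. ennreal (wt p j * (3 * thr p L n j))) + ennreal (2 * L * 2 powr (- (real (Suc k) * (1 + s))))"
  proof (rule err_split[OF p L s f])
    show "lpn p (\<Psi> j) (\<lambda>b. est p L n X j b - inner_L2 f b) \<le> 3 * thr p L n j" if "j < Suc k" for j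
      using that kJ by (intro thresholded_level(1)[OF f0 L n p _ X d]) simp
    show "lpn p (\<Psi> j) (\<lambda>b. est p L n X j b - inner_L2 f b) \<le> lpn p (\<Psi> j) (inner_L2 f)" for j
    proof (cases "j \<le> Jn n")
      case True
      then show ?thesis by (rule thresholded_level(2)[OF f0 L n p _ X d])
    next
      case False
      then show ?thesis by (simp add: est_def lpn_uminus)
    qed
  qed
  define x where "x = 2 powr (?d / 2 - 1)"
  have "2 powr (1 / 2) \<le> x" unfolding x_def using d by (intro powr_mono) auto
  moreover have "(4 / 3)\<^sup>2 \<le> (2 :: real)" by (simp add: power2_eq_square)
  then have "4 / 3 \<le> sqrt 2" by (rule real_le_rsqrt)
  ultimately have x: "4 / 3 \<le> x" by (simp add: powr_half_sqrt)
  define A where "A = 3 * Kt L * ln (real n)"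
  have A0: "0 \<le> A" using Kt_nonneg[OF L] n by (simp add: A_def)
  have lev: "wt p j * (3 * thr p L n j) = A / sqrt (real n) * x ^ j" for j
  proof -
    have "wt p j * (3 * thr p L n j) = A / sqrt (real n) * ((Hn j powr (1 - 2 / p) * Hn j powr (2 / p)) / 2 ^ j)"
      by (simp add: wt_def thr_def A_def mult_ac)
    also have "Hn j powr (1 - 2 / p) * Hn j powr (2 / p) = Hn j" by (simp flip: powr_add)
    also have "Hn j / 2 ^ j = x ^ j"
    proof -
      have "(?d / 2 - 1) * real j = ?d * real j / 2 - real j" by (simp add: algebra_simps)
      then have "x ^ j = 2 powr (?d * real j / 2 - real j)" by (simp add: x_def powr_powr flip: powr_realpow)
      then show ?thesis by (simp add: Hn_def powr_diff powr_realpow)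
    qed
    finally show ?thesis .
  qed
  have low: "(\<Sum>j<Suc k. wt p j * (3 * thr p L n j)) \<le> 4 * A * t powr (- (1 + s))"
  proof -
    have "(\<Sum>j<Suc k. wt p j * (3 * thr p L n j)) = A / sqrt (real n) * (\<Sum>j<Suc k. x ^ j)"
      unfolding lev by (rule sum_distrib_left[symmetric])
    also have "\<dots> \<le> A / sqrt (real n) * (4 * x ^ k)"
      by (intro mult_left_mono sum_geometric_top x) (use A0 in auto)
    also have "\<dots> \<le> A / sqrt (real n) * (4 * t powr (?d / 2 - 1))"
    proof (intro mult_left_mono)
      have "x ^ k = (2 powr real k) powr (?d / 2 - 1)" by (simp add: x_def powr_powr mult.commute flip: powr_realpow)
      also have "\<dots> \<le> t powr (?d / 2 - 1)" using k2(1) d by (intro powr_mono2) auto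
      finally show "x ^ k \<le> t powr (?d / 2 - 1)" .
    qed (use A0 in auto)
    also have "\<dots> = 4 * A * (t powr (?d / 2 - 1) / t powr (?d / 2 + s))" by (simp add: sq)
    also have "t powr (?d / 2 - 1) / t powr (?d / 2 + s) = t powr (- (1 + s))"
      by (simp flip: powr_diff)
    finally show ?thesis .
  qed
  have high: "2 * L * 2 powr (- (real (Suc k) * (1 + s))) \<le> 2 * L * t powr (- (1 + s))"
  proof (rule mult_left_mono)
    have "2 powr (- (real (Suc k) * (1 + s))) = (2 powr real (Suc k)) powr (- (1 + s))" by (simp add: powr_powr algebra_simps)
    also have "\<dots> \<le> t powr (- (1 + s))" using k2(2) t1 s by (intro powr_mono2') auto
    finally show "2 powr (- (real (Suc k) * (1 + s))) \<le> t powr (- (1 + s))" .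
  qed (use L in simp)
  have "(\<Sum>j<Suc k. ennreal (wt p j * (3 * thr p L n j))) = ennreal (\<Sum>j<Suc k. wt p j * (3 * thr p L n j))"
    using A0 x by (intro sum_ennreal) (simp add: lev)
  also have "\<dots> + ennreal (2 * L * 2 powr (- (real (Suc k) * (1 + s)))) \<le>
      ennreal (4 * A * t powr (- (1 + s))) + ennreal (2 * L * t powr (- (1 + s)))"
    by (intro add_mono ennreal_leI low high)
  also have "\<dots> = ennreal (4 * A * t powr (- (1 + s)) + 2 * L * t powr (- (1 + s)))"
    by (rule ennreal_plus[symmetric]) (use A0 L in auto)
  also have "4 * A * t powr (- (1 + s)) + 2 * L * t powr (- (1 + s)) = (12 * Kt L * ln (real n) + 2 * L) * t powr (- (1 + s))"
    by (simp add: A_def algebra_simps)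
  finally have "(\<Sum>j<Suc k. ennreal (wt p j * (3 * thr p L n j))) + ennreal (2 * L * 2 powr (- (real (Suc k) * (1 + s)))) \<le>
    ennreal ((12 * Kt L * ln (real n) + 2 * L) * t powr (- (1 + s)))" .
  then show ?thesis unfolding rate using split unfolding add.assoc by (rule order_trans[OF _ add_left_mono, rotated])
qed

end

section \<open>Besov classes\<close>

lemma epowr_mono: "x \<le> y \<Longrightarrow> 0 \<le> a \<Longrightarrow> epowr x a \<le> epowr y a"
  by (cases x rule: ennreal_cases; cases y rule: ennreal_cases) (auto simp: epowr_def ennreal_leI powr_mono2 top_unique)

lemma epowr_inverse: "0 < a \<Longrightarrow> epowr (epowr x a) (1 / a) = x"
  by (cases x rule: ennreal_cases) (auto simp: epowr_def powr_powr)

text \<open>Every sequence norm dominates the supremum; this removes \<open>q\<close>.\<close>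

lemma eLnorm_ge_point:
  fixes a :: "nat \<Rightarrow> ennreal"
  assumes q: "1 \<le> q"
  shows "a j \<le> eLnorm (count_space UNIV) q a"
proof (cases "q = \<infinity>")
  case True
  have "AE x in count_space UNIV. a x \<le> esssup (count_space UNIV) a" by (rule esssup_AE)
  then show ?thesis using True by (simp add: eLnorm_def AE_count_space)
next
  case False
  define q' where "q' = enn2real q"
  have "enn2real 1 \<le> q'" unfolding q'_def using q False by (intro enn2real_mono) (auto simp: less_top)
  then have q': "0 < q'" by simp
  have "a j = epowr (epowr (a j) q') (1 / q')" by (rule epowr_inverse[OF q', symmetric])
  also have "\<dots> \<le> epowr (\<integral>\<^sup>+x. epowr (a x) q' \<partial>count_space UNIV) (1 / q')"
    by (rule epowr_mono[OF nn_integral_ge_point]) (use q' in auto)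
  finally show ?thesis using False by (simp add: eLnorm_def q'_def)
qed

lemma Lnorm_count_space_ge:
  fixes g :: "'a \<Rightarrow> real"
  assumes S: "finite S" "S \<subseteq> T" and p: "0 < p"
  shows "ennreal (lpn p S g) \<le> Lnorm (count_space T) (ennreal p) g"
proof -
  let ?h = "\<lambda>x. epowr (ennreal (norm (g x))) p"
  have h: "?h x = ennreal (\<bar>g x\<bar> powr p)" for x by (simp add: epowr_ennreal)
  have "ennreal (\<Sum>x\<in>S. \<bar>g x\<bar> powr p) = (\<Sum>x\<in>S. ?h x)" unfolding h by (rule sum_ennreal[symmetric]) simp
  also have "\<dots> = (\<Sum>x\<in>S. ?h x * indicator S x)" by (intro sum.cong) auto
  also have "\<dots> = (\<integral>\<^sup>+x. ?h x * indicator S x \<partial>count_space T)"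
    by (rule nn_integral_count_space'[symmetric]) (use S in auto)
  also have "\<dots> \<le> (\<integral>\<^sup>+x. ?h x \<partial>count_space T)" by (intro nn_integral_mono) (simp add: indicator_def)
  finally have le: "ennreal (\<Sum>x\<in>S. \<bar>g x\<bar> powr p) \<le> (\<integral>\<^sup>+x. ?h x \<partial>count_space T)" .
  have "ennreal (lpn p S g) = epowr (ennreal (\<Sum>x\<in>S. \<bar>g x\<bar> powr p)) (1 / p)"
    by (simp add: lpn_def epowr_ennreal sum_nonneg)
  also have "\<dots> \<le> epowr (\<integral>\<^sup>+x. ?h x \<partial>count_space T) (1 / p)" by (rule epowr_mono[OF le]) (use p in simp)
  finally show ?thesis using p by (simp add: Lnorm_def eLnorm_def)
qed

text \<open>Comparison of power means on a finite set. On a level with about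
  \<open>(Hn j)\<^sup>2\<close> functions the factor matches the difference between the Besov
  weights for \<open>p\<close> and \<open>p'\<close>.\<close>

lemma lpn_le_lpn_larger:
  assumes S: "finite S" "real (card S) \<le> c" "1 \<le> c" and p: "0 < p" "p \<le> p'"
  shows "lpn p S g \<le> c powr (1 / p - 1 / p') * lpn p' S g"
proof -
  have r: "1 \<le> p' / p" using p by simp
  have p'0: "0 < p'" using p by simp
  have "(\<Sum>a\<in>S. \<bar>g a\<bar> powr p) powr (p' / p) \<le> c powr (p' / p - 1) * (\<Sum>a\<in>S. (\<bar>g a\<bar> powr p) powr (p' / p))"
    by (rule sum_powr_le_card[OF S(1) r _ S(2,3)]) simp
  also have "(\<Sum>a\<in>S. (\<bar>g a\<bar> powr p) powr (p' / p)) = (\<Sum>a\<in>S. \<bar>g a\<bar> powr p')" using p by (simp add: powr_powr)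
  finally have "((\<Sum>a\<in>S. \<bar>g a\<bar> powr p) powr (p' / p)) powr (1 / p') \<le> (c powr (p' / p - 1) * (\<Sum>a\<in>S. \<bar>g a\<bar> powr p')) powr (1 / p')"
    using p'0 by (intro powr_mono2) auto
  also have "\<dots> = c powr ((p' / p - 1) * (1 / p')) * lpn p' S g" by (simp only: powr_mult powr_powr lpn_def)
  also have "(p' / p - 1) * (1 / p') = 1 / p - 1 / p'" using p p'0 by (simp add: field_simps)
  also have "((\<Sum>a\<in>S. \<bar>g a\<bar> powr p) powr (p' / p)) powr (1 / p') = lpn p S g"
    using p'0 by (simp add: lpn_def powr_powr)
  finally show ?thesis .
qed

context wavelet_frame
begin

text \<open>A class with index \<open>p'\<close> embeds into the one with the smaller index
  \<open>p\<close> at the same smoothness; \<open>C ^ 3\<close> bounds the constant in the number of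
  wavelets. The set \<Psi>' stands for the levels before repeated functions are dropped.\<close>

lemma besov_class_ball:
  assumes sub: "\<And>j. \<Psi> j \<subseteq> \<Psi>' j" and p: "1 \<le> p" "p \<le> p'" and q: "1 \<le> q" and L: "0 \<le> L"
    and f: "f \<in> besov_class \<Phi> \<Psi>' s p' q L"
  shows "besov_ball p (C ^ 3 * L) s f"
  unfolding besov_ball_def
proof (intro conjI allI)
  show "is_density f" using f by (simp add: besov_class_def)
  fix j
  define w where "w = 2 powr (real j * s) * 2 powr (real CARD('d) * real j * (1/2 - 1/p'))"
  define a where "a = (\<lambda>j. ennreal (2 powr (real j * s) * 2 powr (real CARD('d) * real j * (1/2 - 1/p'))) *
            Lnorm (count_space (\<Psi>' j)) (ennreal p') (\<lambda>\<psi>. inner_L2 f \<psi>))"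
  have w0: "0 < w" by (simp add: w_def)
  have p'0: "0 < p'" using p by linarith
  have "besov_norm \<Phi> \<Psi>' s p' q f \<le> ennreal L" using f by (simp add: besov_class_def)
  then have "eLnorm (count_space UNIV) q a \<le> ennreal L"
    unfolding besov_norm_def a_def by (rule order_trans[rotated]) simp
  then have aL: "a j \<le> ennreal L" by (rule order_trans[OF eLnorm_ge_point[OF q]])
  have "ennreal (w * lpn p' (\<Psi> j) (inner_L2 f)) = ennreal w * ennreal (lpn p' (\<Psi> j) (inner_L2 f))"
    using w0 by (intro ennreal_mult) auto
  also have "\<dots> \<le> a j" unfolding a_def w_def
    by (intro mult_left_mono Lnorm_count_space_ge finite_\<Psi> sub p'0) auto
  finally have "w * lpn p' (\<Psi> j) (inner_L2 f) \<le> L" using aL L by (simp add: ennreal_le_iff[symmetric] del: ennreal_le_iff)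
  then have "lpn p' (\<Psi> j) (inner_L2 f) \<le> L / w" using w0 by (simp add: field_simps)
  also have "L / w = L * (2 powr (- real j * s) * Hn j powr (2 / p' - 1))"
  proof -
    have "1 / w = 2 powr (- (real j * s)) * 2 powr (- (real CARD('d) * real j * (1/2 - 1/p')))"
      by (simp add: w_def powr_minus_divide)
    also have "2 powr (- (real CARD('d) * real j * (1/2 - 1/p'))) = Hn j powr (2 / p' - 1)"
    proof -
      have "- (real CARD('d) * real j * (1/2 - 1/p')) = real CARD('d) * real j / 2 * (2 / p' - 1)"
        by (simp add: right_diff_distrib)
      then show ?thesis by (simp only: Hn_def powr_powr)
    qed
    finally have "1 / w = 2 powr (- real j * s) * Hn j powr (2 / p' - 1)" by simp
    then have "L * (1 / w) = L * (2 powr (- real j * s) * Hn j powr (2 / p' - 1))" by (simp only:)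
    then show ?thesis by simp
  qed
  finally have le: "lpn p' (\<Psi> j) (inner_L2 f) \<le> L * (2 powr (- real j * s) * Hn j powr (2 / p' - 1))" .
  have e: "0 \<le> 1 / p - 1 / p'" "1 / p - 1 / p' \<le> 1"
  proof -
    have "1 / p' \<le> 1 / p" "1 / p \<le> 1 / 1" using p by (intro divide_left_mono; simp)+
    then show "0 \<le> 1 / p - 1 / p'" "1 / p - 1 / p' \<le> 1" using p'0 zero_le_divide_1_iff[of p'] by linarith+
  qed
  have c1: "1 \<le> C ^ 3 * (Hn j)\<^sup>2"
  proof -
    have "1 * 1 \<le> C ^ 3 * (Hn j)\<^sup>2" using C1 Hn_ge_1 by (intro mult_mono one_le_power) auto
    then show ?thesis by simp
  qed
  have "lpn p (\<Psi> j) (inner_L2 f) \<le> (C ^ 3 * (Hn j)\<^sup>2) powr (1 / p - 1 / p') * lpn p' (\<Psi> j) (inner_L2 f)"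
    by (rule lpn_le_lpn_larger[OF finite_\<Psi> card_\<Psi> c1 _ p(2)]) (use p in simp)
  also have "\<dots> \<le> (C ^ 3 * Hn j powr (2 / p - 2 / p')) * (L * (2 powr (- real j * s) * Hn j powr (2 / p' - 1)))"
  proof (rule mult_mono[OF _ le])
    have "(C ^ 3 * (Hn j)\<^sup>2) powr (1 / p - 1 / p') = (C ^ 3) powr (1 / p - 1 / p') * (Hn j powr 2) powr (1 / p - 1 / p')"
      by (simp add: powr_mult powr_numeral)
    also have "(Hn j powr 2) powr (1 / p - 1 / p') = Hn j powr (2 / p - 2 / p')"
      unfolding powr_powr by (simp add: right_diff_distrib)
    also have "(C ^ 3) powr (1 / p - 1 / p') \<le> (C ^ 3) powr 1" using e C1 by (intro powr_mono one_le_power) auto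
    finally show "(C ^ 3 * (Hn j)\<^sup>2) powr (1 / p - 1 / p') \<le> C ^ 3 * Hn j powr (2 / p - 2 / p')"
      by (simp add: mult_right_mono)
  qed auto
  also have "\<dots> = C ^ 3 * L * 2 powr (- real j * s) * (Hn j powr (2 / p - 2 / p') * Hn j powr (2 / p' - 1))"
    by (simp only: mult_ac)
  also have "Hn j powr (2 / p - 2 / p') * Hn j powr (2 / p' - 1) = Hn j powr (2 / p - 1)" by (simp flip: powr_add)
  finally show "lpn p (\<Psi> j) (inner_L2 f) \<le> C ^ 3 * L * 2 powr (- real j * s) * Hn j powr (2 / p - 1)" .
qed

end

text \<open>On a probability space, \<open>y powr p \<le> 1 + y powr p'\<close> suffices for
  finiteness; the size of the bound \<open>F\<close> enters no risk bound.\<close>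

lemma Lspace_lpb:
  assumes f: "f \<in> Lspace cubeM (ennreal p')" and p: "1 \<le> p" "p \<le> p'"
  shows "\<exists>F\<ge>0. lpb p f F"
proof -
  have [measurable]: "f \<in> borel_measurable cubeM" and fin: "Lnorm cubeM (ennreal p') f < \<infinity>" using f by (auto simp: Lspace_def)
  have p'0: "0 < p'" using p by linarith
  have e: "(\<integral>\<^sup>+x. epowr (ennreal (norm (f x))) (enn2real (ennreal p')) \<partial>cubeM) = (\<integral>\<^sup>+x. ennreal (\<bar>f x\<bar> powr p') \<partial>cubeM)"
    using p'0 by (intro nn_integral_cong) (simp add: epowr_ennreal)
  have fin': "(\<integral>\<^sup>+x. ennreal (\<bar>f x\<bar> powr p') \<partial>cubeM) \<noteq> \<infinity>"
  proof
    assume "(\<integral>\<^sup>+x. ennreal (\<bar>f x\<bar> powr p') \<partial>cubeM) = \<infinity>"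
    then have "Lnorm cubeM (ennreal p') f = \<infinity>" unfolding Lnorm_def eLnorm_def e by (simp add: epowr_def)
    then show False using fin by simp
  qed
  have pw: "y powr p \<le> 1 + y powr p'" if "0 \<le> y" for y :: real
  proof (cases "y \<le> 1")
    case True
    then have "y powr p \<le> 1" using that p by (intro powr_le1) auto
    then show ?thesis by (simp add: add_increasing2)
  next
    case False
    then have "y powr p \<le> y powr p'" using p by (intro powr_mono) auto
    then show ?thesis by simp
  qed
  have "(\<integral>\<^sup>+x. ennreal (\<bar>f x\<bar> powr p) \<partial>cubeM) \<le> (\<integral>\<^sup>+x. 1 + ennreal (\<bar>f x\<bar> powr p') \<partial>cubeM)"
  proof (rule nn_integral_mono)
    fix x
    have "ennreal (\<bar>f x\<bar> powr p) \<le> ennreal (1 + \<bar>f x\<bar> powr p')" by (intro ennreal_leI pw) simp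
    then show "ennreal (\<bar>f x\<bar> powr p) \<le> 1 + ennreal (\<bar>f x\<bar> powr p')" by simp
  qed
  also have "\<dots> = 1 + (\<integral>\<^sup>+x. ennreal (\<bar>f x\<bar> powr p') \<partial>cubeM)"
    by (subst nn_integral_add) auto
  also have "\<dots> < \<infinity>" using fin' by (simp add: less_top)
  finally obtain V where V: "0 \<le> V" "(\<integral>\<^sup>+x. ennreal (\<bar>f x\<bar> powr p) \<partial>cubeM) = ennreal V"
    by (cases "\<integral>\<^sup>+x. ennreal (\<bar>f x\<bar> powr p) \<partial>cubeM" rule: ennreal_cases) auto
  have "(V powr (1 / p)) powr p = V" using V p by (simp add: powr_powr)
  then have "lpb p f (V powr (1 / p))" unfolding lpb_def using V by simp
  then show ?thesis by (intro exI[of _ "V powr (1 / p)"]) simp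
qed

section \<open>The rate\<close>

context wavelet_frame
begin

text \<open>From dimension two on, terms of parametric order are within the rate: the noise of
  \<Phi>, the slack of the selection, and the exceptional event.\<close>

lemma rate_ge:
  assumes "2 \<le> CARD('d)" "0 \<le> s" "1 \<le> n"
  shows "1 / sqrt (real n) \<le> real n powr (- ((1 + s) / (real CARD('d) + 2 * s)))"
proof -
  have "(1 + s) / (real CARD('d) + 2 * s) \<le> 1 / 2" using assms by (simp add: field_simps)
  then have "real n powr (- (1 / 2)) \<le> real n powr (- ((1 + s) / (real CARD('d) + 2 * s)))"
    using assms by (intro powr_mono) auto
  then show ?thesis by (simp add: powr_minus_divide powr_half_sqrt)
qed

lemma inverse_le_sqrt:
  assumes "1 \<le> n" shows "1 / real (Suc n) \<le> 1 / sqrt (real n)" "1 / real n \<le> 1 / sqrt (real n)"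
proof -
  have "sqrt (real n) * 1 \<le> sqrt (real n) * sqrt (real n)" using assms by (intro mult_left_mono) auto
  then have s: "sqrt (real n) \<le> real n" by simp
  have "0 < sqrt (real n)" using assms by simp
  then show "1 / real (Suc n) \<le> 1 / sqrt (real n)" "1 / real n \<le> 1 / sqrt (real n)"
    using s assms by (auto intro!: divide_left_mono mult_pos_pos)
qed

text \<open>The constant is chosen before \<open>n\<close>, \<open>f\<close> and \<open>F\<close>.
  In dimension two the terms without logarithm are absorbed through
  \<open>1 \<le> 4 * (ln n)\<^sup>2\<close>, whence the factors 4 in \<open>E2\<close>.\<close>

lemma risk_low_dimension:
  assumes d: "CARD('d) \<le> 2" and p: "1 \<le> p" and L: "0 \<le> L" and s: "0 \<le> s" and m: "0 < m"
  shows "\<exists>K. \<forall>n\<ge>2. \<forall>f F. besov_ball p L s f \<longrightarrow> lpb p f F \<longrightarrow> 0 \<le> F \<longrightarrow> (AE x in cubeM. m \<le> f x) \<longrightarrow>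
    wasserstein_risk p n f (fit p L n) \<le> ennreal (K * rate CARD('d) s n)"
proof -
  define E1 where "E1 = Pc p + Mc p * Cv L * (1 / (1 - 2 powr (- 1 / 2))\<^sup>2) + 2 * L"
  define E2 where "E2 = 4 * Pc p + 16 * Mc p * Cv L + 8 * L"
  define K where "K = Cm p (m / 2) * (if CARD('d) = 2 then 2 * E2 + 4 else 2 * E1 + 1)"
  have Cm0: "0 \<le> Cm p (m / 2)" by (rule Cm_nonneg[OF p])
  have "wasserstein_risk p n f (fit p L n) \<le> ennreal (K * rate CARD('d) s n)"
    if n: "2 \<le> n" and f: "besov_ball p L s f" "lpb p f F" "0 \<le> F" "AE x in cubeM. m \<le> f x" for n f F
  proof -
    have n1: "1 \<le> n" using n by simp
    have fd: "is_density f" using f(1) by (simp add: besov_ball_def)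
    interpret P: prob_space "sampleM f n" by (rule prob_space_sampleM[OF fd])
    define A where "A = Pc p + Mc p * Cv L * (if CARD('d) = 2 then 16 * (ln (real n))\<^sup>2 else 1 / (1 - 2 powr (- 1 / 2))\<^sup>2) + 2 * L"
    have A0: "0 \<le> A" unfolding A_def using Cv_nonneg[OF L] L by (intro add_nonneg_nonneg mult_nonneg_nonneg) auto
    define r where "r = 1 / sqrt (real n)"
    have r0: "0 \<le> r" by (simp add: r_def)
    have em: "err p L n f \<in> borel_measurable (sampleM f n)"
      unfolding measurable_cong_sets[OF sets_sampleM refl] by (rule measurable_err)
    have I: "(\<integral>\<^sup>+X. err p L n f X \<partial>sampleM f n) \<le> ennreal (A * r)"
      using err_low_dimension[OF d p L s f(1) n] by (simp add: A_def r_def)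
    have "wasserstein_risk p n f (fit p L n) \<le>
        (\<integral>\<^sup>+X. ennreal (Cm p (m / 2)) * (err p L n f X + err p L n f X + ennreal (1 / real (Suc n))) \<partial>sampleM f n)"
      unfolding wasserstein_risk_def sampleM_def[symmetric]
      by (intro nn_integral_mono wasserstein_fit[OF fd f(2,4) m f(3) p])
    also have "\<dots> = ennreal (Cm p (m / 2)) * ((\<integral>\<^sup>+X. err p L n f X \<partial>sampleM f n) + (\<integral>\<^sup>+X. err p L n f X \<partial>sampleM f n) + ennreal (1 / real (Suc n)))"
    proof (subst nn_integral_cmult)
      show "(\<lambda>X. err p L n f X + err p L n f X + ennreal (1 / real (Suc n))) \<in> borel_measurable (sampleM f n)"
        by (intro borel_measurable_add em borel_measurable_const)
      have "(\<integral>\<^sup>+X. err p L n f X + err p L n f X + ennreal (1 / real (Suc n)) \<partial>sampleM f n) =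
          (\<integral>\<^sup>+X. err p L n f X + err p L n f X \<partial>sampleM f n) + (\<integral>\<^sup>+X. ennreal (1 / real (Suc n)) \<partial>sampleM f n)"
        by (rule nn_integral_add) (intro borel_measurable_add em borel_measurable_const)+
      also have "(\<integral>\<^sup>+X. err p L n f X + err p L n f X \<partial>sampleM f n) =
          (\<integral>\<^sup>+X. err p L n f X \<partial>sampleM f n) + (\<integral>\<^sup>+X. err p L n f X \<partial>sampleM f n)"
        by (rule nn_integral_add[OF em em])
      also have "(\<integral>\<^sup>+X. ennreal (1 / real (Suc n)) \<partial>sampleM f n) = ennreal (1 / real (Suc n))"
        by (simp only: nn_integral_const P.emeasure_space_1 mult_1_right)
      finally show "ennreal (Cm p (m / 2)) * (\<integral>\<^sup>+X. err p L n f X + err p L n f X + ennreal (1 / real (Suc n)) \<partial>sampleM f n) =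
          ennreal (Cm p (m / 2)) * ((\<integral>\<^sup>+X. err p L n f X \<partial>sampleM f n) + (\<integral>\<^sup>+X. err p L n f X \<partial>sampleM f n) + ennreal (1 / real (Suc n)))"
        by (simp only:)
    qed
    also have "\<dots> \<le> ennreal (Cm p (m / 2)) * (ennreal (A * r) + ennreal (A * r) + ennreal r)"
      unfolding r_def by (intro mult_left_mono add_mono I[unfolded r_def] ennreal_leI inverse_le_sqrt n1) simp
    also have "\<dots> = ennreal (Cm p (m / 2) * (A * r + A * r + r))"
      using Cm0 A0 r0 by (simp only: ennreal_plus[symmetric] ennreal_mult[symmetric] mult_nonneg_nonneg add_nonneg_nonneg)
    also have "\<dots> \<le> ennreal (K * rate CARD('d) s n)"
    proof (rule ennreal_leI)
      have eq: "A * r + A * r + r = (2 * A + 1) * r" by (simp add: algebra_simps)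
      have rn: "real n powr (- 1 / 2) = r" by (simp add: r_def powr_minus_divide powr_half_sqrt)
      show "Cm p (m / 2) * (A * r + A * r + r) \<le> K * rate CARD('d) s n"
      proof (cases "CARD('d) = 2")
        case True
        define l where "l = (ln (real n))\<^sup>2"
        have "(1 / 2)\<^sup>2 \<le> l" unfolding l_def using ln_ge_half[OF n] by (intro power_mono) auto
        then have l: "1 \<le> 4 * l" by (simp add: power2_eq_square)
        have Al: "A = Pc p + Mc p * Cv L * (16 * l) + 2 * L" using True by (simp add: A_def l_def)
        have "Pc p * 1 \<le> Pc p * (4 * l)" "(2 * L) * 1 \<le> (2 * L) * (4 * l)" using l L by (intro mult_left_mono; simp)+
        then have "2 * A + 1 \<le> (2 * E2 + 4) * l" using l unfolding Al E2_def by (simp add: algebra_simps)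
        then have "Cm p (m / 2) * ((2 * A + 1) * r) \<le> Cm p (m / 2) * ((2 * E2 + 4) * l * r)"
          using Cm0 r0 by (intro mult_left_mono mult_right_mono)
        also have "\<dots> = K * rate CARD('d) s n" unfolding K_def rate_def rn using True by (simp add: l_def)
        finally show ?thesis by (simp only: eq)
      next
        case False
        then have "2 * A + 1 = 2 * E1 + 1" by (simp add: A_def E1_def)
        moreover have "rate CARD('d) s n = r" unfolding rate_def rn using False d by simp
        ultimately show ?thesis unfolding K_def eq using False by simp
      qed
    qed
    finally show ?thesis .
  qed
  then show ?thesis by blast
qed

text \<open>On the exceptional event the distance is at most the dimension and the probability is of
  order \<open>1 / n\<close>; elsewhere the coarse noise is integrated and the remaining error is
  deterministic.\<close>

lemma risk_high_dimension:
  assumes d: "3 \<le> CARD('d)" and p: "1 \<le> p" and L: "0 \<le> L" and s: "0 \<le> s" and m: "0 < m"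
  shows "\<exists>K. \<forall>n\<ge>2. \<forall>f F. besov_ball p L s f \<longrightarrow> lpb p f F \<longrightarrow> 0 \<le> F \<longrightarrow> (AE x in cubeM. m \<le> f x) \<longrightarrow>
    wasserstein_risk p n f (fit p L n) \<le> ennreal (K * rate CARD('d) s n)"
proof -
  define c where "c = Cm p (m / 2)"
  define D where "D = real CARD('d) * (2 * real (card \<Phi>) + 4 * C ^ 3)"
  define K where "K = c * (4 * Pc p + 24 * Kt L + 8 * L + 2) + 2 * D"
  have c0: "0 \<le> c" unfolding c_def by (rule Cm_nonneg[OF p])
  have D0: "0 \<le> D" unfolding D_def by (intro mult_nonneg_nonneg add_nonneg_nonneg) auto
  have "wasserstein_risk p n f (fit p L n) \<le> ennreal (K * rate CARD('d) s n)"
    if n: "2 \<le> n" and f: "besov_ball p L s f" "lpb p f F" "0 \<le> F" "AE x in cubeM. m \<le> f x" for n f F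
  proof -
    have n1: "1 \<le> n" using n by simp
    have fd: "is_density f" using f(1) by (simp add: besov_ball_def)
    interpret P: prob_space "sampleM f n" by (rule prob_space_sampleM[OF fd])
    define l where "l = ln (real n)"
    define R where "R = real n powr (- ((1 + s) / (real CARD('d) + 2 * s)))"
    define B where "B = (12 * Kt L * l + 2 * L) * R"
    define u where "u = 1 / real (Suc n)"
    define N where "N = (\<lambda>X. lpn p \<Phi> (\<lambda>b. emp n b X - inner_L2 f b))"
    have l: "1 \<le> 2 * l" using ln_ge_half[OF n] by (simp add: l_def)
    have R0: "0 \<le> R" by (simp add: R_def)
    have B0: "0 \<le> B" unfolding B_def using Kt_nonneg[OF L] L l R0 by (intro mult_nonneg_nonneg add_nonneg_nonneg) auto
    have u0: "0 \<le> u" by (simp add: u_def)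
    have Nm: "(\<lambda>X. ennreal (N X)) \<in> borel_measurable (sampleM f n)"
    proof -
      have "N \<in> borel_measurable (sampleM f n)"
        unfolding measurable_cong_sets[OF sets_sampleM refl] N_def
        by (intro measurable_lpn borel_measurable_diff measurable_emp meas_basis(1) borel_measurable_const)
      then show ?thesis by (rule measurable_compose[OF _ measurable_ennreal])
    qed
    have pt: "wasserstein p (law f) (law (fit p L n X)) \<le>
        (ennreal (2 * c) * ennreal (N X) + ennreal (c * (2 * B + u))) + ennreal (real CARD('d)) * indicator (bad n f) X"
      if X: "X \<in> space (sampleM f n)" for X
    proof (cases "X \<in> bad n f")
      case True
      have "is_density (fit p L n X)" unfolding fit_def by (rule cand_props(2))
      then have "coupled p (law f) (law (fit p L n X)) (real CARD('d))"
        by (intro coupled_trivial prob_space_law fd p sets_law)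
      then have "wasserstein p (law f) (law (fit p L n X)) \<le> ennreal (real CARD('d))"
        by (rule wasserstein_le_coupled) (use p in auto)
      then show ?thesis using True by (simp add: add_increasing)
    next
      case False
      have N0: "0 \<le> N X" by (simp add: N_def)
      have "err p L n f X \<le> ennreal (N X) + ennreal B"
        using err_high_dimension[OF d p L s f(1) n X False] by (simp only: N_def B_def R_def l_def)
      also have "\<dots> = ennreal (N X + B)" by (rule ennreal_plus[OF N0 B0, symmetric])
      finally have e: "err p L n f X \<le> ennreal (N X + B)" .
      have "wasserstein p (law f) (law (fit p L n X)) \<le> ennreal c * (err p L n f X + err p L n f X + ennreal u)"
        unfolding c_def u_def by (rule wasserstein_fit[OF fd f(2,4) m f(3) p])
      also have "\<dots> \<le> ennreal c * (ennreal (N X + B) + ennreal (N X + B) + ennreal u)"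
        by (intro mult_left_mono add_mono e order_refl) simp
      also have "\<dots> = ennreal (c * (N X + B + (N X + B) + u))"
        using c0 N0 B0 u0 by (simp only: ennreal_plus[symmetric] ennreal_mult[symmetric] add_nonneg_nonneg)
      also have "c * (N X + B + (N X + B) + u) = 2 * c * N X + c * (2 * B + u)" by (simp add: algebra_simps)
      also have "ennreal \<dots> = ennreal (2 * c) * ennreal (N X) + ennreal (c * (2 * B + u))"
        using c0 N0 B0 u0 by (subst ennreal_plus) (auto simp: ennreal_mult intro!: mult_nonneg_nonneg)
      finally show ?thesis using False by simp
    qed
    have "wasserstein_risk p n f (fit p L n) \<le>
        (\<integral>\<^sup>+X. (ennreal (2 * c) * ennreal (N X) + ennreal (c * (2 * B + u))) + ennreal (real CARD('d)) * indicator (bad n f) X \<partial>sampleM f n)"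
      unfolding wasserstein_risk_def sampleM_def[symmetric] by (intro nn_integral_mono pt)
    also have "\<dots> = (ennreal (2 * c) * (\<integral>\<^sup>+X. ennreal (N X) \<partial>sampleM f n) + ennreal (c * (2 * B + u))) +
        ennreal (real CARD('d)) * emeasure (sampleM f n) (bad n f)"
    proof -
      note bm = bad_sets(1)[OF fd n1]
      have 1: "(\<lambda>X. ennreal (2 * c) * ennreal (N X)) \<in> borel_measurable (sampleM f n)"
        by (intro borel_measurable_times_ennreal borel_measurable_const Nm)
      have 2: "(\<lambda>X. ennreal (real CARD('d)) * indicator (bad n f) X) \<in> borel_measurable (sampleM f n)"
        by (intro borel_measurable_times_ennreal borel_measurable_const borel_measurable_indicator bm)
      have "(\<integral>\<^sup>+X. ennreal (2 * c) * ennreal (N X) + ennreal (c * (2 * B + u)) \<partial>sampleM f n) =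
          (\<integral>\<^sup>+X. ennreal (2 * c) * ennreal (N X) \<partial>sampleM f n) + (\<integral>\<^sup>+X. ennreal (c * (2 * B + u)) \<partial>sampleM f n)"
        by (rule nn_integral_add[OF 1 borel_measurable_const])
      then show ?thesis
        by (subst nn_integral_add[OF borel_measurable_add[OF 1 borel_measurable_const] 2])
          (simp only: nn_integral_cmult[OF Nm] nn_integral_cmult_indicator[OF bm] nn_integral_const P.emeasure_space_1 mult_1_right)
    qed
    also have "\<dots> \<le> (ennreal (2 * c) * ennreal (Pc p * R) + ennreal (c * (2 * B + R))) +
        ennreal (real CARD('d)) * ennreal ((2 * real (card \<Phi>) + 4 * C ^ 3) * R)"
    proof (intro add_mono mult_left_mono ennreal_leI)
      have rR: "1 / sqrt (real n) \<le> R" unfolding R_def using d s n1 by (intro rate_ge) auto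
      have "(\<integral>\<^sup>+X. ennreal (N X) \<partial>sampleM f n) \<le> ennreal (Pc p / sqrt (real n))"
        unfolding N_def by (rule noise_\<Phi>[OF fd n1 p])
      also have "\<dots> \<le> ennreal (Pc p * R)"
        using mult_left_mono[OF rR Pc_nonneg[of p]] by (intro ennreal_leI) simp
      finally show "(\<integral>\<^sup>+X. ennreal (N X) \<partial>sampleM f n) \<le> ennreal (Pc p * R)" .
      show "u \<le> R" unfolding u_def by (rule order_trans[OF inverse_le_sqrt(1)[OF n1] rR])
      have "emeasure (sampleM f n) (bad n f) \<le> ennreal ((2 * real (card \<Phi>) + 4 * C ^ 3) / real n)"
        by (rule bad_sets(2)[OF fd n1])
      also have "\<dots> \<le> ennreal ((2 * real (card \<Phi>) + 4 * C ^ 3) * R)"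
      proof (rule ennreal_leI)
        have "(2 * real (card \<Phi>) + 4 * C ^ 3) * (1 / real n) \<le> (2 * real (card \<Phi>) + 4 * C ^ 3) * R"
          by (intro mult_left_mono order_trans[OF inverse_le_sqrt(2)[OF n1] rR] add_nonneg_nonneg) auto
        then show "(2 * real (card \<Phi>) + 4 * C ^ 3) / real n \<le> (2 * real (card \<Phi>) + 4 * C ^ 3) * R" by simp
      qed
      finally show "emeasure (sampleM f n) (bad n f) \<le> ennreal ((2 * real (card \<Phi>) + 4 * C ^ 3) * R)" .
    qed (use c0 in auto)
    also have "\<dots> = ennreal (2 * c * (Pc p * R) + c * (2 * B + R) + real CARD('d) * ((2 * real (card \<Phi>) + 4 * C ^ 3) * R))"
    proof -
      have x: "0 \<le> 2 * c" "0 \<le> Pc p * R" "0 \<le> c * (2 * B + R)" "0 \<le> real CARD('d)" "0 \<le> (2 * real (card \<Phi>) + 4 * C ^ 3) * R"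
        using c0 R0 B0 by auto
      show ?thesis
        by (simp only: ennreal_plus[symmetric] ennreal_mult[symmetric] x mult_nonneg_nonneg add_nonneg_nonneg)
    qed
    also have "\<dots> \<le> ennreal (K * rate CARD('d) s n)"
    proof (rule ennreal_leI)
      have h: "y * R \<le> 2 * y * (l * R)" if "0 \<le> y" for y
      proof -
        have "(y * R) * 1 \<le> (y * R) * (2 * l)" using that R0 l by (intro mult_left_mono) auto
        then show ?thesis by (simp add: mult_ac)
      qed
      have "2 * c * (Pc p * R) + c * (2 * B + R) + real CARD('d) * ((2 * real (card \<Phi>) + 4 * C ^ 3) * R) =
          24 * c * Kt L * (l * R) + ((2 * c * Pc p) * R + (4 * c * L) * R + c * R + D * R)"
        by (simp add: B_def D_def algebra_simps)
      also have "\<dots> \<le> 24 * c * Kt L * (l * R) + (2 * (2 * c * Pc p) * (l * R) + 2 * (4 * c * L) * (l * R) + 2 * c * (l * R) + 2 * D * (l * R))"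
        by (intro add_left_mono add_mono h) (use c0 L D0 in auto)
      also have "\<dots> = K * (R * l)" by (simp add: K_def algebra_simps)
      also have "R * l = rate CARD('d) s n" unfolding rate_def R_def l_def using d by simp
      finally show "2 * c * (Pc p * R) + c * (2 * B + R) + real CARD('d) * ((2 * real (card \<Phi>) + 4 * C ^ 3) * R) \<le> K * rate CARD('d) s n" .
    qed
    finally show ?thesis .
  qed
  then show ?thesis by blast
qed

end

theorem theorem2:
  fixes \<Phi> :: "(real ^ 'd \<Rightarrow> real) set"
    and \<Psi> :: "nat \<Rightarrow> (real ^ 'd \<Rightarrow> real) set"
    and r p L :: real
  assumes "r > 1"
    and "wavelet_system r \<Phi> \<Psi>"
    and "1 \<le> p"
    and "0 < L"
  shows "\<exists>F :: nat \<Rightarrow> (nat \<Rightarrow> real ^ 'd) \<Rightarrow> real ^ 'd \<Rightarrow> real.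
    (\<forall>n. density_estimator n (F n)) \<and>
    (\<forall>(p' :: real) (q :: ennreal) (m :: real) (s :: real).
       p \<le> p' \<longrightarrow> 1 \<le> q \<longrightarrow> 0 < m \<longrightarrow> m < 1 \<longrightarrow> 0 \<le> s \<longrightarrow> s < r \<longrightarrow>
       (\<exists>C :: real. \<forall>n\<ge>2.
          (SUP f \<in> besov_class_lower \<Phi> \<Psi> s p' q L m. wasserstein_risk p n f (F n))
            \<le> ennreal (C * rate CARD('d) s n)))"
proof -
  obtain I C where frame: "wavelet_frame \<Phi> (disjoint_levels \<Phi> \<Psi>) I C"
    using wavelet_frame_of_system[OF assms(1,2)] .
  interpret wavelet_frame \<Phi> "disjoint_levels \<Phi> \<Psi>" I C by (rule frame)
  \<comment> \<open>The radius after passing from \<open>p'\<close> to \<open>p\<close>. It depends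
    on \<open>L\<close> and the system only, so that \<open>fit p L'\<close> can be fixed before
    \<open>p'\<close>, \<open>q\<close>, \<open>m\<close> and \<open>s\<close> are given.\<close>
  define L' where "L' = C ^ 3 * L"
  have L': "0 \<le> L'" using assms(4) by (simp add: L'_def)
  show ?thesis
  proof (intro exI[of _ "fit p L'"] conjI allI impI)
    show "density_estimator n (fit p L' n)" for n by (rule density_estimator_fit)
    fix p' :: real and q :: ennreal and m s :: real
    assume H: "p \<le> p'" "1 \<le> q" "0 < m" "0 \<le> s"
    obtain K where K: "\<And>n f F. 2 \<le> n \<Longrightarrow> besov_ball p L' s f \<Longrightarrow> lpb p f F \<Longrightarrow> 0 \<le> F \<Longrightarrow> (AE x in cubeM. m \<le> f x) \<Longrightarrow>
        wasserstein_risk p n f (fit p L' n) \<le> ennreal (K * rate CARD('d) s n)"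
    proof (cases "3 \<le> CARD('d)")
      case True
      show thesis using risk_high_dimension[OF True assms(3) L' H(4) H(3)] that by blast
    next
      case False
      then have d: "CARD('d) \<le> 2" by simp
      show thesis using risk_low_dimension[OF d assms(3) L' H(4) H(3)] that by blast
    qed
    show "\<exists>C :: real. \<forall>n\<ge>2. (SUP f \<in> besov_class_lower \<Phi> \<Psi> s p' q L m. wasserstein_risk p n f (fit p L' n))
            \<le> ennreal (C * rate CARD('d) s n)"
    proof (intro exI[of _ K] allI impI SUP_least)
      fix n :: nat and f assume n: "2 \<le> n" and f: "f \<in> besov_class_lower \<Phi> \<Psi> s p' q L m"
      have fc: "f \<in> besov_class \<Phi> \<Psi> s p' q L" and low: "AE x in cubeM. m \<le> f x"
        using f by (auto simp: besov_class_lower_def)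
      have "f \<in> Lspace cubeM (ennreal p')" using fc by (simp add: besov_class_def)
      from Lspace_lpb[OF this assms(3) H(1)] obtain F where F: "0 \<le> F" "lpb p f F" by blast
      have "besov_ball p L' s f" unfolding L'_def
        by (rule besov_class_ball[OF disjoint_levels_subset assms(3) H(1,2) less_imp_le[OF assms(4)] fc])
      then show "wasserstein_risk p n f (fit p L' n) \<le> ennreal (K * rate CARD('d) s n)"
        by (rule K[OF n _ F(2,1) low])
    qed
  qed
qed

end
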